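(* Let the data $\theta_0,D,\kappa,q,g,f$ satisfy assumptions (1)–(7) of the context for every $T>0$, and assume $\kappa$ is Lipschitz continuous: $|\kappa(\zeta_1)-\kappa(\zeta_2)|\le L_\kappa|\zeta_1-\zeta_2|$ for all $\zeta_1,\zeta_2\in\mathbb R$. Let $\hbar>0$ and let $P_\hbar:H^1(\Omega)\to L^2(\Omega)$ be linear with $\|P_\hbar(u)-u\|\le c_0\hbar^k|u|_k$ for all $u\in H^k(\Omega)$, $k=1,2$. Let $r\in(2,r_0)$ and $s$ satisfy $\frac1r+\frac1s=\frac12$, set $\epsilon=\frac{s}{2(s-1)}$ and $\tilde C_{\boldsymbol w}=\frac1s\frac{(C_{\boldsymbol w}C(r))^s}{(\epsilon D_* )^{s-1}}$ (with $r_0$, $C(r)$, $C_{\boldsymbol w}$ as in the context), and let $\mu>0$ be such that $\mu c_0^2\hbar^2<D_*$ and $$\xi=2\tilde C_{\boldsymbol w}\|g\|^s-\mu<0.$$ Let $(\theta,p)$ and $(\hat\theta,\hat p)$ be defined for all times $t\ge0$ and be, on every interval $[0,T]$, respectively a weak solution of the model problem with initial condition $\theta_0$ and a corresponding data assimilation solution with initial condition $\hat\theta_0\in L^2(\Omega)$. Then $$\|\theta(\cdot,t)-\hat\theta(\cdot,t)\|\to0\quad\text{as }t\to\infty,$$ and furthermore $$\big\|[\kappa(\theta)\nabla p-\kappa(\hat\theta)\nabla\hat p](\cdot,t)\big\|\to0\quad\text{as }t\to\infty.$$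
   Context: Setting. $\Omega\subset\mathbb R^2$ is a bounded open set with Lipschitz boundary $\partial\Omega=\Gamma_D\cup\Gamma_N$, $\Gamma_D\cap\Gamma_N=\emptyset$, $\Gamma_D\neq\emptyset$; $T>0$. $\|\cdot\|$ and $\langle\cdot,\cdot\rangle$ are the norm and inner product of $L^2(\Omega)$; $\|\cdot\|_{k,p}$ is the norm of $W^k_p(\Omega)$; $\|\cdot\|_k$ and $|\cdot|_k$ are the norm and seminorm of $H^k(\Omega)$ (so $|u|_1=\|\nabla u\|$). $H^1_D=\{w\in H^1(\Omega): w=0\text{ on }\Gamma_D\}$ with the $H^1(\Omega)$ norm, and $b_0>0$ is a constant with $b_0\|u\|_1\le\|\nabla u\|\le\|u\|_1$ for all $u\in H^1_D$. $H^{-1}(\Omega)$ is the dual of $H^1_D$, with duality pairing also written $\langle\cdot,\cdot\rangle$. $L^p_T(X)=L^p(0,T;X)$. Assumptions on the data: (1) $\theta_0\in L^2(\Omega)$, $0\le\theta_0\le1$ a.e.; (2) $D\in L^\infty(\Omega)$, $0<D_*<D(\boldsymbol x)\le D^*$ a.e.; (3) $\kappa\in C^0(\mathbb R)\cap L^\infty(\mathbb R)$, $0<\kappa_*\le\kappa\le\kappa^*$; (4) $q\in L^2(\Omega)$; (5) $g\in L^2(\Omega)$; (6) $f\in L^2_T(L^2(\Omega))$; (7) $g+2q\ge0$ and $g+q\ge f\ge0$ a.e. in $\Omega\times[0,T]$. Forms: $A(v,u,w;z)=\langle D\nabla v,\nabla w\rangle+\langle v\kappa(z)\nabla u,\nabla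 w\rangle+\langle qv,w\rangle$ and $B(u,w;z)=\langle\kappa(z)\nabla u,\nabla w\rangle$. Weak solution of the model problem on $[0,T]$: a pair $(\theta,p)\in \big(L^\infty_T(L^2(\Omega))\cap L^2_T(H^1_D)\big)\times L^\infty_T(H^1_D)$ with $\partial_t\theta\in L^2_T(H^{-1}(\Omega))$, $0\le\theta\le1$ a.e. in $\Omega\times[0,T]$, $\theta(\cdot,0)=\theta_0$, and, for a.e. $t\in[0,T]$, $\langle\partial_t\theta,\psi\rangle+A(\theta,p,\psi;\theta)=\langle f,\psi\rangle$ for all $\psi\in H^1_D$ and $B(p,\varphi;\theta)=\langle g,\varphi\rangle$ for all $\varphi\in H^1_D$. Data assimilation solution on $[0,T]$ (for given $\theta$, $\mu$, $P_\hbar$, $\hat\theta_0\in L^2(\Omega)$): a pair $(\hat\theta,\hat p)\in \big(L^\infty_T(L^2(\Omega))\cap L^2_T(H^1_D)\big)\times L^\infty_T(H^1_D)$ with $\partial_t\hat\theta\in L^2_T(H^{-1}(\Omega))$, $\hat\theta(\cdot,0)=\hat\theta_0$, and, for a.e. $t\in[0,T]$, $\langle\partial_t\hat\theta,\psi\rangle+A(\hat\theta,\hat p,\psi;\hat\theta)=\langle f-\mu P_\hbar(\hat\theta-\theta),\psi\rangle$ for all $\psi\in H^1_D$ and $B(\hat p,\varphi;\hat\theta)=\langle g,\varphi\rangle$ for all $\varphi\in H^1_D$. Constants. $r_0\in(2,\infty]$ (depending only on $\kappa_*,\kappa^*,\Omega\cup\Gamma_N$) and, for $r\in[2,r_0)$,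 $C(r)$ (depending on $\kappa_*,\kappa^*,\Omega,r$) are Meyers-type constants: for every measurable $z$ on $\Omega$, the solution $u\in H^1_D$ of $B(u,\varphi;z)=\langle g,\varphi\rangle$ for all $\varphi\in H^1_D$ satisfies $\|u\|_{1,r}\le C(r)\|g\|$. $C_{\rm gn}$ is a constant (depending on $\Omega$) in the Gagliardo–Nirenberg inequality $\|u\|_{0,a}\le C_{\rm gn}\|u\|_{0,c}^{c/a}\|u\|_1^{1-c/a}$, $1\le c\le a<\infty$, $u\in H^1(\Omega)$. $C_{\boldsymbol w}=\max\{\kappa_*^{-1},1+\kappa^*\kappa_*^{-1}\}L_\kappa C_{\rm gn}b_0^{(2-s)/s}$; with this constant $\|\kappa(z_1)\nabla u_1-\kappa(z_2)\nabla u_2\|\le C_{\boldsymbol w}C(r)\|g\|\,\|z_1-z_2\|^{2/s}\|\nabla(z_1-z_2)\|^{(s-2)/s}$ whenever $z_j,u_j\in H^1_D$ and $B(u_j,\varphi;z_j)=\langle g,\varphi\rangle$ for all $\varphi\in H^1_D$, $j=1,2$. Convention: $\theta,\hat\theta$ are identified with their representatives continuous in time with values in $L^2(\Omega)$, and $p(\cdot,t)$, $\hat p(\cdot,t)$ with the solutions of their elliptic equations at time $t$. *)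

theory Defs
  imports "HOL-Analysis.Analysis"
begin

type_synonym plane = "real ^ 2"

text \<open>Elements of function spaces over \<open>\<Omega>\<close> are represented by functions on the whole plane; only
  their values on \<open>\<Omega>\<close> matter, and equality of elements is equality a.e. on \<open>\<Omega>\<close>.\<close>

definition lp_space :: "plane set \<Rightarrow> real \<Rightarrow> (plane \<Rightarrow> real) set" where
  "lp_space \<Omega> p = {u \<in> borel_measurable (lebesgue_on \<Omega>).
     integrable (lebesgue_on \<Omega>) (\<lambda>x. \<bar>u x\<bar> powr p)}"

definition lp_norm :: "plane set \<Rightarrow> real \<Rightarrow> (plane \<Rightarrow> 'b::real_normed_vector) \<Rightarrow> real" where
  "lp_norm \<Omega> p u = (LINT x|lebesgue_on \<Omega>. norm (u x) powr p) powr (1 / p)"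

definition l2_inner :: "plane set \<Rightarrow> (plane \<Rightarrow> 'b::real_inner) \<Rightarrow> (plane \<Rightarrow> 'b) \<Rightarrow> real" where
  "l2_inner \<Omega> u v = (LINT x|lebesgue_on \<Omega>. u x \<bullet> v x)"

abbreviation l2_norm :: "plane set \<Rightarrow> (plane \<Rightarrow> 'b::real_normed_vector) \<Rightarrow> real" where
  "l2_norm \<Omega> \<equiv> lp_norm \<Omega> 2"

definition pderivative :: "2 \<Rightarrow> (plane \<Rightarrow> real) \<Rightarrow> plane \<Rightarrow> real" where
  "pderivative i \<phi> x = frechet_derivative \<phi> (at x) (axis i 1)"

definition smooth :: "(plane \<Rightarrow> real) \<Rightarrow> bool" where
  "smooth \<phi> \<longleftrightarrow> (\<forall>is x. foldr pderivative is \<phi> differentiable (at x))"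

definition test_function :: "plane set \<Rightarrow> (plane \<Rightarrow> real) \<Rightarrow> bool" where
  "test_function \<Omega> \<phi> \<longleftrightarrow> smooth \<phi> \<and>
     compact (closure {x. \<phi> x \<noteq> 0}) \<and> closure {x. \<phi> x \<noteq> 0} \<subseteq> \<Omega>"

definition locally_integrable :: "plane set \<Rightarrow> (plane \<Rightarrow> real) \<Rightarrow> bool" where
  "locally_integrable \<Omega> u \<longleftrightarrow> (\<forall>K. compact K \<longrightarrow> K \<subseteq> \<Omega> \<longrightarrow> u absolutely_integrable_on K)"

text \<open>The pair \<open>a b\<close> is the multi-index of the derivative \<open>\<partial>\<^sub>1\<^sup>a \<partial>\<^sub>2\<^sup>b\<close>.\<close>

definition has_weak_deriv ::
  "plane set \<Rightarrow> nat \<Rightarrow> nat \<Rightarrow> (plane \<Rightarrow> real) \<Rightarrow> (plane \<Rightarrow> real) \<Rightarrow> bool" where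
  "has_weak_deriv \<Omega> a b u v \<longleftrightarrow> locally_integrable \<Omega> u \<and> locally_integrable \<Omega> v \<and>
     (\<forall>\<phi>. test_function \<Omega> \<phi> \<longrightarrow>
        l2_inner \<Omega> u ((pderivative 1 ^^ a) ((pderivative 2 ^^ b) \<phi>))
          = (- 1) ^ (a + b) * l2_inner \<Omega> v \<phi>)"

text \<open>Weak derivatives are unique a.e. on an open \<open>\<Omega>\<close>, so the choice below is immaterial.\<close>

definition weak_deriv :: "plane set \<Rightarrow> nat \<Rightarrow> nat \<Rightarrow> (plane \<Rightarrow> real) \<Rightarrow> plane \<Rightarrow> real" where
  "weak_deriv \<Omega> a b u = (SOME v. has_weak_deriv \<Omega> a b u v)"

definition grad :: "plane set \<Rightarrow> (plane \<Rightarrow> real) \<Rightarrow> plane \<Rightarrow> plane" where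
  "grad \<Omega> u x = vector [weak_deriv \<Omega> 1 0 u x, weak_deriv \<Omega> 0 1 u x]"

definition sobolev :: "plane set \<Rightarrow> nat \<Rightarrow> real \<Rightarrow> (plane \<Rightarrow> real) set" where
  "sobolev \<Omega> k p = {u \<in> lp_space \<Omega> p.
     \<forall>a b. a + b \<le> k \<longrightarrow> (\<exists>v \<in> lp_space \<Omega> p. has_weak_deriv \<Omega> a b u v)}"

definition deriv_abs :: "plane set \<Rightarrow> nat \<Rightarrow> (plane \<Rightarrow> real) \<Rightarrow> plane \<Rightarrow> real" where
  "deriv_abs \<Omega> j u x = sqrt (\<Sum>a\<le>j. (weak_deriv \<Omega> a (j - a) u x)\<^sup>2)"

text \<open>The pointwise size of the derivatives of a given order is measured by the Euclidean norm, so
  that the \<open>L\<^sup>p\<close> norm of the gradient is at most the \<open>W\<^sup>1\<^sub>p\<close> norm for every \<open>p\<close>. For \<open>p = 2\<close>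
  these are the usual Hilbert space norm and seminorm.\<close>

definition sobolev_norm :: "plane set \<Rightarrow> nat \<Rightarrow> real \<Rightarrow> (plane \<Rightarrow> real) \<Rightarrow> real" where
  "sobolev_norm \<Omega> k p u = (\<Sum>j\<le>k. lp_norm \<Omega> p (deriv_abs \<Omega> j u) powr p) powr (1 / p)"

definition sobolev_seminorm :: "plane set \<Rightarrow> nat \<Rightarrow> (plane \<Rightarrow> real) \<Rightarrow> real" where
  "sobolev_seminorm \<Omega> k u = l2_norm \<Omega> (deriv_abs \<Omega> k u)"

abbreviation h_space :: "plane set \<Rightarrow> nat \<Rightarrow> (plane \<Rightarrow> real) set" where
  "h_space \<Omega> k \<equiv> sobolev \<Omega> k 2"

abbreviation h1_norm :: "plane set \<Rightarrow> (plane \<Rightarrow> real) \<Rightarrow> real" where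
  "h1_norm \<Omega> \<equiv> sobolev_norm \<Omega> 1 2"

definition lipschitz_domain :: "plane set \<Rightarrow> bool" where
  "lipschitz_domain \<Omega> \<longleftrightarrow> open \<Omega> \<and> bounded \<Omega> \<and>
     (\<forall>x \<in> frontier \<Omega>. \<exists>\<rho> > 0. \<exists>Q :: plane \<Rightarrow> plane. \<exists>\<gamma> :: real \<Rightarrow> real. \<exists>L.
        orthogonal_transformation Q \<and> L-lipschitz_on UNIV \<gamma> \<and>
        \<Omega> \<inter> ball x \<rho> = {y \<in> ball x \<rho>. \<gamma> (Q y $ 1) < Q y $ 2})"

definition hausdorff_pre :: "real \<Rightarrow> plane set \<Rightarrow> ennreal" where
  "hausdorff_pre \<delta> A =
     (INF C \<in> {C :: nat \<Rightarrow> plane set. A \<subseteq> (\<Union>i. C i) \<and> (\<forall>i. bounded (C i) \<and> diameter (C i) \<le> \<delta>)}.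
        \<Sum>i. ennreal (diameter (C i)))"

definition hausdorff_outer :: "plane set \<Rightarrow> ennreal" where
  "hausdorff_outer A = (SUP \<delta> \<in> {0<..}. hausdorff_pre \<delta> A)"

definition arc_measure :: "plane measure" where
  "arc_measure = measure_of UNIV (sets borel) hausdorff_outer"

text \<open>The outer measure is countably additive on the Borel sets, so \<open>measure_of\<close> does not
  fall back to the zero measure.\<close>

lemma hausdorff_pre_mono: "A \<subseteq> B \<Longrightarrow> hausdorff_pre \<delta> A \<le> hausdorff_pre \<delta> B"
  unfolding hausdorff_pre_def by (rule INF_superset_mono) auto

lemma hausdorff_pre_antimono: "\<delta> \<le> \<delta>' \<Longrightarrow> hausdorff_pre \<delta>' A \<le> hausdorff_pre \<delta> A"
  unfolding hausdorff_pre_def by (rule INF_superset_mono) (auto intro: order_trans)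

lemma hausdorff_pre_le:
  "A \<subseteq> (\<Union>i. C i) \<Longrightarrow> (\<And>i. bounded (C i)) \<Longrightarrow> (\<And>i. diameter (C i) \<le> \<delta>) \<Longrightarrow>
    hausdorff_pre \<delta> A \<le> (\<Sum>i. ennreal (diameter (C i)))"
  unfolding hausdorff_pre_def by (rule INF_lower) auto

lemma hausdorff_pre_empty: "\<delta> > 0 \<Longrightarrow> hausdorff_pre \<delta> {} = 0"
  using hausdorff_pre_le[of "{}" "\<lambda>_. {}" \<delta>] by simp

lemma hausdorff_pre_subadditive:
  "hausdorff_pre \<delta> (\<Union>i::nat. A i) \<le> (\<Sum>i. hausdorff_pre \<delta> (A i))"
proof (rule ennreal_le_epsilon)
  fix e :: real assume "0 < e" and fin: "(\<Sum>n. hausdorff_pre \<delta> (A n)) < top"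
  then have *: "hausdorff_pre \<delta> (A n) < hausdorff_pre \<delta> (A n) + e * (1/2)^Suc n" for n
    by (auto simp add: less_top dest!: ennreal_suminf_lessD)
  have "\<exists>B. A n \<subseteq> (\<Union>i. B i) \<and> (\<forall>i. bounded (B i) \<and> diameter (B i) \<le> \<delta>) \<and>
      (\<Sum>i. ennreal (diameter (B i))) < hausdorff_pre \<delta> (A n) + e * (1/2)^Suc n" for n
    using *[of n] unfolding hausdorff_pre_def[of \<delta> "A n"] INF_less_iff by auto
  then obtain B :: "nat \<Rightarrow> nat \<Rightarrow> plane set"
    where B: "\<And>n. A n \<subseteq> (\<Union>i. B n i)" "\<And>n i. bounded (B n i)" "\<And>n i. diameter (B n i) \<le> \<delta>"
      and Ble: "\<And>n. (\<Sum>i. ennreal (diameter (B n i))) < hausdorff_pre \<delta> (A n) + e * (1/2)^Suc n"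
    by metis
  define C where "C = case_prod B o prod_decode"
  have "(\<Union>i. A i) \<subseteq> (\<Union>i. C i)"
    using B(1) by (auto simp add: C_def subset_eq) (metis prod.case prod_encode_inverse)
  then have "hausdorff_pre \<delta> (\<Union>i. A i) \<le> (\<Sum>i. ennreal (diameter (C i)))"
    by (rule hausdorff_pre_le) (auto simp: C_def split_def B)
  also have "\<dots> = (\<Sum>n. \<Sum>i. ennreal (diameter (B n i)))"
    unfolding C_def comp_def by (intro suminf_ennreal_2dimen) (auto simp: split_def)
  also have "\<dots> \<le> (\<Sum>n. hausdorff_pre \<delta> (A n) + e * (1/2) ^ Suc n)"
    by (intro suminf_le allI less_imp_le[OF Ble]) auto
  also have "... = (\<Sum>n. hausdorff_pre \<delta> (A n)) + (\<Sum>n. ennreal e * ennreal ((1/2) ^ Suc n))"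
    using \<open>0 < e\<close> by (subst suminf_add[symmetric])
      (auto simp del: ennreal_suminf_cmult simp add: ennreal_mult[symmetric])
  also have "\<dots> = (\<Sum>n. hausdorff_pre \<delta> (A n)) + e"
    unfolding ennreal_suminf_cmult
    by (subst suminf_ennreal_eq[OF zero_le_power power_half_series]) auto
  finally show "hausdorff_pre \<delta> (\<Union>i. A i) \<le> (\<Sum>n. hausdorff_pre \<delta> (A n)) + e" .
qed

lemma hausdorff_pre_separated:
  assumes "\<delta> < e" and sep: "\<And>x y. x \<in> A \<Longrightarrow> y \<in> B \<Longrightarrow> e \<le> dist x y"
  shows "hausdorff_pre \<delta> A + hausdorff_pre \<delta> B \<le> hausdorff_pre \<delta> (A \<union> B)"
  unfolding hausdorff_pre_def[of \<delta> "A \<union> B"]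
proof (rule INF_greatest, safe)
  fix C :: "nat \<Rightarrow> plane set"
  assume cov: "A \<union> B \<subseteq> (\<Union>i. C i)" and C: "\<forall>i. bounded (C i) \<and> diameter (C i) \<le> \<delta>"
  have nn: "0 \<le> diameter (C i)" for i
    using C diameter_ge_0 by blast
  define CA where "CA i = (if C i \<inter> A = {} then {} else C i)" for i
  define CB where "CB i = (if C i \<inter> B = {} then {} else C i)" for i
  have "0 \<le> \<delta>" using C nn[of 0] by (meson order_trans)
  have A: "hausdorff_pre \<delta> A \<le> (\<Sum>i. ennreal (diameter (CA i)))"
    using cov C \<open>0 \<le> \<delta>\<close> by (intro hausdorff_pre_le) (auto simp: CA_def, blast)
  have B: "hausdorff_pre \<delta> B \<le> (\<Sum>i. ennreal (diameter (CB i)))"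
    using cov C \<open>0 \<le> \<delta>\<close> by (intro hausdorff_pre_le) (auto simp: CB_def, blast)
  have *: "ennreal (diameter (CA i)) + ennreal (diameter (CB i)) \<le> ennreal (diameter (C i))" for i
  proof -
    have "C i \<inter> A = {} \<or> C i \<inter> B = {}"
    proof (rule ccontr)
      assume "\<not> ?thesis"
      then obtain x y where "x \<in> C i" "x \<in> A" "y \<in> C i" "y \<in> B" by blast
      moreover have "dist x y \<le> diameter (C i)"
        using C calculation diameter_bounded_bound by blast
      ultimately show False using sep[of x y] C \<open>\<delta> < e\<close> by (smt (verit))
    qed
    then show ?thesis by (auto simp: CA_def CB_def)
  qed
  have "hausdorff_pre \<delta> A + hausdorff_pre \<delta> B
      \<le> (\<Sum>i. ennreal (diameter (CA i))) + (\<Sum>i. ennreal (diameter (CB i)))"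
    using A B by (rule add_mono)
  also have "\<dots> = (\<Sum>i. ennreal (diameter (CA i)) + ennreal (diameter (CB i)))"
    by (rule suminf_add) auto
  also have "\<dots> \<le> (\<Sum>i. ennreal (diameter (C i)))"
    by (rule suminf_le) (use * in auto)
  finally show "hausdorff_pre \<delta> A + hausdorff_pre \<delta> B \<le> (\<Sum>i. ennreal (diameter (C i)))" .
qed

lemma hausdorff_outer_mono: "A \<subseteq> B \<Longrightarrow> hausdorff_outer A \<le> hausdorff_outer B"
  unfolding hausdorff_outer_def by (intro SUP_subset_mono hausdorff_pre_mono) auto

lemma hausdorff_outer_empty: "hausdorff_outer {} = 0"
proof -
  have "hausdorff_outer {} = (SUP \<delta> \<in> {0::real<..}. 0)"
    unfolding hausdorff_outer_def by (rule SUP_cong) (simp_all add: hausdorff_pre_empty)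
  then show ?thesis by simp
qed

lemma hausdorff_outer_subadditive:
  "hausdorff_outer (\<Union>i::nat. A i) \<le> (\<Sum>i. hausdorff_outer (A i))"
  unfolding hausdorff_outer_def[of "\<Union>i. A i"]
proof (rule SUP_least)
  fix \<delta> :: real assume \<delta>: "\<delta> \<in> {0<..}"
  have "hausdorff_pre \<delta> (\<Union>i. A i) \<le> (\<Sum>i. hausdorff_pre \<delta> (A i))"
    by (rule hausdorff_pre_subadditive)
  also have "\<dots> \<le> (\<Sum>i. hausdorff_outer (A i))"
    unfolding hausdorff_outer_def using \<delta> by (intro suminf_le) (auto intro: SUP_upper)
  finally show "hausdorff_pre \<delta> (\<Union>i. A i) \<le> (\<Sum>i. hausdorff_outer (A i))" .
qed

lemma hausdorff_outer_Un: "hausdorff_outer (A \<union> B) \<le> hausdorff_outer A + hausdorff_outer B"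
proof -
  let ?C = "\<lambda>i::nat. if i = 0 then A else if i = Suc 0 then B else {}"
  have "(\<Union>i. ?C i) = A \<union> B"
    by (auto split: if_splits)
  then have "hausdorff_outer (A \<union> B) \<le> (\<Sum>i. hausdorff_outer (?C i))"
    using hausdorff_outer_subadditive[of ?C] by metis
  also have "\<dots> = (\<Sum>i<2. hausdorff_outer (?C i))"
    by (rule suminf_finite) (auto simp: hausdorff_outer_empty)
  finally show ?thesis by (simp add: numeral_2_eq_2)
qed

lemma hausdorff_outer_separated:
  assumes "0 < e" and sep: "\<And>x y. x \<in> A \<Longrightarrow> y \<in> B \<Longrightarrow> e \<le> dist x y"
  shows "hausdorff_outer A + hausdorff_outer B \<le> hausdorff_outer (A \<union> B)"
proof -
  have "hausdorff_outer A + hausdorff_outer B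
      = (SUP \<delta>\<in>{0<..}. hausdorff_pre \<delta> A + hausdorff_pre \<delta> B)"
    unfolding hausdorff_outer_def
  proof (rule SUP_add_directed_ennreal[symmetric])
    fix i j :: real assume "i \<in> {0<..}" "j \<in> {0<..}"
    then show "\<exists>k\<in>{0<..}. hausdorff_pre i A + hausdorff_pre j B
        \<le> hausdorff_pre k A + hausdorff_pre k B"
      by (intro bexI[of _ "min i j"] add_mono hausdorff_pre_antimono) auto
  qed
  also have "\<dots> \<le> hausdorff_outer (A \<union> B)"
  proof (rule SUP_least)
    fix \<delta> :: real assume \<delta>: "\<delta> \<in> {0<..}"
    let ?d = "min \<delta> (e / 2)"
    have "hausdorff_pre \<delta> A + hausdorff_pre \<delta> B \<le> hausdorff_pre ?d A + hausdorff_pre ?d B"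
      by (intro add_mono hausdorff_pre_antimono) auto
    also have "\<dots> \<le> hausdorff_pre ?d (A \<union> B)"
      by (rule hausdorff_pre_separated[OF _ sep]) (use \<open>0 < e\<close> in auto)
    also have "\<dots> \<le> hausdorff_outer (A \<union> B)"
      unfolding hausdorff_outer_def using \<delta> \<open>0 < e\<close> by (intro SUP_upper) auto
    finally show "hausdorff_pre \<delta> A + hausdorff_pre \<delta> B \<le> hausdorff_outer (A \<union> B)" .
  qed
  finally show ?thesis .
qed

lemma ennreal_less_add_pos: "x < top \<Longrightarrow> 0 < e \<Longrightarrow> x < x + (e :: ennreal)"
  by (cases x rule: ennreal_cases; cases e rule: ennreal_cases)
    (auto simp flip: ennreal_plus simp: ennreal_less_iff)

lemma hausdorff_outer_sum_separated:
  fixes R :: "nat \<Rightarrow> plane set"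
  assumes sep: "\<And>n. \<exists>e>0. \<forall>j<n. \<forall>x\<in>R j. \<forall>y\<in>R n. e \<le> dist x y"
  shows "(\<Sum>j<n. hausdorff_outer (R j)) \<le> hausdorff_outer (\<Union>j<n. R j)"
proof (induction n)
  case (Suc n)
  obtain e where e: "e > 0" "\<forall>j<n. \<forall>x\<in>R j. \<forall>y\<in>R n. e \<le> dist x y" using sep by blast
  have "(\<Sum>j<Suc n. hausdorff_outer (R j)) \<le> hausdorff_outer (\<Union>j<n. R j) + hausdorff_outer (R n)"
    using Suc by (simp add: add_mono)
  also have "\<dots> \<le> hausdorff_outer ((\<Union>j<n. R j) \<union> R n)"
    by (rule hausdorff_outer_separated[OF e(1)]) (use e(2) in auto)
  finally show ?case by (simp add: lessThan_Suc Un_commute)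
qed (simp add: hausdorff_outer_empty)

lemma hausdorff_outer_open:
  assumes U: "open U"
  shows "hausdorff_outer (E \<inter> U) + hausdorff_outer (E - U) \<le> hausdorff_outer E"
proof (cases "U = UNIV")
  case True then show ?thesis by (simp add: hausdorff_outer_empty)
next
  case False
  let ?H = hausdorff_outer
  let ?F = "- U"
  have F: "?F \<noteq> {}" "closed ?F" using False U by auto
  define d where "d n = 1 / real (Suc n)" for n
  have dpos: "d n > 0" for n by (simp add: d_def)
  have dmono: "m \<le> n \<Longrightarrow> d n \<le> d m" for m n by (simp add: d_def frac_le)
  have dless: "m < n \<Longrightarrow> d n < d m" for m n by (simp add: d_def frac_less2)
  define A where "A n = {x \<in> E. d n \<le> infdist x ?F}" for n
  have Amono: "m \<le> n \<Longrightarrow> A m \<subseteq> A n" for m n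
    using dmono by (force simp: A_def)
  have AU: "A n \<subseteq> E \<inter> U" for n
  proof
    fix x assume "x \<in> A n"
    then have "x \<in> E" "infdist x ?F > 0" using dpos[of n] by (auto simp: A_def)
    then show "x \<in> E \<inter> U" by (cases "x \<in> U") auto
  qed
  have UA: "(\<Union>n. A n) = E \<inter> U"
  proof (rule antisym)
    show "E \<inter> U \<subseteq> (\<Union>n. A n)"
    proof
      fix x assume x: "x \<in> E \<inter> U"
      then have "infdist x ?F > 0"
        using F infdist_pos_not_in_closed[of ?F x] by auto
      then obtain n where "inverse (real (Suc n)) < infdist x ?F" using reals_Archimedean by blast
      then have "x \<in> A n" using x by (auto simp: A_def d_def inverse_eq_divide)
      then show "x \<in> (\<Union>n. A n)" by blast
    qed
  qed (use AU in blast)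
  have base: "?H (A n) + ?H (E - U) \<le> ?H E" for n
  proof -
    have "?H (A n) + ?H (E - U) \<le> ?H (A n \<union> (E - U))"
    proof (rule hausdorff_outer_separated[OF dpos[of n]])
      fix x y assume "x \<in> A n" "y \<in> E - U"
      then have "d n \<le> infdist x ?F" "y \<in> ?F" by (auto simp: A_def)
      then show "d n \<le> dist x y" using infdist_le[of y ?F x] by linarith
    qed
    also have "\<dots> \<le> ?H E" by (rule hausdorff_outer_mono) (auto simp: A_def)
    finally show ?thesis .
  qed
  define M where "M = (SUP n. ?H (A n))"
  have AM: "?H (A n) \<le> M" for n unfolding M_def by (rule SUP_upper) simp
  have ME: "M + ?H (E - U) \<le> ?H E"
  proof -
    have "M + ?H (E - U) = (SUP n. ?H (A n) + ?H (E - U))"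
      unfolding M_def by (subst ennreal_SUP_add_left) auto
    also have "\<dots> \<le> ?H E" by (rule SUP_least) (rule base)
    finally show ?thesis .
  qed
  have "?H (E \<inter> U) \<le> M"
  proof (cases "M = top")
    case False
    define R where "R k = A (Suc k) - A k" for k
    have sep: "d (Suc j) - d (Suc (Suc j)) \<le> dist x y"
      if "Suc j < k" "x \<in> R j" "y \<in> R k" for j k x y
    proof -
      have "d (Suc j) \<le> infdist x ?F" using that by (auto simp: R_def A_def)
      moreover have "infdist y ?F < d (Suc (Suc j))"
        using that dmono[of "Suc (Suc j)" k] by (auto simp: R_def A_def)
      moreover have "infdist x ?F \<le> infdist y ?F + dist x y" by (rule infdist_triangle)
      ultimately show ?thesis by linarith
    qed
    have half: "(\<Sum>j<n. ?H (R (2 * j + c))) \<le> M" for c n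
    proof -
      have "(\<Sum>j<n. ?H (R (2 * j + c))) \<le> ?H (\<Union>j<n. R (2 * j + c))"
      proof (rule hausdorff_outer_sum_separated[of "\<lambda>j. R (2 * j + c)"])
        fix n
        let ?e = "\<lambda>j. d (Suc (2 * j + c)) - d (Suc (Suc (2 * j + c)))"
        define e where "e = Min (insert 1 (?e ` {..<n}))"
        have "e > 0" unfolding e_def using dless by (subst Min_gr_iff) auto
        moreover have "e \<le> dist x y" if "j < n" "x \<in> R (2 * j + c)" "y \<in> R (2 * n + c)" for j x y
        proof -
          have "e \<le> ?e j" unfolding e_def using that by (intro Min_le) auto
          then show ?thesis using sep[of "2 * j + c" "2 * n + c" x y] that by linarith
        qed
        ultimately show "\<exists>e>0. \<forall>j<n. \<forall>x\<in>R (2 * j + c). \<forall>y\<in>R (2 * n + c). e \<le> dist x y"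
          by blast
      qed
      also have "\<dots> \<le> ?H (A (2 * n + c))"
      proof (rule hausdorff_outer_mono, safe)
        fix j x assume "j < n" "x \<in> R (2 * j + c)"
        then show "x \<in> A (2 * n + c)"
          using Amono[of "Suc (2 * j + c)" "2 * n + c"] by (auto simp: R_def)
      qed
      finally show ?thesis using AM order_trans by blast
    qed
    let ?f = "\<lambda>k. ?H (R k)"
    have part: "(\<Sum>k<n. ?f k) \<le> M + M" for n
    proof -
      have "(\<Sum>k<n. ?f k) \<le> (\<Sum>k<2*n. ?f k)" by (rule sum_mono2) auto
      also have "\<dots> = (\<Sum>j<n. ?f (2 * j + 0)) + (\<Sum>j<n. ?f (2 * j + 1))"
        by (induction n) (auto simp: algebra_simps)
      also have "\<dots> \<le> M + M" by (intro add_mono half)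
      finally show ?thesis .
    qed
    have "(\<Sum>k. ?f k) \<le> M + M"
      unfolding suminf_eq_SUP by (rule SUP_least) (rule part)
    also have "\<dots> < top" using False by (simp add: less_top)
    finally have fin: "(\<Sum>k. ?f k) < top" .
    show ?thesis
    proof (rule ennreal_le_epsilon)
      fix e :: real assume e: "0 < e"
      have "\<exists>n. (\<Sum>k. ?f k) \<le> (\<Sum>k<n. ?f k) + e"
      proof (rule ccontr)
        assume "\<not> ?thesis"
        then have "(\<Sum>k<n. ?f k) + e \<le> (\<Sum>k. ?f k)" for n by (meson linear)
        then have "(SUP n. (\<Sum>k<n. ?f k) + e) \<le> (\<Sum>k. ?f k)" by (intro SUP_least)
        then have "(\<Sum>k. ?f k) + e \<le> (\<Sum>k. ?f k)"
          by (simp add: ennreal_SUP_add_left suminf_eq_SUP)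
        moreover have "(\<Sum>k. ?f k) < (\<Sum>k. ?f k) + e"
          using e fin by (intro ennreal_less_add_pos) auto
        ultimately show False by (meson not_less)
      qed
      then obtain n where n: "(\<Sum>k. ?f k) \<le> (\<Sum>k<n. ?f k) + e" by blast
      have "(\<Sum>k. ?f (k + n)) + (\<Sum>k<n. ?f k) = (\<Sum>k. ?f k)"
        using suminf_offset[of ?f n] by (simp add: add.commute)
      then have "(\<Sum>k<n. ?f k) + (\<Sum>k. ?f (k + n)) \<le> (\<Sum>k<n. ?f k) + e"
        using n by (simp add: add.commute)
      moreover have "(\<Sum>k<n. ?f k) \<noteq> top"
        using part[of n] False by (metis ennreal_add_eq_top neq_top_trans)
      ultimately have tail: "(\<Sum>k. ?f (k + n)) \<le> e"
        by (simp add: ennreal_add_left_cancel_le)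
      have "E \<inter> U \<subseteq> A n \<union> (\<Union>k. R (k + n))"
      proof
        fix x assume "x \<in> E \<inter> U"
        then have ex: "\<exists>m. x \<in> A m" using UA by blast
        define m where "m = (LEAST m. x \<in> A m)"
        have m: "x \<in> A m" "\<And>k. k < m \<Longrightarrow> x \<notin> A k"
          using LeastI_ex[OF ex] not_less_Least unfolding m_def by blast+
        show "x \<in> A n \<union> (\<Union>k. R (k + n))"
        proof (cases "m \<le> n")
          case True then show ?thesis using m Amono by blast
        next
          case False
          then have "x \<in> R ((m - 1 - n) + n)" using m(1) m(2)[of "m - 1"] by (auto simp: R_def)
          then show ?thesis by blast
        qed
      qed
      then have "?H (E \<inter> U) \<le> ?H (A n \<union> (\<Union>k. R (k + n)))" by (rule hausdorff_outer_mono)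
      also have "\<dots> \<le> ?H (A n) + ?H (\<Union>k. R (k + n))" by (rule hausdorff_outer_Un)
      also have "\<dots> \<le> M + (\<Sum>k. ?f (k + n))"
        by (intro add_mono AM hausdorff_outer_subadditive)
      also have "\<dots> \<le> M + e" by (intro add_mono tail order_refl)
      finally show "?H (E \<inter> U) \<le> M + e" .
    qed
  qed simp
  then have "?H (E \<inter> U) + ?H (E - U) \<le> M + ?H (E - U)" by (rule add_right_mono)
  with ME show ?thesis by (rule order_trans[rotated])
qed

lemma sets_arc_measure [simp, measurable_cong]: "sets arc_measure = sets borel"
proof -
  have "sets arc_measure = sigma_sets UNIV (sets (borel :: plane measure))"
    unfolding arc_measure_def by (rule sets_measure_of) simp
  also have "\<dots> = sets borel"
    using sets.sigma_sets_eq[of "borel :: plane measure"] unfolding space_borel .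
  finally show ?thesis .
qed

lemma emeasure_arc_measure:
  assumes "A \<in> sets borel"
  shows "emeasure arc_measure A = hausdorff_outer A"
proof -
  let ?L = "lambda_system UNIV (Pow UNIV) hausdorff_outer"
  have "outer_measure_space (Pow UNIV) hausdorff_outer"
    by (auto simp: outer_measure_space_def positive_def increasing_def countably_subadditive_def
        hausdorff_outer_empty hausdorff_outer_mono hausdorff_outer_subadditive)
  then have ms: "measure_space UNIV ?L hausdorff_outer"
    by (rule sigma_algebra.caratheodory_lemma[OF sigma_algebra_Pow])
  have "U \<in> ?L" if "open U" for U
  proof -
    have "hausdorff_outer (E \<inter> U) + hausdorff_outer (E - U) = hausdorff_outer E" for E
      using hausdorff_outer_open[OF that, of E] hausdorff_outer_Un[of "E \<inter> U" "E - U"]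
      by (simp add: Int_Diff_Un antisym)
    moreover have "U \<inter> E = E \<inter> U" "(UNIV - U) \<inter> E = E - U" for E by blast+
    ultimately show ?thesis by (simp add: lambda_system_def)
  qed
  then have "sigma_sets UNIV {U. open U} \<subseteq> ?L"
    using ms unfolding measure_space_def by (intro sigma_algebra.sigma_sets_subset) auto
  then have "sets borel \<subseteq> ?L"
    by (simp add: sets_borel)
  moreover have sa: "sigma_algebra UNIV (sets (borel :: plane measure))"
    using sets.sigma_algebra_axioms[of "borel :: plane measure"] by simp
  ultimately have "measure_space UNIV (sets (borel :: plane measure)) hausdorff_outer"
    using measure_down[OF ms] by blast
  then show ?thesis
    unfolding arc_measure_def measure_space_def
    using assms by (intro emeasure_measure_of_sigma) auto
qed

text \<open>The trace on the boundary is the continuous extension to \<open>H\<^sup>1\<close> of the restriction of smooth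
  functions, with values in \<open>L\<^sup>2\<close> for the one-dimensional Hausdorff measure.\<close>

definition has_trace :: "plane set \<Rightarrow> (plane \<Rightarrow> real) \<Rightarrow> (plane \<Rightarrow> real) \<Rightarrow> bool" where
  "has_trace \<Omega> u \<gamma> \<longleftrightarrow> u \<in> h_space \<Omega> 1 \<and> \<gamma> \<in> borel_measurable borel \<and>
     (\<exists>\<phi> :: nat \<Rightarrow> plane \<Rightarrow> real. (\<forall>n. smooth (\<phi> n)) \<and>
        (\<lambda>n. h1_norm \<Omega> (\<lambda>x. \<phi> n x - u x)) \<longlonglongrightarrow> 0 \<and>
        (\<lambda>n. \<integral>\<^sup>+x. ennreal ((\<phi> n x - \<gamma> x)\<^sup>2) * indicator (frontier \<Omega>) x \<partial>arc_measure) \<longlonglongrightarrow> 0)"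

definition h1d :: "plane set \<Rightarrow> plane set \<Rightarrow> (plane \<Rightarrow> real) set" where
  "h1d \<Omega> \<Gamma>\<^sub>D = {u \<in> h_space \<Omega> 1. \<exists>\<gamma>. has_trace \<Omega> u \<gamma> \<and> (AE x in arc_measure. x \<in> \<Gamma>\<^sub>D \<longrightarrow> \<gamma> x = 0)}"

definition h1d_dual :: "plane set \<Rightarrow> plane set \<Rightarrow> ((plane \<Rightarrow> real) \<Rightarrow> real) set" where
  "h1d_dual \<Omega> \<Gamma>\<^sub>D = {F.
     (\<forall>u \<in> h1d \<Omega> \<Gamma>\<^sub>D. \<forall>v \<in> h1d \<Omega> \<Gamma>\<^sub>D. \<forall>a b. F (\<lambda>x. a * u x + b * v x) = a * F u + b * F v) \<and>
     (\<exists>K. \<forall>u \<in> h1d \<Omega> \<Gamma>\<^sub>D. \<bar>F u\<bar> \<le> K * h1_norm \<Omega> u)}"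

definition h1d_dual_norm :: "plane set \<Rightarrow> plane set \<Rightarrow> ((plane \<Rightarrow> real) \<Rightarrow> real) \<Rightarrow> real" where
  "h1d_dual_norm \<Omega> \<Gamma>\<^sub>D F = (SUP u \<in> {u \<in> h1d \<Omega> \<Gamma>\<^sub>D. h1_norm \<Omega> u \<le> 1}. \<bar>F u\<bar>)"

text \<open>Values lie in a space of functions \<open>'a \<Rightarrow> real\<close> given by its carrier \<open>X\<close> and norm \<open>N\<close>.\<close>

definition simple_curve :: "real \<Rightarrow> ('a \<Rightarrow> real) set \<Rightarrow> (real \<Rightarrow> 'a \<Rightarrow> real) \<Rightarrow> bool" where
  "simple_curve T X s \<longleftrightarrow> s ` {0..T} \<subseteq> X \<and> finite (s ` {0..T}) \<and>
     (\<forall>v. {t \<in> {0..T}. s t = v} \<in> sets lebesgue)"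

definition strongly_measurable ::
  "real \<Rightarrow> ('a \<Rightarrow> real) set \<Rightarrow> (('a \<Rightarrow> real) \<Rightarrow> real) \<Rightarrow> (real \<Rightarrow> 'a \<Rightarrow> real) \<Rightarrow> bool" where
  "strongly_measurable T X N u \<longleftrightarrow> (AE t in lebesgue_on {0..T}. u t \<in> X) \<and>
     (\<exists>s :: nat \<Rightarrow> real \<Rightarrow> 'a \<Rightarrow> real. (\<forall>n. simple_curve T X (s n)) \<and>
        (AE t in lebesgue_on {0..T}. (\<lambda>n. N (\<lambda>x. s n t x - u t x)) \<longlonglongrightarrow> 0))"

definition bochner_lp ::
  "real \<Rightarrow> real \<Rightarrow> ('a \<Rightarrow> real) set \<Rightarrow> (('a \<Rightarrow> real) \<Rightarrow> real) \<Rightarrow> (real \<Rightarrow> 'a \<Rightarrow> real) set" where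
  "bochner_lp p T X N = {u. strongly_measurable T X N u \<and>
     integrable (lebesgue_on {0..T}) (\<lambda>t. N (u t) powr p)}"

definition bochner_linf ::
  "real \<Rightarrow> ('a \<Rightarrow> real) set \<Rightarrow> (('a \<Rightarrow> real) \<Rightarrow> real) \<Rightarrow> (real \<Rightarrow> 'a \<Rightarrow> real) set" where
  "bochner_linf T X N = {u. strongly_measurable T X N u \<and>
     (\<exists>M. AE t in lebesgue_on {0..T}. N (u t) \<le> M)}"

definition time_test_function :: "real \<Rightarrow> (real \<Rightarrow> real) \<Rightarrow> bool" where
  "time_test_function T \<eta> \<longleftrightarrow> (\<forall>n t. (deriv ^^ n) \<eta> differentiable (at t)) \<and>
     closure {t. \<eta> t \<noteq> 0} \<subseteq> {0<..<T}"

text \<open>The distributional derivative in time of a curve in \<open>L\<^sup>2(\<Omega>)\<close>, as a curve of functionals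
  on \<open>H\<^sup>1\<^sub>D\<close>; \<open>L\<^sup>2(\<Omega>)\<close> is embedded in the dual by its inner product.\<close>

definition has_time_deriv ::
  "plane set \<Rightarrow> plane set \<Rightarrow> real \<Rightarrow> (real \<Rightarrow> plane \<Rightarrow> real) \<Rightarrow>
     (real \<Rightarrow> (plane \<Rightarrow> real) \<Rightarrow> real) \<Rightarrow> bool" where
  "has_time_deriv \<Omega> \<Gamma>\<^sub>D T u u' \<longleftrightarrow>
     (\<forall>\<eta>. time_test_function T \<eta> \<longrightarrow> (\<forall>\<psi> \<in> h1d \<Omega> \<Gamma>\<^sub>D.
        (LINT t|lebesgue_on {0..T}. deriv \<eta> t * l2_inner \<Omega> (u t) \<psi>)
          = - (LINT t|lebesgue_on {0..T}. \<eta> t * u' t \<psi>)))"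

definition form_A ::
  "plane set \<Rightarrow> (plane \<Rightarrow> real) \<Rightarrow> (real \<Rightarrow> real) \<Rightarrow> (plane \<Rightarrow> real) \<Rightarrow>
     (plane \<Rightarrow> real) \<Rightarrow> (plane \<Rightarrow> real) \<Rightarrow> (plane \<Rightarrow> real) \<Rightarrow> (plane \<Rightarrow> real) \<Rightarrow> real" where
  "form_A \<Omega> D \<kappa> q v u w z =
     l2_inner \<Omega> (\<lambda>x. D x *\<^sub>R grad \<Omega> v x) (grad \<Omega> w)
     + l2_inner \<Omega> (\<lambda>x. (v x * \<kappa> (z x)) *\<^sub>R grad \<Omega> u x) (grad \<Omega> w)
     + l2_inner \<Omega> (\<lambda>x. q x * v x) w"

definition form_B ::
  "plane set \<Rightarrow> (real \<Rightarrow> real) \<Rightarrow> (plane \<Rightarrow> real) \<Rightarrow> (plane \<Rightarrow> real) \<Rightarrow> (plane \<Rightarrow> real) \<Rightarrow> real" where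
  "form_B \<Omega> \<kappa> u w z = l2_inner \<Omega> (\<lambda>x. \<kappa> (z x) *\<^sub>R grad \<Omega> u x) (grad \<Omega> w)"

definition elliptic_solution ::
  "plane set \<Rightarrow> plane set \<Rightarrow> (real \<Rightarrow> real) \<Rightarrow> (plane \<Rightarrow> real) \<Rightarrow>
     (plane \<Rightarrow> real) \<Rightarrow> (plane \<Rightarrow> real) \<Rightarrow> bool" where
  "elliptic_solution \<Omega> \<Gamma>\<^sub>D \<kappa> g z u \<longleftrightarrow> u \<in> h1d \<Omega> \<Gamma>\<^sub>D \<and>
     (\<forall>\<phi> \<in> h1d \<Omega> \<Gamma>\<^sub>D. form_B \<Omega> \<kappa> u \<phi> z = l2_inner \<Omega> g \<phi>)"

definition admissible_data ::
  "plane set \<Rightarrow> (plane \<Rightarrow> real) \<Rightarrow> (plane \<Rightarrow> real) \<Rightarrow> real \<Rightarrow> real \<Rightarrow>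
     (real \<Rightarrow> real) \<Rightarrow> real \<Rightarrow> real \<Rightarrow> (plane \<Rightarrow> real) \<Rightarrow> (plane \<Rightarrow> real) \<Rightarrow>
     (real \<Rightarrow> plane \<Rightarrow> real) \<Rightarrow> real \<Rightarrow> bool" where
  "admissible_data \<Omega> \<theta>0 D Dmin Dmax \<kappa> \<kappa>min \<kappa>max q g f T \<longleftrightarrow>
     \<theta>0 \<in> lp_space \<Omega> 2 \<and> (AE x in lebesgue_on \<Omega>. 0 \<le> \<theta>0 x \<and> \<theta>0 x \<le> 1) \<and>
     D \<in> borel_measurable (lebesgue_on \<Omega>) \<and> 0 < Dmin \<and>
     (AE x in lebesgue_on \<Omega>. Dmin < D x \<and> D x \<le> Dmax) \<and>
     continuous_on UNIV \<kappa> \<and> 0 < \<kappa>min \<and> (\<forall>\<zeta>. \<kappa>min \<le> \<kappa> \<zeta> \<and> \<kappa> \<zeta> \<le> \<kappa>max) \<and>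
     q \<in> lp_space \<Omega> 2 \<and> g \<in> lp_space \<Omega> 2 \<and>
     f \<in> bochner_lp 2 T (lp_space \<Omega> 2) (l2_norm \<Omega>) \<and>
     (AE x in lebesgue_on \<Omega>. 0 \<le> g x + 2 * q x) \<and>
     (AE t in lebesgue_on {0..T}. AE x in lebesgue_on \<Omega>. f t x \<le> g x + q x \<and> 0 \<le> f t x)"

definition system_solution ::
  "plane set \<Rightarrow> plane set \<Rightarrow> (plane \<Rightarrow> real) \<Rightarrow> (real \<Rightarrow> real) \<Rightarrow> (plane \<Rightarrow> real) \<Rightarrow>
     (plane \<Rightarrow> real) \<Rightarrow> (real \<Rightarrow> plane \<Rightarrow> real) \<Rightarrow> (plane \<Rightarrow> real) \<Rightarrow> real \<Rightarrow>
     (real \<Rightarrow> plane \<Rightarrow> real) \<Rightarrow> (real \<Rightarrow> plane \<Rightarrow> real) \<Rightarrow> bool" where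
  "system_solution \<Omega> \<Gamma>\<^sub>D D \<kappa> q g F \<theta>0 T \<theta> p \<longleftrightarrow>
     \<theta> \<in> bochner_linf T (lp_space \<Omega> 2) (l2_norm \<Omega>) \<and>
     \<theta> \<in> bochner_lp 2 T (h1d \<Omega> \<Gamma>\<^sub>D) (h1_norm \<Omega>) \<and>
     p \<in> bochner_linf T (h1d \<Omega> \<Gamma>\<^sub>D) (h1_norm \<Omega>) \<and>
     (AE x in lebesgue_on \<Omega>. \<theta> 0 x = \<theta>0 x) \<and>
     (\<exists>\<theta>' \<in> bochner_lp 2 T (h1d_dual \<Omega> \<Gamma>\<^sub>D) (h1d_dual_norm \<Omega> \<Gamma>\<^sub>D).
        has_time_deriv \<Omega> \<Gamma>\<^sub>D T \<theta> \<theta>' \<and>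
        (AE t in lebesgue_on {0..T}. \<forall>\<psi> \<in> h1d \<Omega> \<Gamma>\<^sub>D.
           \<theta>' t \<psi> + form_A \<Omega> D \<kappa> q (\<theta> t) (p t) \<psi> (\<theta> t) = l2_inner \<Omega> (F t) \<psi>)) \<and>
     (AE t in lebesgue_on {0..T}. \<forall>\<phi> \<in> h1d \<Omega> \<Gamma>\<^sub>D. form_B \<Omega> \<kappa> (p t) \<phi> (\<theta> t) = l2_inner \<Omega> g \<phi>)"

definition weak_solution ::
  "plane set \<Rightarrow> plane set \<Rightarrow> (plane \<Rightarrow> real) \<Rightarrow> (real \<Rightarrow> real) \<Rightarrow> (plane \<Rightarrow> real) \<Rightarrow>
     (plane \<Rightarrow> real) \<Rightarrow> (real \<Rightarrow> plane \<Rightarrow> real) \<Rightarrow> (plane \<Rightarrow> real) \<Rightarrow> real \<Rightarrow>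
     (real \<Rightarrow> plane \<Rightarrow> real) \<Rightarrow> (real \<Rightarrow> plane \<Rightarrow> real) \<Rightarrow> bool" where
  "weak_solution \<Omega> \<Gamma>\<^sub>D D \<kappa> q g f \<theta>0 T \<theta> p \<longleftrightarrow>
     system_solution \<Omega> \<Gamma>\<^sub>D D \<kappa> q g f \<theta>0 T \<theta> p \<and>
     (AE t in lebesgue_on {0..T}. AE x in lebesgue_on \<Omega>. 0 \<le> \<theta> t x \<and> \<theta> t x \<le> 1)"

definition assimilation_solution ::
  "plane set \<Rightarrow> plane set \<Rightarrow> (plane \<Rightarrow> real) \<Rightarrow> (real \<Rightarrow> real) \<Rightarrow> (plane \<Rightarrow> real) \<Rightarrow>
     (plane \<Rightarrow> real) \<Rightarrow> (real \<Rightarrow> plane \<Rightarrow> real) \<Rightarrow> real \<Rightarrow> ((plane \<Rightarrow> real) \<Rightarrow> plane \<Rightarrow> real) \<Rightarrow>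
     (real \<Rightarrow> plane \<Rightarrow> real) \<Rightarrow> (plane \<Rightarrow> real) \<Rightarrow> real \<Rightarrow>
     (real \<Rightarrow> plane \<Rightarrow> real) \<Rightarrow> (real \<Rightarrow> plane \<Rightarrow> real) \<Rightarrow> bool" where
  "assimilation_solution \<Omega> \<Gamma>\<^sub>D D \<kappa> q g f \<mu> P \<theta> \<theta>h0 T \<theta>h ph \<longleftrightarrow>
     system_solution \<Omega> \<Gamma>\<^sub>D D \<kappa> q g (\<lambda>t x. f t x - \<mu> * P (\<lambda>y. \<theta>h t y - \<theta> t y) x) \<theta>h0 T \<theta>h ph"

text \<open>The solutions above are determined only for a.e. time. This selects the representative of
  \<open>\<theta>\<close> that is continuous in time with values in \<open>L\<^sup>2(\<Omega>)\<close>, and \<open>p t\<close> as the solution of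
  the elliptic equation at every time.\<close>

definition canonical_in_time ::
  "plane set \<Rightarrow> plane set \<Rightarrow> (real \<Rightarrow> real) \<Rightarrow> (plane \<Rightarrow> real) \<Rightarrow>
     (real \<Rightarrow> plane \<Rightarrow> real) \<Rightarrow> (real \<Rightarrow> plane \<Rightarrow> real) \<Rightarrow> bool" where
  "canonical_in_time \<Omega> \<Gamma>\<^sub>D \<kappa> g \<theta> p \<longleftrightarrow>
     (\<forall>t \<ge> 0. \<theta> t \<in> lp_space \<Omega> 2 \<and>
        ((\<lambda>\<tau>. l2_norm \<Omega> (\<lambda>x. \<theta> \<tau> x - \<theta> t x)) \<longlongrightarrow> 0) (at t within {0..}) \<and>
        elliptic_solution \<Omega> \<Gamma>\<^sub>D \<kappa> g (\<theta> t) (p t))"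

definition linear_h1_l2 :: "plane set \<Rightarrow> ((plane \<Rightarrow> real) \<Rightarrow> plane \<Rightarrow> real) \<Rightarrow> bool" where
  "linear_h1_l2 \<Omega> P \<longleftrightarrow>
     (\<forall>u \<in> h_space \<Omega> 1. P u \<in> lp_space \<Omega> 2) \<and>
     (\<forall>u \<in> h_space \<Omega> 1. \<forall>v \<in> h_space \<Omega> 1. (AE x in lebesgue_on \<Omega>. u x = v x) \<longrightarrow>
        (AE x in lebesgue_on \<Omega>. P u x = P v x)) \<and>
     (\<forall>u \<in> h_space \<Omega> 1. \<forall>v \<in> h_space \<Omega> 1. \<forall>a b.
        AE x in lebesgue_on \<Omega>. P (\<lambda>y. a * u y + b * v y) x = a * P u x + b * P v x)"

definition meyers_constants ::
  "plane set \<Rightarrow> plane set \<Rightarrow> (real \<Rightarrow> real) \<Rightarrow> (plane \<Rightarrow> real) \<Rightarrow> ereal \<Rightarrow> (real \<Rightarrow> real) \<Rightarrow> bool" where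
  "meyers_constants \<Omega> \<Gamma>\<^sub>D \<kappa> g r0 C \<longleftrightarrow> 2 < r0 \<and>
     (\<forall>r \<ge> 2. ereal r < r0 \<longrightarrow>
        (\<forall>z \<in> borel_measurable (lebesgue_on \<Omega>). \<forall>u. elliptic_solution \<Omega> \<Gamma>\<^sub>D \<kappa> g z u \<longrightarrow>
           u \<in> sobolev \<Omega> 1 r \<and> sobolev_norm \<Omega> 1 r u \<le> C r * l2_norm \<Omega> g))"

text \<open>The exponents \<open>a\<close>, \<open>c\<close> are parameters because no single constant serves all
  \<open>1 \<le> c \<le> a < \<infinity>\<close>: letting \<open>a\<close> tend to infinity would bound the supremum norm by the
  \<open>H\<^sup>1\<close> norm, which fails in two dimensions.\<close>

definition gagliardo_nirenberg_constant :: "plane set \<Rightarrow> real \<Rightarrow> real \<Rightarrow> real \<Rightarrow> bool" where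
  "gagliardo_nirenberg_constant \<Omega> a c K \<longleftrightarrow>
     (\<forall>u \<in> h_space \<Omega> 1. u \<in> lp_space \<Omega> a \<and>
        lp_norm \<Omega> a u \<le> K * lp_norm \<Omega> c u powr (c / a) * h1_norm \<Omega> u powr (1 - c / a))"

end

(* Write v, vh for the two moisture fields and w, wh for their Darcy fluxes. The difference e = vh - v
   satisfies, for a.e. t,
     d/dt |e|^2 + 2 <D grad e, grad e> + 2 <vh wh - v w, grad e> + 2 <q e, e> = -2 mu <P e, e>,
   the convective term being split with the elliptic equation: <e wh, grad e> = <g, e^2> / 2 cancels
   against q by g + 2q >= 0, while <v (wh - w), grad e> is controlled by 0 <= v <= 1 and the bound on
   wh - w from the Meyers and Gagliardo-Nirenberg inequalities. Young's inequality and the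
   approximation property of P then give d/dt |e|^2 <= xi |e|^2, hence decay. For the fluxes,
   |kappa(z1) - kappa(z2)| in L^s is bounded by interpolation between L^2 and L^oo, so the decay of |e|
   passes to wh - w through Hoelder and Meyers. *)

theory Submission
  imports Defs
begin

subsection \<open>Smooth functions\<close>

text \<open>Two obstacles shape the proof. The square of \<open>e\<close> need not be an admissible
  test function, and \<open>g\<close> and \<open>q\<close> are only square integrable, so every
  pairing with it requires \<open>e\<close> in L^4. The Gagliardo-Nirenberg hypothesis concerns the
  exponents \<open>s\<close> and 2 alone; the L^4 bound is therefore derived from the Lipschitz
  boundary by Gagliardo's product of line integrals and extended from smooth functions by Fatou's
  lemma. Smooth approximants come with the definition of the trace. The second obstacle is the
  formula d/dt |e|^2 = 2 <e', e> for a distributional derivative with values in the dual. It is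
  bypassed: backward differences of |e|^2 yield a one-sided inequality in integrated form, and this
  is enough for decay. In the pointwise estimate the diffusion Dmin |grad e|^2 is shared equally.
  One half absorbs the coupling of the fluxes, which fixes the weight s / (2 (s - 1)) in Young's
  inequality; the other half absorbs the error of \<open>P\<close>, which is the purpose of the
  smallness condition on \<mu>.\<close>

lemma smooth_coinduct:
  assumes "S \<phi>" and "\<And>f x. S f \<Longrightarrow> f differentiable (at x)"
    and "\<And>f i. S f \<Longrightarrow> S (pderivative i f)"
  shows "smooth \<phi>"
proof -
  have "S (foldr pderivative is \<phi>)" for "is"
    by (induction "is") (use assms in auto)
  then show ?thesis unfolding smooth_def using assms(2) by blast
qed

lemma smooth_differentiable: "smooth \<phi> \<Longrightarrow> \<phi> differentiable (at x)"
  unfolding smooth_def by (metis foldr_Nil id_apply)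

lemma smooth_pderivative: "smooth \<phi> \<Longrightarrow> smooth (pderivative i \<phi>)"
proof -
  assume "smooth \<phi>"
  \<comment> \<open>\<open>foldr\<close> applies the last entry of the list first, so appending
    \<open>i\<close> differentiates in direction \<open>i\<close> before all other
    directions.\<close>
  then have "foldr pderivative (is @ [i]) \<phi> differentiable (at x)" for "is" x
    unfolding smooth_def by blast
  then show ?thesis unfolding smooth_def by auto
qed

lemma pderivative_eqI: "(\<phi> has_derivative D) (at x) \<Longrightarrow> pderivative i \<phi> x = D (axis i 1)"
  unfolding pderivative_def by (drule frechet_derivative_at) simp

lemma differentiable_has_derivative:
  "\<phi> differentiable (at x) \<Longrightarrow> (\<phi> has_derivative frechet_derivative \<phi> (at x)) (at x)"
  using frechet_derivative_works by blast

lemma pderivative_add: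
  assumes "f differentiable (at x)" "g differentiable (at x)"
  shows "pderivative i (\<lambda>x. f x + g x) x = pderivative i f x + pderivative i g x"
  using pderivative_eqI[OF has_derivative_add[OF assms[THEN differentiable_has_derivative]], of i]
  by (simp add: pderivative_def)

lemma pderivative_mult:
  assumes "f differentiable (at x)" "g differentiable (at x)"
  shows "pderivative i (\<lambda>x. f x * g x) x = f x * pderivative i g x + pderivative i f x * g x"
  using pderivative_eqI[OF has_derivative_mult[OF assms[THEN differentiable_has_derivative]], of i]
  by (simp add: pderivative_def)

text \<open>Single products are not closed under differentiation, since the product rule yields
  sums. Sums and products are therefore generated together, and \<open>smooth_coinduct\<close> is
  applied to the whole algebra.\<close>

inductive smooth_algebra :: "(plane \<Rightarrow> real) \<Rightarrow> bool" where
  base: "smooth f \<Longrightarrow> smooth_algebra f"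
| add: "smooth_algebra f \<Longrightarrow> smooth_algebra g \<Longrightarrow> smooth_algebra (\<lambda>x. f x + g x)"
| mult: "smooth_algebra f \<Longrightarrow> smooth_algebra g \<Longrightarrow> smooth_algebra (\<lambda>x. f x * g x)"

lemma smooth_algebra_closed:
  "smooth_algebra f \<Longrightarrow> (\<forall>x. f differentiable (at x)) \<and> (\<forall>i. smooth_algebra (pderivative i f))"
proof (induction rule: smooth_algebra.induct)
  case (base f)
  then show ?case
    by (auto intro: smooth_algebra.base smooth_pderivative smooth_differentiable)
next
  case (add f g)
  have "pderivative i (\<lambda>x. f x + g x) = (\<lambda>x. pderivative i f x + pderivative i g x)" for i
    using add by (intro ext pderivative_add) auto
  then show ?case using add by (auto intro: smooth_algebra.add differentiable_add)
next
  case (mult f g)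
  have "pderivative i (\<lambda>x. f x * g x) = (\<lambda>x. f x * pderivative i g x + pderivative i f x * g x)" for i
    using mult by (intro ext pderivative_mult) auto
  then show ?case
    using mult by (auto intro!: smooth_algebra.add smooth_algebra.mult intro: differentiable_mult)
qed

lemma smooth_algebra_smooth: "smooth_algebra f \<Longrightarrow> smooth f"
  by (rule smooth_coinduct[of smooth_algebra]) (use smooth_algebra_closed in auto)

lemma smooth_add: "smooth f \<Longrightarrow> smooth g \<Longrightarrow> smooth (\<lambda>x. f x + g x)"
  by (rule smooth_algebra_smooth[OF smooth_algebra.add[OF smooth_algebra.base smooth_algebra.base]])

lemma smooth_mult: "smooth f \<Longrightarrow> smooth g \<Longrightarrow> smooth (\<lambda>x. f x * g x)"
  by (rule smooth_algebra_smooth[OF smooth_algebra.mult[OF smooth_algebra.base smooth_algebra.base]])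

lemma pderivative_const: "pderivative i (\<lambda>x. c) = (\<lambda>x. 0)"
proof
  fix x show "pderivative i (\<lambda>x. c) x = 0"
    using pderivative_eqI[OF has_derivative_const, of i c x] .
qed

lemma smooth_const: "smooth (\<lambda>x. c)"
  by (rule smooth_coinduct[of "\<lambda>f. \<exists>c. f = (\<lambda>x. c)"]) (auto simp: pderivative_const)

lemma smooth_linear_combination:
  "smooth f \<Longrightarrow> smooth g \<Longrightarrow> smooth (\<lambda>x. a * f x + b * g x)"
  by (intro smooth_add smooth_mult smooth_const)

lemma smooth_continuous: "smooth \<phi> \<Longrightarrow> continuous_on S \<phi>"
  by (meson continuous_at_imp_continuous_on differentiable_imp_continuous_within smooth_differentiable)

lemma test_function_smooth: "test_function \<Omega> \<phi> \<Longrightarrow> smooth \<phi>"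
  by (simp add: test_function_def)

text \<open>The last inclusion is into the closure, so that it serves both for products, which
  vanish wherever \<phi> does, and for derivatives, which are known to vanish only off the closed
  support.\<close>

lemma compact_support_mono:
  assumes "compact (closure {x. \<phi> x \<noteq> 0})" "closure {x. \<phi> x \<noteq> 0} \<subseteq> \<Omega>"
    and "{x. \<psi> x \<noteq> 0} \<subseteq> closure {x. \<phi> x \<noteq> 0}"
  shows "compact (closure {x. \<psi> x \<noteq> 0}) \<and> closure {x. \<psi> x \<noteq> 0} \<subseteq> \<Omega>"
proof -
  have "closure {x. \<psi> x \<noteq> 0} \<subseteq> closure {x. \<phi> x \<noteq> 0}"
    using assms(3) by (simp add: closure_minimal)
  moreover from this have "compact (closure {x. \<phi> x \<noteq> 0} \<inter> closure {x. \<psi> x \<noteq> 0})"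
    using assms(1) by (intro compact_Int_closed) auto
  ultimately show ?thesis using assms(2) by (simp add: inf.absorb2)
qed

lemma test_function_mult:
  "smooth \<psi> \<Longrightarrow> test_function \<Omega> \<phi> \<Longrightarrow> test_function \<Omega> (\<lambda>x. \<psi> x * \<phi> x)"
  unfolding test_function_def
  using compact_support_mono[of \<phi> \<Omega> "\<lambda>x. \<psi> x * \<phi> x"]
    subset_trans[OF _ closure_subset, of "{x. \<psi> x * \<phi> x \<noteq> 0}" "{x. \<phi> x \<noteq> 0}"]
  by (auto intro: smooth_mult)

lemma pderivative_zero_off_support:
  assumes "x \<notin> closure {x. \<phi> x \<noteq> 0}"
  shows "pderivative i \<phi> x = 0"
proof -
  have "(\<phi> has_derivative (\<lambda>_. 0)) (at x)"
    by (rule has_derivative_transform_within_open[of "\<lambda>_. 0" _ _ _ "- closure {x. \<phi> x \<noteq> 0}"])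
      (use assms closure_subset[of "{x. \<phi> x \<noteq> 0}"] in auto)
  from pderivative_eqI[OF this] show ?thesis .
qed

lemma test_function_pderivative:
  "test_function \<Omega> \<phi> \<Longrightarrow> test_function \<Omega> (pderivative i \<phi>)"
  unfolding test_function_def
  using compact_support_mono[of \<phi> \<Omega> "pderivative i \<phi>"] pderivative_zero_off_support[of _ \<phi> i]
  by (auto intro!: smooth_pderivative)

lemma test_function_zero: "test_function \<Omega> \<phi> \<Longrightarrow> x \<notin> \<Omega> \<Longrightarrow> \<phi> x = 0"
  unfolding test_function_def using closure_subset[of "{x. \<phi> x \<noteq> 0}"] by auto

lemma test_function_bounded:
  assumes "test_function \<Omega> \<phi>" obtains M where "\<And>x. \<bar>\<phi> x\<bar> \<le> M"
proof -
  let ?K = "closure {x. \<phi> x \<noteq> 0}"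
  have "bounded (\<phi> ` ?K)"
    using assms by (intro compact_imp_bounded compact_continuous_image smooth_continuous)
      (auto simp: test_function_def)
  then obtain M where M: "M > 0" "\<And>x. x \<in> ?K \<Longrightarrow> \<bar>\<phi> x\<bar> \<le> M"
    unfolding bounded_pos by auto
  have "\<bar>\<phi> x\<bar> \<le> M" for x
    using M closure_subset[of "{x. \<phi> x \<noteq> 0}"] by (cases "\<phi> x = 0") auto
  then show ?thesis by (rule that)
qed

lemma test_function_integrable:
  assumes "test_function \<Omega> \<phi>" shows "integrable lborel \<phi>"
proof -
  let ?K = "closure {x. \<phi> x \<noteq> 0}"
  have "set_integrable lborel ?K \<phi>"
    unfolding set_integrable_def
    using assms borel_integrable_compact[of ?K \<phi>] smooth_continuous[of \<phi> ?K]
    by (auto simp: test_function_def)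
  moreover have "(\<lambda>x. indicator ?K x *\<^sub>R \<phi> x) = \<phi>"
    using closure_subset[of "{x. \<phi> x \<noteq> 0}"] by (auto simp: indicator_def fun_eq_iff)
  ultimately show ?thesis unfolding set_integrable_def by simp
qed

text \<open>Moves the integral to the Borel measure on the whole plane, where translations are
  available.\<close>

lemma integral_lebesgue_on_test_function:
  assumes "open \<Omega>" "test_function \<Omega> \<phi>"
  shows "(LINT x|lebesgue_on \<Omega>. \<phi> x) = (LINT x|lborel. \<phi> x)"
proof -
  have "\<Omega> \<in> sets lebesgue" using assms(1) by (simp add: lebesgue_openin)
  then have "(LINT x|lebesgue_on \<Omega>. \<phi> x) = (LINT x|lebesgue. indicator \<Omega> x *\<^sub>R \<phi> x)"
    by (subst integral_restrict_space) auto
  also have "(\<lambda>x. indicator \<Omega> x *\<^sub>R \<phi> x) = \<phi>"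
    using test_function_zero[OF assms(2)] by (auto simp: indicator_def fun_eq_iff)
  also have "(LINT x|lebesgue. \<phi> x) = (LINT x|lborel. \<phi> x)"
    using test_function_integrable[OF assms(2)] by (intro integral_completion) auto
  finally show ?thesis .
qed

text \<open>Translation invariance makes the integral of every difference quotient vanish.\<close>

lemma integral_pderivative_test_function:
  assumes "open \<Omega>" "test_function \<Omega> \<phi>"
  shows "(LINT x|lebesgue_on \<Omega>. pderivative i \<phi> x) = 0"
proof -
  let ?e = "axis i 1 :: plane" and ?K = "closure {x. \<phi> x \<noteq> 0}"
  let ?d = "\<lambda>n x. real (Suc n) * (\<phi> (x + (1 / real (Suc n)) *\<^sub>R ?e) - \<phi> x)"
  have sm: "smooth \<phi>" using assms(2) by (rule test_function_smooth)
  obtain M where M: "\<And>x. \<bar>pderivative i \<phi> x\<bar> \<le> M"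
    using test_function_bounded[OF test_function_pderivative[OF assms(2)]] by blast
  have line: "((\<lambda>t. \<phi> (x + t *\<^sub>R ?e)) has_real_derivative pderivative i \<phi> (x + t *\<^sub>R ?e)) (at t)" for x t
  proof -
    have g: "((\<lambda>t. x + t *\<^sub>R ?e) has_derivative (\<lambda>t. t *\<^sub>R ?e)) (at t)"
      by (auto intro!: derivative_eq_intros)
    let ?D = "frechet_derivative \<phi> (at (x + t *\<^sub>R ?e))"
    have D: "(\<phi> has_derivative ?D) (at (x + t *\<^sub>R ?e))"
      by (rule differentiable_has_derivative[OF smooth_differentiable[OF sm]])
    have "((\<lambda>t. \<phi> (x + t *\<^sub>R ?e)) has_derivative (\<lambda>t. ?D (t *\<^sub>R ?e))) (at t)"
      using has_derivative_compose[OF g D] .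
    also have "(\<lambda>t. ?D (t *\<^sub>R ?e)) = (*) (pderivative i \<phi> (x + t *\<^sub>R ?e))"
      using linear_cmul[OF has_derivative_linear[OF D]] by (auto simp: pderivative_def mult.commute)
    finally show ?thesis unfolding has_field_derivative_def .
  qed
  \<comment> \<open>By the mean value theorem along the line in direction \<open>?e\<close>, all
    difference quotients share the bound of the partial derivative.\<close>
  have bnd: "\<bar>?d n x\<bar> \<le> M" for n x
  proof -
    obtain z where "\<phi> (x + (1 / real (Suc n)) *\<^sub>R ?e) - \<phi> (x + 0 *\<^sub>R ?e)
        = (1 / real (Suc n) - 0) * pderivative i \<phi> (x + z *\<^sub>R ?e)"
      using MVT2[of 0 "1 / real (Suc n)" "\<lambda>t. \<phi> (x + t *\<^sub>R ?e)" "\<lambda>t. pderivative i \<phi> (x + t *\<^sub>R ?e)"]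
        line by auto
    then show ?thesis using M[of "x + z *\<^sub>R ?e"] by simp
  qed
  obtain B where B: "\<And>x. x \<in> ?K \<Longrightarrow> norm x \<le> B"
    using compact_imp_bounded[of ?K] assms(2) unfolding test_function_def bounded_iff by auto
  have zero: "\<phi> x = 0" if "norm x > B" for x
    using B[of x] closure_subset[of "{x. \<phi> x \<noteq> 0}"] that by fastforce
  \<comment> \<open>The increment has length at most 1, so all difference quotients vanish outside
    one ball of radius \<open>B + 1\<close>. Together with \<open>bnd\<close> this gives the
    integrable majorant.\<close>
  have supp: "?d n x = 0" if "norm x > B + 1" for n x
  proof -
    have "norm x \<le> norm (x + (1 / real (Suc n)) *\<^sub>R ?e) + norm ((1 / real (Suc n)) *\<^sub>R ?e)"
      by (metis add_diff_cancel_right' norm_triangle_ineq4)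
    moreover have "norm ((1 / real (Suc n)) *\<^sub>R ?e) \<le> 1" by simp
    ultimately have "norm (x + (1 / real (Suc n)) *\<^sub>R ?e) > B" using that by linarith
    moreover have "norm x > B" using that by simp
    ultimately show ?thesis using zero by simp
  qed
  have int: "integrable lborel \<phi>" by (rule test_function_integrable[OF assms(2)])
  have tr: "integrable lborel (\<lambda>x. \<phi> (x + y)) \<and> (LINT x|lborel. \<phi> (x + y)) = (LINT x|lborel. \<phi> x)" for y
  proof -
    have m: "(\<lambda>x. y + x) \<in> borel_measurable (lborel :: plane measure)" by simp
    have "\<phi> \<in> borel_measurable borel" using int by auto
    then show ?thesis
      using integral_distr[OF m, of \<phi>] integrable_distr_eq[OF m, of \<phi>] int
      by (simp add: lborel_distr_plus add.commute[of _ y])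
  qed
  have d0: "(LINT x|lborel. ?d n x) = 0" for n
    using tr[of "(1 / real (Suc n)) *\<^sub>R ?e"] int by simp
  have M0: "0 \<le> M" using M[of 0] by linarith
  have "(\<lambda>n. LINT x|lborel. ?d n x) \<longlonglongrightarrow> (LINT x|lborel. pderivative i \<phi> x)"
  proof (rule integral_dominated_convergence[where w="\<lambda>x. indicator (cball 0 (B+1)) x *\<^sub>R M"])
    show "pderivative i \<phi> \<in> borel_measurable lborel"
      using test_function_integrable[OF test_function_pderivative[OF assms(2)]] by auto
    show "?d n \<in> borel_measurable lborel" for n
      using tr[of "(1 / real (Suc n)) *\<^sub>R ?e"] int by auto
    show "integrable lborel (\<lambda>x. indicator (cball 0 (B+1)) x *\<^sub>R M)"
      by (intro integrable_scaleR_left integrable_real_indicator emeasure_bounded_finite) auto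
    show "AE x in lborel. norm (?d n x) \<le> indicator (cball 0 (B+1)) x *\<^sub>R M" for n
    proof (rule AE_I2)
      fix x show "norm (?d n x) \<le> indicator (cball 0 (B+1)) x *\<^sub>R M"
        using bnd[of n x] supp[of x n] M0 by (cases "norm x > B + 1") (auto simp: indicator_def)
    qed
    show "AE x in lborel. (\<lambda>n. ?d n x) \<longlonglongrightarrow> pderivative i \<phi> x"
    proof (rule AE_I2)
      fix x
      have "((\<lambda>h. (\<phi> (x + h *\<^sub>R ?e) - \<phi> x) / h) \<longlongrightarrow> pderivative i \<phi> x) (at 0)"
        using line[of x 0] unfolding DERIV_def by simp
      moreover have "filterlim (\<lambda>n. 1 / real (Suc n)) (at 0) sequentially"
        unfolding filterlim_at
        using LIMSEQ_inverse_real_of_nat by (auto simp: inverse_eq_divide)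
      ultimately have "(\<lambda>n. (\<phi> (x + (1 / real (Suc n)) *\<^sub>R ?e)
          - \<phi> x) / (1 / real (Suc n))) \<longlonglongrightarrow> pderivative i \<phi> x"
        by (rule filterlim_compose)
      then show "(\<lambda>n. ?d n x) \<longlonglongrightarrow> pderivative i \<phi> x" by (simp add: mult.commute)
    qed
  qed
  then have "(LINT x|lborel. pderivative i \<phi> x) = 0"
    unfolding d0 by (simp add: LIMSEQ_const_iff)
  then show ?thesis
    using integral_lebesgue_on_test_function[OF assms(1) test_function_pderivative[OF assms(2)]] by simp
qed

subsection \<open>Bump functions\<close>

text \<open>The flat function exp(-1/x), extended by zero to the left, and its multiples by powers
  of 1/x. The index \<open>k\<close> is there because differentiation produces such powers.\<close>

definition flat :: "nat \<Rightarrow> real \<Rightarrow> real" where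
  "flat k x = (if x \<le> 0 then 0 else (1 / x) ^ k * exp (- (1 / x)))"

text \<open>Substituting y = 1/x turns the right-hand limit into the decay of y^k / exp y.\<close>

lemma flat_tendsto_0: "(flat k \<longlongrightarrow> 0) (at 0)"
proof -
  have "((\<lambda>y::real. y ^ k / exp y) \<longlongrightarrow> 0) at_top" by (rule tendsto_power_div_exp_0)
  moreover have "filterlim (\<lambda>x::real. 1 / x) at_top (at_right 0)"
    using filterlim_inverse_at_top_right by (simp add: inverse_eq_divide)
  ultimately have "((\<lambda>x::real. (1 / x) ^ k / exp (1 / x)) \<longlongrightarrow> 0) (at_right 0)"
    by (rule filterlim_compose)
  then have R: "(flat k \<longlongrightarrow> 0) (at_right 0)"
    by (rule Lim_transform_eventually)
      (auto simp: flat_def exp_minus field_simps eventually_at_filter)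
  have L: "(flat k \<longlongrightarrow> 0) (at_left 0)"
    by (rule Lim_transform_eventually[of "\<lambda>_. 0"]) (auto simp: flat_def eventually_at_filter)
  from R L show ?thesis by (simp add: filterlim_split_at_real)
qed

text \<open>At the critical point 0 the difference quotient of \<open>flat k\<close> is exactly
  \<open>flat (k + 1)\<close>, which tends to 0. Up to linear combinations the family is thus closed
  under differentiation, at 0 as well.\<close>

lemma flat_has_derivative:
  "(flat k has_real_derivative (flat (k + 2) x - real k * flat (k + 1) x)) (at x)"
proof -
  consider "x < 0" | "x = 0" | "x > 0" by linarith
  then show ?thesis
  proof cases
    case 1
    have "(flat k has_real_derivative 0) (at x)"
      by (rule has_field_derivative_transform_within_open[of "\<lambda>_. 0" _ _ "{..<0}"])
        (use 1 in \<open>auto simp: flat_def\<close>)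
    then show ?thesis using 1 by (simp add: flat_def)
  next
    case 2
    have "((\<lambda>h. flat (k + 1) h) \<longlongrightarrow> 0) (at 0)" by (rule flat_tendsto_0)
    moreover have "(flat k (0 + h) - flat k 0) / h = flat (k + 1) h" for h
      by (simp add: flat_def)
    ultimately show ?thesis unfolding 2 DERIV_def by (simp add: flat_def)
  next
    case 3
    have "((\<lambda>x. (1 / x) ^ k * exp (- (1 / x))) has_real_derivative
        (1 / x) ^ (k + 2) * exp (- (1 / x)) - real k * ((1 / x) ^ (k + 1) * exp (- (1 / x)))) (at x)"
    proof (cases k)
      case 0
      then show ?thesis using 3
        by (auto intro!: derivative_eq_intros simp: power2_eq_square field_simps)
    next
      case (Suc m)
      have inv: "((\<lambda>x. 1 / x) has_real_derivative - (1 / x)\<^sup>2) (at x)"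
        using 3 by (auto intro!: derivative_eq_intros simp: power2_eq_square field_simps)
      have e: "((\<lambda>x. exp (- (1 / x))) has_real_derivative exp (- (1 / x)) * (1 / x)\<^sup>2) (at x)"
        using DERIV_fun_exp[OF DERIV_minus[OF inv]] by simp
      have p: "((\<lambda>x. (1 / x) ^ k) has_real_derivative real k * (- (1 / x)\<^sup>2 * (1 / x) ^ (k - 1))) (at x)"
        using DERIV_power[OF inv, of k] by simp
      show ?thesis
        using DERIV_mult[OF p e] Suc
        by (simp add: power2_eq_square algebra_simps)
    qed
    then have "(flat k has_real_derivative
        (1 / x) ^ (k + 2) * exp (- (1 / x)) - real k * ((1 / x) ^ (k + 1) * exp (- (1 / x)))) (at x)"
      by (rule has_field_derivative_transform_within_open[of _ _ _ "{0<..}"])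
        (use 3 in \<open>auto simp: flat_def\<close>)
    then show ?thesis using 3 by (simp add: flat_def)
  qed
qed

lemma flat_0_bounds: "0 \<le> flat 0 x" "flat 0 x \<le> 1" "x > 0 \<Longrightarrow> flat 0 x > 0"
  by (auto simp: flat_def)

text \<open>Affine arguments supply the rescaled, shifted and reflected copies from which bumps are
  built; constants, sums and products are what the chain and product rules generate.\<close>

inductive flat_algebra :: "(real \<Rightarrow> real) \<Rightarrow> bool" where
  base: "flat_algebra (\<lambda>x. flat k (a * x + b))"
| const: "flat_algebra (\<lambda>x. c)"
| add: "flat_algebra f \<Longrightarrow> flat_algebra g \<Longrightarrow> flat_algebra (\<lambda>x. f x + g x)"
| mult: "flat_algebra f \<Longrightarrow> flat_algebra g \<Longrightarrow> flat_algebra (\<lambda>x. f x * g x)"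

lemma flat_algebra_deriv_ex:
  "flat_algebra f \<Longrightarrow> \<exists>f'. flat_algebra f' \<and> (\<forall>x. (f has_real_derivative f' x) (at x))"
proof (induction rule: flat_algebra.induct)
  case (base k a b)
  let ?f = "\<lambda>x. a * (flat (k + 2) (a * x + b) + (- real k) * flat (k + 1) (a * x + b))"
  have "flat_algebra ?f"
    by (intro flat_algebra.mult flat_algebra.add flat_algebra.const flat_algebra.base)
  moreover have "((\<lambda>x. flat k (a * x + b)) has_real_derivative ?f x) (at x)" for x
  proof -
    have "((\<lambda>x. a * x + b) has_real_derivative a) (at x)"
      by (auto intro!: derivative_eq_intros)
    from DERIV_chain2[OF flat_has_derivative this] show ?thesis
      by (simp add: mult.commute)
  qed
  ultimately show ?case by blast
next
  case (const c)
  show ?case by (intro exI[of _ "\<lambda>_. 0"]) (auto intro: flat_algebra.const)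
next
  case (add f g)
  then obtain f' g' where "flat_algebra f'" "flat_algebra g'"
    and "\<And>x. (f has_real_derivative f' x) (at x)" "\<And>x. (g has_real_derivative g' x) (at x)"
    by blast
  then show ?case
    by (intro exI[of _ "\<lambda>x. f' x + g' x"]) (auto intro: flat_algebra.add DERIV_add)
next
  case (mult f g)
  then obtain f' g' where *: "flat_algebra f'" "flat_algebra g'"
    "\<And>x. (f has_real_derivative f' x) (at x)" "\<And>x. (g has_real_derivative g' x) (at x)"
    by blast
  have "flat_algebra (\<lambda>x. f' x * g x + g' x * f x)"
    by (intro flat_algebra.add flat_algebra.mult * mult)
  with * show ?case by (intro exI[of _ "\<lambda>x. f' x * g x + g' x * f x"]) (auto intro: DERIV_mult)
qed

lemma flat_algebra_deriv:
  assumes "flat_algebra f"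
  shows "flat_algebra (deriv f)" "(f has_real_derivative deriv f x) (at x)"
proof -
  obtain f' where f': "flat_algebra f'" "\<And>x. (f has_real_derivative f' x) (at x)"
    using flat_algebra_deriv_ex[OF assms] by blast
  then have "deriv f = f'" by (intro ext DERIV_imp_deriv) auto
  with f' show "flat_algebra (deriv f)" "(f has_real_derivative deriv f x) (at x)" by auto
qed

lemma flat_algebra_deriv_iter: "flat_algebra f \<Longrightarrow> flat_algebra ((deriv ^^ n) f)"
  by (induction n) (auto intro: flat_algebra_deriv)

lemma flat_algebra_tensor_derivative:
  assumes "flat_algebra f" "flat_algebra g"
  shows "((\<lambda>x::plane. f (x $ 1) * g (x $ 2)) has_derivative
     (\<lambda>h. deriv f (x $ 1) * g (x $ 2) * h $ 1 + f (x $ 1) * deriv g (x $ 2) * h $ 2)) (at x)"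
proof -
  have "((\<lambda>x::plane. f (x $ 1)) has_derivative (\<lambda>h. deriv f (x $ 1) * h $ 1)) (at x)"
    using has_derivative_compose[OF bounded_linear.has_derivative[OF bounded_linear_vec_nth
        has_derivative_ident]
        flat_algebra_deriv(2)[OF assms(1), unfolded has_field_derivative_def]] .
  moreover have "((\<lambda>x::plane. g (x $ 2)) has_derivative (\<lambda>h. deriv g (x $ 2) * h $ 2)) (at x)"
    using has_derivative_compose[OF bounded_linear.has_derivative[OF bounded_linear_vec_nth
        has_derivative_ident]
        flat_algebra_deriv(2)[OF assms(2), unfolded has_field_derivative_def]] .
  ultimately have "((\<lambda>x::plane. f (x $ 1) * g (x $ 2)) has_derivative
     (\<lambda>h. f (x $ 1) * (deriv g (x $ 2) * h $ 2) + deriv f (x $ 1) * h $ 1 * g (x $ 2))) (at x)"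
    by (rule has_derivative_mult)
  then show ?thesis by (simp add: algebra_simps)
qed

text \<open>A partial derivative of a tensor product differentiates one factor only, so tensor
  products over \<open>flat_algebra\<close> are closed under differentiation by themselves, without
  forming sums.\<close>

lemma smooth_tensor:
  assumes "flat_algebra f" "flat_algebra g"
  shows "smooth (\<lambda>x. f (x $ 1) * g (x $ 2))"
proof (rule smooth_coinduct[of "\<lambda>\<phi>. \<exists>f g. flat_algebra f \<and> flat_algebra g \<and> \<phi>
    = (\<lambda>x. f (x $ 1) * g (x $ 2))"])
  fix \<phi> :: "plane \<Rightarrow> real" and i assume "\<exists>f g. flat_algebra f \<and> flat_algebra g \<and> \<phi>
      = (\<lambda>x. f (x $ 1) * g (x $ 2))"
  then obtain f g where fg: "flat_algebra f" "flat_algebra g" "\<phi> = (\<lambda>x. f (x $ 1) * g (x $ 2))" by blast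
  have pd: "pderivative i \<phi> x = deriv f (x $ 1) * g (x $ 2) * axis i 1 $ 1
      + f (x $ 1) * deriv g (x $ 2) * axis i 1 $ 2" for x
    unfolding fg(3) by (rule pderivative_eqI[OF flat_algebra_tensor_derivative[OF fg(1,2)]])
  have "i = 1 \<or> i = 2" by (rule exhaust_2)
  then show "\<exists>f g. flat_algebra f \<and> flat_algebra g \<and> pderivative i \<phi> = (\<lambda>x. f (x $ 1) * g (x $ 2))"
  proof
    assume "i = 1"
    then have "pderivative i \<phi> = (\<lambda>x. deriv f (x $ 1) * g (x $ 2))"
      using pd by (intro ext) (simp add: axis_def)
    then show ?thesis using flat_algebra_deriv fg by blast
  next
    assume "i = 2"
    then have "pderivative i \<phi> = (\<lambda>x. f (x $ 1) * deriv g (x $ 2))"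
      using pd by (intro ext) (simp add: axis_def)
    then show ?thesis using flat_algebra_deriv fg by blast
  qed
qed (use assms flat_algebra_tensor_derivative in \<open>unfold differentiable_def, blast+\<close>)

text \<open>The parameter \<open>n\<close> steepens both flanks: at an interior point both arguments
  tend to infinity, where \<open>flat 0\<close> tends to 1. The bumps therefore approximate the
  indicator of the open interval.\<close>

definition interval_bump :: "nat \<Rightarrow> real \<Rightarrow> real \<Rightarrow> real \<Rightarrow> real" where
  "interval_bump n a b x = flat 0 (real n * (x - a)) * flat 0 (real n * (b - x))"

lemma flat_algebra_interval_bump: "flat_algebra (interval_bump n a b)"
proof -
  have "flat_algebra (\<lambda>x. flat 0 (real n * x + (- real n * a)) * flat 0 ((- real n) * x + real n * b))"
    by (intro flat_algebra.mult flat_algebra.base)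
  then show ?thesis unfolding interval_bump_def[abs_def] by (simp add: algebra_simps)
qed

lemma interval_bump_bounds: "0 \<le> interval_bump n a b x" "interval_bump n a b x \<le> 1"
  using flat_0_bounds by (auto simp: interval_bump_def intro!: mult_le_one)

lemma interval_bump_outside: "x \<le> a \<or> b \<le> x \<Longrightarrow> interval_bump n a b x = 0"
  by (auto simp: interval_bump_def flat_def mult_le_0_iff)

lemma interval_bump_tendsto:
  assumes "a < x" "x < b"
  shows "(\<lambda>n. interval_bump n a b x) \<longlonglongrightarrow> 1"
proof -
  have *: "(\<lambda>n. flat 0 (real n * y)) \<longlonglongrightarrow> 1" if "y > 0" for y
  proof -
    have "(\<lambda>n. exp (- ((1 / y) * (1 / real n)))) \<longlonglongrightarrow> exp (- ((1 / y) * 0))"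
      by (intro tendsto_intros lim_1_over_n)
    moreover have "eventually (\<lambda>n. exp (- ((1 / y) * (1 / real n))) = flat 0 (real n * y)) sequentially"
      using eventually_gt_at_top[of 0]
      by eventually_elim (use that in \<open>auto simp: flat_def not_le zero_less_mult_iff\<close>)
    ultimately show ?thesis by (simp add: Lim_transform_eventually)
  qed
  have "(\<lambda>n. flat 0 (real n * (x - a)) * flat 0 (real n * (b - x))) \<longlonglongrightarrow> 1 * 1"
    by (intro tendsto_mult *) (use assms in auto)
  then show ?thesis by (simp add: interval_bump_def)
qed

definition box_bump :: "nat \<Rightarrow> plane \<Rightarrow> plane \<Rightarrow> plane \<Rightarrow> real" where
  "box_bump n a b x = interval_bump n (a $ 1) (b $ 1) (x $ 1) * interval_bump n (a $ 2) (b $ 2) (x $ 2)"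

lemma mem_box_plane:
  "x \<in> box a b \<longleftrightarrow> a $ 1 < x $ 1 \<and> x $ 1 < b $ 1 \<and> a $ 2 < x $ 2 \<and> x $ 2 < (b :: plane) $ 2"
  by (auto simp: mem_box_cart forall_2)

lemma box_bump_outside: "x \<notin> box a b \<Longrightarrow> box_bump n a b x = 0"
  by (auto simp: mem_box_plane box_bump_def not_less intro: interval_bump_outside)

lemma box_bump_bounds: "0 \<le> box_bump n a b x" "box_bump n a b x \<le> 1"
  using interval_bump_bounds by (auto simp: box_bump_def intro!: mult_le_one)

lemma box_bump_tendsto: "(\<lambda>n. box_bump n a b x) \<longlonglongrightarrow> indicator (box a b) x"
proof (cases "x \<in> box a b")
  case True
  then have "(\<lambda>n. box_bump n a b x) \<longlonglongrightarrow> 1 * 1"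
    unfolding box_bump_def mem_box_plane by (intro tendsto_mult interval_bump_tendsto) auto
  with True show ?thesis by simp
qed (simp add: box_bump_outside)

lemma test_function_box_bump:
  assumes "cbox a b \<subseteq> \<Omega>" shows "test_function \<Omega> (box_bump n a b)"
proof -
  have "closure {x. box_bump n a b x \<noteq> 0} \<subseteq> cbox a b"
    using box_bump_outside[of _ a b n] box_subset_cbox[of a b]
    by (intro closure_minimal) auto
  moreover from this have "compact (closure {x. box_bump n a b x \<noteq> 0})"
    using compact_Int_closed[OF compact_cbox closed_closure, of a b "{x. box_bump n a b x \<noteq> 0}"]
    by (simp add: inf.absorb2)
  moreover have "smooth (box_bump n a b)"
    using smooth_tensor[OF flat_algebra_interval_bump flat_algebra_interval_bump]
    unfolding box_bump_def[abs_def] .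
  ultimately show ?thesis using assms unfolding test_function_def by auto
qed

text \<open>Lebesgue differentiation: at almost every point of a box inside \<Omega> the value of
  \<open>u\<close> is the limit of averages over small cubes, and these averages vanish. Countably
  many closed boxes exhaust \<Omega>.\<close>

lemma AE_zero_if_box_integrals_zero:
  fixes u :: "plane \<Rightarrow> real"
  assumes "open \<Omega>" and li: "locally_integrable \<Omega> u"
    and zero: "\<And>a b. cbox a b \<subseteq> \<Omega> \<Longrightarrow> integral (cbox a b) u = 0"
  shows "AE x in lebesgue_on \<Omega>. u x = 0"
proof -
  obtain \<D> where \<D>: "countable \<D>" "\<D> \<subseteq> Pow \<Omega>" "\<And>X. X \<in> \<D> \<Longrightarrow> \<exists>a b. X = cbox a b" "\<Union>\<D> = \<Omega>"
    by (rule open_countable_Union_open_cbox[OF assms(1)]) blast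
  have box: "negligible {x \<in> X. u x \<noteq> 0}" if XD: "X \<in> \<D>" for X
  proof -
    obtain a b where X: "X = cbox a b" using \<D>(3)[OF XD] by blast
    have sub: "cbox a b \<subseteq> \<Omega>" using \<D>(2) XD X by blast
    \<comment> \<open>The differentiation theorem asks for integrability on every box of the plane,
      hence the extension by zero.\<close>
    let ?f = "\<lambda>x. if x \<in> cbox a b then u x else 0"
    have ui: "u integrable_on cbox a b"
      using li sub unfolding locally_integrable_def
      by (meson compact_cbox set_lebesgue_integral_eq_integral(1))
    have "?f integrable_on UNIV" using ui by (simp add: integrable_restrict_UNIV)
    then have "?f integrable_on cbox c d" for c d
      by (rule integrable_on_subcbox) simp
    then obtain N where N: "negligible N" "\<And>x e. x \<notin> N \<Longrightarrow> 0 < e \<Longrightarrow>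
        \<exists>d>0. \<forall>h. 0 < h \<and> h < d \<longrightarrow>
          norm (integral (cbox x (x + h *\<^sub>R One)) ?f /\<^sub>R h ^ DIM(plane) - ?f x) < e"
      using integrable_ccontinuous_explicit[of ?f] by blast
    have "u x = 0" if x: "x \<in> box a b" "x \<notin> N" for x
    proof (rule ccontr)
      assume "u x \<noteq> 0"
      then have e: "\<bar>u x\<bar> > 0" by simp
      obtain d where d: "d > 0" "\<And>h. 0 < h \<Longrightarrow> h < d \<Longrightarrow>
          norm (integral (cbox x (x + h *\<^sub>R One)) ?f /\<^sub>R h ^ DIM(plane) - ?f x) < \<bar>u x\<bar>"
        using N(2)[OF x(2) e] by blast
      obtain \<rho> where \<rho>: "\<rho> > 0" "ball x \<rho> \<subseteq> box a b"
        using x(1) open_box open_contains_ball by blast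
      \<comment> \<open>A cube of side \<open>h\<close> has diameter \<open>h * norm One\<close>.
        The second bound keeps the cube inside the ball of radius \<rho>, hence inside the box; the
        added 1 only makes the denominator visibly positive.\<close>
      define h where "h = min (d / 2) (\<rho> / (2 * (norm (One :: plane) + 1)))"
      have nn: "norm (One :: plane) + 1 > 0" by (simp add: add_nonneg_pos)
      have h: "0 < h" "h < d" using d(1) \<rho>(1) nn by (auto simp: h_def)
      have inb: "cbox x (x + h *\<^sub>R One) \<subseteq> ball x \<rho>"
      proof
        fix y assume "y \<in> cbox x (x + h *\<^sub>R One)"
        then have "\<bar>(y - x) \<bullet> i\<bar> \<le> \<bar>(h *\<^sub>R One) \<bullet> i\<bar>" if "i \<in> Basis" for i
          using that h(1) by (auto simp: mem_box inner_diff_left inner_add_left)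
        then have "norm (y - x) \<le> norm (h *\<^sub>R (One :: plane))"
          by (rule norm_le_componentwise)
        also have "\<dots> = h * norm (One :: plane)" using h by simp
        also have "\<dots> \<le> h * (norm (One :: plane) + 1)" using h by simp
        also have "\<dots> \<le> \<rho> / (2 * (norm (One :: plane) + 1)) * (norm (One :: plane) + 1)"
          using nn by (intro mult_right_mono) (auto simp: h_def)
        also have "\<dots> = \<rho> / 2" using nn by (simp add: field_simps)
        also have "\<dots> < \<rho>" using \<rho> by simp
        finally show "y \<in> ball x \<rho>" by (simp add: dist_norm norm_minus_commute)
      qed
      then have inc: "cbox x (x + h *\<^sub>R One) \<subseteq> cbox a b"
        using \<rho>(2) box_subset_cbox by blast
      have "integral (cbox x (x + h *\<^sub>R One)) ?f = integral (cbox x (x + h *\<^sub>R One)) u"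
        using inc by (intro integral_cong) auto
      also have "\<dots> = 0" using zero inc sub by blast
      finally have "norm (- ?f x) < \<bar>u x\<bar>" using d(2)[OF h] by simp
      then show False using x(1) box_subset_cbox[of a b] by (auto split: if_splits)
    qed
    \<comment> \<open>Only interior points of the box have been treated; its boundary is
      negligible.\<close>
    then have "{x \<in> X. u x \<noteq> 0} \<subseteq> N \<union> (cbox a b - box a b)" using X by blast
    then show ?thesis
      using N(1) negligible_frontier_interval negligible_Un negligible_subset by blast
  qed
  have "negligible (\<Union>X\<in>\<D>. {x \<in> X. u x \<noteq> 0})"
    using \<D>(1) box by (intro negligible_countable_Union) auto
  also have "(\<Union>X\<in>\<D>. {x \<in> X. u x \<noteq> 0}) = {x \<in> \<Omega>. u x \<noteq> 0}" using \<D>(4) by blast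
  finally have "{x \<in> \<Omega>. u x \<noteq> 0} \<in> null_sets lebesgue" by (simp add: negligible_iff_null_sets)
  then have "AE x in lebesgue. x \<notin> {x \<in> \<Omega>. u x \<noteq> 0}" by (rule AE_not_in)
  then show ?thesis
    using assms(1) by (subst AE_restrict_space_iff) (auto simp: lebesgue_openin elim: eventually_mono)
qed

text \<open>The bumps of a closed box are test functions tending to the indicator of the open box,
  and the absolute value of \<open>u\<close> on the closed box is an integrable majorant. Hence all
  box integrals of \<open>u\<close> vanish.\<close>

lemma du_bois_reymond:
  assumes "open \<Omega>" and li: "locally_integrable \<Omega> u"
    and zero: "\<And>\<phi>. test_function \<Omega> \<phi> \<Longrightarrow> l2_inner \<Omega> u \<phi> = 0"
  shows "AE x in lebesgue_on \<Omega>. u x = 0"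
proof (rule AE_zero_if_box_integrals_zero[OF assms(1,2)])
  fix a b assume sub: "cbox a b \<subseteq> \<Omega>"
  have \<Omega>: "\<Omega> \<in> sets lebesgue" using assms(1) by (simp add: lebesgue_openin)
  have ai: "u absolutely_integrable_on cbox a b"
    using li sub unfolding locally_integrable_def by simp
  let ?B = "\<lambda>n x. box_bump n a b x"
  have eq: "(LINT x|lebesgue. (indicator (cbox a b) x *\<^sub>R u x) * ?B n x) = 0" for n
  proof -
    have "l2_inner \<Omega> u (?B n) = 0" using zero test_function_box_bump[OF sub] by blast
    then have "(LINT x|lebesgue. indicator \<Omega> x *\<^sub>R (u x * ?B n x)) = 0"
      unfolding l2_inner_def using \<Omega> by (subst (asm) integral_restrict_space) auto
    also have "(\<lambda>x. indicator \<Omega> x *\<^sub>R (u x * ?B n x)) = (\<lambda>x. (indicator (cbox a b) x *\<^sub>R u x) * ?B n x)"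
    proof
      fix x
      show "indicator \<Omega> x *\<^sub>R (u x * ?B n x) = (indicator (cbox a b) x *\<^sub>R u x) * ?B n x"
        using sub box_bump_outside[of x a b n] box_subset_cbox[of a b]
        by (cases "x \<in> box a b") (auto simp: indicator_def)
    qed
    finally show ?thesis .
  qed
  have meas: "?B n \<in> borel_measurable lebesgue" for n
    using smooth_continuous[OF test_function_smooth[OF test_function_box_bump[OF sub]], of UNIV n]
    by (intro continuous_imp_measurable_on_sets_lebesgue[of UNIV, unfolded lebesgue_on_UNIV_eq]) auto
  have um: "(\<lambda>x. indicator (cbox a b) x *\<^sub>R u x) \<in> borel_measurable lebesgue"
    using ai unfolding set_integrable_def by auto
  have "(\<lambda>n. LINT x|lebesgue. (indicator (cbox a b) x *\<^sub>R u x) * ?B n x) \<longlonglongrightarrow>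
      (LINT x|lebesgue. (indicator (cbox a b) x *\<^sub>R u x) * indicator (box a b) x)"
  proof (rule integral_dominated_convergence[where w="\<lambda>x. \<bar>indicator (cbox a b) x *\<^sub>R u x\<bar>"])
    show "integrable lebesgue (\<lambda>x. \<bar>indicator (cbox a b) x *\<^sub>R u x\<bar>)"
      using ai unfolding set_integrable_def by (rule integrable_abs)
    show "AE x in lebesgue. (\<lambda>n. (indicator (cbox a b) x *\<^sub>R u x) * ?B n x) \<longlonglongrightarrow>
        (indicator (cbox a b) x *\<^sub>R u x) * indicator (box a b) x"
      by (intro AE_I2 tendsto_mult tendsto_const box_bump_tendsto)
    show "AE x in lebesgue. norm ((indicator (cbox a b) x *\<^sub>R u x) * ?B n x)
        \<le> \<bar>indicator (cbox a b) x *\<^sub>R u x\<bar>" for n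
      using box_bump_bounds[of n a b] by (intro AE_I2) (auto simp: abs_mult intro!: mult_left_le)
  qed (use um meas in \<open>auto intro!: borel_measurable_times borel_measurable_indicator
      lmeasurable_box[THEN fmeasurableD]\<close>)
  then have "(LINT x|lebesgue. (indicator (cbox a b) x *\<^sub>R u x) * indicator (box a b) x) = 0"
    unfolding eq by (simp add: LIMSEQ_const_iff)
  also have "(\<lambda>x. (indicator (cbox a b) x *\<^sub>R u x) * indicator (box a b) x)
      = (\<lambda>x. indicator (box a b) x *\<^sub>R u x)"
    using box_subset_cbox[of a b] by (auto simp: indicator_def fun_eq_iff)
  finally have z: "(LINT x:box a b|lebesgue. u x) = 0"
    unfolding set_lebesgue_integral_def .
  have "u absolutely_integrable_on box a b"
    using ai by (rule set_integrable_subset) (auto simp: box_subset_cbox)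
  with z have "integral (box a b) u = 0" by (simp add: set_lebesgue_integral_eq_integral)
  then show "integral (cbox a b) u = 0" by (simp add: integral_open_interval)
qed

subsection \<open>Square integrable functions\<close>

text \<open>Covers vector fields such as gradients, whereas \<open>lp_space\<close> is confined to
  scalar functions; the plain square replaces \<open>powr 2\<close>.\<close>

definition square_integrable :: "plane set \<Rightarrow> (plane \<Rightarrow> 'b::euclidean_space) \<Rightarrow> bool" where
  "square_integrable \<Omega> u \<longleftrightarrow> u \<in> borel_measurable (lebesgue_on \<Omega>) \<and>
     integrable (lebesgue_on \<Omega>) (\<lambda>x. (norm (u x))\<^sup>2)"

lemma square_integrableD:
  assumes "square_integrable \<Omega> u"
  shows "u \<in> borel_measurable (lebesgue_on \<Omega>)" "integrable (lebesgue_on \<Omega>) (\<lambda>x. (norm (u x))\<^sup>2)"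
  using assms by (auto simp: square_integrable_def)

lemma lp_space_2: "u \<in> lp_space \<Omega> 2 \<longleftrightarrow> square_integrable \<Omega> u"
  by (simp add: lp_space_def square_integrable_def)

lemma l2_norm_eq: "l2_norm \<Omega> u = sqrt (LINT x|lebesgue_on \<Omega>. (norm (u x))\<^sup>2)"
  unfolding lp_norm_def by (simp add: powr_half_sqrt)

lemma lp_norm_nonneg [simp]: "0 \<le> lp_norm \<Omega> r u"
  by (simp add: lp_norm_def)

lemma sobolev_norm_nonneg [simp]: "0 \<le> sobolev_norm \<Omega> k r u"
  by (simp add: sobolev_norm_def)

lemma l2_norm_power2: "(l2_norm \<Omega> u)\<^sup>2 = (LINT x|lebesgue_on \<Omega>. (norm (u x))\<^sup>2)"
  by (simp add: l2_norm_eq)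

lemma l2_inner_self: "l2_inner \<Omega> u u = (l2_norm \<Omega> u)\<^sup>2"
  by (simp add: l2_norm_power2 l2_inner_def power2_norm_eq_inner)

lemma square_integrable_bound:
  assumes "square_integrable \<Omega> u" "v \<in> borel_measurable (lebesgue_on \<Omega>)"
    and "AE x in lebesgue_on \<Omega>. norm (v x) \<le> K * norm (u x)"
  shows "square_integrable \<Omega> v"
proof -
  have "integrable (lebesgue_on \<Omega>) (\<lambda>x. K\<^sup>2 * (norm (u x))\<^sup>2)"
    using assms(1) by (simp add: square_integrable_def)
  then have "integrable (lebesgue_on \<Omega>) (\<lambda>x. (norm (v x))\<^sup>2)"
  proof (rule Bochner_Integration.integrable_bound)
    show "(\<lambda>x. (norm (v x))\<^sup>2) \<in> borel_measurable (lebesgue_on \<Omega>)" using assms(2) by simp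
    show "AE x in lebesgue_on \<Omega>. norm ((norm (v x))\<^sup>2) \<le> norm (K\<^sup>2 * (norm (u x))\<^sup>2)"
      using assms(3)
    proof eventually_elim
      case (elim x)
      then have "(norm (v x))\<^sup>2 \<le> (K * norm (u x))\<^sup>2" by (intro power_mono) auto
      then show ?case by (simp add: power_mult_distrib)
    qed
  qed
  then show ?thesis using assms(2) by (simp add: square_integrable_def)
qed

lemma l2_norm_bound:
  fixes u :: "plane \<Rightarrow> 'a::euclidean_space" and v :: "plane \<Rightarrow> 'b::euclidean_space"
  assumes "square_integrable \<Omega> u" "v \<in> borel_measurable (lebesgue_on \<Omega>)" "0 \<le> K"
    and "AE x in lebesgue_on \<Omega>. norm (v x) \<le> K * norm (u x)"
  shows "l2_norm \<Omega> v \<le> K * l2_norm \<Omega> u"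
proof -
  have "square_integrable \<Omega> v" by (rule square_integrable_bound[OF assms(1,2,4)])
  then have "(LINT x|lebesgue_on \<Omega>. (norm (v x))\<^sup>2) \<le> (LINT x|lebesgue_on \<Omega>. K\<^sup>2 * (norm (u x))\<^sup>2)"
  proof (intro integral_mono_AE)
    show "AE x in lebesgue_on \<Omega>. (norm (v x))\<^sup>2 \<le> K\<^sup>2 * (norm (u x))\<^sup>2"
      using assms(4)
    proof eventually_elim
      case (elim x)
      then have "(norm (v x))\<^sup>2 \<le> (K * norm (u x))\<^sup>2" by (intro power_mono) auto
      then show ?case by (simp add: power_mult_distrib)
    qed
  qed (use assms(1) in \<open>auto simp: square_integrable_def\<close>)
  then have "(l2_norm \<Omega> v)\<^sup>2 \<le> (K * l2_norm \<Omega> u)\<^sup>2"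
    by (simp add: l2_norm_power2 power_mult_distrib)
  then show ?thesis using power2_le_imp_le[of "l2_norm \<Omega> v" "K * l2_norm \<Omega> u"] assms(3) by simp
qed

lemma l2_norm_cong:
  assumes "square_integrable \<Omega> u" "v \<in> borel_measurable (lebesgue_on \<Omega>)"
    and "AE x in lebesgue_on \<Omega>. norm (v x) = norm (u x)"
  shows "l2_norm \<Omega> v = l2_norm \<Omega> u"
  unfolding l2_norm_eq
  using assms
  by (intro arg_cong[where f=sqrt] integral_cong_AE) (auto simp: square_integrable_def elim:
      eventually_mono)

text \<open>Keeps the Sobolev order 1 from being rewritten to \<open>Suc 0\<close>, so that facts
  about \<open>h_space \<Omega> 1\<close> and \<open>sobolev_norm \<Omega> 1\<close> still match
  after simplification.\<close>

declare One_nat_def [simp del]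

lemma square_integrable_add:
  assumes "square_integrable \<Omega> u" "square_integrable \<Omega> v"
  shows "square_integrable \<Omega> (\<lambda>x. u x + v x)"
proof -
  have "integrable (lebesgue_on \<Omega>) (\<lambda>x. 2 * (norm (u x))\<^sup>2 + 2 * (norm (v x))\<^sup>2)"
    using assms by (simp add: square_integrable_def)
  then have "integrable (lebesgue_on \<Omega>) (\<lambda>x. (norm (u x + v x))\<^sup>2)"
  proof (rule Bochner_Integration.integrable_bound)
    show "(\<lambda>x. (norm (u x + v x))\<^sup>2) \<in> borel_measurable (lebesgue_on \<Omega>)"
      using assms by (auto simp: square_integrable_def)
    show "AE x in lebesgue_on \<Omega>. norm ((norm (u x + v x))\<^sup>2) \<le> norm (2 * (norm (u x))\<^sup>2
        + 2 * (norm (v x))\<^sup>2)"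
    proof (rule AE_I2)
      fix x
      have "(norm (u x + v x))\<^sup>2 \<le> (norm (u x) + norm (v x))\<^sup>2"
        by (intro power_mono norm_triangle_ineq) auto
      also have "\<dots> \<le> 2 * (norm (u x))\<^sup>2 + 2 * (norm (v x))\<^sup>2"
        using sum_squares_bound[of "norm (u x)" "norm (v x)"] by (simp add: power2_sum)
      finally show "norm ((norm (u x + v x))\<^sup>2) \<le> norm (2 * (norm (u x))\<^sup>2 + 2 * (norm (v x))\<^sup>2)" by simp
    qed
  qed
  then show ?thesis using assms by (auto simp: square_integrable_def)
qed

lemma square_integrable_scaleR:
  "square_integrable \<Omega> u \<Longrightarrow> square_integrable \<Omega> (\<lambda>x. c *\<^sub>R u x)"
  by (rule square_integrable_bound[of \<Omega> u _ "\<bar>c\<bar>"]) (auto simp: square_integrable_def)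

lemma square_integrable_linear_combination:
  "square_integrable \<Omega> u \<Longrightarrow> square_integrable \<Omega> v \<Longrightarrow> square_integrable \<Omega> (\<lambda>x. a *\<^sub>R u x + b *\<^sub>R v x)"
  by (intro square_integrable_add square_integrable_scaleR)

lemma square_integrable_diff:
  "square_integrable \<Omega> u \<Longrightarrow> square_integrable \<Omega> v \<Longrightarrow> square_integrable \<Omega> (\<lambda>x. u x - v x)"
  using square_integrable_linear_combination[of \<Omega> u v 1 "-1"] by simp

lemma square_integrable_component:
  fixes u :: "plane \<Rightarrow> plane"
  assumes "square_integrable \<Omega> u" shows "square_integrable \<Omega> (\<lambda>x. u x $ i)"
proof (rule square_integrable_bound[OF assms, of _ 1])
  have "(\<lambda>y::plane. y $ i) \<in> borel_measurable borel"
    by (intro borel_measurable_continuous_onI continuous_intros)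
  from measurable_compose[OF square_integrableD(1)[OF assms] this]
  show "(\<lambda>x. u x $ i) \<in> borel_measurable (lebesgue_on \<Omega>)" .
qed (use component_le_norm_cart in auto)

lemma norm_plane_le: "norm (y :: plane) \<le> \<bar>y $ 1\<bar> + \<bar>y $ 2\<bar>"
  using norm_le_l1_cart[of y] by (simp add: sum_2)

lemma norm_vector_plane: "norm (vector [a, b] :: plane) = sqrt (a\<^sup>2 + b\<^sup>2)"
  by (simp add: norm_vec_def L2_set_def sum_2)

lemma vector_plane_eq: "vector [y $ 1, y $ 2] = (y :: plane)"
  by (simp add: vec_eq_iff forall_2)

lemma vector_plane_decompose: "vector [a, b] = a *\<^sub>R axis 1 1 + b *\<^sub>R (axis 2 1 :: plane)"
  by (simp add: vec_eq_iff forall_2 axis_def)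

lemma borel_measurable_vector_plane:
  "a \<in> borel_measurable M \<Longrightarrow> b \<in> borel_measurable M \<Longrightarrow>
    (\<lambda>x. vector [a x, b x] :: plane) \<in> borel_measurable M"
  unfolding vector_plane_decompose by simp

lemma square_integrable_vector:
  assumes "square_integrable \<Omega> a" "square_integrable \<Omega> b"
  shows "square_integrable \<Omega> (\<lambda>x. vector [a x, b x] :: plane)"
  using assms by (auto simp: square_integrable_def norm_vector_plane borel_measurable_vector_plane)

lemma square_integrable_inner:
  assumes "square_integrable \<Omega> u" "square_integrable \<Omega> v"
  shows "integrable (lebesgue_on \<Omega>) (\<lambda>x. u x \<bullet> v x)"
proof (rule Bochner_Integration.integrable_bound[of _ "\<lambda>x. (norm (u x))\<^sup>2 + (norm (v x))\<^sup>2"])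
  show "AE x in lebesgue_on \<Omega>. norm (u x \<bullet> v x) \<le> norm ((norm (u x))\<^sup>2 + (norm (v x))\<^sup>2)"
  proof (rule AE_I2)
    fix x
    have "2 * \<bar>u x \<bullet> v x\<bar> \<le> 2 * (norm (u x) * norm (v x))"
      using Cauchy_Schwarz_ineq2 by auto
    also have "\<dots> \<le> (norm (u x))\<^sup>2 + (norm (v x))\<^sup>2"
      using sum_squares_bound[of "norm (u x)" "norm (v x)"] by (simp add: mult.assoc)
    finally have "2 * \<bar>u x \<bullet> v x\<bar> \<le> (norm (u x))\<^sup>2 + (norm (v x))\<^sup>2" .
    then show "norm (u x \<bullet> v x) \<le> norm ((norm (u x))\<^sup>2 + (norm (v x))\<^sup>2)"
      unfolding real_norm_def by linarith
  qed
qed (use assms in \<open>auto simp: square_integrable_def\<close>)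

lemma square_integrable_times:
  fixes u v :: "plane \<Rightarrow> real"
  assumes "square_integrable \<Omega> u" "square_integrable \<Omega> v"
  shows "integrable (lebesgue_on \<Omega>) (\<lambda>x. u x * v x)"
  using square_integrable_inner[OF assms] by simp

section \<open>The inner product of L^2, Cauchy-Schwarz and Hoelder inequalities\<close>

lemma l2_inner_add_left:
  assumes "square_integrable \<Omega> u" "square_integrable \<Omega> v" "square_integrable \<Omega> w"
  shows "l2_inner \<Omega> (\<lambda>x. u x + v x) w = l2_inner \<Omega> u w + l2_inner \<Omega> v w"
  unfolding l2_inner_def using assms by (simp add: inner_add_left square_integrable_inner)

lemma l2_inner_diff_left:
  assumes "square_integrable \<Omega> u" "square_integrable \<Omega> v" "square_integrable \<Omega> w"
  shows "l2_inner \<Omega> (\<lambda>x. u x - v x) w = l2_inner \<Omega> u w - l2_inner \<Omega> v w"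
  unfolding l2_inner_def using assms by (simp add: inner_diff_left square_integrable_inner)

lemma l2_inner_commute: "l2_inner \<Omega> u v = l2_inner \<Omega> v u"
  by (simp add: l2_inner_def inner_commute)

lemma l2_inner_add_right:
  assumes "square_integrable \<Omega> u" "square_integrable \<Omega> v" "square_integrable \<Omega> w"
  shows "l2_inner \<Omega> w (\<lambda>x. u x + v x) = l2_inner \<Omega> w u + l2_inner \<Omega> w v"
  using l2_inner_add_left[OF assms] by (simp add: l2_inner_commute)

lemma l2_inner_diff_right:
  assumes "square_integrable \<Omega> u" "square_integrable \<Omega> v" "square_integrable \<Omega> w"
  shows "l2_inner \<Omega> w (\<lambda>x. u x - v x) = l2_inner \<Omega> w u - l2_inner \<Omega> w v"
  using l2_inner_diff_left[OF assms] by (simp add: l2_inner_commute)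

lemma l2_inner_scaleR_left: "l2_inner \<Omega> (\<lambda>x. c *\<^sub>R u x) w = c * l2_inner \<Omega> u w"
  by (simp add: l2_inner_def)

text \<open>Evaluation at the minimum -b/c. The degenerate case c = 0, where an affine function
  bounded below must be constant, is included because \<open>l2_norm\<close> vanishes on every
  function that is zero almost everywhere.\<close>

lemma quadratic_discriminant:
  fixes a b c :: real
  assumes "\<And>t. 0 \<le> a + 2 * t * b + t\<^sup>2 * c" "0 \<le> c"
  shows "b\<^sup>2 \<le> a * c"
proof (cases "c = 0")
  case True
  have "b = 0"
  proof (rule ccontr)
    assume "b \<noteq> 0"
    \<comment> \<open>At this parameter the affine expression takes the value -1.\<close>
    then have "2 * (- (a + 1) / (2 * b)) * b = - (a + 1)" by simp
    then show False using assms(1)[of "- (a + 1) / (2 * b)"] True by simp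
  qed
  then show ?thesis using True by simp
next
  case False
  then show ?thesis using assms(1)[of "- b / c"] assms(2)
    by (simp add: field_simps power2_eq_square)
qed

text \<open>The squared norm of u + t v is a nonnegative quadratic polynomial in t.\<close>

lemma l2_cauchy_schwarz:
  assumes "square_integrable \<Omega> u" "square_integrable \<Omega> v"
  shows "\<bar>l2_inner \<Omega> u v\<bar> \<le> l2_norm \<Omega> u * l2_norm \<Omega> v"
proof -
  have "0 \<le> (l2_norm \<Omega> u)\<^sup>2 + 2 * t * l2_inner \<Omega> u v + t\<^sup>2 * (l2_norm \<Omega> v)\<^sup>2" for t
  proof -
    note tv = square_integrable_scaleR[OF assms(2), of t]
    have "0 \<le> l2_inner \<Omega> (\<lambda>x. u x + t *\<^sub>R v x) (\<lambda>x. u x + t *\<^sub>R v x)"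
      by (simp add: l2_inner_self)
    also have "\<dots> = l2_inner \<Omega> u u + l2_inner \<Omega> (\<lambda>x. t *\<^sub>R v x) u
        + (l2_inner \<Omega> u (\<lambda>x. t *\<^sub>R v x) + l2_inner \<Omega> (\<lambda>x. t *\<^sub>R v x) (\<lambda>x. t *\<^sub>R v x))"
      using assms tv square_integrable_add[OF assms(1) tv]
      by (simp add: l2_inner_add_left l2_inner_add_right)
    also have "\<dots> = (l2_norm \<Omega> u)\<^sup>2 + 2 * t * l2_inner \<Omega> u v + t\<^sup>2 * (l2_norm \<Omega> v)\<^sup>2"
      by (simp add: l2_inner_commute[of \<Omega> u "\<lambda>x. t *\<^sub>R v x"] l2_inner_commute[of \<Omega> v "\<lambda>x. t *\<^sub>R v x"]
          l2_inner_scaleR_left l2_inner_commute[of \<Omega> v u] l2_inner_self[symmetric]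
              power2_eq_square[of t])
    finally show ?thesis .
  qed
  then have "(l2_inner \<Omega> u v)\<^sup>2 \<le> (l2_norm \<Omega> u)\<^sup>2 * (l2_norm \<Omega> v)\<^sup>2"
    by (rule quadratic_discriminant) simp
  then have "\<bar>l2_inner \<Omega> u v\<bar>\<^sup>2 \<le> (l2_norm \<Omega> u * l2_norm \<Omega> v)\<^sup>2"
    by (simp add: power_mult_distrib)
  then show ?thesis by (rule power2_le_imp_le) simp
qed

lemma l2_norm_scaleR: "l2_norm \<Omega> (\<lambda>x. c *\<^sub>R u x) = \<bar>c\<bar> * l2_norm \<Omega> u"
  by (simp add: l2_norm_eq power_mult_distrib real_sqrt_mult)

lemma l2_norm_triangle:
  assumes "square_integrable \<Omega> u" "square_integrable \<Omega> v"
  shows "l2_norm \<Omega> (\<lambda>x. u x + v x) \<le> l2_norm \<Omega> u + l2_norm \<Omega> v"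
proof (rule power2_le_imp_le)
  have "(l2_norm \<Omega> (\<lambda>x. u x + v x))\<^sup>2 = (l2_norm \<Omega> u)\<^sup>2 + 2 * l2_inner \<Omega> u v + (l2_norm \<Omega> v)\<^sup>2"
    using assms square_integrable_add[OF assms]
    by (simp add: l2_inner_self[symmetric] l2_inner_add_left l2_inner_add_right l2_inner_commute[of
        \<Omega> v u])
  also have "\<dots> \<le> (l2_norm \<Omega> u + l2_norm \<Omega> v)\<^sup>2"
    using l2_cauchy_schwarz[OF assms] by (simp add: power2_sum)
  finally show "(l2_norm \<Omega> (\<lambda>x. u x + v x))\<^sup>2 \<le> (l2_norm \<Omega> u + l2_norm \<Omega> v)\<^sup>2" .
qed simp

lemma l2_norm_diff_triangle:
  assumes "square_integrable \<Omega> u" "square_integrable \<Omega> v"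
  shows "\<bar>l2_norm \<Omega> u - l2_norm \<Omega> v\<bar> \<le> l2_norm \<Omega> (\<lambda>x. u x - v x)"
proof -
  have "l2_norm \<Omega> u \<le> l2_norm \<Omega> (\<lambda>x. u x - v x) + l2_norm \<Omega> v"
    using l2_norm_triangle[OF square_integrable_diff[OF assms] assms(2)] by simp
  moreover have "l2_norm \<Omega> v \<le> l2_norm \<Omega> (\<lambda>x. v x - u x) + l2_norm \<Omega> u"
    using l2_norm_triangle[OF square_integrable_diff[OF assms(2,1)] assms(1)] by simp
  moreover have "l2_norm \<Omega> (\<lambda>x. v x - u x) = l2_norm \<Omega> (\<lambda>x. u x - v x)"
    by (simp add: l2_norm_eq norm_minus_commute)
  ultimately show ?thesis by linarith
qed

text \<open>Young's inequality with the conjugate exponents r/2 and s/2, applied to the squares of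
  the two functions after division by their norms.\<close>

lemma l2_holder:
  fixes u :: "plane \<Rightarrow> 'b::euclidean_space" and v :: "plane \<Rightarrow> real"
  assumes exps: "2 < r" "2 < s" "1 / r + 1 / s = 1 / 2"
    and u: "u \<in> borel_measurable (lebesgue_on \<Omega>)" "integrable (lebesgue_on \<Omega>) (\<lambda>x. norm (u x) powr r)"
    and v: "v \<in> borel_measurable (lebesgue_on \<Omega>)" "integrable (lebesgue_on \<Omega>) (\<lambda>x. \<bar>v x\<bar> powr s)"
  shows "square_integrable \<Omega> (\<lambda>x. v x *\<^sub>R u x)"
    and "l2_norm \<Omega> (\<lambda>x. v x *\<^sub>R u x) \<le> lp_norm \<Omega> s v * lp_norm \<Omega> r u"
proof -
  let ?M = "lebesgue_on \<Omega>"
  have young: "a\<^sup>2 * b\<^sup>2 \<le> 2 / r * a powr r + 2 / s * b powr s" if "a \<ge> 0" "b \<ge> 0" for a b :: real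
  proof -
    have "1 / (r / 2) + 1 / (s / 2) = 1" using exps by simp
    then have "a\<^sup>2 * b\<^sup>2 \<le> a\<^sup>2 powr (r / 2) / (r / 2) + b\<^sup>2 powr (s / 2) / (s / 2)"
      using exps by (intro Youngs_inequality) auto
    moreover have "a\<^sup>2 powr (r / 2) = a powr r" "b\<^sup>2 powr (s / 2) = b powr s"
      using that by (simp_all flip: powr_numeral add: powr_powr)
    ultimately show ?thesis by (simp add: field_simps)
  qed
  have meas: "(\<lambda>x. v x *\<^sub>R u x) \<in> borel_measurable ?M" using u v by simp
  have "integrable ?M (\<lambda>x. (norm (v x *\<^sub>R u x))\<^sup>2)"
  proof (rule Bochner_Integration.integrable_bound)
    show "integrable ?M (\<lambda>x. 2 / r * norm (u x) powr r + 2 / s * \<bar>v x\<bar> powr s)"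
      using u(2) v(2) by simp
    show "AE x in ?M. norm ((norm (v x *\<^sub>R u x))\<^sup>2) \<le> norm (2 / r * norm (u x) powr r
        + 2 / s * \<bar>v x\<bar> powr s)"
    proof (rule AE_I2)
      fix x
      have "0 \<le> 2 / r * norm (u x) powr r + 2 / s * \<bar>v x\<bar> powr s"
        using exps by (intro add_nonneg_nonneg mult_nonneg_nonneg) auto
      then show "norm ((norm (v x *\<^sub>R u x))\<^sup>2) \<le> norm (2 / r * norm (u x) powr r + 2 / s * \<bar>v x\<bar> powr s)"
        using young[of "norm (u x)" "\<bar>v x\<bar>"] by (simp add: power_mult_distrib mult.commute)
    qed
  qed (use meas in \<open>measurable\<close>)
  then show sq: "square_integrable \<Omega> (\<lambda>x. v x *\<^sub>R u x)" using meas by (simp add: square_integrable_def)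
  define A where "A = lp_norm \<Omega> r u"
  define B where "B = lp_norm \<Omega> s v"
  have A: "A \<ge> 0" "A powr r = (LINT x|?M. norm (u x) powr r)"
    using exps by (auto simp: A_def lp_norm_def powr_powr)
  have B: "B \<ge> 0" "B powr s = (LINT x|?M. \<bar>v x\<bar> powr s)"
    using exps by (auto simp: B_def lp_norm_def powr_powr)
  show "l2_norm \<Omega> (\<lambda>x. v x *\<^sub>R u x) \<le> B * A"
  \<comment> \<open>Normalisation is impossible if one of the norms vanishes; the product is then
    zero almost everywhere.\<close>
  proof (cases "A = 0 \<or> B = 0")
    case True
    have "AE x in ?M. v x *\<^sub>R u x = 0"
      using True
    proof
      assume "A = 0"
      then have "AE x in ?M. norm (u x) powr r = 0"
        using A(2) integral_nonneg_eq_0_iff_AE[OF u(2)] by simp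
      then show ?thesis by eventually_elim simp
    next
      assume "B = 0"
      then have "AE x in ?M. \<bar>v x\<bar> powr s = 0"
        using B(2) integral_nonneg_eq_0_iff_AE[OF v(2)] by simp
      then show ?thesis by eventually_elim simp
    qed
    then have "(LINT x|?M. (norm (v x *\<^sub>R u x))\<^sup>2) = 0"
      by (intro integral_eq_zero_AE) (auto elim: eventually_mono)
    then show ?thesis using A(1) B(1) by (simp add: l2_norm_eq)
  next
    case False
    then have pos: "A > 0" "B > 0" using A B by auto
    have "(LINT x|?M. (norm (v x *\<^sub>R u x))\<^sup>2) / (A * B)\<^sup>2
        = (LINT x|?M. (norm (u x) / A)\<^sup>2 * (\<bar>v x\<bar> / B)\<^sup>2)"
      by (subst integral_divide_zero[symmetric]) (simp add: power_mult_distrib power_divide mult.commute)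
    also have "\<dots> \<le> (LINT x|?M. 2 / r * (norm (u x) powr r / A powr r)
        + 2 / s * (\<bar>v x\<bar> powr s / B powr s))"
    proof (rule integral_mono)
      show "integrable ?M (\<lambda>x. (norm (u x) / A)\<^sup>2 * (\<bar>v x\<bar> / B)\<^sup>2)"
        using integrable_mult_left[OF square_integrableD(2)[OF sq], of "1 / (A\<^sup>2 * B\<^sup>2)"]
        by (simp add: power_mult_distrib power_divide mult.commute)
      show "integrable ?M (\<lambda>x. 2 / r * (norm (u x) powr r / A powr r)
          + 2 / s * (\<bar>v x\<bar> powr s / B powr s))"
        using u(2) v(2) by simp
      fix x
      have "(norm (u x) / A)\<^sup>2 * (\<bar>v x\<bar> / B)\<^sup>2 \<le> 2 / r * (norm (u x) / A) powr r
          + 2 / s * (\<bar>v x\<bar> / B) powr s"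
        using pos by (intro young) auto
      then show "(norm (u x) / A)\<^sup>2 * (\<bar>v x\<bar> / B)\<^sup>2
          \<le> 2 / r * (norm (u x) powr r / A powr r) + 2 / s * (\<bar>v x\<bar> powr s / B powr s)"
        using pos by (simp add: powr_divide)
    qed
    also have "\<dots> = 2 / r * (A powr r / A powr r) + 2 / s * (B powr s / B powr s)"
      using u(2) v(2) by (simp add: A(2) B(2))
    also have "\<dots> = 2 * (1 / r + 1 / s)" using pos by simp
    also have "\<dots> = 1" using exps by simp
    finally have "(LINT x|?M. (norm (v x *\<^sub>R u x))\<^sup>2) \<le> (B * A)\<^sup>2"
      using pos by (simp add: divide_le_eq mult.commute)
    then have "(l2_norm \<Omega> (\<lambda>x. v x *\<^sub>R u x))\<^sup>2 \<le> (B * A)\<^sup>2" by (simp add: l2_norm_power2)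
    then show ?thesis using power2_le_imp_le[of "l2_norm \<Omega> (\<lambda>x. v x *\<^sub>R u x)" "B * A"] A B by simp
  qed
qed

subsection \<open>Weak gradients\<close>

text \<open>A relation rather than a chosen function: gradients of products and combinations can be
  exhibited explicitly, and uniqueness almost everywhere transfers them to \<open>grad\<close>,
  which is the result of a choice.\<close>

definition weak_grad :: "plane set \<Rightarrow> (plane \<Rightarrow> real) \<Rightarrow> (plane \<Rightarrow> plane) \<Rightarrow> bool" where
  "weak_grad \<Omega> u G \<longleftrightarrow> square_integrable \<Omega> u \<and> square_integrable \<Omega> G \<and>
     (\<forall>\<phi> i. test_function \<Omega> \<phi> \<longrightarrow>
        l2_inner \<Omega> u (pderivative i \<phi>) = - l2_inner \<Omega> (\<lambda>x. G x $ i) \<phi>)"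

definition classical_grad :: "(plane \<Rightarrow> real) \<Rightarrow> plane \<Rightarrow> plane" where
  "classical_grad \<phi> x = vector [pderivative 1 \<phi> x, pderivative 2 \<phi> x]"

lemma classical_grad_component: "classical_grad \<phi> x $ i = pderivative i \<phi> x"
  using exhaust_2[of i] by (auto simp: classical_grad_def)

locale bounded_domain =
  fixes \<Omega> :: "plane set"
  assumes open_domain: "open \<Omega>" and bounded_domain: "bounded \<Omega>"
begin

abbreviation "M \<equiv> lebesgue_on \<Omega>"

lemma sets_domain: "\<Omega> \<in> sets lebesgue"
  using open_domain by (simp add: lebesgue_openin)

lemma AE_domain_iff: "(AE x in M. Q x) \<longleftrightarrow> (AE x in lebesgue. x \<in> \<Omega> \<longrightarrow> Q x)"
  using sets_domain by (subst AE_restrict_space_iff) auto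

lemma finite_measure_domain: "finite_measure M"
proof -
  have "\<Omega> \<in> lmeasurable" using bounded_domain sets_domain by (rule bounded_set_imp_lmeasurable)
  then show ?thesis
    by (intro finite_measureI) (auto simp: emeasure_restrict_space sets_domain fmeasurable_def)
qed

text \<open>Completeness of Lebesgue measure. It makes chosen weak derivatives measurable, since
  they agree almost everywhere with functions known to be so.\<close>

lemma borel_measurable_AE_domain:
  fixes f g :: "plane \<Rightarrow> 'b::euclidean_space"
  assumes "f \<in> borel_measurable M" "AE x in M. f x = g x"
  shows "g \<in> borel_measurable M"
proof -
  have "(\<lambda>x. if x \<in> \<Omega> then f x else 0) \<in> borel_measurable lebesgue"
    using assms(1) sets_domain by (simp add: borel_measurable_if)
  then have "(\<lambda>x. if x \<in> \<Omega> then g x else 0) \<in> borel_measurable lebesgue"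
    by (rule borel_measurable_AE) (use assms(2) in \<open>auto simp: AE_domain_iff elim: eventually_mono\<close>)
  then show ?thesis using sets_domain by (simp add: borel_measurable_if)
qed

lemma continuous_measurable:
  fixes f :: "plane \<Rightarrow> 'b::euclidean_space"
  assumes "continuous_on UNIV f" shows "f \<in> borel_measurable M"
  using assms continuous_on_subset sets_domain
  by (intro continuous_imp_measurable_on_sets_lebesgue) auto

lemma integrable_imp_locally_integrable:
  assumes "integrable M u" shows "locally_integrable \<Omega> u"
  unfolding locally_integrable_def
proof (intro allI impI)
  fix K assume K: "compact K" "K \<subseteq> \<Omega>"
  have "set_integrable lebesgue \<Omega> u"
    using assms sets_domain by (simp add: set_integrable_def integrable_restrict_space)
  then show "u absolutely_integrable_on K"
    by (rule set_integrable_subset) (use K in \<open>auto intro: lmeasurable_compact fmeasurableD\<close>)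
qed

lemma bounded_square_integrable:
  fixes u :: "plane \<Rightarrow> 'b::euclidean_space"
  assumes "u \<in> borel_measurable M" "AE x in M. norm (u x) \<le> K"
  shows "square_integrable \<Omega> u"
proof -
  interpret finite_measure M by (rule finite_measure_domain)
  have "integrable M (\<lambda>x. (norm (u x))\<^sup>2)"
  proof (rule integrable_const_bound[of _ "K\<^sup>2"])
    show "AE x in M. norm ((norm (u x))\<^sup>2) \<le> K\<^sup>2"
      using assms(2) by eventually_elim (auto intro: power_mono)
  qed (use assms in simp)
  then show ?thesis using assms(1) by (simp add: square_integrable_def)
qed

lemma square_integrable_imp_integrable:
  fixes u :: "plane \<Rightarrow> real"
  assumes "square_integrable \<Omega> u" shows "integrable M u"
proof -
  have "square_integrable \<Omega> (\<lambda>x. 1 :: real)"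
    by (rule bounded_square_integrable[of _ 1]) auto
  from square_integrable_times[OF assms this] show ?thesis by simp
qed

lemma square_integrable_locally_integrable:
  "square_integrable \<Omega> (u :: plane \<Rightarrow> real) \<Longrightarrow> locally_integrable \<Omega> u"
  by (intro integrable_imp_locally_integrable square_integrable_imp_integrable)

lemma test_function_square_integrable: "test_function \<Omega> \<phi> \<Longrightarrow> square_integrable \<Omega> \<phi>"
proof -
  assume \<phi>: "test_function \<Omega> \<phi>"
  then obtain B where "\<And>x. \<bar>\<phi> x\<bar> \<le> B" using test_function_bounded by blast
  then show ?thesis
    using bounded_square_integrable[OF continuous_measurable[OF smooth_continuous[OF
        test_function_smooth[OF \<phi>]]], of B]
    by simp
qed

lemma smooth_bounded:
  assumes "smooth \<phi>" obtains B where "\<And>x. x \<in> closure \<Omega> \<Longrightarrow> \<bar>\<phi> x\<bar> \<le> B"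
proof -
  have "compact (closure \<Omega>)" using bounded_domain by simp
  then have "bounded (\<phi> ` closure \<Omega>)"
    using assms by (intro compact_imp_bounded compact_continuous_image smooth_continuous)
  then show ?thesis using that unfolding bounded_iff by auto
qed

text \<open>Compactness of the closure gives the bound. The version on the closure reaches the
  boundary points that occur in trace integrals; the a.e. version serves integrals over
  \<Omega>.\<close>

lemma smooth_AE_bounded:
  assumes "smooth \<phi>" obtains B where "B \<ge> 0" "\<And>x. x \<in> closure \<Omega> \<Longrightarrow> \<bar>\<phi> x\<bar> \<le> B" "AE x in M. \<bar>\<phi> x\<bar> \<le> B"
proof -
  obtain B where B: "\<And>x. x \<in> closure \<Omega> \<Longrightarrow> \<bar>\<phi> x\<bar> \<le> B" using smooth_bounded[OF assms] by blast
  then have *: "\<bar>\<phi> x\<bar> \<le> \<bar>B\<bar>" if "x \<in> closure \<Omega>" for x using that by fastforce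
  then have "AE x in M. \<bar>\<phi> x\<bar> \<le> \<bar>B\<bar>"
    using closure_subset by (intro AE_I2) (auto simp: space_restrict_space)
  with * show ?thesis by (intro that[of "\<bar>B\<bar>"]) auto
qed

lemma smooth_square_integrable: "smooth \<phi> \<Longrightarrow> square_integrable \<Omega> \<phi>"
proof -
  assume \<phi>: "smooth \<phi>"
  then obtain B where "AE x in M. \<bar>\<phi> x\<bar> \<le> B" using smooth_AE_bounded by blast
  then show ?thesis
    using bounded_square_integrable[OF continuous_measurable[OF smooth_continuous[OF \<phi>]], of B]
    by simp
qed

lemma square_integrable_smooth_scaleR:
  assumes "smooth \<phi>" "square_integrable \<Omega> u"
  shows "square_integrable \<Omega> (\<lambda>x. \<phi> x *\<^sub>R u x)"
proof -
  obtain B where B: "B \<ge> 0" "AE x in M. \<bar>\<phi> x\<bar> \<le> B" using smooth_AE_bounded[OF assms(1)] by metis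
  show ?thesis
  proof (rule square_integrable_bound[OF assms(2), of _ B])
    show "(\<lambda>x. \<phi> x *\<^sub>R u x) \<in> borel_measurable M"
      using continuous_measurable[OF smooth_continuous[OF assms(1)]] square_integrableD(1)[OF assms(2)]
      by (rule borel_measurable_scaleR)
    show "AE x in M. norm (\<phi> x *\<^sub>R u x) \<le> B * norm (u x)"
      using B(2) by eventually_elim (simp add: mult_right_mono)
  qed
qed

lemma square_integrable_smooth_times:
  "smooth \<phi> \<Longrightarrow> square_integrable \<Omega> u \<Longrightarrow> square_integrable \<Omega> (\<lambda>x. \<phi> x * (u x :: real))"
  using square_integrable_smooth_scaleR[of \<phi> u] by simp

lemma square_integrable_classical_grad: "smooth \<phi> \<Longrightarrow> square_integrable \<Omega> (classical_grad \<phi>)"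
  unfolding classical_grad_def[abs_def]
  by (intro square_integrable_vector smooth_square_integrable smooth_pderivative)

text \<open>Weak derivatives are a priori only locally integrable; the compact support of the test
  function makes the product integrable over all of \<Omega>.\<close>

lemma locally_integrable_times_test_function:
  assumes "locally_integrable \<Omega> v" "test_function \<Omega> \<phi>"
  shows "integrable M (\<lambda>x. v x * \<phi> x)"
proof -
  let ?K = "closure {x. \<phi> x \<noteq> 0}"
  obtain B where B: "\<And>x. \<bar>\<phi> x\<bar> \<le> B" using test_function_bounded[OF assms(2)] by blast
  have K: "compact ?K" "?K \<subseteq> \<Omega>" using assms(2) by (auto simp: test_function_def)
  have iK: "integrable lebesgue (\<lambda>x. indicator ?K x *\<^sub>R v x)"
    using assms(1) K by (auto simp: locally_integrable_def set_integrable_def)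
  have fm: "\<phi> \<in> borel_measurable lebesgue"
    using smooth_continuous[OF test_function_smooth[OF assms(2)], of UNIV]
    by (intro continuous_imp_measurable_on_sets_lebesgue[of UNIV, unfolded lebesgue_on_UNIV_eq]) auto
  have "integrable lebesgue (\<lambda>x. B * (indicator ?K x *\<^sub>R v x))"
    using iK by simp
  then have "integrable lebesgue (\<lambda>x. (indicator ?K x *\<^sub>R v x) * \<phi> x)"
  proof (rule Bochner_Integration.integrable_bound)
    show "(\<lambda>x. (indicator ?K x *\<^sub>R v x) * \<phi> x) \<in> borel_measurable lebesgue"
      using iK fm by (intro borel_measurable_times) auto
    show "AE x in lebesgue. norm ((indicator ?K x *\<^sub>R v x) * \<phi> x) \<le> norm (B * (indicator ?K x *\<^sub>R v x))"
    proof (rule AE_I2)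
      fix x
      have "\<bar>indicator ?K x *\<^sub>R v x\<bar> * \<bar>\<phi> x\<bar> \<le> \<bar>indicator ?K x *\<^sub>R v x\<bar> * \<bar>B\<bar>"
        using B[of x] by (intro mult_left_mono) auto
      then show "norm ((indicator ?K x *\<^sub>R v x) * \<phi> x) \<le> norm (B * (indicator ?K x *\<^sub>R v x))"
        by (simp add: abs_mult mult.commute)
    qed
  qed
  also have "(\<lambda>x. (indicator ?K x *\<^sub>R v x) * \<phi> x) = (\<lambda>x. indicator \<Omega> x *\<^sub>R (v x * \<phi> x))"
    using closure_subset[of "{x. \<phi> x \<noteq> 0}"] K(2) by (auto simp: fun_eq_iff indicator_def)
  finally show ?thesis using sets_domain by (simp add: integrable_restrict_space)
qed

lemma has_weak_deriv_unique:
  assumes "has_weak_deriv \<Omega> a b u v" "has_weak_deriv \<Omega> a b u w"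
  shows "AE x in M. v x = w x"
proof -
  have li: "locally_integrable \<Omega> v" "locally_integrable \<Omega> w"
    using assms by (auto simp: has_weak_deriv_def)
  have "AE x in M. v x - w x = 0"
  proof (rule du_bois_reymond[OF open_domain])
    show "locally_integrable \<Omega> (\<lambda>x. v x - w x)"
      using li unfolding locally_integrable_def by (auto intro: set_integral_diff)
    fix \<phi> assume \<phi>: "test_function \<Omega> \<phi>"
    have "l2_inner \<Omega> (\<lambda>x. v x - w x) \<phi> = l2_inner \<Omega> v \<phi> - l2_inner \<Omega> w \<phi>"
      using li[THEN locally_integrable_times_test_function[OF _ \<phi>]]
      by (simp add: l2_inner_def left_diff_distrib)
    also have "\<dots> = 0" using assms \<phi> by (simp add: has_weak_deriv_def)
    finally show "l2_inner \<Omega> (\<lambda>x. v x - w x) \<phi> = 0" .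
  qed
  then show ?thesis by simp
qed

lemma weak_deriv_AE:
  assumes "has_weak_deriv \<Omega> a b u v" shows "AE x in M. weak_deriv \<Omega> a b u x = v x"
  unfolding weak_deriv_def
  by (rule has_weak_deriv_unique[OF someI[of "has_weak_deriv \<Omega> a b u", OF assms] assms])

lemma weak_deriv_00_AE:
  assumes "locally_integrable \<Omega> u" shows "AE x in M. weak_deriv \<Omega> 0 0 u x = u x"
  by (rule weak_deriv_AE) (use assms in \<open>simp add: has_weak_deriv_def\<close>)

lemma weak_grad_has_weak_deriv:
  assumes "weak_grad \<Omega> u G"
  shows "has_weak_deriv \<Omega> 1 0 u (\<lambda>x. G x $ 1)" "has_weak_deriv \<Omega> 0 1 u (\<lambda>x. G x $ 2)"
  using assms by (auto simp: weak_grad_def has_weak_deriv_def One_nat_def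
      intro!: square_integrable_locally_integrable square_integrable_component)

lemma weak_grad_AE:
  assumes "weak_grad \<Omega> u G" shows "AE x in M. grad \<Omega> u x = G x"
  using weak_deriv_AE[OF weak_grad_has_weak_deriv(1)[OF assms]]
    weak_deriv_AE[OF weak_grad_has_weak_deriv(2)[OF assms]]
  by eventually_elim (simp add: grad_def vector_plane_eq)

lemma weak_grad_measurable:
  assumes "weak_grad \<Omega> u G" shows "grad \<Omega> u \<in> borel_measurable M"
proof (rule borel_measurable_AE_domain)
  show "G \<in> borel_measurable M" using assms by (simp add: weak_grad_def square_integrable_def)
  show "AE x in M. G x = grad \<Omega> u x" using weak_grad_AE[OF assms] by eventually_elim simp
qed

lemma weak_grad_l2_norm:
  assumes "weak_grad \<Omega> u G" shows "l2_norm \<Omega> (grad \<Omega> u) = l2_norm \<Omega> G"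
  using assms weak_grad_measurable[OF assms] weak_grad_AE[OF assms]
  by (intro l2_norm_cong) (auto simp: weak_grad_def elim: eventually_mono)

lemma h_space_iff_weak_grad: "u \<in> h_space \<Omega> 1 \<longleftrightarrow> (\<exists>G. weak_grad \<Omega> u G)"
proof
  assume "\<exists>G. weak_grad \<Omega> u G"
  then obtain G where G: "weak_grad \<Omega> u G" ..
  have "\<exists>v\<in>lp_space \<Omega> 2. has_weak_deriv \<Omega> a b u v" if "a + b \<le> 1" for a b
  proof -
    have "a = 0 \<and> b = 0 \<or> a = 1 \<and> b = 0 \<or> a = 0 \<and> b = 1" using that by linarith
    then consider "a = 0" "b = 0" | "a = 1" "b = 0" | "a = 0" "b = 1" by blast
    then show ?thesis
    proof cases
      case 1
      have "has_weak_deriv \<Omega> 0 0 u u"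
        using G by (simp add: has_weak_deriv_def weak_grad_def square_integrable_locally_integrable)
      then show ?thesis using G 1 by (auto simp: weak_grad_def lp_space_2)
    next
      case 2
      then show ?thesis using weak_grad_has_weak_deriv(1)[OF G] square_integrable_component[of \<Omega> G 1] G
        by (auto simp: weak_grad_def lp_space_2)
    next
      case 3
      then show ?thesis using weak_grad_has_weak_deriv(2)[OF G] square_integrable_component[of \<Omega> G 2] G
        by (auto simp: weak_grad_def lp_space_2)
    qed
  qed
  then show "u \<in> h_space \<Omega> 1" using G by (simp add: sobolev_def weak_grad_def lp_space_2)
next
  assume u: "u \<in> h_space \<Omega> 1"
  then have D: "a + b \<le> 1 \<Longrightarrow> \<exists>v\<in>lp_space \<Omega> 2. has_weak_deriv \<Omega> a b u v" for a b
    by (simp add: sobolev_def)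
  obtain v1 where v1: "v1 \<in> lp_space \<Omega> 2" "has_weak_deriv \<Omega> 1 0 u v1"
    using D[of 1 0] by auto
  obtain v2 where v2: "v2 \<in> lp_space \<Omega> 2" "has_weak_deriv \<Omega> 0 1 u v2"
    using D[of 0 1] by auto
  have "l2_inner \<Omega> u (pderivative i \<phi>) = - l2_inner \<Omega> (\<lambda>x. (vector [v1 x, v2 x] :: plane) $ i) \<phi>"
    if "test_function \<Omega> \<phi>" for \<phi> i
    using exhaust_2[of i] v1(2) v2(2) that by (auto simp: has_weak_deriv_def One_nat_def)
  then have "weak_grad \<Omega> u (\<lambda>x. vector [v1 x, v2 x])"
    using u v1(1) v2(1) by (auto simp: weak_grad_def sobolev_def lp_space_2 square_integrable_vector)
  then show "\<exists>G. weak_grad \<Omega> u G" by (intro exI)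
qed

text \<open>The components of \<open>grad\<close> are chosen among locally integrable functions.
  Square integrability and the integration by parts formula are inherited, through equality almost
  everywhere, from one representative that has them.\<close>

lemma weak_grad_grad:
  assumes "u \<in> h_space \<Omega> 1" shows "weak_grad \<Omega> u (grad \<Omega> u)"
proof -
  obtain G where G: "weak_grad \<Omega> u G" using assms h_space_iff_weak_grad by blast
  have m: "grad \<Omega> u \<in> borel_measurable M" by (rule weak_grad_measurable[OF G])
  have sG: "square_integrable \<Omega> G" using G by (simp add: weak_grad_def)
  have sg: "square_integrable \<Omega> (grad \<Omega> u)"
  proof (rule square_integrable_bound[OF sG m, of 1])
    show "AE x in M. norm (grad \<Omega> u x) \<le> 1 * norm (G x)"
      using weak_grad_AE[OF G] by eventually_elim simp
  qed
  have li: "l2_inner \<Omega> (\<lambda>x. grad \<Omega> u x $ i) \<phi> = l2_inner \<Omega> (\<lambda>x. G x $ i) \<phi>"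
    if "test_function \<Omega> \<phi>" for \<phi> i
    unfolding l2_inner_def
  proof (rule integral_cong_AE)
    have "\<phi> \<in> borel_measurable M" using that
      by (simp add: continuous_measurable smooth_continuous test_function_smooth)
    moreover have "(\<lambda>x. grad \<Omega> u x $ i) \<in> borel_measurable M" "(\<lambda>x. G x $ i) \<in> borel_measurable M"
      using square_integrableD(1)[OF square_integrable_component[OF sg]] square_integrableD(1)[OF
          square_integrable_component[OF sG]]
      by auto
    ultimately show "(\<lambda>x. grad \<Omega> u x $ i \<bullet> \<phi> x) \<in> borel_measurable M"
      "(\<lambda>x. G x $ i \<bullet> \<phi> x) \<in> borel_measurable M" by auto
    show "AE x in M. grad \<Omega> u x $ i \<bullet> \<phi> x = G x $ i \<bullet> \<phi> x"
      using weak_grad_AE[OF G] by eventually_elim simp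
  qed
  show ?thesis using G sg by (simp add: weak_grad_def li)
qed

lemma h_space_square_integrable:
  assumes "u \<in> h_space \<Omega> 1"
  shows "square_integrable \<Omega> u" "square_integrable \<Omega> (grad \<Omega> u)"
  using weak_grad_grad[OF assms] by (auto simp: weak_grad_def)

lemma deriv_abs_1: "deriv_abs \<Omega> 1 u x = norm (grad \<Omega> u x)"
  by (simp add: deriv_abs_def grad_def norm_vector_plane add.commute One_nat_def)

lemma h1_norm_eq:
  assumes "u \<in> h_space \<Omega> 1"
  shows "h1_norm \<Omega> u = sqrt ((l2_norm \<Omega> u)\<^sup>2 + (l2_norm \<Omega> (grad \<Omega> u))\<^sup>2)"
proof -
  note sq = h_space_square_integrable[OF assms]
  have d0: "deriv_abs \<Omega> 0 u x = \<bar>weak_deriv \<Omega> 0 0 u x\<bar>" for x by (simp add: deriv_abs_def)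
  \<comment> \<open>The order-zero term of \<open>sobolev_norm\<close> is itself a chosen weak
    derivative, equal to \<open>u\<close> only almost everywhere.\<close>
  have ae: "AE x in M. weak_deriv \<Omega> 0 0 u x = u x"
    by (rule weak_deriv_00_AE[OF square_integrable_locally_integrable[OF sq(1)]])
  have "weak_deriv \<Omega> 0 0 u \<in> borel_measurable M"
    by (rule borel_measurable_AE_domain[of u]) (use sq ae in \<open>auto simp: square_integrable_def elim:
        eventually_mono\<close>)
  then have "l2_norm \<Omega> (deriv_abs \<Omega> 0 u) = l2_norm \<Omega> u"
    by (intro l2_norm_cong sq) (use ae in \<open>auto simp: d0[abs_def] elim: eventually_mono\<close>)
  moreover have "l2_norm \<Omega> (deriv_abs \<Omega> 1 u) = l2_norm \<Omega> (grad \<Omega> u)"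
    by (simp add: l2_norm_eq deriv_abs_1[abs_def])
  ultimately show ?thesis
    unfolding sobolev_norm_def One_nat_def by (simp add: powr_half_sqrt)
qed

lemma sobolev_seminorm_1: "sobolev_seminorm \<Omega> 1 u = l2_norm \<Omega> (grad \<Omega> u)"
  by (simp add: sobolev_seminorm_def l2_norm_eq deriv_abs_1[abs_def])

lemma l2_norm_le_h1_norm: "u \<in> h_space \<Omega> 1 \<Longrightarrow> l2_norm \<Omega> u \<le> h1_norm \<Omega> u"
  by (simp add: h1_norm_eq real_le_rsqrt)

lemma l2_norm_grad_le_h1_norm: "u \<in> h_space \<Omega> 1 \<Longrightarrow> l2_norm \<Omega> (grad \<Omega> u) \<le> h1_norm \<Omega> u"
  by (simp add: h1_norm_eq real_le_rsqrt)

lemma h1_norm_le_sum: "u \<in> h_space \<Omega> 1 \<Longrightarrow> h1_norm \<Omega> u \<le> l2_norm \<Omega> u + l2_norm \<Omega> (grad \<Omega> u)"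
  using sqrt_sum_squares_le_sum[of "l2_norm \<Omega> u" "l2_norm \<Omega> (grad \<Omega> u)"] by (simp add: h1_norm_eq)

lemma weak_grad_linear_combination:
  assumes "weak_grad \<Omega> u G" "weak_grad \<Omega> v H"
  shows "weak_grad \<Omega> (\<lambda>x. a * u x + b * v x) (\<lambda>x. a *\<^sub>R G x + b *\<^sub>R H x)"
proof -
  have s: "square_integrable \<Omega> u" "square_integrable \<Omega> v" "square_integrable \<Omega> G" "square_integrable \<Omega> H"
    using assms by (auto simp: weak_grad_def)
  have "l2_inner \<Omega> (\<lambda>x. a * u x + b * v x) (pderivative i \<phi>) =
      - l2_inner \<Omega> (\<lambda>x. (a *\<^sub>R G x + b *\<^sub>R H x) $ i) \<phi>" if \<phi>: "test_function \<Omega> \<phi>" for \<phi> i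
  proof -
    note t = test_function_square_integrable[OF \<phi>] test_function_square_integrable[OF
        test_function_pderivative[OF \<phi>]]
    have "l2_inner \<Omega> (\<lambda>x. a *\<^sub>R u x + b *\<^sub>R v x) (pderivative i \<phi>)
        = a * l2_inner \<Omega> u (pderivative i \<phi>) + b * l2_inner \<Omega> v (pderivative i \<phi>)"
      using s t by (simp only: l2_inner_add_left square_integrable_scaleR l2_inner_scaleR_left)
    also have "\<dots> = - (a * l2_inner \<Omega> (\<lambda>x. G x $ i) \<phi> + b * l2_inner \<Omega> (\<lambda>x. H x $ i) \<phi>)"
      using assms \<phi> by (simp add: weak_grad_def)
    also have "a * l2_inner \<Omega> (\<lambda>x. G x $ i) \<phi> + b * l2_inner \<Omega> (\<lambda>x. H x $ i) \<phi>
        = l2_inner \<Omega> (\<lambda>x. a *\<^sub>R (G x $ i) + b *\<^sub>R (H x $ i)) \<phi>"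
      using s t
      by (simp only: l2_inner_add_left square_integrable_scaleR square_integrable_component
          l2_inner_scaleR_left)
    finally show ?thesis by simp
  qed
  then show ?thesis
    using square_integrable_linear_combination[OF s(1,2), of a b]
        square_integrable_linear_combination[OF s(3,4), of a b]
    by (simp add: weak_grad_def)
qed

lemma h_space_linear_combination:
  assumes "u \<in> h_space \<Omega> 1" "v \<in> h_space \<Omega> 1"
  shows "(\<lambda>x. a * u x + b * v x) \<in> h_space \<Omega> 1"
    "AE x in M. grad \<Omega> (\<lambda>x. a * u x + b * v x) x = a *\<^sub>R grad \<Omega> u x + b *\<^sub>R grad \<Omega> v x"
    "h1_norm \<Omega> (\<lambda>x. a * u x + b * v x) \<le> \<bar>a\<bar> * h1_norm \<Omega> u + \<bar>b\<bar> * h1_norm \<Omega> v"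
proof -
  note wg = weak_grad_linear_combination[OF weak_grad_grad[OF assms(1)] weak_grad_grad[OF assms(2)],
      of a b]
  show hs: "(\<lambda>x. a * u x + b * v x) \<in> h_space \<Omega> 1" using wg h_space_iff_weak_grad by blast
  show "AE x in M. grad \<Omega> (\<lambda>x. a * u x + b * v x) x = a *\<^sub>R grad \<Omega> u x + b *\<^sub>R grad \<Omega> v x"
    by (rule weak_grad_AE[OF wg])
  note sq = h_space_square_integrable[OF assms(1)] h_space_square_integrable[OF assms(2)]
  have 1: "l2_norm \<Omega> (\<lambda>x. a * u x + b * v x) \<le> \<bar>a\<bar> * l2_norm \<Omega> u + \<bar>b\<bar> * l2_norm \<Omega> v"
    using l2_norm_triangle[OF square_integrable_scaleR[OF sq(1), of a] square_integrable_scaleR[OF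
        sq(3), of b]]
    by (simp only: l2_norm_scaleR flip: real_scaleR_def)
  have 2: "l2_norm \<Omega> (grad \<Omega> (\<lambda>x. a * u x + b * v x)) \<le> \<bar>a\<bar> * l2_norm \<Omega> (grad \<Omega> u)
      + \<bar>b\<bar> * l2_norm \<Omega> (grad \<Omega> v)"
    unfolding weak_grad_l2_norm[OF wg]
    using l2_norm_triangle[OF square_integrable_scaleR[OF sq(2), of a] square_integrable_scaleR[OF
        sq(4), of b]]
    by (simp only: l2_norm_scaleR)
  have "h1_norm \<Omega> (\<lambda>x. a * u x + b * v x)
      \<le> sqrt ((\<bar>a\<bar> * l2_norm \<Omega> u + \<bar>b\<bar> * l2_norm \<Omega> v)\<^sup>2 + (\<bar>a\<bar> * l2_norm \<Omega> (grad \<Omega> u) + \<bar>b\<bar> *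
          l2_norm \<Omega> (grad \<Omega> v))\<^sup>2)"
    unfolding h1_norm_eq[OF hs] by (intro real_sqrt_le_mono add_mono power_mono 1 2) auto
  \<comment> \<open>The triangle inequality of the Euclidean plane, for the vectors formed by the
    L^2 norm of a function and that of its gradient.\<close>
  also have "\<dots> \<le> sqrt ((\<bar>a\<bar> * l2_norm \<Omega> u)\<^sup>2 + (\<bar>a\<bar> * l2_norm \<Omega> (grad \<Omega> u))\<^sup>2)
      + sqrt ((\<bar>b\<bar> * l2_norm \<Omega> v)\<^sup>2 + (\<bar>b\<bar> * l2_norm \<Omega> (grad \<Omega> v))\<^sup>2)"
    by (rule real_sqrt_sum_squares_triangle_ineq)
  also have "\<dots> = \<bar>a\<bar> * h1_norm \<Omega> u + \<bar>b\<bar> * h1_norm \<Omega> v"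
    by (simp add: h1_norm_eq assms power_mult_distrib real_sqrt_mult flip: distrib_left)
  finally show "h1_norm \<Omega> (\<lambda>x. a * u x + b * v x) \<le> \<bar>a\<bar> * h1_norm \<Omega> u + \<bar>b\<bar> * h1_norm \<Omega> v" .
qed

lemma h_space_diff:
  assumes "u \<in> h_space \<Omega> 1" "v \<in> h_space \<Omega> 1"
  shows "(\<lambda>x. u x - v x) \<in> h_space \<Omega> 1"
    "AE x in M. grad \<Omega> (\<lambda>x. u x - v x) x = grad \<Omega> u x - grad \<Omega> v x"
    "h1_norm \<Omega> (\<lambda>x. u x - v x) \<le> h1_norm \<Omega> u + h1_norm \<Omega> v"
  using h_space_linear_combination[OF assms, of 1 "-1"] by simp_all

text \<open>The product of \<phi> with a test function is again a test function, so the weak formula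
  of \<open>u\<close> may be tested with it; the classical product rule separates the two
  contributions.\<close>

lemma weak_grad_smooth_times:
  assumes "smooth \<phi>" "weak_grad \<Omega> u G"
  shows "weak_grad \<Omega> (\<lambda>x. \<phi> x * u x) (\<lambda>x. \<phi> x *\<^sub>R G x + u x *\<^sub>R classical_grad \<phi> x)"
proof -
  have s: "square_integrable \<Omega> u" "square_integrable \<Omega> G" using assms by (auto simp: weak_grad_def)
  obtain B1 where B1: "AE x in M. \<bar>pderivative 1 \<phi> x\<bar> \<le> B1" "B1 \<ge> 0"
    using smooth_AE_bounded[OF smooth_pderivative[OF assms(1)]] by metis
  obtain B2 where B2: "AE x in M. \<bar>pderivative 2 \<phi> x\<bar> \<le> B2" "B2 \<ge> 0"
    using smooth_AE_bounded[OF smooth_pderivative[OF assms(1)]] by metis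
  have s2: "square_integrable \<Omega> (\<lambda>x. u x *\<^sub>R classical_grad \<phi> x)"
  proof (rule square_integrable_bound[OF s(1), of _ "B1 + B2"])
    show "(\<lambda>x. u x *\<^sub>R classical_grad \<phi> x) \<in> borel_measurable M"
      using square_integrableD(1)[OF s(1)] square_integrableD(1)[OF
          square_integrable_classical_grad[OF assms(1)]]
      by (rule borel_measurable_scaleR)
    show "AE x in M. norm (u x *\<^sub>R classical_grad \<phi> x) \<le> (B1 + B2) * norm (u x)"
      using B1(1) B2(1)
    proof eventually_elim
      case (elim x)
      have "norm (classical_grad \<phi> x) \<le> B1 + B2"
        using norm_plane_le[of "classical_grad \<phi> x"] elim by (simp add: classical_grad_component)
      from mult_right_mono[OF this abs_ge_zero[of "u x"]] show ?case
        by (simp only: norm_scaleR real_norm_def mult.commute[of "\<bar>u x\<bar>"])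
    qed
  qed
  have "l2_inner \<Omega> (\<lambda>x. \<phi> x * u x) (pderivative i \<eta>) =
      - l2_inner \<Omega> (\<lambda>x. (\<phi> x *\<^sub>R G x + u x *\<^sub>R classical_grad \<phi> x) $ i) \<eta>"
    if \<eta>: "test_function \<Omega> \<eta>" for \<eta> i
  proof -
    note sm = test_function_smooth[OF \<eta>] smooth_pderivative[OF test_function_smooth[OF \<eta>], of i]
      smooth_pderivative[OF assms(1), of i]
    note t = test_function_square_integrable[OF \<eta>] test_function_square_integrable[OF
        test_function_pderivative[OF \<eta>], of i]
    have i1: "integrable M (\<lambda>x. u x * (\<phi> x * pderivative i \<eta> x))"
      using square_integrable_times[OF s(1) square_integrable_smooth_times[OF assms(1) t(2)]] .
    have i2: "integrable M (\<lambda>x. u x * (pderivative i \<phi> x * \<eta> x))"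
      using square_integrable_times[OF s(1) square_integrable_smooth_times[OF sm(3) t(1)]] .
    have i3: "integrable M (\<lambda>x. G x $ i * (\<phi> x * \<eta> x))"
      using square_integrable_times[OF square_integrable_component[OF s(2)]
          square_integrable_smooth_times[OF assms(1) t(1)]] .
    have "l2_inner \<Omega> u (pderivative i (\<lambda>x. \<phi> x * \<eta> x)) = - l2_inner \<Omega> (\<lambda>x. G x $ i) (\<lambda>x. \<phi> x * \<eta> x)"
      using assms(2) test_function_mult[OF assms(1) \<eta>] by (simp add: weak_grad_def)
    moreover have "pderivative i (\<lambda>x. \<phi> x * \<eta> x) = (\<lambda>x. \<phi> x * pderivative i \<eta> x
        + pderivative i \<phi> x * \<eta> x)"
      using assms(1) sm by (intro ext pderivative_mult smooth_differentiable)
    ultimately have "(LINT x|M. u x * (\<phi> x * pderivative i \<eta> x))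
        + (LINT x|M. u x * (pderivative i \<phi> x * \<eta> x))
        = - (LINT x|M. G x $ i * (\<phi> x * \<eta> x))"
      using i1 i2 by (simp add: l2_inner_def distrib_left)
    then have "(LINT x|M. u x * (\<phi> x * pderivative i \<eta> x))
        = - ((LINT x|M. G x $ i * (\<phi> x * \<eta> x)) + (LINT x|M. u x * (pderivative i \<phi> x * \<eta> x)))" by simp
    also have "\<dots> = - (LINT x|M. G x $ i * (\<phi> x * \<eta> x) + u x * (pderivative i \<phi> x * \<eta> x))"
      using i2 i3 by simp
    finally show ?thesis
      by (simp add: l2_inner_def classical_grad_component algebra_simps)
  qed
  then show ?thesis
    using square_integrable_smooth_times[OF assms(1) s(1)]
      square_integrable_add[OF square_integrable_smooth_scaleR[OF assms(1) s(2)] s2]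
    by (simp add: weak_grad_def)
qed

text \<open>Multiplication by a test function makes \<phi> compactly supported in \<Omega>, and the
  integral of each partial derivative of that product vanishes.\<close>

lemma weak_grad_smooth:
  assumes "smooth \<phi>" shows "weak_grad \<Omega> \<phi> (classical_grad \<phi>)"
proof -
  have "l2_inner \<Omega> \<phi> (pderivative i \<eta>) = - l2_inner \<Omega> (\<lambda>x. classical_grad \<phi> x $ i) \<eta>"
    if \<eta>: "test_function \<Omega> \<eta>" for \<eta> i
  proof -
    note sm = test_function_smooth[OF \<eta>] smooth_pderivative[OF test_function_smooth[OF \<eta>], of i]
      smooth_pderivative[OF assms(1), of i]
    have "(LINT x|M. pderivative i (\<lambda>x. \<phi> x * \<eta> x) x) = 0"
      by (rule integral_pderivative_test_function[OF open_domain test_function_mult[OF assms \<eta>]])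
    moreover have "pderivative i (\<lambda>x. \<phi> x * \<eta> x) = (\<lambda>x. \<phi> x * pderivative i \<eta> x
        + pderivative i \<phi> x * \<eta> x)"
      using assms(1) sm by (intro ext pderivative_mult smooth_differentiable)
    moreover have "integrable M (\<lambda>x. \<phi> x * pderivative i \<eta> x)"
        "integrable M (\<lambda>x. pderivative i \<phi> x * \<eta> x)"
      using assms sm by (auto intro!: square_integrable_times smooth_square_integrable)
    ultimately have "(LINT x|M. \<phi> x * pderivative i \<eta> x) + (LINT x|M. pderivative i \<phi> x * \<eta> x) = 0"
      by simp
    then show ?thesis by (simp add: l2_inner_def classical_grad_component)
  qed
  then show ?thesis
    using assms by (simp add: weak_grad_def smooth_square_integrable square_integrable_classical_grad)
qed

lemma smooth_h_space: "smooth \<phi> \<Longrightarrow> \<phi> \<in> h_space \<Omega> 1"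
  using weak_grad_smooth h_space_iff_weak_grad by blast

text \<open>The constant is fixed before \<open>u\<close>, so multiplication by a smooth function
  preserves convergence in the H^1 norm.\<close>

lemma h1_norm_smooth_times_le:
  assumes "smooth \<phi>"
  obtains B where "\<And>u. u \<in> h_space \<Omega> 1 \<Longrightarrow>
    (\<lambda>x. \<phi> x * u x) \<in> h_space \<Omega> 1 \<and> h1_norm \<Omega> (\<lambda>x. \<phi> x * u x) \<le> B * h1_norm \<Omega> u"
proof -
  obtain B0 where B0: "AE x in M. \<bar>\<phi> x\<bar> \<le> B0" "B0 \<ge> 0"
    using smooth_AE_bounded[OF assms(1)] by metis
  obtain B1 where B1: "AE x in M. \<bar>pderivative 1 \<phi> x\<bar> \<le> B1" "B1 \<ge> 0"
    using smooth_AE_bounded[OF smooth_pderivative[OF assms(1)]] by metis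
  obtain B2 where B2: "AE x in M. \<bar>pderivative 2 \<phi> x\<bar> \<le> B2" "B2 \<ge> 0"
    using smooth_AE_bounded[OF smooth_pderivative[OF assms(1)]] by metis
  show ?thesis
  \<comment> \<open>One \<open>B0\<close> for the product itself, one for \<phi> times the gradient
    of \<open>u\<close>, and \<open>B1 + B2\<close> for \<open>u\<close> times the gradient of
    \<phi>.\<close>
  proof (rule that[of "2 * B0 + (B1 + B2)"])
    fix u assume u: "u \<in> h_space \<Omega> 1"
    note wg = weak_grad_smooth_times[OF assms weak_grad_grad[OF u]]
    have hs: "(\<lambda>x. \<phi> x * u x) \<in> h_space \<Omega> 1" using wg h_space_iff_weak_grad by blast
    note sq = h_space_square_integrable[OF u]
    note sm = square_integrable_smooth_scaleR[OF assms sq(2)] square_integrable_smooth_times[OF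
        assms sq(1)]
      square_integrable_classical_grad[OF assms]
    have n1: "l2_norm \<Omega> (\<lambda>x. \<phi> x * u x) \<le> B0 * l2_norm \<Omega> u"
      by (rule l2_norm_bound[OF sq(1)])
        (use sm B0 in \<open>auto simp: square_integrable_def abs_mult elim!: eventually_mono intro:
            mult_right_mono\<close>)
    have n2: "l2_norm \<Omega> (\<lambda>x. \<phi> x *\<^sub>R grad \<Omega> u x) \<le> B0 * l2_norm \<Omega> (grad \<Omega> u)"
      by (rule l2_norm_bound[OF sq(2)])
        (use sm B0 in \<open>auto simp: square_integrable_def abs_mult elim!: eventually_mono intro:
            mult_right_mono\<close>)
    have m: "(\<lambda>x. u x *\<^sub>R classical_grad \<phi> x) \<in> borel_measurable M"
      using square_integrableD(1)[OF sq(1)] square_integrableD(1)[OF sm(3)]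
      by (rule borel_measurable_scaleR)
    have ae: "AE x in M. norm (u x *\<^sub>R classical_grad \<phi> x) \<le> (B1 + B2) * norm (u x)"
      using B1(1) B2(1)
    proof eventually_elim
      case (elim x)
      have "norm (classical_grad \<phi> x) \<le> B1 + B2"
        using norm_plane_le[of "classical_grad \<phi> x"] elim by (simp add: classical_grad_component)
      from mult_right_mono[OF this abs_ge_zero[of "u x"]] show ?case
        by (simp only: norm_scaleR real_norm_def mult.commute[of "\<bar>u x\<bar>"])
    qed
    have n3: "l2_norm \<Omega> (\<lambda>x. u x *\<^sub>R classical_grad \<phi> x) \<le> (B1 + B2) * l2_norm \<Omega> u"
      by (rule l2_norm_bound[OF sq(1) m _ ae]) (use B1 B2 in simp)
    have "h1_norm \<Omega> (\<lambda>x. \<phi> x * u x) \<le> l2_norm \<Omega> (\<lambda>x. \<phi> x * u x) + l2_norm \<Omega> (grad \<Omega> (\<lambda>x. \<phi> x * u x))"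
      by (rule h1_norm_le_sum[OF hs])
    also have "\<dots> \<le> B0 * l2_norm \<Omega> u + (B0 * l2_norm \<Omega> (grad \<Omega> u) + (B1 + B2) * l2_norm \<Omega> u)"
      unfolding weak_grad_l2_norm[OF wg]
      using l2_norm_triangle[OF sm(1) square_integrable_bound[OF sq(1) m ae]] n1 n2 n3 by linarith
    also have "\<dots> \<le> B0 * h1_norm \<Omega> u + (B0 * h1_norm \<Omega> u + (B1 + B2) * h1_norm \<Omega> u)"
      using B0 B1 B2 by (intro add_mono mult_left_mono l2_norm_le_h1_norm l2_norm_grad_le_h1_norm u) auto
    finally show "(\<lambda>x. \<phi> x * u x) \<in> h_space \<Omega> 1 \<and> h1_norm \<Omega> (\<lambda>x. \<phi> x * u x) \<le> (2 * B0 + (B1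
        + B2)) * h1_norm \<Omega> u"
      using hs by (simp add: algebra_simps)
  qed
qed

end

subsection \<open>The space of functions vanishing on the Dirichlet boundary\<close>

lemma has_traceD:
  assumes "has_trace \<Omega> u \<gamma>"
  obtains \<phi> :: "nat \<Rightarrow> plane \<Rightarrow> real" where "u \<in> h_space \<Omega> 1" "\<gamma> \<in> borel_measurable borel"
    "\<And>n. smooth (\<phi> n)" "(\<lambda>n. h1_norm \<Omega> (\<lambda>x. \<phi> n x - u x)) \<longlonglongrightarrow> 0"
    "(\<lambda>n. \<integral>\<^sup>+x. ennreal ((\<phi> n x - \<gamma> x)\<^sup>2) * indicator (frontier \<Omega>) x \<partial>arc_measure) \<longlonglongrightarrow> 0"
  using assms unfolding has_trace_def by blast

lemma ennreal_tendsto_0_bound: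
  fixes f g :: "nat \<Rightarrow> ennreal"
  assumes "g \<longlonglongrightarrow> 0" "\<And>n. f n \<le> g n" shows "f \<longlonglongrightarrow> 0"
  by (rule tendsto_sandwich[of "\<lambda>_. 0" f _ g]) (use assms in auto)

lemma measurable_arc_measure [simp]: "measurable arc_measure N = measurable borel N"
  by (rule measurable_cong_sets) simp_all

context bounded_domain
begin

text \<open>The approximating sequences are combined termwise. Boundary errors are extended
  nonnegative integrals of squares, hence the factors 2 a^2 and 2 b^2, and no integrability on the
  boundary has to be discussed.\<close>

lemma has_trace_linear_combination:
  assumes "has_trace \<Omega> u \<gamma>" "has_trace \<Omega> v \<delta>"
  shows "has_trace \<Omega> (\<lambda>x. a * u x + b * v x) (\<lambda>x. a * \<gamma> x + b * \<delta> x)"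
proof -
  obtain \<phi> where \<phi>: "u \<in> h_space \<Omega> 1" "\<gamma> \<in> borel_measurable borel" "\<And>n. smooth (\<phi> n)"
    "(\<lambda>n. h1_norm \<Omega> (\<lambda>x. \<phi> n x - u x)) \<longlonglongrightarrow> 0"
    "(\<lambda>n. \<integral>\<^sup>+x. ennreal ((\<phi> n x - \<gamma> x)\<^sup>2) * indicator (frontier \<Omega>) x \<partial>arc_measure) \<longlonglongrightarrow> 0"
    using assms(1) by (rule has_traceD) blast
  obtain \<psi> where \<psi>: "v \<in> h_space \<Omega> 1" "\<delta> \<in> borel_measurable borel" "\<And>n. smooth (\<psi> n)"
    "(\<lambda>n. h1_norm \<Omega> (\<lambda>x. \<psi> n x - v x)) \<longlonglongrightarrow> 0"
    "(\<lambda>n. \<integral>\<^sup>+x. ennreal ((\<psi> n x - \<delta> x)\<^sup>2) * indicator (frontier \<Omega>) x \<partial>arc_measure) \<longlonglongrightarrow> 0"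
    using assms(2) by (rule has_traceD) blast
  let ?\<Phi> = "\<lambda>n x. a * \<phi> n x + b * \<psi> n x" and ?u = "\<lambda>x. a * u x + b * v x"
  have hd: "(\<lambda>x. \<phi> n x - u x) \<in> h_space \<Omega> 1" "(\<lambda>x. \<psi> n x - v x) \<in> h_space \<Omega> 1" for n
    using h_space_diff(1)[OF smooth_h_space[OF \<phi>(3)] \<phi>(1)] h_space_diff(1)[OF smooth_h_space[OF
        \<psi>(3)] \<psi>(1)]
    by auto
  have eq: "(\<lambda>x. ?\<Phi> n x - ?u x) = (\<lambda>x. a * (\<phi> n x - u x) + b * (\<psi> n x - v x))" for n
    by (simp add: algebra_simps)
  have "(\<lambda>n. h1_norm \<Omega> (\<lambda>x. ?\<Phi> n x - ?u x)) \<longlonglongrightarrow> 0"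
  proof (rule tendsto_sandwich[of "\<lambda>_. 0"])
    show "(\<lambda>n. \<bar>a\<bar> * h1_norm \<Omega> (\<lambda>x. \<phi> n x - u x) + \<bar>b\<bar> * h1_norm \<Omega> (\<lambda>x. \<psi> n x - v x)) \<longlonglongrightarrow> 0"
      using \<phi>(4) \<psi>(4) by (auto intro!: tendsto_eq_intros)
    show "\<forall>\<^sub>F n in sequentially. 0 \<le> h1_norm \<Omega> (\<lambda>x. ?\<Phi> n x - ?u x)"
      unfolding eq using hd by (intro always_eventually allI sobolev_norm_nonneg
          h_space_linear_combination(1))
    show "\<forall>\<^sub>F n in sequentially. h1_norm \<Omega> (\<lambda>x. ?\<Phi> n x - ?u x)
        \<le> \<bar>a\<bar> * h1_norm \<Omega> (\<lambda>x. \<phi> n x - u x) + \<bar>b\<bar> * h1_norm \<Omega> (\<lambda>x. \<psi> n x - v x)"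
      unfolding eq using hd by (intro always_eventually allI h_space_linear_combination(3))
  qed simp
  moreover have "(\<lambda>n. \<integral>\<^sup>+x. ennreal ((?\<Phi> n x - (a * \<gamma> x
      + b * \<delta> x))\<^sup>2) * indicator (frontier \<Omega>) x \<partial>arc_measure) \<longlonglongrightarrow> 0"
  proof (rule ennreal_tendsto_0_bound)
    let ?I = "\<lambda>n. \<integral>\<^sup>+x. ennreal ((\<phi> n x - \<gamma> x)\<^sup>2) * indicator (frontier \<Omega>) x \<partial>arc_measure"
    let ?J = "\<lambda>n. \<integral>\<^sup>+x. ennreal ((\<psi> n x - \<delta> x)\<^sup>2) * indicator (frontier \<Omega>) x \<partial>arc_measure"
    have "(\<lambda>n. ennreal (2 * a\<^sup>2) * ?I n + ennreal (2 * b\<^sup>2) * ?J n) \<longlonglongrightarrow> ennreal (2 * a\<^sup>2) * 0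
        + ennreal (2 * b\<^sup>2) * 0"
      by (intro tendsto_add ennreal_tendsto_cmult \<phi>(5) \<psi>(5)) auto
    then show "(\<lambda>n. ennreal (2 * a\<^sup>2) * ?I n + ennreal (2 * b\<^sup>2) * ?J n) \<longlonglongrightarrow> 0" by simp
    fix n
    have m[measurable]: "\<phi> n \<in> borel_measurable borel" "\<psi> n \<in> borel_measurable borel"
      using \<phi>(3) \<psi>(3) by (auto intro!: borel_measurable_continuous_onI smooth_continuous)
    note [measurable] = \<phi>(2) \<psi>(2)
    have fr[measurable]: "frontier \<Omega> \<in> sets borel" by (simp add: frontier_closed)
    have "(\<integral>\<^sup>+x. ennreal ((?\<Phi> n x - (a * \<gamma> x + b * \<delta> x))\<^sup>2) * indicator (frontier \<Omega>) x \<partial>arc_measure)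
      \<le> (\<integral>\<^sup>+x. ennreal (2 * a\<^sup>2) * (ennreal ((\<phi> n x - \<gamma> x)\<^sup>2) * indicator (frontier \<Omega>) x)
          + ennreal (2 * b\<^sup>2) * (ennreal ((\<psi> n x - \<delta> x)\<^sup>2) * indicator (frontier \<Omega>) x) \<partial>arc_measure)"
    proof (rule nn_integral_mono)
      fix x
      have "(?\<Phi> n x - (a * \<gamma> x + b * \<delta> x))\<^sup>2 = (a * (\<phi> n x - \<gamma> x) + b * (\<psi> n x - \<delta> x))\<^sup>2"
        by (simp add: algebra_simps)
      also have "\<dots> \<le> 2 * a\<^sup>2 * (\<phi> n x - \<gamma> x)\<^sup>2 + 2 * b\<^sup>2 * (\<psi> n x - \<delta> x)\<^sup>2"
        using sum_squares_bound[of "a * (\<phi> n x - \<gamma> x)" "b * (\<psi> n x - \<delta> x)"]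
        by (simp add: power2_sum power_mult_distrib)
      finally have "ennreal ((?\<Phi> n x - (a * \<gamma> x + b * \<delta> x))\<^sup>2)
          \<le> ennreal (2 * a\<^sup>2) * ennreal ((\<phi> n x - \<gamma> x)\<^sup>2) + ennreal (2 * b\<^sup>2) * ennreal ((\<psi> n x - \<delta>
              x)\<^sup>2)"
        by (simp flip: ennreal_mult ennreal_plus add: ennreal_leI)
      then show "ennreal ((?\<Phi> n x - (a * \<gamma> x + b * \<delta> x))\<^sup>2) * indicator (frontier \<Omega>) x
          \<le> ennreal (2 * a\<^sup>2) * (ennreal ((\<phi> n x - \<gamma> x)\<^sup>2) * indicator (frontier \<Omega>) x)
          + ennreal (2 * b\<^sup>2) * (ennreal ((\<psi> n x - \<delta> x)\<^sup>2) * indicator (frontier \<Omega>) x)"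
        by (simp add: indicator_def)
    qed
    also have "\<dots> = ennreal (2 * a\<^sup>2) * ?I n + ennreal (2 * b\<^sup>2) * ?J n"
      by (simp add: nn_integral_add nn_integral_cmult)
    finally show "(\<integral>\<^sup>+x. ennreal ((?\<Phi> n x - (a * \<gamma> x
        + b * \<delta> x))\<^sup>2) * indicator (frontier \<Omega>) x \<partial>arc_measure)
        \<le> ennreal (2 * a\<^sup>2) * ?I n + ennreal (2 * b\<^sup>2) * ?J n" .
  qed
  moreover have "smooth (?\<Phi> n)" for n using \<phi>(3) \<psi>(3) by (intro smooth_linear_combination)
  moreover have "(\<lambda>x. a * \<gamma> x + b * \<delta> x) \<in> borel_measurable borel" using \<phi>(2) \<psi>(2) by simp
  ultimately show ?thesis
    unfolding has_trace_def using h_space_linear_combination(1)[OF \<phi>(1) \<psi>(1), of a b]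
    by (intro conjI exI[of _ ?\<Phi>]) auto
qed

text \<open>Makes \<open>h1d\<close> stable under multiplication by smooth functions, the source of
  the admissible test functions that replace the square of \<open>e\<close>.\<close>

lemma has_trace_smooth_times:
  assumes "smooth \<eta>" "has_trace \<Omega> u \<gamma>"
  shows "has_trace \<Omega> (\<lambda>x. \<eta> x * u x) (\<lambda>x. \<eta> x * \<gamma> x)"
proof -
  obtain \<phi> where \<phi>: "u \<in> h_space \<Omega> 1" "\<gamma> \<in> borel_measurable borel" "\<And>n. smooth (\<phi> n)"
    "(\<lambda>n. h1_norm \<Omega> (\<lambda>x. \<phi> n x - u x)) \<longlonglongrightarrow> 0"
    "(\<lambda>n. \<integral>\<^sup>+x. ennreal ((\<phi> n x - \<gamma> x)\<^sup>2) * indicator (frontier \<Omega>) x \<partial>arc_measure) \<longlonglongrightarrow> 0"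
    using assms(2) by (rule has_traceD) blast
  obtain B where B: "\<And>u. u \<in> h_space \<Omega> 1 \<Longrightarrow>
    (\<lambda>x. \<eta> x * u x) \<in> h_space \<Omega> 1 \<and> h1_norm \<Omega> (\<lambda>x. \<eta> x * u x) \<le> B * h1_norm \<Omega> u"
    using h1_norm_smooth_times_le[OF assms(1)] by blast
  obtain K where K: "K \<ge> 0" "\<And>x. x \<in> closure \<Omega> \<Longrightarrow> \<bar>\<eta> x\<bar> \<le> K"
    using smooth_AE_bounded[OF assms(1)] by metis
  have hd: "(\<lambda>x. \<phi> n x - u x) \<in> h_space \<Omega> 1" for n
    by (rule h_space_diff(1)[OF smooth_h_space[OF \<phi>(3)] \<phi>(1)])
  have eq: "(\<lambda>x. \<eta> x * \<phi> n x - \<eta> x * u x) = (\<lambda>x. \<eta> x * (\<phi> n x - u x))" for n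
    by (simp add: algebra_simps)
  have "(\<lambda>n. h1_norm \<Omega> (\<lambda>x. \<eta> x * \<phi> n x - \<eta> x * u x)) \<longlonglongrightarrow> 0"
  proof (rule tendsto_sandwich[of "\<lambda>_. 0"])
    show "(\<lambda>n. B * h1_norm \<Omega> (\<lambda>x. \<phi> n x - u x)) \<longlonglongrightarrow> 0"
      using \<phi>(4) by (auto intro!: tendsto_eq_intros)
    show "\<forall>\<^sub>F n in sequentially. 0 \<le> h1_norm \<Omega> (\<lambda>x. \<eta> x * \<phi> n x - \<eta> x * u x)"
      unfolding eq using B[OF hd] by (intro always_eventually allI sobolev_norm_nonneg)
    show "\<forall>\<^sub>F n in sequentially. h1_norm \<Omega> (\<lambda>x. \<eta> x * \<phi> n x - \<eta> x * u x) \<le> B * h1_norm \<Omega> (\<lambda>x. \<phi> n x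
        - u x)"
      unfolding eq using B[OF hd] by (intro always_eventually allI) auto
  qed simp
  moreover have "(\<lambda>n. \<integral>\<^sup>+x. ennreal ((\<eta> x * \<phi> n x - \<eta> x * \<gamma> x)\<^sup>2) * indicator (frontier \<Omega>) x
      \<partial>arc_measure) \<longlonglongrightarrow> 0"
  proof (rule ennreal_tendsto_0_bound)
    let ?I = "\<lambda>n. \<integral>\<^sup>+x. ennreal ((\<phi> n x - \<gamma> x)\<^sup>2) * indicator (frontier \<Omega>) x \<partial>arc_measure"
    have "(\<lambda>n. ennreal (K\<^sup>2) * ?I n) \<longlonglongrightarrow> ennreal (K\<^sup>2) * 0"
      by (intro ennreal_tendsto_cmult \<phi>(5)) auto
    then show "(\<lambda>n. ennreal (K\<^sup>2) * ?I n) \<longlonglongrightarrow> 0" by simp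
    fix n
    have m[measurable]: "\<phi> n \<in> borel_measurable borel"
      using \<phi>(3) by (auto intro!: borel_measurable_continuous_onI smooth_continuous)
    note [measurable] = \<phi>(2)
    have fr[measurable]: "frontier \<Omega> \<in> sets borel" by (simp add: frontier_closed)
    have "(\<integral>\<^sup>+x. ennreal ((\<eta> x * \<phi> n x - \<eta> x * \<gamma> x)\<^sup>2) * indicator (frontier \<Omega>) x \<partial>arc_measure)
      \<le> (\<integral>\<^sup>+x. ennreal (K\<^sup>2) * (ennreal ((\<phi> n x - \<gamma> x)\<^sup>2) * indicator (frontier \<Omega>) x) \<partial>arc_measure)"
    proof (rule nn_integral_mono)
      fix x
      show "ennreal ((\<eta> x * \<phi> n x - \<eta> x * \<gamma> x)\<^sup>2) * indicator (frontier \<Omega>) x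
          \<le> ennreal (K\<^sup>2) * (ennreal ((\<phi> n x - \<gamma> x)\<^sup>2) * indicator (frontier \<Omega>) x)"
      proof (cases "x \<in> frontier \<Omega>")
        case True
        \<comment> \<open>Here the bound on the closure is essential: the point lies on the boundary
          of the open set \<Omega>, outside it.\<close>
        then have "\<bar>\<eta> x\<bar> \<le> K" using K(2) by (simp add: frontier_def)
        then have "(\<eta> x)\<^sup>2 \<le> K\<^sup>2" by (metis abs_ge_zero power2_abs power_mono)
        then have "(\<eta> x)\<^sup>2 * (\<phi> n x - \<gamma> x)\<^sup>2 \<le> K\<^sup>2 * (\<phi> n x - \<gamma> x)\<^sup>2" by (rule mult_right_mono) simp
        moreover have "(\<eta> x * \<phi> n x - \<eta> x * \<gamma> x)\<^sup>2 = (\<eta> x)\<^sup>2 * (\<phi> n x - \<gamma> x)\<^sup>2"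
          by (simp flip: right_diff_distrib add: power_mult_distrib)
        ultimately show ?thesis using True by (simp flip: ennreal_mult add: ennreal_leI)
      qed simp
    qed
    also have "\<dots> = ennreal (K\<^sup>2) * ?I n" by (simp add: nn_integral_cmult)
    finally show "(\<integral>\<^sup>+x. ennreal ((\<eta> x * \<phi> n x - \<eta> x * \<gamma> x)\<^sup>2) * indicator (frontier \<Omega>) x \<partial>arc_measure)
        \<le> ennreal (K\<^sup>2) * ?I n" .
  qed
  moreover have "smooth (\<lambda>x. \<eta> x * \<phi> n x)" for n using \<phi>(3) assms(1) by (intro smooth_mult)
  moreover have "(\<lambda>x. \<eta> x * \<gamma> x) \<in> borel_measurable borel"
    using \<phi>(2) borel_measurable_continuous_onI[OF smooth_continuous[OF assms(1)]] by simp
  ultimately show ?thesis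
    unfolding has_trace_def using B[OF \<phi>(1)] by (intro conjI exI[of _ "\<lambda>n x. \<eta> x * \<phi> n x"]) auto
qed

lemma h1d_h_space: "u \<in> h1d \<Omega> \<Gamma> \<Longrightarrow> u \<in> h_space \<Omega> 1"
  by (simp add: h1d_def)

lemma h1d_linear_combination:
  assumes "u \<in> h1d \<Omega> \<Gamma>" "v \<in> h1d \<Omega> \<Gamma>"
  shows "(\<lambda>x. a * u x + b * v x) \<in> h1d \<Omega> \<Gamma>"
proof -
  obtain \<gamma> \<delta> where t: "has_trace \<Omega> u \<gamma>" "has_trace \<Omega> v \<delta>"
    and z: "AE x in arc_measure. x \<in> \<Gamma> \<longrightarrow> \<gamma> x = 0" "AE x in arc_measure. x \<in> \<Gamma> \<longrightarrow> \<delta> x = 0"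
    using assms by (auto simp: h1d_def)
  have "AE x in arc_measure. x \<in> \<Gamma> \<longrightarrow> a * \<gamma> x + b * \<delta> x = 0"
    using z by eventually_elim simp
  then show ?thesis
    using has_trace_linear_combination[OF t, of a b] h_space_linear_combination(1)[of u v a b] assms
    by (auto simp: h1d_def)
qed

lemma h1d_diff: "u \<in> h1d \<Omega> \<Gamma> \<Longrightarrow> v \<in> h1d \<Omega> \<Gamma> \<Longrightarrow> (\<lambda>x. u x - v x) \<in> h1d \<Omega> \<Gamma>"
  using h1d_linear_combination[of u \<Gamma> v 1 "-1"] by simp

lemma h1d_smooth_times:
  assumes "smooth \<eta>" "u \<in> h1d \<Omega> \<Gamma>" shows "(\<lambda>x. \<eta> x * u x) \<in> h1d \<Omega> \<Gamma>"
proof -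
  obtain \<gamma> where t: "has_trace \<Omega> u \<gamma>" and z: "AE x in arc_measure. x \<in> \<Gamma> \<longrightarrow> \<gamma> x = 0"
    using assms by (auto simp: h1d_def)
  have "AE x in arc_measure. x \<in> \<Gamma> \<longrightarrow> \<eta> x * \<gamma> x = 0"
    using z by eventually_elim simp
  moreover note has_trace_smooth_times[OF assms(1) t]
  moreover from this have "(\<lambda>x. \<eta> x * u x) \<in> h_space \<Omega> 1" by (simp add: has_trace_def)
  ultimately show ?thesis by (auto simp: h1d_def)
qed

text \<open>The interior half of the trace condition. Every member of \<open>h1d\<close> has such a
  sequence by the very definition of its trace, and the approximants are smooth on the whole
  plane.\<close>

definition smooth_approximation :: "(plane \<Rightarrow> real) \<Rightarrow> (nat \<Rightarrow> plane \<Rightarrow> real) \<Rightarrow> bool" where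
  "smooth_approximation u \<phi> \<longleftrightarrow> u \<in> h_space \<Omega> 1 \<and> (\<forall>n. smooth (\<phi> n)) \<and>
     (\<lambda>n. h1_norm \<Omega> (\<lambda>x. \<phi> n x - u x)) \<longlonglongrightarrow> 0"

lemma h1d_smooth_approximation:
  assumes "u \<in> h1d \<Omega> \<Gamma>" obtains \<phi> where "smooth_approximation u \<phi>"
proof -
  obtain \<gamma> where t: "has_trace \<Omega> u \<gamma>" using assms by (auto simp: h1d_def)
  then show ?thesis using that unfolding has_trace_def smooth_approximation_def by blast
qed

end

subsection \<open>The embedding into fourth powers on Lipschitz domains\<close>

lemma emeasure_lborel_linear_image_box:
  fixes S :: "plane \<Rightarrow> plane"
  assumes "linear S" "S ` box l u \<in> sets borel"
  shows "emeasure lborel (S ` box l u) = ennreal (\<bar>det (matrix S)\<bar> * measure lborel (box l u))"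
proof -
  have l: "box l u \<in> lmeasurable" by simp
  have m: "S ` box l u \<in> lmeasurable" using measurable_linear_image[OF assms(1) l] .
  have e: "measure lebesgue (S ` box l u) = \<bar>det (matrix S)\<bar> * measure lebesgue (box l u)"
    using measure_linear_image[OF assms(1) l] .
  have "emeasure lebesgue (S ` box l u) = ennreal (measure lebesgue (S ` box l u))"
    using m by (simp add: emeasure_eq_measure2 fmeasurableD2)
  moreover have "emeasure lebesgue (S ` box l u) = emeasure lborel (S ` box l u)"
    using assms(2) by simp
  ultimately show ?thesis using e by simp
qed

text \<open>Lebesgue measure is identified by its values on boxes; the preimage of a box under
  \<open>T\<close> is its image under the inverse, whose area is given by a determinant.\<close>

lemma nn_integral_lborel_linear:
  fixes T :: "plane \<Rightarrow> plane"
  assumes "linear T" "inj T"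
  obtains c :: real where "c > 0"
    "\<And>k. k \<in> borel_measurable borel \<Longrightarrow> (\<integral>\<^sup>+y. k y \<partial>lborel) = ennreal c * (\<integral>\<^sup>+x. k (T x) \<partial>lborel)"
proof -
  obtain S where S: "linear S" "\<And>x. S (T x) = x" "\<And>x. T (S x) = x"
    using linear_injective_isomorphism[OF assms] by auto
  have iS: "inj S" using S(3) by (metis injI)
  \<comment> \<open>The Jacobian of the inverse map, so that the constant 1/\<delta> obtained below
    is the Jacobian of \<open>T\<close>.\<close>
  define \<delta> where "\<delta> = \<bar>det (matrix S)\<bar>"
  have \<delta>: "\<delta> > 0" using det_nz_iff_inj[OF S(1)] iS by (simp add: \<delta>_def)
  have Tm[measurable]: "T \<in> borel_measurable borel"
    using assms(1) by (intro borel_measurable_continuous_onI linear_continuous_on) (simp add: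
        linear_conv_bounded_linear)
  have "lborel = density (distr lborel borel T) (\<lambda>_. ennreal (1 / \<delta>))"
  proof (rule lborel_eqI)
    fix l u :: "plane" assume lu: "\<And>b. b \<in> Basis \<Longrightarrow> l \<bullet> b \<le> u \<bullet> b"
    have vim: "T -` box l u = S ` box l u"
    proof (intro set_eqI iffI)
      fix x assume "x \<in> T -` box l u"
      then show "x \<in> S ` box l u" using S(2)[of x] by (metis image_eqI vimageD)
    next
      fix x assume "x \<in> S ` box l u"
      then show "x \<in> T -` box l u" using S(3) by auto
    qed
    have "emeasure (density (distr lborel borel T) (\<lambda>_. ennreal (1 / \<delta>))) (box l u)
        = ennreal (1 / \<delta>) * emeasure lborel (T -` box l u)"
      by (simp add: emeasure_density_const emeasure_distr)
    also have "\<dots> = ennreal (1 / \<delta>) * ennreal (\<delta> * measure lborel (box l u))"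
      using emeasure_lborel_linear_image_box[OF S(1), of l u] measurable_sets[OF Tm, of "box l u"]
      by (simp add: vim \<delta>_def)
    also have "\<dots> = ennreal (measure lborel (box l u))"
      using \<delta> by (simp flip: ennreal_mult)
    also have "\<dots> = ennreal (\<Prod>b\<in>Basis. (u - l) \<bullet> b)"
      using lu by (simp add: measure_lborel_box_eq)
    finally show "emeasure (density (distr lborel borel T) (\<lambda>_. ennreal (1 / \<delta>))) (box l u)
        = ennreal (\<Prod>b\<in>Basis. (u - l) \<bullet> b)" .
  qed simp
  then have main: "(\<integral>\<^sup>+y. k y \<partial>lborel) = ennreal (1 / \<delta>) * (\<integral>\<^sup>+x. k (T x) \<partial>lborel)"
    if [measurable]: "k \<in> borel_measurable borel" for k
  proof -
    assume L: "lborel = density (distr lborel borel T) (\<lambda>_. ennreal (1 / \<delta>))"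
    have "(\<integral>\<^sup>+y. k y \<partial>lborel) = (\<integral>\<^sup>+y. k y \<partial>density (distr lborel borel T) (\<lambda>_. ennreal (1 / \<delta>)))"
      by (subst L) (rule refl)
    also have "\<dots> = ennreal (1 / \<delta>) * (\<integral>\<^sup>+x. k (T x) \<partial>lborel)"
      by (simp add: nn_integral_density nn_integral_distr nn_integral_cmult)
    finally show ?thesis .
  qed
  show ?thesis by (rule that[of "1 / \<delta>"]) (use \<delta> in simp, rule main)
qed

lemma borel_measurable_vector_pair: "(\<lambda>(a, b). vector [a, b] :: plane) \<in> borel_measurable borel"
proof -
  have "continuous_on UNIV (\<lambda>z::real \<times> real. fst z *\<^sub>R axis 1 1 + snd z *\<^sub>R (axis 2 1 :: plane))"
    by (intro continuous_intros)
  then show ?thesis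
    by (simp add: vector_plane_decompose split_def borel_measurable_continuous_onI)
qed

text \<open>Identifies the vector type with a product of two lines, as iterated integration
  requires; both measures agree on boxes.\<close>

lemma lborel_plane: "(lborel :: plane measure) = distr (lborel \<Otimes>\<^sub>M lborel) borel (\<lambda>(a, b). vector
    [a, b])"
proof (rule lborel_eqI)
  fix l u :: plane assume lu: "\<And>b. b \<in> Basis \<Longrightarrow> l \<bullet> b \<le> u \<bullet> b"
  have le: "l $ i \<le> u $ i" for i
    using lu[of "axis i 1"] by (simp add: inner_axis)
  have B: "(Basis :: plane set) = {axis 1 1, axis 2 1}"
    by (auto simp: Basis_vec_def UNIV_2)
  have ne: "axis 1 1 \<noteq> (axis 2 1 :: plane)" by (simp add: axis_eq_axis)
  have vim: "(\<lambda>(a, b). vector [a, b] :: plane) -` box l u = box (l $ 1) (u $ 1) \<times> box (l $ 2) (u $ 2)"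
    by (auto simp: mem_box_plane)
  have "emeasure (distr (lborel \<Otimes>\<^sub>M lborel) borel (\<lambda>(a, b). vector [a, b])) (box l u)
      = emeasure (lborel \<Otimes>\<^sub>M lborel) (box (l $ 1) (u $ 1) \<times> box (l $ 2) (u $ 2))"
    using borel_measurable_vector_pair
    by (subst emeasure_distr) (auto simp: vim lborel_prod space_pair_measure)
  also have "\<dots> = emeasure lborel (box (l $ 1) (u $ 1)) * emeasure lborel (box (l $ 2) (u $ 2))"
    by (rule lborel.emeasure_pair_measure_Times) auto
  also have "\<dots> = ennreal ((u $ 1 - l $ 1) * (u $ 2 - l $ 2))"
    using le by (simp add: ennreal_mult)
  also have "\<dots> = ennreal (\<Prod>b\<in>Basis. (u - l) \<bullet> b)"
    using ne by (simp add: B inner_axis)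
  finally show "emeasure (distr (lborel \<Otimes>\<^sub>M lborel) borel (\<lambda>(a, b). vector [a, b])) (box l u)
      = ennreal (\<Prod>b\<in>Basis. (u - l) \<bullet> b)" .
qed simp

lemma nn_integral_plane:
  assumes [measurable]: "k \<in> borel_measurable (borel :: plane measure)"
  shows "(\<integral>\<^sup>+x. k x \<partial>lborel) = (\<integral>\<^sup>+b. \<integral>\<^sup>+a. k (vector [a, b]) \<partial>lborel \<partial>lborel)"
proof -
  have vm[measurable]: "(\<lambda>(a, b). vector [a, b] :: plane) \<in> borel_measurable (lborel \<Otimes>\<^sub>M lborel)"
    using borel_measurable_vector_pair by (simp add: lborel_prod)
  have "(\<integral>\<^sup>+x. k x \<partial>lborel) = (\<integral>\<^sup>+z. k (case z of (a, b) \<Rightarrow> vector [a, b]) \<partial>(lborel \<Otimes>\<^sub>M lborel))"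
    by (subst lborel_plane) (simp add: nn_integral_distr)
  also have "\<dots> = (\<integral>\<^sup>+b. \<integral>\<^sup>+a. k (vector [a, b]) \<partial>lborel \<partial>lborel)"
    by (subst lborel_pair.nn_integral_snd[symmetric]) (auto simp: split_def)
  finally show ?thesis .
qed

lemma nn_integral_plane_swap:
  assumes [measurable]: "k \<in> borel_measurable (borel :: plane measure)"
  shows "(\<integral>\<^sup>+b. \<integral>\<^sup>+a. k (vector [a, b]) \<partial>lborel \<partial>lborel)
      = (\<integral>\<^sup>+a. \<integral>\<^sup>+b. k (vector [a, b]) \<partial>lborel \<partial>lborel)"
proof -
  have vm: "(\<lambda>(a, b). vector [a, b] :: plane) \<in> borel_measurable (lborel \<Otimes>\<^sub>M lborel)"
    using borel_measurable_vector_pair by (simp add: lborel_prod)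
  have "(\<lambda>(a, b). k (vector [a, b])) \<in> borel_measurable (lborel \<Otimes>\<^sub>M lborel)"
    using measurable_compose[OF vm assms] by (simp add: split_def)
  then show ?thesis by (rule lborel_pair.Fubini')
qed

text \<open>The Gagliardo argument: in the coordinates along \<open>d\<^sub>1\<close> and \<open>d\<^sub>2\<close>, the integral of \<open>k\<close> along a
  line in direction \<open>d\<^sub>i\<close> does not depend on the \<open>i\<close>-th coordinate.\<close>

lemma line_integrals_product:
  fixes d1 d2 :: plane
  assumes ind: "inj (\<lambda>x::plane. x $ 1 *\<^sub>R d1 + x $ 2 *\<^sub>R d2)"
  obtains c :: real where "c > 0"
    "\<And>k. k \<in> borel_measurable borel \<Longrightarrow>
      (\<integral>\<^sup>+y. (\<integral>\<^sup>+t. k (y + t *\<^sub>R d1) \<partial>lborel) * (\<integral>\<^sup>+t. k (y + t *\<^sub>R d2) \<partial>lborel) \<partial>lborel)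
        \<le> ennreal c * (\<integral>\<^sup>+y. k y \<partial>lborel) * (\<integral>\<^sup>+y. k y \<partial>lborel)"
proof -
  let ?T = "\<lambda>x::plane. x $ 1 *\<^sub>R d1 + x $ 2 *\<^sub>R d2"
  have lin: "linear ?T" by (intro linearI) (auto simp: algebra_simps)
  obtain c where c: "c > 0"
    "\<And>k. k \<in> borel_measurable borel \<Longrightarrow> (\<integral>\<^sup>+y. k y \<partial>lborel) = ennreal c * (\<integral>\<^sup>+x. k (?T x) \<partial>lborel)"
    by (rule nn_integral_lborel_linear[OF lin ind]) blast
  have Tm[measurable]: "?T \<in> borel_measurable borel"
    using lin by (intro borel_measurable_continuous_onI linear_continuous_on) (simp add:
        linear_conv_bounded_linear)
  show ?thesis
  \<comment> \<open>The change of variables on the left contributes one factor c, and each of the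
    two integrals of \<open>k\<close> on the right contains another; this leaves 1/c.\<close>
  proof (rule that[of "1 / c"])
    fix k :: "plane \<Rightarrow> ennreal" assume k[measurable]: "k \<in> borel_measurable borel"
    have ic: "ennreal (1 / c) * ennreal c = 1" using c(1) by (simp flip: ennreal_mult)
    have Tv: "?T (vector [a, b]) = a *\<^sub>R d1 + b *\<^sub>R d2" for a b by simp
    have Tvm[measurable]: "(\<lambda>(a, b). a *\<^sub>R d1 + b *\<^sub>R d2) \<in> borel_measurable (lborel \<Otimes>\<^sub>M lborel)"
      by simp
    define H1 where "H1 b = (\<integral>\<^sup>+a. k (a *\<^sub>R d1 + b *\<^sub>R d2) \<partial>lborel)" for b
    define H2 where "H2 a = (\<integral>\<^sup>+b. k (a *\<^sub>R d1 + b *\<^sub>R d2) \<partial>lborel)" for a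
    have km: "(\<lambda>(a, b). k (a *\<^sub>R d1 + b *\<^sub>R d2)) \<in> borel_measurable (lborel \<Otimes>\<^sub>M lborel)"
      using measurable_compose[OF Tvm k] by (simp add: split_def)
    have H2m[measurable]: "H2 \<in> borel_measurable lborel"
      unfolding H2_def[abs_def] using lborel.borel_measurable_nn_integral[OF km] .
    have km': "(\<lambda>(b, a). k (a *\<^sub>R d1 + b *\<^sub>R d2)) \<in> borel_measurable (lborel \<Otimes>\<^sub>M lborel)"
      by simp
    have H1m[measurable]: "H1 \<in> borel_measurable lborel"
      unfolding H1_def[abs_def] using lborel.borel_measurable_nn_integral[OF km'] .
    have kT: "(\<lambda>x. k (?T x)) \<in> borel_measurable borel" by simp
    have K: "(\<integral>\<^sup>+y. k y \<partial>lborel) = ennreal c * (\<integral>\<^sup>+b. H1 b \<partial>lborel)"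
      unfolding c(2)[OF k] nn_integral_plane[OF kT] Tv H1_def ..
    have K2: "(\<integral>\<^sup>+b. H1 b \<partial>lborel) = (\<integral>\<^sup>+a. H2 a \<partial>lborel)"
      using nn_integral_plane_swap[OF kT] unfolding Tv H1_def H2_def .
    have L1: "(\<integral>\<^sup>+t. k (?T (vector [a, b]) + t *\<^sub>R d1) \<partial>lborel) = H1 b" for a b
    proof -
      have "H1 b = ennreal \<bar>1\<bar> * (\<integral>\<^sup>+t. k ((a + 1 * t) *\<^sub>R d1 + b *\<^sub>R d2) \<partial>lborel)"
        unfolding H1_def by (rule nn_integral_real_affine[of "\<lambda>a. k (a *\<^sub>R d1 + b *\<^sub>R d2)" 1 a]) auto
      then show ?thesis by (simp add: algebra_simps)
    qed
    have L2: "(\<integral>\<^sup>+t. k (?T (vector [a, b]) + t *\<^sub>R d2) \<partial>lborel) = H2 a" for a b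
    proof -
      have "H2 a = ennreal \<bar>1\<bar> * (\<integral>\<^sup>+t. k (a *\<^sub>R d1 + (b + 1 * t) *\<^sub>R d2) \<partial>lborel)"
        unfolding H2_def by (rule nn_integral_real_affine[of "\<lambda>b. k (a *\<^sub>R d1 + b *\<^sub>R d2)" 1 b]) auto
      then show ?thesis by (simp add: algebra_simps)
    qed
    define F where "F d y = (\<integral>\<^sup>+t. k (y + t *\<^sub>R d) \<partial>lborel)" for d y :: plane
    have Fm[measurable]: "F d \<in> borel_measurable borel" for d
    proof -
      have "(\<lambda>(y, t). k (y + t *\<^sub>R d)) \<in> borel_measurable (borel \<Otimes>\<^sub>M lborel)" by simp
      from lborel.borel_measurable_nn_integral[OF this] show ?thesis unfolding F_def[abs_def] .
    qed
    have FF: "(\<lambda>y. F d1 y * F d2 y) \<in> borel_measurable borel" by simp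
    have FT: "(\<lambda>x. F d1 (?T x) * F d2 (?T x)) \<in> borel_measurable borel" by simp
    have "(\<integral>\<^sup>+y. F d1 y * F d2 y \<partial>lborel) = ennreal c * (\<integral>\<^sup>+b. \<integral>\<^sup>+a. H1 b * H2 a \<partial>lborel \<partial>lborel)"
      unfolding c(2)[OF FF] nn_integral_plane[OF FT] unfolding F_def L1 L2 ..
    also have "\<dots> = ennreal c * ((\<integral>\<^sup>+b. H1 b \<partial>lborel) * (\<integral>\<^sup>+a. H2 a \<partial>lborel))"
      by (simp add: nn_integral_cmult nn_integral_multc)
    also have "\<dots> = ennreal (1 / c) * ennreal c * ennreal c * ((\<integral>\<^sup>+b. H1 b \<partial>lborel) * (\<integral>\<^sup>+a. H2 a
        \<partial>lborel))"
      unfolding ic by simp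
    also have "\<dots> = ennreal (1 / c) * (\<integral>\<^sup>+y. k y \<partial>lborel) * (\<integral>\<^sup>+y. k y \<partial>lborel)"
      unfolding K K2[symmetric] by (simp add: mult_ac)
    finally show "(\<integral>\<^sup>+y. (\<integral>\<^sup>+t. k (y + t *\<^sub>R d1) \<partial>lborel) * (\<integral>\<^sup>+t. k (y + t *\<^sub>R d2) \<partial>lborel) \<partial>lborel)
        \<le> ennreal (1 / c) * (\<integral>\<^sup>+y. k y \<partial>lborel) * (\<integral>\<^sup>+y. k y \<partial>lborel)"
      unfolding F_def by simp
  qed (use c in simp)
qed

section \<open>Squares bounded by line integrals, fourth powers by their products\<close>

definition energy_density :: "(plane \<Rightarrow> real) \<Rightarrow> plane \<Rightarrow> real" where
  "energy_density \<phi> x = (\<phi> x)\<^sup>2 + (norm (classical_grad \<phi> x))\<^sup>2"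

lemma energy_density_nonneg: "0 \<le> energy_density \<phi> x"
  by (simp add: energy_density_def)

text \<open>Because the gradient is the classical one, the density is continuous on the whole plane;
  cut off by the indicator of \<Omega>, it can be integrated along entire lines.\<close>

lemma energy_density_continuous:
  assumes "smooth \<phi>" shows "continuous_on UNIV (energy_density \<phi>)"
proof -
  have eq: "energy_density \<phi> = (\<lambda>x. (\<phi> x)\<^sup>2 + ((pderivative 1 \<phi> x)\<^sup>2 + (pderivative 2 \<phi> x)\<^sup>2))"
    by (simp add: energy_density_def[abs_def] classical_grad_def norm_vector_plane)
  show ?thesis
    unfolding eq using assms by (intro continuous_intros smooth_continuous smooth_pderivative)
qed

lemma smooth_directional_derivative:
  assumes "smooth \<phi>"
  shows "((\<lambda>t. \<phi> (y + t *\<^sub>R d)) has_real_derivative (classical_grad \<phi> (y + t *\<^sub>R d) \<bullet> d)) (at t)"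
proof -
  have g: "((\<lambda>t. y + t *\<^sub>R d) has_derivative (\<lambda>t. t *\<^sub>R d)) (at t)"
    by (auto intro!: derivative_eq_intros)
  let ?D = "frechet_derivative \<phi> (at (y + t *\<^sub>R d))"
  have D: "(\<phi> has_derivative ?D) (at (y + t *\<^sub>R d))"
    by (rule differentiable_has_derivative[OF smooth_differentiable[OF assms]])
  have lin: "linear ?D" by (rule has_derivative_linear[OF D])
  have "?D d = classical_grad \<phi> (y + t *\<^sub>R d) \<bullet> d"
  proof -
    have "d = d $ 1 *\<^sub>R axis 1 1 + d $ 2 *\<^sub>R axis 2 1"
      using vector_plane_decompose[of "d $ 1" "d $ 2"] vector_plane_eq[of d] by simp
    then have "?D d = ?D (d $ 1 *\<^sub>R axis 1 1 + d $ 2 *\<^sub>R axis 2 1)" by simp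
    also have "\<dots> = d $ 1 * ?D (axis 1 1) + d $ 2 * ?D (axis 2 1)"
      using lin by (simp add: linear_add linear_cmul)
    also have "\<dots> = classical_grad \<phi> (y + t *\<^sub>R d) \<bullet> d"
      by (simp add: inner_vec_def sum_2 classical_grad_def pderivative_def mult.commute)
    finally show ?thesis .
  qed
  then have "(\<lambda>t. ?D (t *\<^sub>R d)) = (*) (classical_grad \<phi> (y + t *\<^sub>R d) \<bullet> d)"
    using linear_cmul[OF lin] by (auto simp: mult.commute)
  then show ?thesis
    using has_derivative_compose[OF g D] unfolding has_field_derivative_def by simp
qed

text \<open>The weight 1 - t/\<tau> is 1 at \<open>y\<close> and 0 at the end of the segment, so
  integrating the derivative of the weighted square leaves the value at \<open>y\<close> and nothing
  at the far end. The integral is then enlarged to the full line to suit the product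
  argument.\<close>

lemma square_le_line_integral:
  assumes sm: "smooth \<phi>" and \<tau>: "\<tau> > 0" and seg: "\<And>t. 0 \<le> t \<Longrightarrow> t \<le> \<tau> \<Longrightarrow> y + t *\<^sub>R d \<in> \<Omega>"
  shows "ennreal ((\<phi> y)\<^sup>2)
    \<le> ennreal (1 / \<tau> + norm d) * (\<integral>\<^sup>+t. ennreal (energy_density \<phi> (y + t *\<^sub>R d)) * indicator \<Omega> (y +
        t *\<^sub>R d) \<partial>lborel)"
proof -
  define g where "g t = \<phi> (y + t *\<^sub>R d)" for t
  define g' where "g' t = classical_grad \<phi> (y + t *\<^sub>R d) \<bullet> d" for t
  define e where "e t = energy_density \<phi> (y + t *\<^sub>R d)" for t
  have der: "(g has_real_derivative g' t) (at t)" for t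
    unfolding g_def g'_def by (rule smooth_directional_derivative[OF sm])
  have "((\<lambda>t. - ((1 - t / \<tau>) * (g t)\<^sup>2)) has_real_derivative
      ((1 / \<tau>) * (g t)\<^sup>2 - (1 - t / \<tau>) * (2 * g t * g' t))) (at t)" for t
    using \<tau> by (auto intro!: derivative_eq_intros der simp: field_simps)
  then have "((\<lambda>t. (1 / \<tau>) * (g t)\<^sup>2 - (1 - t / \<tau>) * (2 * g t * g' t)) has_integral
      (- ((1 - \<tau> / \<tau>) * (g \<tau>)\<^sup>2)) - (- ((1 - 0 / \<tau>) * (g 0)\<^sup>2))) {0..\<tau>}"
    using \<tau> by (intro fundamental_theorem_of_calculus)
      (auto simp flip: has_real_derivative_iff_has_vector_derivative intro:
          has_field_derivative_at_within)
  then have FTC: "((\<lambda>t. (1 / \<tau>) * (g t)\<^sup>2 - (1 - t / \<tau>) * (2 * g t * g' t)) has_integral (\<phi> y)\<^sup>2) {0..\<tau>}"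
    using \<tau> by (simp add: g_def)
  have ce: "continuous_on UNIV e"
    unfolding e_def by (rule continuous_on_compose2[OF energy_density_continuous[OF sm]])
      (auto intro!: continuous_intros)
  then have "continuous_on {0..\<tau>} e" using continuous_on_subset by blast
  then have "e integrable_on {0..\<tau>}" by (rule integrable_continuous_interval)
  then have eI: "(e has_integral integral {0..\<tau>} e) {0..\<tau>}" by (rule integrable_integral)
  then have eI2: "((\<lambda>t. (1 / \<tau> + norm d) * e t) has_integral (1 / \<tau>
      + norm d) * integral {0..\<tau>} e) {0..\<tau>}"
    by (rule has_integral_mult_right)
  \<comment> \<open>The derivative of the weight contributes 1/\<tau> times the square; the
    derivative of the square contributes at most \<open>norm d\<close> times the density, by 2 a b
    \<le> a^2 + b^2.\<close>
  have le: "(1 / \<tau>) * (g t)\<^sup>2 - (1 - t / \<tau>) * (2 * g t * g' t) \<le> (1 / \<tau> + norm d) * e t"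
      if "t \<in> {0..\<tau>}" for t
  proof -
    have w: "0 \<le> 1 - t / \<tau>" "1 - t / \<tau> \<le> 1" using that \<tau> by auto
    let ?n = "norm (classical_grad \<phi> (y + t *\<^sub>R d))"
    have "\<bar>g' t\<bar> \<le> ?n * norm d" unfolding g'_def by (rule Cauchy_Schwarz_ineq2)
    then have "2 * \<bar>g t\<bar> * \<bar>g' t\<bar> \<le> 2 * \<bar>g t\<bar> * (?n * norm d)" by (intro mult_left_mono) auto
    also have "\<dots> = (2 * \<bar>g t\<bar> * ?n) * norm d" by simp
    also have "\<dots> \<le> ((g t)\<^sup>2 + ?n\<^sup>2) * norm d"
      using sum_squares_bound[of "\<bar>g t\<bar>" ?n] by (intro mult_right_mono) auto
    also have "\<dots> = norm d * e t" by (simp add: e_def energy_density_def g_def)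
    finally have a: "\<bar>2 * g t * g' t\<bar> \<le> norm d * e t" by (simp add: abs_mult)
    have "- ((1 - t / \<tau>) * (2 * g t * g' t)) \<le> (1 - t / \<tau>) * \<bar>2 * g t * g' t\<bar>"
      using w(1) by (metis abs_ge_minus_self abs_mult abs_of_nonneg)
    also have "\<dots> \<le> 1 * \<bar>2 * g t * g' t\<bar>" using w by (intro mult_right_mono) auto
    finally have b: "- ((1 - t / \<tau>) * (2 * g t * g' t)) \<le> norm d * e t" using a by simp
    have "(g t)\<^sup>2 \<le> e t" by (simp add: e_def energy_density_def g_def)
    then have "(1 / \<tau>) * (g t)\<^sup>2 \<le> (1 / \<tau>) * e t" using \<tau> by (intro mult_left_mono) auto
    then show ?thesis using b by (simp add: distrib_right)
  qed
  have "(\<phi> y)\<^sup>2 \<le> (1 / \<tau> + norm d) * integral {0..\<tau>} e"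
    by (rule has_integral_le[OF FTC eI2 le])
  then have "ennreal ((\<phi> y)\<^sup>2) \<le> ennreal (1 / \<tau> + norm d) * ennreal (integral {0..\<tau>} e)"
    using \<tau> by (subst ennreal_mult'[symmetric]) (simp_all add: ennreal_leI)
  also have "ennreal (integral {0..\<tau>} e) = (\<integral>\<^sup>+t. ennreal (e t) * indicator {0..\<tau>} t \<partial>lborel)"
    by (rule nn_integral_has_integral_lebesgue'[OF _ eI, symmetric]) (simp add: e_def
        energy_density_nonneg)
  also have "\<dots> \<le> (\<integral>\<^sup>+t. ennreal (energy_density \<phi> (y + t *\<^sub>R d)) * indicator \<Omega> (y + t *\<^sub>R d) \<partial>lborel)"
    using seg by (intro nn_integral_mono) (auto simp: e_def indicator_def)
  finally show ?thesis by (simp add: mult_left_mono)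
qed

text \<open>The fourth power is a product of two squares, one bounded by an integral along
  \<open>d1\<close> and the other by an integral along \<open>d2\<close>;
  \<open>line_integrals_product\<close> integrates the product of these bounds.\<close>

lemma local_fourth_power_bound:
  assumes "open \<Omega>" "open U" and \<tau>: "\<tau> > 0"
    and ind: "inj (\<lambda>x::plane. x $ 1 *\<^sub>R d1 + x $ 2 *\<^sub>R d2)"
    and seg1: "\<And>y t. y \<in> U \<inter> \<Omega> \<Longrightarrow> 0 \<le> t \<Longrightarrow> t \<le> \<tau> \<Longrightarrow> y + t *\<^sub>R d1 \<in> \<Omega>"
    and seg2: "\<And>y t. y \<in> U \<inter> \<Omega> \<Longrightarrow> 0 \<le> t \<Longrightarrow> t \<le> \<tau> \<Longrightarrow> y + t *\<^sub>R d2 \<in> \<Omega>"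
  obtains C :: real where "C \<ge> 0" "\<And>\<phi>. smooth \<phi> \<Longrightarrow>
    (\<integral>\<^sup>+y. ennreal ((\<phi> y) ^ 4) * indicator (U \<inter> \<Omega>) y \<partial>lborel)
      \<le> ennreal C * (\<integral>\<^sup>+y. ennreal (energy_density \<phi> y) * indicator \<Omega> y \<partial>lborel)\<^sup>2"
proof -
  obtain c where c: "c > 0"
    "\<And>k. k \<in> borel_measurable borel \<Longrightarrow>
      (\<integral>\<^sup>+y. (\<integral>\<^sup>+t. k (y + t *\<^sub>R d1) \<partial>lborel) * (\<integral>\<^sup>+t. k (y + t *\<^sub>R d2) \<partial>lborel) \<partial>lborel)
        \<le> ennreal c * (\<integral>\<^sup>+y. k y \<partial>lborel) * (\<integral>\<^sup>+y. k y \<partial>lborel)"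
    by (rule line_integrals_product[OF ind]) blast
  let ?c1 = "1 / \<tau> + norm d1" and ?c2 = "1 / \<tau> + norm d2"
  have nn: "?c1 \<ge> 0" "?c2 \<ge> 0" using \<tau> by auto
  show ?thesis
  proof (rule that[of "?c1 * ?c2 * c"])
    show "0 \<le> ?c1 * ?c2 * c" using nn c by (intro mult_nonneg_nonneg) auto
    fix \<phi> assume sm: "smooth \<phi>"
    define k where "k y = ennreal (energy_density \<phi> y) * indicator \<Omega> y" for y
    define F where "F d y = (\<integral>\<^sup>+t. k (y + t *\<^sub>R d) \<partial>lborel)" for d y :: plane
    have [measurable]: "energy_density \<phi> \<in> borel_measurable borel" "\<Omega> \<in> sets borel" "U \<in> sets borel"
      using energy_density_continuous[OF sm] assms by (auto intro: borel_measurable_continuous_onI)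
    have km[measurable]: "k \<in> borel_measurable borel" unfolding k_def[abs_def] by simp
    have Fm[measurable]: "F d \<in> borel_measurable borel" for d
    proof -
      have "(\<lambda>(y, t). k (y + t *\<^sub>R d)) \<in> borel_measurable (borel \<Otimes>\<^sub>M lborel)" by simp
      from lborel.borel_measurable_nn_integral[OF this] show ?thesis unfolding F_def[abs_def] .
    qed
    have "(\<integral>\<^sup>+y. ennreal ((\<phi> y) ^ 4) * indicator (U \<inter> \<Omega>) y \<partial>lborel)
        \<le> (\<integral>\<^sup>+y. ennreal (?c1 * ?c2) * (F d1 y * F d2 y) \<partial>lborel)"
    proof (rule nn_integral_mono)
      fix y
      show "ennreal ((\<phi> y) ^ 4) * indicator (U \<inter> \<Omega>) y \<le> ennreal (?c1 * ?c2) * (F d1 y * F d2 y)"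
      proof (cases "y \<in> U \<inter> \<Omega>")
        case True
        have "ennreal ((\<phi> y) ^ 4) = ennreal ((\<phi> y)\<^sup>2) * ennreal ((\<phi> y)\<^sup>2)"
          by (simp flip: ennreal_mult power_add)
        also have "\<dots> \<le> (ennreal ?c1 * F d1 y) * (ennreal ?c2 * F d2 y)"
          unfolding F_def k_def
          by (intro mult_mono square_le_line_integral[OF sm \<tau>] seg1[OF True] seg2[OF True]) auto
        also have "\<dots> = ennreal (?c1 * ?c2) * (F d1 y * F d2 y)"
          using nn by (simp add: ennreal_mult mult_ac)
        finally show ?thesis using True by simp
      qed simp
    qed
    also have "\<dots> = ennreal (?c1 * ?c2) * (\<integral>\<^sup>+y. F d1 y * F d2 y \<partial>lborel)"
      by (simp add: nn_integral_cmult)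
    also have "\<dots> \<le> ennreal (?c1 * ?c2) * (ennreal c * (\<integral>\<^sup>+y. k y \<partial>lborel) * (\<integral>\<^sup>+y. k y \<partial>lborel))"
      unfolding F_def by (intro mult_left_mono c(2) km) auto
    also have "\<dots> = ennreal (?c1 * ?c2 * c) * (\<integral>\<^sup>+y. k y \<partial>lborel)\<^sup>2"
      using nn c by (simp add: ennreal_mult power2_eq_square mult_ac)
    finally show "(\<integral>\<^sup>+y. ennreal ((\<phi> y) ^ 4) * indicator (U \<inter> \<Omega>) y \<partial>lborel)
      \<le> ennreal (?c1 * ?c2 * c) * (\<integral>\<^sup>+y. ennreal (energy_density \<phi> y) * indicator \<Omega> y \<partial>lborel)\<^sup>2"
      unfolding k_def .
  qed
qed

lemma plane_directions_inj:
  fixes d1 d2 :: plane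
  assumes "d1 $ 1 * d2 $ 2 \<noteq> d1 $ 2 * d2 $ 1"
  shows "inj (\<lambda>x::plane. x $ 1 *\<^sub>R d1 + x $ 2 *\<^sub>R d2)"
proof -
  have lin: "linear (\<lambda>x::plane. x $ 1 *\<^sub>R d1 + x $ 2 *\<^sub>R d2)"
    by (intro linearI) (auto simp: algebra_simps)
  have "x = 0" if "x $ 1 *\<^sub>R d1 + x $ 2 *\<^sub>R d2 = 0" for x :: plane
  proof -
    have e: "x $ 1 * d1 $ 1 + x $ 2 * d2 $ 1 = 0" "x $ 1 * d1 $ 2 + x $ 2 * d2 $ 2 = 0"
      using that by (auto simp: vec_eq_iff)
    \<comment> \<open>Cramer's rule for the two coordinates; the determinant is nonzero by
      assumption.\<close>
    have "x $ 1 * (d1 $ 1 * d2 $ 2 - d1 $ 2 * d2 $ 1)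
        = (x $ 1 * d1 $ 1 + x $ 2 * d2 $ 1) * d2 $ 2 - (x $ 1 * d1 $ 2 + x $ 2 * d2 $ 2) * d2 $ 1"
      by (simp add: algebra_simps)
    moreover have "x $ 2 * (d1 $ 1 * d2 $ 2 - d1 $ 2 * d2 $ 1)
        = (x $ 1 * d1 $ 2 + x $ 2 * d2 $ 2) * d1 $ 1 - (x $ 1 * d1 $ 1 + x $ 2 * d2 $ 1) * d1 $ 2"
      by (simp add: algebra_simps)
    ultimately have "x $ 1 = 0" "x $ 2 = 0" unfolding e using assms by auto
    then show "x = 0" by (simp add: vec_eq_iff forall_2)
  qed
  then show ?thesis using linear_injective_0[OF lin] by blast
qed

text \<open>The uniform cone condition, in the weak form with two transversal directions.\<close>

lemma lipschitz_domain_cone: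
  assumes "lipschitz_domain \<Omega>" "x \<in> closure \<Omega>"
  obtains U \<tau> d1 d2 where "open U" "x \<in> U" "\<tau> > (0::real)"
    "inj (\<lambda>x::plane. x $ 1 *\<^sub>R d1 + x $ 2 *\<^sub>R d2)"
    "\<And>y t. y \<in> U \<inter> \<Omega> \<Longrightarrow> 0 \<le> t \<Longrightarrow> t \<le> \<tau> \<Longrightarrow> y + t *\<^sub>R d1 \<in> \<Omega>"
    "\<And>y t. y \<in> U \<inter> \<Omega> \<Longrightarrow> 0 \<le> t \<Longrightarrow> t \<le> \<tau> \<Longrightarrow> y + t *\<^sub>R d2 \<in> \<Omega>"
proof (cases "x \<in> \<Omega>")
  case True
  have "open \<Omega>" using assms(1) by (simp add: lipschitz_domain_def)
  then obtain \<rho> where \<rho>: "\<rho> > 0" "ball x \<rho> \<subseteq> \<Omega>" using True open_contains_ball by blast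
  have in\<Omega>: "y + t *\<^sub>R axis i 1 \<in> \<Omega>" if "y \<in> ball x (\<rho>/2) \<inter> \<Omega>" "0 \<le> t" "t \<le> \<rho> / 3" for y t i
  proof -
    have "dist x (y + t *\<^sub>R axis i 1) \<le> dist x y + dist y (y + t *\<^sub>R axis i 1)" by (rule dist_triangle)
    also have "dist y (y + t *\<^sub>R axis i 1) = t" using that(2) by (simp add: dist_norm)
    finally show ?thesis using that \<rho> by (intro subsetD[OF \<rho>(2)]) auto
  qed
  show ?thesis
    \<comment> \<open>Half the radius for the point plus a third for the displacement stays inside
      the ball.\<close>
    by (rule that[of "ball x (\<rho>/2)" "\<rho>/3" "axis 1 1" "axis 2 1"])
      (use \<rho> in\<Omega> in \<open>auto intro!: plane_directions_inj simp: axis_def\<close>)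
next
  case False
  have "open \<Omega>" using assms(1) by (simp add: lipschitz_domain_def)
  then have "x \<in> frontier \<Omega>" using assms(2) False by (simp add: frontier_def interior_open)
  then obtain \<rho> L and Q :: "plane \<Rightarrow> plane" and \<gamma> :: "real \<Rightarrow> real" where \<rho>: "\<rho> > 0"
      and Q: "orthogonal_transformation Q"
    and L: "L-lipschitz_on UNIV \<gamma>" and eq: "\<Omega> \<inter> ball x \<rho> = {y \<in> ball x \<rho>. \<gamma> (Q y $ 1) < Q y $ 2}"
    using assms(1) unfolding lipschitz_domain_def by blast
  have L0: "L \<ge> 0" using L by (rule lipschitz_on_nonneg)
  have linQ: "linear Q" using Q by (rule orthogonal_transformation_linear)
  have "surj Q" using Q by (rule orthogonal_transformation_surj)
  \<comment> \<open>In the coordinates given by \<open>Q\<close> both directions climb at rate L + 1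
    per unit of horizontal motion, faster than the boundary graph can, so motion along them stays
    above it. Their determinant there is 2 (L + 1), which makes them independent.\<close>
  then obtain d1 d2 where d: "Q d1 = vector [1, L + 1]" "Q d2 = vector [-1, L + 1]" by (metis surjD)
  define N where "N = norm d1 + norm d2 + 1"
  have N: "N > 0" "norm d1 \<le> N" "norm d2 \<le> N" by (auto simp: N_def add_nonneg_pos)
  define \<tau> where "\<tau> = \<rho> / (3 * N)"
  have \<tau>: "\<tau> > 0" using \<rho> N by (simp add: \<tau>_def)
  have inb: "y + t *\<^sub>R d \<in> ball x \<rho>" if "y \<in> ball x (\<rho>/2)" "0 \<le> t" "t \<le> \<tau>" "norm d \<le> N" for y t d
  proof -
    have "dist x (y + t *\<^sub>R d) \<le> dist x y + dist y (y + t *\<^sub>R d)" by (rule dist_triangle)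
    also have "dist y (y + t *\<^sub>R d) = t * norm d" using that(2) by (simp add: dist_norm)
    also have "t * norm d \<le> \<tau> * N" using that \<tau> by (intro mult_mono) auto
    also have "\<tau> * N = \<rho> / 3" using N by (simp add: \<tau>_def)
    finally show ?thesis using that(1) \<rho> by auto
  qed
  have up: "y + t *\<^sub>R d \<in> \<Omega>"
    if y: "y \<in> ball x (\<rho>/2) \<inter> \<Omega>" "0 \<le> t" "t \<le> \<tau>" "norm d \<le> N"
        and Qd: "\<bar>Q d $ 1\<bar> \<le> 1" "Q d $ 2 = L + 1" for y t d
  proof -
    have "y \<in> \<Omega> \<inter> ball x \<rho>" using y \<rho> by auto
    then have gy: "\<gamma> (Q y $ 1) < Q y $ 2" using eq by blast
    have Qe: "Q (y + t *\<^sub>R d) = Q y + t *\<^sub>R Q d" using linQ by (simp add: linear_add linear_cmul)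
    have "dist (\<gamma> (Q y $ 1 + t * Q d $ 1)) (\<gamma> (Q y $ 1)) \<le> L * dist (Q y $ 1 + t * Q d $ 1) (Q y $ 1)"
      using L by (rule lipschitz_onD) auto
    then have "\<gamma> (Q y $ 1 + t * Q d $ 1) \<le> \<gamma> (Q y $ 1) + L * \<bar>t * Q d $ 1\<bar>"
      by (auto simp: dist_real_def)
    also have "L * \<bar>t * Q d $ 1\<bar> \<le> L * t"
      using L0 y(2) Qd(1) by (intro mult_left_mono) (auto simp: abs_mult intro: mult_left_le)
    also have "\<gamma> (Q y $ 1) + L * t < Q y $ 2 + t * (L + 1)"
      using gy y(2) by (simp add: algebra_simps)
    finally have "\<gamma> (Q (y + t *\<^sub>R d) $ 1) < Q (y + t *\<^sub>R d) $ 2" by (simp add: Qe Qd(2))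
    then show ?thesis using inb[of y t d] y eq by blast
  qed
  have ind: "inj (\<lambda>x::plane. x $ 1 *\<^sub>R d1 + x $ 2 *\<^sub>R d2)"
  proof -
    let ?T = "\<lambda>x::plane. x $ 1 *\<^sub>R Q d1 + x $ 2 *\<^sub>R Q d2"
    have "inj ?T" by (rule plane_directions_inj) (use L0 in \<open>auto simp: d\<close>)
    moreover have "?T x = Q (x $ 1 *\<^sub>R d1 + x $ 2 *\<^sub>R d2)" for x
      using linQ by (simp add: linear_add linear_cmul)
    ultimately show ?thesis by (metis (no_types, lifting) injD injI)
  qed
  show ?thesis
    by (rule that[of "ball x (\<rho>/2)" \<tau> d1 d2]) (use \<rho> \<tau> ind up N d in auto)
qed

text \<open>The local bounds are patched over a finite subcover of the compact closure, and their
  constants add up.\<close>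

lemma smooth_fourth_power_bound:
  assumes "lipschitz_domain \<Omega>"
  obtains C :: real where "C \<ge> 0" "\<And>\<phi>. smooth \<phi> \<Longrightarrow>
    (\<integral>\<^sup>+y. ennreal ((\<phi> y) ^ 4) * indicator \<Omega> y \<partial>lborel)
      \<le> ennreal C * (\<integral>\<^sup>+y. ennreal (energy_density \<phi> y) * indicator \<Omega> y \<partial>lborel)\<^sup>2"
proof -
  have op: "open \<Omega>" "bounded \<Omega>" using assms by (auto simp: lipschitz_domain_def)
  \<comment> \<open>Neighbourhood and constant are bundled so that both can be chosen at once as
    functions of the point.\<close>
  define good where "good U C \<longleftrightarrow> open U \<and> C \<ge> 0 \<and> (\<forall>\<phi>. smooth \<phi> \<longrightarrow>
      (\<integral>\<^sup>+y. ennreal ((\<phi> y) ^ 4) * indicator (U \<inter> \<Omega>) y \<partial>lborel)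
        \<le> ennreal C * (\<integral>\<^sup>+y. ennreal (energy_density \<phi> y) * indicator \<Omega> y \<partial>lborel)\<^sup>2)" for U C
  have "\<exists>U C. x \<in> U \<and> good U C" if x: "x \<in> closure \<Omega>" for x
  proof -
    obtain U \<tau> d1 d2 where U: "open U" "x \<in> U" "\<tau> > (0::real)"
      "inj (\<lambda>x::plane. x $ 1 *\<^sub>R d1 + x $ 2 *\<^sub>R d2)"
      "\<And>y t. y \<in> U \<inter> \<Omega> \<Longrightarrow> 0 \<le> t \<Longrightarrow> t \<le> \<tau> \<Longrightarrow> y + t *\<^sub>R d1 \<in> \<Omega>"
      "\<And>y t. y \<in> U \<inter> \<Omega> \<Longrightarrow> 0 \<le> t \<Longrightarrow> t \<le> \<tau> \<Longrightarrow> y + t *\<^sub>R d2 \<in> \<Omega>"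
      by (rule lipschitz_domain_cone[OF assms x]) blast
    obtain C where C: "C \<ge> 0" "\<And>\<phi>. smooth \<phi> \<Longrightarrow>
      (\<integral>\<^sup>+y. ennreal ((\<phi> y) ^ 4) * indicator (U \<inter> \<Omega>) y \<partial>lborel)
        \<le> ennreal C * (\<integral>\<^sup>+y. ennreal (energy_density \<phi> y) * indicator \<Omega> y \<partial>lborel)\<^sup>2"
      by (rule local_fourth_power_bound[OF op(1) U(1,3,4,5,6)]) blast+
    show ?thesis unfolding good_def using U(1,2) C by (intro exI[of _ U] exI[of _ C]) auto
  qed
  then obtain U C where "\<And>x. x \<in> closure \<Omega> \<Longrightarrow> x \<in> U x \<and> good (U x) (C x)" by metis
  then have UC: "\<And>x. x \<in> closure \<Omega> \<Longrightarrow> x \<in> U x" "\<And>x. x \<in> closure \<Omega> \<Longrightarrow> open (U x)"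
    "\<And>x. x \<in> closure \<Omega> \<Longrightarrow> C x \<ge> 0"
    "\<And>x \<phi>. x \<in> closure \<Omega> \<Longrightarrow> smooth \<phi> \<Longrightarrow>
      (\<integral>\<^sup>+y. ennreal ((\<phi> y) ^ 4) * indicator (U x \<inter> \<Omega>) y \<partial>lborel)
        \<le> ennreal (C x) * (\<integral>\<^sup>+y. ennreal (energy_density \<phi> y) * indicator \<Omega> y \<partial>lborel)\<^sup>2"
    unfolding good_def by auto
  have "compact (closure \<Omega>)" using op by simp
  then obtain I where I: "I \<subseteq> closure \<Omega>" "finite I" "closure \<Omega> \<subseteq> (\<Union>x\<in>I. U x)"
  proof (rule compactE_image)
    show "open (U x)" if "x \<in> closure \<Omega>" for x using UC(2)[OF that] .
    show "closure \<Omega> \<subseteq> (\<Union>x\<in>closure \<Omega>. U x)" using UC(1) by (meson UN_I subsetI)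
  qed
  show ?thesis
  proof (rule that[of "\<Sum>x\<in>I. C x"])
    show "0 \<le> (\<Sum>x\<in>I. C x)" using UC(3) I(1) by (intro sum_nonneg) auto
    fix \<phi> assume sm: "smooth \<phi>"
    have [measurable]: "\<phi> \<in> borel_measurable borel"
      by (rule borel_measurable_continuous_onI[OF smooth_continuous[OF sm]])
    have [measurable]: "\<Omega> \<in> sets borel" using op by simp
    have Um: "U x \<in> sets borel" if "x \<in> I" for x using UC(2)[of x] I(1) that by auto
    let ?E = "(\<integral>\<^sup>+y. ennreal (energy_density \<phi> y) * indicator \<Omega> y \<partial>lborel)\<^sup>2"
    have "(\<integral>\<^sup>+y. ennreal ((\<phi> y) ^ 4) * indicator \<Omega> y \<partial>lborel)
        \<le> (\<integral>\<^sup>+y. (\<Sum>x\<in>I. ennreal ((\<phi> y) ^ 4) * indicator (U x \<inter> \<Omega>) y) \<partial>lborel)"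
    proof (rule nn_integral_mono)
      fix y
      show "ennreal ((\<phi> y) ^ 4) * indicator \<Omega> y \<le> (\<Sum>x\<in>I. ennreal ((\<phi> y) ^ 4) * indicator (U x \<inter> \<Omega>) y)"
      proof (cases "y \<in> \<Omega>")
        case True
        then obtain x where x: "x \<in> I" "y \<in> U x" using I(3) closure_subset by blast
        have "ennreal ((\<phi> y) ^ 4) * indicator (U x \<inter> \<Omega>) y
            \<le> (\<Sum>x\<in>I. ennreal ((\<phi> y) ^ 4) * indicator (U x \<inter> \<Omega>) y)"
          using x(1) I(2) by (intro member_le_sum) auto
        then show ?thesis using x True by simp
      qed simp
    qed
    also have "\<dots> = (\<Sum>x\<in>I. \<integral>\<^sup>+y. ennreal ((\<phi> y) ^ 4) * indicator (U x \<inter> \<Omega>) y \<partial>lborel)"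
      using Um by (intro nn_integral_sum borel_measurable_times_ennreal borel_measurable_indicator) auto
    also have "\<dots> \<le> (\<Sum>x\<in>I. ennreal (C x) * ?E)"
      using UC(4)[OF _ sm] I(1) by (intro sum_mono) auto
    also have "\<dots> = ennreal (\<Sum>x\<in>I. C x) * ?E"
      using UC(3) I(1) by (subst sum_ennreal[symmetric]) (auto simp: sum_distrib_right)
    finally show "(\<integral>\<^sup>+y. ennreal ((\<phi> y) ^ 4) * indicator \<Omega> y \<partial>lborel) \<le> ennreal (\<Sum>x\<in>I. C x) * ?E" .
  qed
qed

section \<open>Passage from smooth functions to the Sobolev space\<close>

context bounded_domain
begin

lemma nn_integral_domain:
  assumes "f \<in> borel_measurable borel"
  shows "(\<integral>\<^sup>+x. f x \<partial>M) = (\<integral>\<^sup>+x. f x * indicator \<Omega> x \<partial>lborel)"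
proof -
  have "\<Omega> \<in> sets borel" using open_domain by simp
  then have m: "(\<lambda>x. f x * indicator \<Omega> x) \<in> borel_measurable lborel" using assms by simp
  have "(\<integral>\<^sup>+x. f x \<partial>M) = (\<integral>\<^sup>+x. f x * indicator \<Omega> x \<partial>lebesgue)"
    using sets_domain by (subst nn_integral_restrict_space) auto
  also have "\<dots> = (\<integral>\<^sup>+x. f x * indicator \<Omega> x \<partial>lborel)"
    using m by (simp add: nn_integral_completion)
  finally show ?thesis .
qed

text \<open>The chosen weak gradient of a smooth function has the same norm as the classical one, so
  the integral produced by the line argument is the squared Sobolev norm.\<close>

lemma nn_integral_energy_density:
  assumes "smooth \<phi>"
  shows "(\<integral>\<^sup>+y. ennreal (energy_density \<phi> y) * indicator \<Omega> y \<partial>lborel) = ennreal ((h1_norm \<Omega> \<phi>)\<^sup>2)"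
proof -
  have m: "energy_density \<phi> \<in> borel_measurable borel"
    by (rule borel_measurable_continuous_onI[OF energy_density_continuous[OF assms]])
  note sq = smooth_square_integrable[OF assms] square_integrable_classical_grad[OF assms]
  have i: "integrable M (energy_density \<phi>)"
    using square_integrableD(2)[OF sq(1)] square_integrableD(2)[OF sq(2)]
    by (simp add: energy_density_def[abs_def])
  have "(\<integral>\<^sup>+y. ennreal (energy_density \<phi> y) * indicator \<Omega> y \<partial>lborel)
      = (\<integral>\<^sup>+y. ennreal (energy_density \<phi> y) \<partial>M)"
    using m by (subst nn_integral_domain) auto
  also have "\<dots> = ennreal (LINT y|M. energy_density \<phi> y)"
    by (rule nn_integral_eq_integral[OF i]) (simp add: energy_density_nonneg)
  also have "(LINT y|M. energy_density \<phi> y) = (l2_norm \<Omega> \<phi>)\<^sup>2 + (l2_norm \<Omega> (classical_grad \<phi>))\<^sup>2"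
    using square_integrableD(2)[OF sq(1)] square_integrableD(2)[OF sq(2)]
    by (simp add: energy_density_def[abs_def] l2_norm_power2)
  also have "\<dots> = (h1_norm \<Omega> \<phi>)\<^sup>2"
    by (simp add: h1_norm_eq[OF smooth_h_space[OF assms]] weak_grad_l2_norm[OF weak_grad_smooth[OF
        assms]])
  finally show ?thesis .
qed

lemma smooth_approximation_norm_tendsto:
  assumes "smooth_approximation u \<phi>"
  shows "(\<lambda>n. h1_norm \<Omega> (\<phi> n)) \<longlonglongrightarrow> h1_norm \<Omega> u"
proof -
  have u: "u \<in> h_space \<Omega> 1" and \<phi>: "\<phi> n \<in> h_space \<Omega> 1" for n
    using assms by (auto simp: smooth_approximation_def intro: smooth_h_space)
  have "\<bar>h1_norm \<Omega> (\<phi> n) - h1_norm \<Omega> u\<bar> \<le> h1_norm \<Omega> (\<lambda>x. \<phi> n x - u x)" for n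
  proof -
    note d = h_space_diff(1)[OF \<phi>[of n] u]
    have "h1_norm \<Omega> (\<phi> n) \<le> h1_norm \<Omega> (\<lambda>x. \<phi> n x - u x) + h1_norm \<Omega> u"
      using h_space_linear_combination(3)[OF d u, of 1 1] by simp
    moreover have "h1_norm \<Omega> u \<le> h1_norm \<Omega> (\<phi> n) + h1_norm \<Omega> (\<lambda>x. \<phi> n x - u x)"
      using h_space_linear_combination(3)[OF \<phi>[of n] d, of 1 "-1"] by simp
    ultimately show ?thesis by linarith
  qed
  then have "\<forall>\<^sub>F n in sequentially. norm (h1_norm \<Omega> (\<phi> n) - h1_norm \<Omega> u) \<le> h1_norm \<Omega> (\<lambda>x. \<phi> n x - u x)"
    by simp
  moreover have "(\<lambda>n. h1_norm \<Omega> (\<lambda>x. \<phi> n x - u x)) \<longlonglongrightarrow> 0"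
    using assms by (simp add: smooth_approximation_def)
  ultimately have "(\<lambda>n. h1_norm \<Omega> (\<phi> n) - h1_norm \<Omega> u) \<longlonglongrightarrow> 0"
    by (rule Lim_null_comparison)
  then show ?thesis by (simp add: LIM_zero_iff)
qed

text \<open>Fatou's lemma along a subsequence that converges almost everywhere. The constant is
  independent of the function and of the sequence, so the bound can later be applied to
  approximation errors.\<close>

lemma fourth_power_embedding:
  assumes "lipschitz_domain \<Omega>"
  obtains C :: real where "C \<ge> 0" "\<And>u \<phi>. smooth_approximation u \<phi> \<Longrightarrow>
    integrable M (\<lambda>x. (u x) ^ 4) \<and> (LINT x|M. (u x) ^ 4) \<le> C * (h1_norm \<Omega> u) ^ 4"
proof -
  obtain C :: real where C: "C \<ge> 0" "\<And>\<phi>. smooth \<phi> \<Longrightarrow>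
    (\<integral>\<^sup>+y. ennreal ((\<phi> y) ^ 4) * indicator \<Omega> y \<partial>lborel)
      \<le> ennreal C * (\<integral>\<^sup>+y. ennreal (energy_density \<phi> y) * indicator \<Omega> y \<partial>lborel)\<^sup>2"
    by (rule smooth_fourth_power_bound[OF assms]) blast
  have Cs: "(\<integral>\<^sup>+y. ennreal ((\<phi> y) ^ 4) \<partial>M) \<le> ennreal (C * (h1_norm \<Omega> \<phi>) ^ 4)" if sm: "smooth \<phi>" for \<phi>
  proof -
    have "\<phi> \<in> borel_measurable borel"
      by (rule borel_measurable_continuous_onI[OF smooth_continuous[OF sm]])
    then have "(\<integral>\<^sup>+y. ennreal ((\<phi> y) ^ 4) \<partial>M) = (\<integral>\<^sup>+y. ennreal ((\<phi> y) ^ 4) * indicator \<Omega> y \<partial>lborel)"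
      by (subst nn_integral_domain) auto
    also have "\<dots> \<le> ennreal C * (ennreal ((h1_norm \<Omega> \<phi>)\<^sup>2))\<^sup>2"
      using C(2)[OF sm] unfolding nn_integral_energy_density[OF sm] .
    also have "\<dots> = ennreal (C * (h1_norm \<Omega> \<phi>) ^ 4)"
      using C(1) by (simp add: ennreal_mult ennreal_power)
    finally show ?thesis .
  qed
  show ?thesis
  proof (rule that[OF C(1)])
    fix u \<phi> assume ap: "smooth_approximation u \<phi>"
    have u: "u \<in> h_space \<Omega> 1" and sm: "smooth (\<phi> n)" and \<phi>: "\<phi> n \<in> h_space \<Omega> 1" for n
      using ap by (auto simp: smooth_approximation_def intro: smooth_h_space)
    have squ: "square_integrable \<Omega> u" by (rule h_space_square_integrable[OF u])
    note d = h_space_diff(1)[OF \<phi> u]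
    have "(\<lambda>n. (h1_norm \<Omega> (\<lambda>x. \<phi> n x - u x))\<^sup>2) \<longlonglongrightarrow> 0\<^sup>2"
      using ap by (intro tendsto_power) (simp add: smooth_approximation_def)
    then have h0: "(\<lambda>n. (h1_norm \<Omega> (\<lambda>x. \<phi> n x - u x))\<^sup>2) \<longlonglongrightarrow> 0" by simp
    have le: "(LINT x|M. norm ((\<phi> n x - u x)\<^sup>2)) \<le> (h1_norm \<Omega> (\<lambda>x. \<phi> n x - u x))\<^sup>2" for n
      using power_mono[OF l2_norm_le_h1_norm[OF d[of n]], of 2] by (simp add: l2_norm_power2)
    have "(\<lambda>n. LINT x|M. norm ((\<phi> n x - u x)\<^sup>2)) \<longlonglongrightarrow> 0"
      by (rule tendsto_sandwich[OF _ _ tendsto_const h0]) (use le in auto)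
    moreover have "integrable M (\<lambda>x. (\<phi> n x - u x)\<^sup>2)" for n
      using square_integrableD(2)[OF h_space_square_integrable(1)[OF d[of n]]] by simp
    \<comment> \<open>Convergence in L^2 means that the squared differences tend to zero in L^1,
      which yields almost everywhere convergence along a subsequence.\<close>
    ultimately obtain r where r: "strict_mono r" "AE x in M. (\<lambda>n. (\<phi> (r n) x - u x)\<^sup>2) \<longlonglongrightarrow> 0"
      using tendsto_L1_AE_subseq[of M "\<lambda>n x. (\<phi> n x - u x)\<^sup>2"] by blast
    have conv: "AE x in M. ennreal ((u x) ^ 4) = liminf (\<lambda>n. ennreal ((\<phi> (r n) x) ^ 4))"
      using r(2)
    proof eventually_elim
      case (elim x)
      then have "(\<lambda>n. sqrt ((\<phi> (r n) x - u x)\<^sup>2)) \<longlonglongrightarrow> sqrt 0" by (rule tendsto_real_sqrt)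
      then have "(\<lambda>n. \<phi> (r n) x - u x) \<longlonglongrightarrow> 0" by (simp add: tendsto_rabs_zero_iff)
      then have "(\<lambda>n. \<phi> (r n) x) \<longlonglongrightarrow> u x" by (simp add: LIM_zero_iff)
      then have "(\<lambda>n. ennreal ((\<phi> (r n) x) ^ 4)) \<longlonglongrightarrow> ennreal ((u x) ^ 4)"
        by (intro tendsto_ennrealI tendsto_power)
      then show ?case by (rule lim_imp_Liminf[OF trivial_limit_sequentially, symmetric])
    qed
    have pm: "\<phi> n \<in> borel_measurable M" for n
      by (rule square_integrableD(1)[OF smooth_square_integrable[OF sm]])
    have "(\<lambda>n. h1_norm \<Omega> (\<phi> (r n))) \<longlonglongrightarrow> h1_norm \<Omega> u"
      using LIMSEQ_subseq_LIMSEQ[OF smooth_approximation_norm_tendsto[OF ap] r(1)]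
          by (simp add: comp_def)
    then have lim: "(\<lambda>n. ennreal (C * (h1_norm \<Omega> (\<phi> (r n))) ^ 4)) \<longlonglongrightarrow> ennreal (C * (h1_norm \<Omega> u) ^ 4)"
      by (intro tendsto_ennrealI tendsto_mult tendsto_const tendsto_power)
    have "(\<integral>\<^sup>+x. ennreal ((u x) ^ 4) \<partial>M) = (\<integral>\<^sup>+x. liminf (\<lambda>n. ennreal ((\<phi> (r n) x) ^ 4)) \<partial>M)"
      by (rule nn_integral_cong_AE[OF conv])
    also have "\<dots> \<le> liminf (\<lambda>n. \<integral>\<^sup>+x. ennreal ((\<phi> (r n) x) ^ 4) \<partial>M)"
      using pm by (intro nn_integral_liminf) auto
    also have "\<dots> \<le> liminf (\<lambda>n. ennreal (C * (h1_norm \<Omega> (\<phi> (r n))) ^ 4))"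
      using Cs[OF sm] by (intro Liminf_mono always_eventually) auto
    also have "\<dots> = ennreal (C * (h1_norm \<Omega> u) ^ 4)"
      by (rule lim_imp_Liminf[OF trivial_limit_sequentially lim])
    finally have fin: "(\<integral>\<^sup>+x. ennreal ((u x) ^ 4) \<partial>M) \<le> ennreal (C * (h1_norm \<Omega> u) ^ 4)" .
    have um: "(\<lambda>x. (u x) ^ 4) \<in> borel_measurable M" using square_integrableD(1)[OF squ] by simp
    have "(\<integral>\<^sup>+x. ennreal ((u x) ^ 4) \<partial>M) < \<infinity>" using fin by (rule le_less_trans) simp
    then have i: "integrable M (\<lambda>x. (u x) ^ 4)" by (intro integrableI_nonneg um) auto
    moreover have "(LINT x|M. (u x) ^ 4) \<le> C * (h1_norm \<Omega> u) ^ 4"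
      using fin C(1) nn_integral_eq_integral[OF i] by simp
    ultimately show "integrable M (\<lambda>x. (u x) ^ 4) \<and> (LINT x|M. (u x) ^ 4) \<le> C * (h1_norm \<Omega> u) ^ 4" ..
  qed
qed

end

subsection \<open>Fluxes\<close>

lemma lp_norm_le:
  assumes "s > 0" "0 \<le> c" "integrable (lebesgue_on \<Omega>) F"
    and "f \<in> borel_measurable (lebesgue_on \<Omega>)"
    and "AE x in lebesgue_on \<Omega>. norm (f x) powr s \<le> c * F x"
  shows "integrable (lebesgue_on \<Omega>) (\<lambda>x. norm (f x) powr s)"
    "lp_norm \<Omega> s f \<le> (c * (LINT x|lebesgue_on \<Omega>. F x)) powr (1 / s)"
proof -
  show i: "integrable (lebesgue_on \<Omega>) (\<lambda>x. norm (f x) powr s)"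
  proof (rule Bochner_Integration.integrable_bound[of _ "\<lambda>x. c * F x"])
    show "AE x in lebesgue_on \<Omega>. norm (norm (f x) powr s) \<le> norm (c * F x)"
      using assms(5)
    proof eventually_elim
      case (elim x)
      then show ?case using abs_ge_self[of "c * F x"] unfolding real_norm_def by (simp del: abs_mult)
    qed
    show "(\<lambda>x. norm (f x) powr s) \<in> borel_measurable (lebesgue_on \<Omega>)"
      using assms(4) by measurable
  qed (use assms(3) in simp)
  have "(LINT x|lebesgue_on \<Omega>. norm (f x) powr s) \<le> (LINT x|lebesgue_on \<Omega>. c * F x)"
    using assms(3,5) i by (intro integral_mono_AE) auto
  then show "lp_norm \<Omega> s f \<le> (c * (LINT x|lebesgue_on \<Omega>. F x)) powr (1 / s)"
    unfolding lp_norm_def using assms(1) by (intro powr_mono2) auto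
qed

lemma lp_norm_le_mult:
  assumes "s > 0" "0 \<le> L" "integrable (lebesgue_on \<Omega>) (\<lambda>x. norm (h x) powr s)"
    and "f \<in> borel_measurable (lebesgue_on \<Omega>)"
    and "AE x in lebesgue_on \<Omega>. norm (f x) \<le> L * norm (h x)"
  shows "lp_norm \<Omega> s f \<le> L * lp_norm \<Omega> s h"
proof -
  have "AE x in lebesgue_on \<Omega>. norm (f x) powr s \<le> L powr s * norm (h x) powr s"
    using assms(5)
  proof eventually_elim
    case (elim x)
    then have "norm (f x) powr s \<le> (L * norm (h x)) powr s"
      using assms(1) by (intro powr_mono2) auto
    then show ?case using assms(2) by (simp add: powr_mult)
  qed
  from lp_norm_le(2)[OF assms(1) _ assms(3,4) this]
  have "lp_norm \<Omega> s f \<le> (L powr s * (LINT x|lebesgue_on \<Omega>. norm (h x) powr s)) powr (1 / s)" by simp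
  also have "\<dots> = L * lp_norm \<Omega> s h"
    using assms(1,2) by (simp add: powr_mult powr_powr lp_norm_def)
  finally show ?thesis .
qed

definition flux :: "plane set \<Rightarrow> (real \<Rightarrow> real) \<Rightarrow> (plane \<Rightarrow> real) \<Rightarrow> (plane \<Rightarrow> real) \<Rightarrow> plane \<Rightarrow> plane" where
  "flux \<Omega> \<kappa> z u x = \<kappa> (z x) *\<^sub>R grad \<Omega> u x"

locale bounded_coefficient = bounded_domain +
  fixes \<kappa> :: "real \<Rightarrow> real" and \<kappa>min \<kappa>max :: real
  assumes \<kappa>_cont: "continuous_on UNIV \<kappa>" and \<kappa>min_pos: "0 < \<kappa>min"
    and \<kappa>_bounds: "\<kappa>min \<le> \<kappa> \<zeta>" "\<kappa> \<zeta> \<le> \<kappa>max"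
begin

lemma \<kappa>max_pos: "0 < \<kappa>max"
  using \<kappa>min_pos \<kappa>_bounds[of 0] by linarith

lemma \<kappa>_measurable: "z \<in> borel_measurable M \<Longrightarrow> (\<lambda>x. \<kappa> (z x)) \<in> borel_measurable M"
  using measurable_compose[of z M borel \<kappa> borel] borel_measurable_continuous_onI[OF \<kappa>_cont] by simp

lemma abs_\<kappa>_le: "\<bar>\<kappa> \<zeta>\<bar> \<le> \<kappa>max"
  using \<kappa>_bounds[of \<zeta>] \<kappa>min_pos by linarith

lemma \<kappa>_scaleR_square_integrable:
  assumes "z \<in> borel_measurable M" "square_integrable \<Omega> G"
  shows "square_integrable \<Omega> (\<lambda>x. \<kappa> (z x) *\<^sub>R G x)"
proof (rule square_integrable_bound[OF assms(2), of _ \<kappa>max])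
  show "(\<lambda>x. \<kappa> (z x) *\<^sub>R G x) \<in> borel_measurable M"
    using \<kappa>_measurable[OF assms(1)] square_integrableD(1)[OF assms(2)] by (rule borel_measurable_scaleR)
qed (use abs_\<kappa>_le in \<open>auto intro!: AE_I2 mult_right_mono\<close>)

lemma flux_square_integrable:
  assumes "z \<in> borel_measurable M" "u \<in> h_space \<Omega> 1"
  shows "square_integrable \<Omega> (flux \<Omega> \<kappa> z u)"
  unfolding flux_def[abs_def]
  by (rule \<kappa>_scaleR_square_integrable[OF assms(1) h_space_square_integrable(2)[OF assms(2)]])

text \<open>Both fluxes have the same weak divergence, so their difference \<open>W\<close> is
  orthogonal to the gradient of v = u1 - u2. Since \<open>W\<close> is \<kappa>(z1) grad v plus the
  coefficient error \<open>F\<close>, coercivity bounds grad v by \<open>F\<close>, and then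
  \<open>W\<close> by \<open>F\<close>.\<close>

lemma flux_difference:
  assumes z: "z1 \<in> borel_measurable M" "z2 \<in> borel_measurable M"
    and u: "elliptic_solution \<Omega> \<Gamma> \<kappa> g z1 u1" "elliptic_solution \<Omega> \<Gamma> \<kappa> g z2 u2"
  shows "l2_norm \<Omega> (\<lambda>x. flux \<Omega> \<kappa> z1 u1 x - flux \<Omega> \<kappa> z2 u2 x)
    \<le> (1 + \<kappa>max / \<kappa>min) * l2_norm \<Omega> (\<lambda>x. (\<kappa> (z1 x) - \<kappa> (z2 x)) *\<^sub>R grad \<Omega> u2 x)"
proof -
  have ud: "u1 \<in> h1d \<Omega> \<Gamma>" "u2 \<in> h1d \<Omega> \<Gamma>" using u by (auto simp: elliptic_solution_def)
  note uh = ud[THEN h1d_h_space]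
  define v where "v = (\<lambda>x. u1 x - u2 x)"
  have vd: "v \<in> h1d \<Omega> \<Gamma>" unfolding v_def by (rule h1d_diff[OF ud])
  note vh = h1d_h_space[OF vd]
  have gv: "AE x in M. grad \<Omega> v x = grad \<Omega> u1 x - grad \<Omega> u2 x"
    unfolding v_def by (rule h_space_diff(2)[OF uh])
  define F where "F = (\<lambda>x. (\<kappa> (z1 x) - \<kappa> (z2 x)) *\<^sub>R grad \<Omega> u2 x)"
  define V where "V = (\<lambda>x. \<kappa> (z1 x) *\<^sub>R grad \<Omega> v x)"
  define W where "W = (\<lambda>x. flux \<Omega> \<kappa> z1 u1 x - flux \<Omega> \<kappa> z2 u2 x)"
  note f = flux_square_integrable[OF z(1) uh(1)] flux_square_integrable[OF z(2) uh(2)]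
  have Fs: "square_integrable \<Omega> F"
    using square_integrable_diff[OF flux_square_integrable[OF z(1) uh(2)] f(2)]
    by (simp add: F_def flux_def scaleR_diff_left)
  have Vs: "square_integrable \<Omega> V"
    unfolding V_def by (rule \<kappa>_scaleR_square_integrable[OF z(1) h_space_square_integrable(2)[OF vh]])
  have Ws: "square_integrable \<Omega> W" unfolding W_def by (rule square_integrable_diff[OF f])
  have WVF: "AE x in M. W x = V x + F x"
    using gv by eventually_elim (simp add: W_def V_def F_def flux_def scaleR_diff_left scaleR_diff_right)
  note gs = h_space_square_integrable(2)[OF vh]
  have "l2_inner \<Omega> (flux \<Omega> \<kappa> z1 u1) (grad \<Omega> v) = l2_inner \<Omega> g v"
    "l2_inner \<Omega> (flux \<Omega> \<kappa> z2 u2) (grad \<Omega> v) = l2_inner \<Omega> g v"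
    using u vd by (auto simp: elliptic_solution_def form_B_def flux_def[abs_def])
  then have "l2_inner \<Omega> W (grad \<Omega> v) = 0"
    unfolding W_def using l2_inner_diff_left[OF f gs] by simp
  moreover have "l2_inner \<Omega> W (grad \<Omega> v) = l2_inner \<Omega> (\<lambda>x. V x + F x) (grad \<Omega> v)"
    unfolding l2_inner_def
  proof (rule integral_cong_AE)
    show "(\<lambda>x. W x \<bullet> grad \<Omega> v x) \<in> borel_measurable M" "(\<lambda>x. (V x
        + F x) \<bullet> grad \<Omega> v x) \<in> borel_measurable M"
      using square_integrable_inner[OF Ws gs] square_integrable_inner[OF square_integrable_add[OF Vs
          Fs] gs] by auto
    show "AE x in M. W x \<bullet> grad \<Omega> v x = (V x + F x) \<bullet> grad \<Omega> v x"
      using WVF by eventually_elim simp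
  qed
  ultimately have VF: "l2_inner \<Omega> V (grad \<Omega> v) = - l2_inner \<Omega> F (grad \<Omega> v)"
    using l2_inner_add_left[OF Vs Fs gs] by simp
  have "\<kappa>min * (l2_norm \<Omega> (grad \<Omega> v))\<^sup>2 \<le> l2_inner \<Omega> V (grad \<Omega> v)"
  proof -
    have "(LINT x|M. \<kappa>min * (norm (grad \<Omega> v x))\<^sup>2) \<le> (LINT x|M. V x \<bullet> grad \<Omega> v x)"
    proof (rule integral_mono)
      show "integrable M (\<lambda>x. \<kappa>min * (norm (grad \<Omega> v x))\<^sup>2)" using square_integrableD(2)[OF gs] by simp
      show "integrable M (\<lambda>x. V x \<bullet> grad \<Omega> v x)" by (rule square_integrable_inner[OF Vs gs])
      show "\<kappa>min * (norm (grad \<Omega> v x))\<^sup>2 \<le> V x \<bullet> grad \<Omega> v x" for x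
        using \<kappa>_bounds(1)[of "z1 x"] by (simp add: V_def power2_norm_eq_inner mult_right_mono)
    qed
    then show ?thesis by (simp add: l2_norm_power2 l2_inner_def)
  qed
  also have "\<dots> \<le> l2_norm \<Omega> F * l2_norm \<Omega> (grad \<Omega> v)"
    unfolding VF using l2_cauchy_schwarz[OF Fs gs] by linarith
  finally have "\<kappa>min * l2_norm \<Omega> (grad \<Omega> v) * l2_norm \<Omega> (grad \<Omega> v) \<le> l2_norm \<Omega> F * l2_norm \<Omega> (grad \<Omega> v)"
    by (simp add: power2_eq_square mult.assoc)
  \<comment> \<open>Division by the gradient norm; if that norm is zero, the bound is
    trivial.\<close>
  then have "\<kappa>min * l2_norm \<Omega> (grad \<Omega> v) \<le> l2_norm \<Omega> F"
    using lp_norm_nonneg[of \<Omega> 2 "grad \<Omega> v"]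
        by (cases "l2_norm \<Omega> (grad \<Omega> v) = 0") (auto simp: mult_le_cancel_right)
  then have gb: "l2_norm \<Omega> (grad \<Omega> v) \<le> l2_norm \<Omega> F / \<kappa>min"
    using \<kappa>min_pos by (simp add: field_simps)
  have "l2_norm \<Omega> V \<le> \<kappa>max * l2_norm \<Omega> (grad \<Omega> v)"
  proof (rule l2_norm_bound[OF gs])
    show "V \<in> borel_measurable M" by (rule square_integrableD(1)[OF Vs])
    show "AE x in M. norm (V x) \<le> \<kappa>max * norm (grad \<Omega> v x)"
      using abs_\<kappa>_le by (auto simp: V_def intro!: AE_I2 mult_right_mono)
  qed (use \<kappa>max_pos in simp)
  also have "\<dots> \<le> \<kappa>max * (l2_norm \<Omega> F / \<kappa>min)"
    using gb \<kappa>max_pos by (intro mult_left_mono) auto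
  finally have Vb: "l2_norm \<Omega> V \<le> \<kappa>max / \<kappa>min * l2_norm \<Omega> F" by simp
  have "l2_norm \<Omega> W = l2_norm \<Omega> (\<lambda>x. V x + F x)"
    by (rule l2_norm_cong[OF square_integrable_add[OF Vs Fs] square_integrableD(1)[OF Ws]])
      (use WVF in eventually_elim, simp)
  also have "\<dots> \<le> l2_norm \<Omega> V + l2_norm \<Omega> F" by (rule l2_norm_triangle[OF Vs Fs])
  also have "\<dots> \<le> (1 + \<kappa>max / \<kappa>min) * l2_norm \<Omega> F" using Vb by (simp add: algebra_simps)
  finally show ?thesis unfolding W_def F_def .
qed

end

section \<open>Gradients in L^r and the convection identity\<close>

context bounded_domain
begin

text \<open>Membership in \<open>sobolev\<close> provides some r-integrable weak derivatives; the
  chosen gradient agrees with them almost everywhere and inherits the integrability.\<close>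

lemma grad_lp:
  assumes "u \<in> h_space \<Omega> 1" "u \<in> sobolev \<Omega> 1 r" "r > 1"
  shows "integrable M (\<lambda>x. norm (grad \<Omega> u x) powr r)"
    "lp_norm \<Omega> r (grad \<Omega> u) \<le> sobolev_norm \<Omega> 1 r u"
proof -
  have D: "a + b \<le> 1 \<Longrightarrow> \<exists>v\<in>lp_space \<Omega> r. has_weak_deriv \<Omega> a b u v" for a b
    using assms(2) by (simp add: sobolev_def)
  obtain v1 where v1: "v1 \<in> lp_space \<Omega> r" "has_weak_deriv \<Omega> 1 0 u v1" using D[of 1 0] by auto
  obtain v2 where v2: "v2 \<in> lp_space \<Omega> r" "has_weak_deriv \<Omega> 0 1 u v2" using D[of 0 1] by auto
  have i: "integrable M (\<lambda>x. \<bar>v1 x\<bar> powr r + \<bar>v2 x\<bar> powr r)"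
    using v1(1) v2(1) by (simp add: lp_space_def)
  have ae: "AE x in M. norm (grad \<Omega> u x) powr r \<le> 2 powr r * (\<bar>v1 x\<bar> powr r + \<bar>v2 x\<bar> powr r)"
    using weak_deriv_AE[OF v1(2)] weak_deriv_AE[OF v2(2)]
  proof eventually_elim
    case (elim x)
    have "norm (grad \<Omega> u x) \<le> \<bar>v1 x\<bar> + \<bar>v2 x\<bar>"
      using norm_plane_le[of "grad \<Omega> u x"] elim by (simp add: grad_def)
    also have "\<dots> \<le> 2 * max \<bar>v1 x\<bar> \<bar>v2 x\<bar>" by simp
    finally have "norm (grad \<Omega> u x) powr r \<le> (2 * max \<bar>v1 x\<bar> \<bar>v2 x\<bar>) powr r"
      using assms(3) by (intro powr_mono2) auto
    also have "\<dots> = 2 powr r * (max \<bar>v1 x\<bar> \<bar>v2 x\<bar>) powr r" by (simp add: powr_mult)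
    also have "\<dots> \<le> 2 powr r * (\<bar>v1 x\<bar> powr r + \<bar>v2 x\<bar> powr r)"
      by (intro mult_left_mono) (auto simp: max_def)
    finally show ?case .
  qed
  show "integrable M (\<lambda>x. norm (grad \<Omega> u x) powr r)"
    by (rule lp_norm_le(1)[OF _ _ i weak_grad_measurable[OF weak_grad_grad[OF assms(1)]] ae])
      (use assms(3) in auto)
  have "lp_norm \<Omega> r (grad \<Omega> u) = (lp_norm \<Omega> r (deriv_abs \<Omega> 1 u) powr r) powr (1 / r)"
    using assms(3) by (simp add: powr_powr lp_norm_def[of _ _ "grad \<Omega> u"] lp_norm_def[of _ _
        "deriv_abs \<Omega> 1 u"] deriv_abs_1)
  \<comment> \<open>The Sobolev norm adds the order-zero term, which is nonnegative.\<close>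
  also have "\<dots> \<le> sobolev_norm \<Omega> 1 r u"
    unfolding sobolev_norm_def using assms(3) by (intro powr_mono2) (auto simp: One_nat_def)
  finally show "lp_norm \<Omega> r (grad \<Omega> u) \<le> sobolev_norm \<Omega> 1 r u" .
qed

text \<open>Cauchy-Schwarz for the squares of the two functions.\<close>

lemma fourth_power_product:
  fixes u v :: "plane \<Rightarrow> real"
  assumes "u \<in> borel_measurable M" "v \<in> borel_measurable M"
    and "integrable M (\<lambda>x. (u x) ^ 4)" "integrable M (\<lambda>x. (v x) ^ 4)"
  shows "square_integrable \<Omega> (\<lambda>x. u x * v x)"
    "(l2_norm \<Omega> (\<lambda>x. u x * v x))\<^sup>2 \<le> sqrt (LINT x|M. (u x) ^ 4) * sqrt (LINT x|M. (v x) ^ 4)"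
proof -
  have p: "(x\<^sup>2)\<^sup>2 = x ^ 4" for x :: real by (simp flip: power_mult)
  have s: "square_integrable \<Omega> (\<lambda>x. (u x)\<^sup>2)" "square_integrable \<Omega> (\<lambda>x. (v x)\<^sup>2)"
    using assms by (auto simp: square_integrable_def p)
  have "integrable M (\<lambda>x. (u x)\<^sup>2 * (v x)\<^sup>2)" by (rule square_integrable_times[OF s])
  then show "square_integrable \<Omega> (\<lambda>x. u x * v x)"
    using assms(1,2) by (simp add: square_integrable_def power_mult_distrib)
  show "(l2_norm \<Omega> (\<lambda>x. u x * v x))\<^sup>2 \<le> sqrt (LINT x|M. (u x) ^ 4) * sqrt (LINT x|M. (v x) ^ 4)"
    using l2_cauchy_schwarz[OF s]
    by (simp add: l2_norm_power2 power_mult_distrib l2_inner_def l2_norm_eq p)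
qed

text \<open>For fixed \<open>n\<close> the error is itself the limit of differences of smooth
  functions as m grows. The L^4 bound therefore applies to errors, which is how H^1 convergence
  becomes L^4 convergence.\<close>

lemma smooth_approximation_diff:
  assumes "smooth_approximation u \<phi>"
  shows "smooth_approximation (\<lambda>x. \<phi> n x - u x) (\<lambda>m x. \<phi> n x - \<phi> m x)"
proof -
  have u: "u \<in> h_space \<Omega> 1" and \<phi>: "smooth (\<phi> m)" for m
    using assms by (auto simp: smooth_approximation_def)
  have "(\<lambda>x. (\<phi> n x - \<phi> m x) - (\<phi> n x - u x)) = (\<lambda>x. 0 * (\<phi> m x - u x) + (-1) * (\<phi> m x - u x))" for m
    by auto
  moreover have "norm (h1_norm \<Omega> (\<lambda>x. 0 * (\<phi> m x - u x) + (-1) * (\<phi> m x - u x)))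
      \<le> h1_norm \<Omega> (\<lambda>x. \<phi> m x - u x)" for m
  proof -
    note d = h_space_diff(1)[OF smooth_h_space[OF \<phi>[of m]] u]
    have "h1_norm \<Omega> (\<lambda>x. 0 * (\<phi> m x - u x) + (-1) * (\<phi> m x - u x)) \<le> h1_norm \<Omega> (\<lambda>x. \<phi> m x - u x)"
      using h_space_linear_combination(3)[OF d d, of 0 "-1"] by simp
    moreover have "0 \<le> h1_norm \<Omega> (\<lambda>x. 0 * (\<phi> m x - u x) + (-1) * (\<phi> m x - u x))"
      by (rule sobolev_norm_nonneg)
    ultimately show ?thesis by simp
  qed
  moreover have "(\<lambda>m. h1_norm \<Omega> (\<lambda>x. \<phi> m x - u x)) \<longlonglongrightarrow> 0"
    using assms by (simp add: smooth_approximation_def)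
  ultimately have "(\<lambda>m. h1_norm \<Omega> (\<lambda>x. (\<phi> n x - \<phi> m x) - (\<phi> n x - u x))) \<longlonglongrightarrow> 0"
    using Lim_null_comparison[OF always_eventually[OF allI], of
        "\<lambda>m. h1_norm \<Omega> (\<lambda>x. 0 * (\<phi> m x - u x) + (-1) * (\<phi> m x - u x))"
        "\<lambda>m. h1_norm \<Omega> (\<lambda>x. \<phi> m x - u x)" sequentially]
    by (simp only:)
  moreover have "smooth (\<lambda>x. \<phi> n x - \<phi> m x)" for m
    using smooth_linear_combination[OF \<phi>[of n] \<phi>[of m], of 1 "-1"] by simp
  ultimately show ?thesis
    unfolding smooth_approximation_def using h_space_diff(1)[OF smooth_h_space[OF \<phi>] u] by blast
qed

text \<open>Formally \<open>e \<nabla>e = \<nabla>(e\<^sup>2) / 2\<close>, but \<open>e\<^sup>2\<close> need not be an admissible test function; the products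
  \<open>\<phi>\<^sub>n e\<close> with smooth \<open>\<phi>\<^sub>n\<close> approximating \<open>e\<close> are.\<close>

lemma convection_identity:
  assumes lip: "lipschitz_domain \<Omega>"
    and exps: "2 < r" "2 < s" "1 / r + 1 / s = 1 / 2"
    and gn: "gagliardo_nirenberg_constant \<Omega> s 2 K"
    and e: "e \<in> h1d \<Omega> \<Gamma>" and g: "square_integrable \<Omega> g"
    and W: "square_integrable \<Omega> W" "integrable M (\<lambda>x. norm (W x) powr r)"
    and sol: "\<And>\<psi>. \<psi> \<in> h1d \<Omega> \<Gamma> \<Longrightarrow> l2_inner \<Omega> W (grad \<Omega> \<psi>) = l2_inner \<Omega> g \<psi>"
  shows "square_integrable \<Omega> (\<lambda>x. e x *\<^sub>R W x)" "square_integrable \<Omega> (\<lambda>x. e x * e x)"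
    "2 * l2_inner \<Omega> (\<lambda>x. e x *\<^sub>R W x) (grad \<Omega> e) = l2_inner \<Omega> g (\<lambda>x. e x * e x)"
proof -
  obtain \<phi> where ap: "smooth_approximation e \<phi>" using h1d_smooth_approximation[OF e] by blast
  have eh: "e \<in> h_space \<Omega> 1" and sm: "smooth (\<phi> n)" and h0: "(\<lambda>n. h1_norm \<Omega> (\<lambda>x. \<phi> n x - e x)) \<longlonglongrightarrow> 0" for n
    using ap by (auto simp: smooth_approximation_def)
  note \<phi>h = smooth_h_space[OF sm]
  note dh = h_space_diff(1)[OF \<phi>h eh]
  have gns: "u \<in> lp_space \<Omega> s" "lp_norm \<Omega> s u \<le> K * l2_norm \<Omega> u powr (2 / s) * h1_norm \<Omega> u powr (1
      - 2 / s)"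
    if "u \<in> h_space \<Omega> 1" for u using gn that by (auto simp: gagliardo_nirenberg_constant_def)
  have lps: "u \<in> borel_measurable M" "integrable M (\<lambda>x. \<bar>u x\<bar> powr s)" if "u \<in> h_space \<Omega> 1" for u
    using gns(1)[OF that] by (auto simp: lp_space_def)
  note Wm = square_integrableD(1)[OF W(1)]
  note hold = l2_holder[OF exps Wm W(2) lps]
  show Es: "square_integrable \<Omega> (\<lambda>x. e x *\<^sub>R W x)" by (rule hold(1)[OF eh eh])
  obtain C where C: "C \<ge> 0" "\<And>u \<phi>. smooth_approximation u \<phi> \<Longrightarrow>
    integrable M (\<lambda>x. (u x) ^ 4) \<and> (LINT x|M. (u x) ^ 4) \<le> C * (h1_norm \<Omega> u) ^ 4"
    by (rule fourth_power_embedding[OF lip]) blast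
  have e4: "integrable M (\<lambda>x. (e x) ^ 4)" using C(2)[OF ap] by blast
  have d4: "integrable M (\<lambda>x. (\<phi> n x - e x) ^ 4)" "(LINT x|M. (\<phi> n x - e x) ^ 4)
      \<le> C * (h1_norm \<Omega> (\<lambda>x. \<phi> n x - e x)) ^ 4" for n
    using C(2)[OF smooth_approximation_diff[OF ap, of n]] by auto
  have em: "e \<in> borel_measurable M" by (rule lps(1)[OF eh])
  show ees: "square_integrable \<Omega> (\<lambda>x. e x * e x)" by (rule fourth_power_product(1)[OF em em e4 e4])
  have s0: "s > 0" using exps by simp
  note ge = h_space_square_integrable(2)[OF eh]
  have ev: "eventually P sequentially" if "\<And>n. P n" for P :: "nat \<Rightarrow> bool"
    by (rule always_eventually, rule allI, rule that)
  \<comment> \<open>The error \<phi> n - e is measured in L^s by Gagliardo-Nirenberg and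
    \<open>W\<close> in L^r, so their product is small in L^2.\<close>
  have lim1: "(\<lambda>n. l2_inner \<Omega> (\<lambda>x. \<phi> n x *\<^sub>R W x) (grad \<Omega> e)) \<longlonglongrightarrow> l2_inner \<Omega> (\<lambda>x. e x *\<^sub>R W x) (grad \<Omega> e)"
  proof (rule LIM_zero_cancel, rule Lim_null_comparison)
    have "norm (l2_inner \<Omega> (\<lambda>x. \<phi> n x *\<^sub>R W x) (grad \<Omega> e) - l2_inner \<Omega> (\<lambda>x. e x *\<^sub>R W x) (grad \<Omega> e))
        \<le> \<bar>K\<bar> * h1_norm \<Omega> (\<lambda>x. \<phi> n x - e x) * lp_norm \<Omega> r W * l2_norm \<Omega> (grad \<Omega> e)" for n
    proof -
      let ?d = "\<lambda>x. \<phi> n x - e x"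
      have ds: "square_integrable \<Omega> (\<lambda>x. ?d x *\<^sub>R W x)" by (rule hold(1)[OF dh dh])
      have "l2_inner \<Omega> (\<lambda>x. \<phi> n x *\<^sub>R W x) (grad \<Omega> e) - l2_inner \<Omega> (\<lambda>x. e x *\<^sub>R W x) (grad \<Omega> e)
          = l2_inner \<Omega> (\<lambda>x. ?d x *\<^sub>R W x) (grad \<Omega> e)"
        using l2_inner_diff_left[OF square_integrable_smooth_scaleR[OF sm W(1)] Es ge]
            by (simp add: scaleR_diff_left)
      then have "norm (l2_inner \<Omega> (\<lambda>x. \<phi> n x *\<^sub>R W x) (grad \<Omega> e)
          - l2_inner \<Omega> (\<lambda>x. e x *\<^sub>R W x) (grad \<Omega> e))
          \<le> l2_norm \<Omega> (\<lambda>x. ?d x *\<^sub>R W x) * l2_norm \<Omega> (grad \<Omega> e)"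
        using l2_cauchy_schwarz[OF ds ge] by simp
      also have "l2_norm \<Omega> (\<lambda>x. ?d x *\<^sub>R W x) \<le> lp_norm \<Omega> s ?d * lp_norm \<Omega> r W"
          by (rule hold(2)[OF dh dh])
      also have "lp_norm \<Omega> s ?d \<le> \<bar>K\<bar> * h1_norm \<Omega> ?d"
      proof -
        let ?h = "h1_norm \<Omega> ?d"
        have h: "?h \<ge> 0" by (rule sobolev_norm_nonneg)
        have "lp_norm \<Omega> s ?d \<le> K * (l2_norm \<Omega> ?d powr (2 / s) * ?h powr (1 - 2 / s))"
          using gns(2)[OF dh] by (simp add: mult.assoc)
        \<comment> \<open>No sign is assumed for \<open>K\<close>; the absolute value makes the
          following monotonicity step valid.\<close>
        also have "\<dots> \<le> \<bar>K\<bar> * (l2_norm \<Omega> ?d powr (2 / s) * ?h powr (1 - 2 / s))"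
          by (intro mult_right_mono) auto
        also have "\<dots> \<le> \<bar>K\<bar> * (?h powr (2 / s) * ?h powr (1 - 2 / s))"
          using s0 by (intro mult_left_mono mult_right_mono powr_mono2 l2_norm_le_h1_norm dh) auto
        also have "?h powr (2 / s) * ?h powr (1 - 2 / s) = ?h"
          using h by (simp flip: powr_add)
        finally show ?thesis .
      qed
      finally show ?thesis by (simp add: mult_right_mono)
    qed
    then show "\<forall>\<^sub>F n in sequentially. norm (l2_inner \<Omega> (\<lambda>x. \<phi> n x *\<^sub>R W x) (grad \<Omega> e)
        - l2_inner \<Omega> (\<lambda>x. e x *\<^sub>R W x) (grad \<Omega> e))
        \<le> \<bar>K\<bar> * h1_norm \<Omega> (\<lambda>x. \<phi> n x - e x) * lp_norm \<Omega> r W * l2_norm \<Omega> (grad \<Omega> e)" by (rule ev)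
    show "(\<lambda>n. \<bar>K\<bar> * h1_norm \<Omega> (\<lambda>x. \<phi> n x - e x) * lp_norm \<Omega> r W * l2_norm \<Omega> (grad \<Omega> e)) \<longlonglongrightarrow> 0"
      using h0 by (auto intro!: tendsto_eq_intros)
  qed
  have cg: "square_integrable \<Omega> (classical_grad (\<phi> n))" for n
      by (rule square_integrable_classical_grad[OF sm])
  have lim2: "(\<lambda>n. l2_inner \<Omega> (\<lambda>x. e x *\<^sub>R W x) (classical_grad (\<phi> n))) \<longlonglongrightarrow> l2_inner \<Omega> (\<lambda>x. e x *\<^sub>R W
      x) (grad \<Omega> e)"
  proof (rule LIM_zero_cancel, rule Lim_null_comparison)
    have "norm (l2_inner \<Omega> (\<lambda>x. e x *\<^sub>R W x) (classical_grad (\<phi> n))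
        - l2_inner \<Omega> (\<lambda>x. e x *\<^sub>R W x) (grad \<Omega> e))
        \<le> l2_norm \<Omega> (\<lambda>x. e x *\<^sub>R W x) * h1_norm \<Omega> (\<lambda>x. \<phi> n x - e x)" for n
    proof -
      have wg: "weak_grad \<Omega> (\<lambda>x. \<phi> n x - e x) (\<lambda>x. classical_grad (\<phi> n) x - grad \<Omega> e x)"
        using weak_grad_linear_combination[OF weak_grad_smooth[OF sm[of n]] weak_grad_grad[OF eh],
            of 1 "-1"] by simp
      have "norm (l2_inner \<Omega> (\<lambda>x. e x *\<^sub>R W x) (classical_grad (\<phi> n))
          - l2_inner \<Omega> (\<lambda>x. e x *\<^sub>R W x) (grad \<Omega> e))
        \<le> l2_norm \<Omega> (\<lambda>x. e x *\<^sub>R W x) * l2_norm \<Omega> (\<lambda>x. classical_grad (\<phi> n) x - grad \<Omega> e x)"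
        using l2_inner_diff_right[OF cg ge Es] l2_cauchy_schwarz[OF Es square_integrable_diff[OF cg
            ge]] by simp
      also have "\<dots> \<le> l2_norm \<Omega> (\<lambda>x. e x *\<^sub>R W x) * h1_norm \<Omega> (\<lambda>x. \<phi> n x - e x)"
        unfolding weak_grad_l2_norm[OF wg, symmetric]
            by (intro mult_left_mono l2_norm_grad_le_h1_norm dh) auto
      finally show ?thesis .
    qed
    then show "\<forall>\<^sub>F n in sequentially. norm (l2_inner \<Omega> (\<lambda>x. e x *\<^sub>R W x) (classical_grad (\<phi> n))
        - l2_inner \<Omega> (\<lambda>x. e x *\<^sub>R W x) (grad \<Omega> e))
        \<le> l2_norm \<Omega> (\<lambda>x. e x *\<^sub>R W x) * h1_norm \<Omega> (\<lambda>x. \<phi> n x - e x)" by (rule ev)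
    show "(\<lambda>n. l2_norm \<Omega> (\<lambda>x. e x *\<^sub>R W x) * h1_norm \<Omega> (\<lambda>x. \<phi> n x - e x)) \<longlonglongrightarrow> 0"
      using h0 by (auto intro!: tendsto_eq_intros)
  qed
  have se: "square_integrable \<Omega> (\<lambda>x. \<phi> n x * e x)" for n
    by (rule square_integrable_smooth_times[OF sm h_space_square_integrable(1)[OF eh]])
  \<comment> \<open>Since \<open>g\<close> is only square integrable, the product of the error with
    \<open>e\<close> must be small in L^2; this uses both factors in L^4.\<close>
  have lim3: "(\<lambda>n. l2_inner \<Omega> g (\<lambda>x. \<phi> n x * e x)) \<longlonglongrightarrow> l2_inner \<Omega> g (\<lambda>x. e x * e x)"
  proof (rule LIM_zero_cancel, rule Lim_null_comparison)
    let ?B = "\<lambda>n. l2_norm \<Omega> g * sqrt (sqrt (C * (h1_norm \<Omega> (\<lambda>x. \<phi> n x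
        - e x)) ^ 4) * sqrt (LINT x|M. (e x) ^ 4))"
    have "norm (l2_inner \<Omega> g (\<lambda>x. \<phi> n x * e x) - l2_inner \<Omega> g (\<lambda>x. e x * e x)) \<le> ?B n" for n
    proof -
      have dm: "(\<lambda>x. \<phi> n x - e x) \<in> borel_measurable M" by (rule lps(1)[OF dh])
      note fp = fourth_power_product[OF dm em d4(1) e4]
      have "l2_inner \<Omega> g (\<lambda>x. \<phi> n x * e x) - l2_inner \<Omega> g (\<lambda>x. e x * e x) = l2_inner \<Omega> g (\<lambda>x. (\<phi> n x
          - e x) * e x)"
        using l2_inner_diff_right[OF se[of n] ees g] by (simp add: left_diff_distrib)
      then have "norm (l2_inner \<Omega> g (\<lambda>x. \<phi> n x * e x) - l2_inner \<Omega> g (\<lambda>x. e x * e x))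
          \<le> l2_norm \<Omega> g * l2_norm \<Omega> (\<lambda>x. (\<phi> n x - e x) * e x)"
        using l2_cauchy_schwarz[OF g fp(1)] by simp
      also have "\<dots> \<le> ?B n"
      proof (intro mult_left_mono real_le_rsqrt)
        have "(l2_norm \<Omega> (\<lambda>x. (\<phi> n x - e x) * e x))\<^sup>2 \<le> sqrt (LINT x|M. (\<phi> n x
            - e x) ^ 4) * sqrt (LINT x|M. (e x) ^ 4)"
          by (rule fp(2))
        also have "\<dots> \<le> sqrt (C * (h1_norm \<Omega> (\<lambda>x. \<phi> n x - e x)) ^ 4) * sqrt (LINT x|M. (e x) ^ 4)"
          by (intro mult_right_mono real_sqrt_le_mono d4(2) real_sqrt_ge_zero integral_nonneg_AE
              AE_I2) auto
        finally show "(l2_norm \<Omega> (\<lambda>x. (\<phi> n x - e x) * e x))\<^sup>2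
          \<le> sqrt (C * (h1_norm \<Omega> (\<lambda>x. \<phi> n x - e x)) ^ 4) * sqrt (LINT x|M. (e x) ^ 4)" .
      qed simp
      finally show ?thesis .
    qed
    then show "\<forall>\<^sub>F n in sequentially. norm (l2_inner \<Omega> g (\<lambda>x. \<phi> n x * e x)
        - l2_inner \<Omega> g (\<lambda>x. e x * e x)) \<le> ?B n" by (rule ev)
    have "?B \<longlonglongrightarrow> l2_norm \<Omega> g * sqrt (sqrt (C * 0 ^ 4) * sqrt (LINT x|M. (e x) ^ 4))"
      by (intro tendsto_mult tendsto_const tendsto_real_sqrt tendsto_power h0)
    then show "?B \<longlonglongrightarrow> 0" by simp
  qed
  \<comment> \<open>The product rule splits the equation tested with the smooth multiple of
    \<open>e\<close> into two terms. Both have the same limit, hence the factor 2 in the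
    identity.\<close>
  have eq: "l2_inner \<Omega> g (\<lambda>x. \<phi> n x * e x)
      = l2_inner \<Omega> (\<lambda>x. \<phi> n x *\<^sub>R W x) (grad \<Omega> e) + l2_inner \<Omega> (\<lambda>x. e x *\<^sub>R W x) (classical_grad (\<phi>
          n))" for n
  proof -
    note wg = weak_grad_smooth_times[OF sm[of n] weak_grad_grad[OF eh]]
    have 1: "integrable M (\<lambda>x. (\<phi> n x *\<^sub>R W x) \<bullet> grad \<Omega> e x)"
      by (rule square_integrable_inner[OF square_integrable_smooth_scaleR[OF sm W(1)] ge])
    have 2: "integrable M (\<lambda>x. (e x *\<^sub>R W x) \<bullet> classical_grad (\<phi> n) x)"
      by (rule square_integrable_inner[OF Es cg])
    have wgm: "grad \<Omega> (\<lambda>x. \<phi> n x * e x) \<in> borel_measurable M" by (rule weak_grad_measurable[OF wg])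
    have "l2_inner \<Omega> g (\<lambda>x. \<phi> n x * e x) = l2_inner \<Omega> W (grad \<Omega> (\<lambda>x. \<phi> n x * e x))"
      by (rule sol[OF h1d_smooth_times[OF sm e], symmetric])
    also have "\<dots> = (LINT x|M. (\<phi> n x *\<^sub>R W x) \<bullet> grad \<Omega> e x + (e x *\<^sub>R W x) \<bullet> classical_grad (\<phi> n) x)"
      unfolding l2_inner_def
    proof (rule integral_cong_AE)
      show "(\<lambda>x. W x \<bullet> grad \<Omega> (\<lambda>x. \<phi> n x * e x) x) \<in> borel_measurable M"
        using Wm wgm by simp
      show "(\<lambda>x. (\<phi> n x *\<^sub>R W x) \<bullet> grad \<Omega> e x + (e x *\<^sub>R W x) \<bullet> classical_grad (\<phi> n) x) \<in>
          borel_measurable M"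
        using 1 2 by auto
      show "AE x in M. W x \<bullet> grad \<Omega> (\<lambda>x. \<phi> n x * e x) x
          = (\<phi> n x *\<^sub>R W x) \<bullet> grad \<Omega> e x + (e x *\<^sub>R W x) \<bullet> classical_grad (\<phi> n) x"
        using weak_grad_AE[OF wg] by eventually_elim (simp add: inner_add_right)
    qed
    also have "\<dots> = l2_inner \<Omega> (\<lambda>x. \<phi> n x *\<^sub>R W x) (grad \<Omega> e)
        + l2_inner \<Omega> (\<lambda>x. e x *\<^sub>R W x) (classical_grad (\<phi> n))"
      using 1 2 by (simp add: l2_inner_def)
    finally show ?thesis .
  qed
  have "(\<lambda>n. l2_inner \<Omega> g (\<lambda>x. \<phi> n x * e x)) \<longlonglongrightarrow>
      l2_inner \<Omega> (\<lambda>x. e x *\<^sub>R W x) (grad \<Omega> e) + l2_inner \<Omega> (\<lambda>x. e x *\<^sub>R W x) (grad \<Omega> e)"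
    unfolding eq by (intro tendsto_add lim1 lim2)
  from LIMSEQ_unique[OF this lim3]
  show "2 * l2_inner \<Omega> (\<lambda>x. e x *\<^sub>R W x) (grad \<Omega> e) = l2_inner \<Omega> g (\<lambda>x. e x * e x)" by simp
qed

end

subsection \<open>The energy estimate at a fixed time\<close>

text \<open>Young's inequality with exponents s and s/(s - 1), after the powers of \<open>G\<close>
  are collected to the exponent 2 (s - 1)/s. The weight is chosen so that the coefficient of G^2
  becomes \<delta>/2; this is the origin of the factor s / (2 (s - 1)).\<close>

lemma young_absorption:
  fixes s K n G \<delta> :: real
  assumes "s > 2" "K \<ge> 0" "n \<ge> 0" "G \<ge> 0" "\<delta> > 0"
  shows "K * n powr (2 / s) * G powr ((s - 2) / s) * G
    \<le> 1 / s * (K powr s / (s / (2 * (s - 1)) * \<delta>) powr (s - 1)) * n\<^sup>2 + \<delta> / 2 * G\<^sup>2"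
proof -
  define \<gamma> where "\<gamma> = s / (2 * (s - 1)) * \<delta>"
  \<comment> \<open>With this exponent, the power s/(s - 1) of \<open>c\<close> is \<gamma>, in
    front of G^2, and the power s of \<open>c\<close> is \<gamma>^(s - 1), in the denominator of the
    other term.\<close>
  define c where "c = \<gamma> powr ((s - 1) / s)"
  have s: "s > 0" "s - 1 > 0" using assms(1) by auto
  have \<gamma>: "\<gamma> > 0" unfolding \<gamma>_def using s assms(5) by simp
  have c: "c > 0" using \<gamma> by (simp add: c_def)
  define a where "a = K * n powr (2 / s) / c"
  define b where "b = c * G powr (2 * (s - 1) / s)"
  have ab: "a \<ge> 0" "b \<ge> 0" using assms c by (auto simp: a_def b_def)
  have "a * b \<le> a powr s / s + b powr (s / (s - 1)) / (s / (s - 1))"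
    using s assms(1) ab by (intro Youngs_inequality) (auto simp: field_simps)
  also have "a powr s = K powr s * n\<^sup>2 / \<gamma> powr (s - 1)"
  proof -
    have e: "2 / s * s = 2" using s by simp
    have "(n powr (2 / s)) powr s = n powr 2" unfolding powr_powr e ..
    then have "(n powr (2 / s)) powr s = n\<^sup>2" using assms(3) by simp
    moreover have "c powr s = \<gamma> powr (s - 1)" using s by (simp add: c_def powr_powr)
    ultimately show ?thesis using assms c by (simp add: a_def powr_mult powr_divide)
  qed
  also have "b powr (s / (s - 1)) = \<gamma> * G\<^sup>2"
  proof -
    have "c powr (s / (s - 1)) = \<gamma>" using s \<gamma> by (simp add: c_def powr_powr)
    moreover have "(G powr (2 * (s - 1) / s)) powr (s / (s - 1)) = G\<^sup>2"
    proof -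
      have e: "2 * (s - 1) / s * (s / (s - 1)) = 2" using s by (simp add: field_simps)
      show ?thesis unfolding powr_powr e using assms(4) by simp
    qed
    ultimately show ?thesis using assms c by (simp add: b_def powr_mult)
  qed
  also have "\<gamma> * G\<^sup>2 / (s / (s - 1)) = \<delta> / 2 * G\<^sup>2"
    using s by (simp add: \<gamma>_def field_simps)
  finally have ineq: "a * b \<le> K powr s * n\<^sup>2 / \<gamma> powr (s - 1) / s + \<delta> / 2 * G\<^sup>2" .
  have "G powr ((s - 2) / s) * G = G powr (2 * (s - 1) / s)"
  proof (cases "G = 0")
    case True
    then show ?thesis using s by simp
  next
    case False
    then have "G powr ((s - 2) / s) * G = G powr ((s - 2) / s + 1)"
      using assms(4) by (simp add: powr_add)
    also have "(s - 2) / s + 1 = 2 * (s - 1) / s" using s by (simp add: field_simps)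
    finally show ?thesis .
  qed
  then have "K * n powr (2 / s) * G powr ((s - 2) / s) * G = a * b"
    using c by (simp add: a_def b_def mult.assoc)
  with ineq show ?thesis unfolding \<gamma>_def[symmetric] by (simp add: field_simps)
qed

text \<open>\<open>R\<close> is the Meyers bound with the norm of the source included, and
  \<open>\<Gamma>\<close> is the Dirichlet part of the boundary. \<open>Cgn\<close> and
  \<open>R\<close> come without a sign; where signs matter they are deduced or handled by
  cases.\<close>

locale elliptic_data = bounded_coefficient +
  fixes L b\<^sub>0 r s Cgn R :: real and \<Gamma> :: "plane set" and g :: "plane \<Rightarrow> real"
  assumes lip_domain: "lipschitz_domain \<Omega>"
    and \<kappa>_lip: "\<bar>\<kappa> \<zeta>1 - \<kappa> \<zeta>2\<bar> \<le> L * \<bar>\<zeta>1 - \<zeta>2\<bar>"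
    and b0_pos: "b\<^sub>0 > 0"
    and poincare_ineq: "u \<in> h1d \<Omega> \<Gamma> \<Longrightarrow> b\<^sub>0 * h1_norm \<Omega> u \<le> l2_norm \<Omega> (grad \<Omega> u)"
    and exps: "2 < r" "2 < s" "1 / r + 1 / s = 1 / 2"
    and gn: "gagliardo_nirenberg_constant \<Omega> s 2 Cgn"
    and g_sq: "square_integrable \<Omega> g"
    and meyers: "z \<in> borel_measurable M \<Longrightarrow> elliptic_solution \<Omega> \<Gamma> \<kappa> g z u \<Longrightarrow>
      u \<in> sobolev \<Omega> 1 r \<and> sobolev_norm \<Omega> 1 r u \<le> R"
begin

lemma L_nonneg: "0 \<le> L"
  using \<kappa>_lip[of 1 0] by simp

lemma elliptic_solution_grad_lp:
  assumes "z \<in> borel_measurable M" "elliptic_solution \<Omega> \<Gamma> \<kappa> g z u"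
  shows "u \<in> h_space \<Omega> 1" "integrable M (\<lambda>x. norm (grad \<Omega> u x) powr r)" "lp_norm \<Omega> r (grad \<Omega> u) \<le> R"
      "0 \<le> R"
proof -
  show u: "u \<in> h_space \<Omega> 1" using assms(2) h1d_h_space by (auto simp: elliptic_solution_def)
  have r: "r > 1" using exps by simp
  note m = meyers[OF assms]
  show "integrable M (\<lambda>x. norm (grad \<Omega> u x) powr r)" using grad_lp(1)[OF u _ r] m by blast
  show le: "lp_norm \<Omega> r (grad \<Omega> u) \<le> R" using grad_lp(2)[OF u _ r] m by force
  show "0 \<le> R" using le lp_norm_nonneg order_trans by blast
qed

text \<open>Meyers places the gradient of \<open>u2\<close> in L^r, so Hoelder leaves only the L^s
  norm of the coefficient difference to be estimated.\<close>

lemma flux_difference_lp: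
  assumes z: "z1 \<in> borel_measurable M" "z2 \<in> borel_measurable M"
    and u: "elliptic_solution \<Omega> \<Gamma> \<kappa> g z1 u1" "elliptic_solution \<Omega> \<Gamma> \<kappa> g z2 u2"
  shows "l2_norm \<Omega> (\<lambda>x. flux \<Omega> \<kappa> z1 u1 x - flux \<Omega> \<kappa> z2 u2 x)
    \<le> (1 + \<kappa>max / \<kappa>min) * (lp_norm \<Omega> s (\<lambda>x. \<kappa> (z1 x) - \<kappa> (z2 x)) * R)"
proof -
  interpret finite_measure M by (rule finite_measure_domain)
  note e = elliptic_solution_grad_lp[OF z(2) u(2)]
  have km: "(\<lambda>x. \<kappa> (z1 x) - \<kappa> (z2 x)) \<in> borel_measurable M"
    using \<kappa>_measurable[OF z(1)] \<kappa>_measurable[OF z(2)] by simp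
  \<comment> \<open>A bounded coefficient on a bounded domain: measurability of \<open>z1\<close>
    and \<open>z2\<close> is enough.\<close>
  have "integrable M (\<lambda>x. \<bar>\<kappa> (z1 x) - \<kappa> (z2 x)\<bar> powr s)"
  proof (rule integrable_const_bound[of _ "(2 * \<kappa>max) powr s"])
    have "\<bar>\<kappa> (z1 x) - \<kappa> (z2 x)\<bar> \<le> 2 * \<kappa>max" for x
      using abs_\<kappa>_le[of "z1 x"] abs_\<kappa>_le[of "z2 x"] by linarith
    then show "AE x in M. norm (\<bar>\<kappa> (z1 x) - \<kappa> (z2 x)\<bar> powr s) \<le> (2 * \<kappa>max) powr s"
      using exps by (auto intro!: AE_I2 powr_mono2)
  qed (use km in measurable)
  note h = l2_holder[OF exps weak_grad_measurable[OF weak_grad_grad[OF e(1)]] e(2) km this]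
  have p: "0 \<le> 1 + \<kappa>max / \<kappa>min" using \<kappa>max_pos \<kappa>min_pos by simp
  have "l2_norm \<Omega> (\<lambda>x. flux \<Omega> \<kappa> z1 u1 x - flux \<Omega> \<kappa> z2 u2 x)
      \<le> (1 + \<kappa>max / \<kappa>min) * l2_norm \<Omega> (\<lambda>x. (\<kappa> (z1 x) - \<kappa> (z2 x)) *\<^sub>R grad \<Omega> u2 x)"
    by (rule flux_difference[OF z u])
  also have "\<dots> \<le> (1 + \<kappa>max / \<kappa>min) * (lp_norm \<Omega> s (\<lambda>x. \<kappa> (z1 x) - \<kappa> (z2 x)) * R)"
    using h(2) e(3) p by (intro mult_left_mono order_trans[OF h(2)]) auto
  finally show ?thesis .
qed

text \<open>Interpolating between \<open>L\<^sup>2\<close> and the bound on \<open>\<kappa>\<close> avoids the gradients of \<open>z1\<close> and \<open>z2\<close>.\<close>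

lemma flux_difference_l2:
  assumes z: "square_integrable \<Omega> z1" "square_integrable \<Omega> z2"
    and u: "elliptic_solution \<Omega> \<Gamma> \<kappa> g z1 u1" "elliptic_solution \<Omega> \<Gamma> \<kappa> g z2 u2"
  shows "l2_norm \<Omega> (\<lambda>x. flux \<Omega> \<kappa> z1 u1 x - flux \<Omega> \<kappa> z2 u2 x)
    \<le> (1 + \<kappa>max / \<kappa>min) * (((2 * \<kappa>max) powr (s - 2) * L\<^sup>2 * (l2_norm \<Omega> (\<lambda>x. z1 x - z2 x))\<^sup>2) powr (1
        / s) * R)"
proof -
  have zm: "z1 \<in> borel_measurable M" "z2 \<in> borel_measurable M" using z
      by (auto simp: square_integrable_def)
  have km: "(\<lambda>x. \<kappa> (z1 x) - \<kappa> (z2 x)) \<in> borel_measurable M"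
    using \<kappa>_measurable[OF zm(1)] \<kappa>_measurable[OF zm(2)] by simp
  let ?c = "(2 * \<kappa>max) powr (s - 2) * L\<^sup>2"
  have "norm (\<kappa> (z1 x) - \<kappa> (z2 x)) powr s \<le> ?c * (norm (z1 x - z2 x))\<^sup>2" for x
  proof -
    let ?a = "\<bar>\<kappa> (z1 x) - \<kappa> (z2 x)\<bar>"
    \<comment> \<open>Of the s powers, s - 2 are spent on the bound of \<kappa> and two on its
      Lipschitz constant, which leaves exactly the square needed for an L^2 norm.\<close>
    have "?a powr s = ?a powr ((s - 2) + 2)" by simp
    also have "\<dots> = ?a powr (s - 2) * ?a\<^sup>2" by (subst powr_add) simp
    also have "\<dots> \<le> (2 * \<kappa>max) powr (s - 2) * (L * \<bar>z1 x - z2 x\<bar>)\<^sup>2"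
    proof (rule mult_mono)
      show "?a powr (s - 2) \<le> (2 * \<kappa>max) powr (s - 2)"
        using exps abs_\<kappa>_le[of "z1 x"] abs_\<kappa>_le[of "z2 x"] by (intro powr_mono2) auto
      show "?a\<^sup>2 \<le> (L * \<bar>z1 x - z2 x\<bar>)\<^sup>2" using \<kappa>_lip[of "z1 x" "z2 x"] by (intro power_mono) auto
    qed auto
    finally show ?thesis by (simp add: power_mult_distrib)
  qed
  then have "lp_norm \<Omega> s (\<lambda>x. \<kappa> (z1 x) - \<kappa> (z2 x)) \<le> (?c * (LINT x|M. (norm (z1 x
      - z2 x))\<^sup>2)) powr (1 / s)"
    using exps square_integrableD(2)[OF square_integrable_diff[OF z]] km
    by (intro lp_norm_le(2) AE_I2) auto
  then have le: "lp_norm \<Omega> s (\<lambda>x. \<kappa> (z1 x) - \<kappa> (z2 x)) \<le> (?c * (l2_norm \<Omega> (\<lambda>x. z1 x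
      - z2 x))\<^sup>2) powr (1 / s)"
    by (simp only: l2_norm_power2)
  have p: "0 \<le> 1 + \<kappa>max / \<kappa>min" using \<kappa>max_pos \<kappa>min_pos by simp
  note R0 = elliptic_solution_grad_lp(4)[OF zm(2) u(2)]
  show ?thesis
    by (rule order_trans[OF flux_difference_lp[OF zm u]]) (intro mult_left_mono mult_right_mono le p R0)
qed

text \<open>Gagliardo-Nirenberg bounds the L^s norm of z1 - z2, and the H^1 norm in it is exchanged
  for the gradient norm by the Poincare-type inequality; this produces the power of
  \<open>b\<^sub>0\<close>. The maximum in the constant dominates its second entry, the factor
  delivered by \<open>flux_difference_lp\<close>.\<close>

lemma flux_difference_h1:
  assumes z: "z1 \<in> h1d \<Omega> \<Gamma>" "z2 \<in> h1d \<Omega> \<Gamma>"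
    and u: "elliptic_solution \<Omega> \<Gamma> \<kappa> g z1 u1" "elliptic_solution \<Omega> \<Gamma> \<kappa> g z2 u2"
  shows "l2_norm \<Omega> (\<lambda>x. flux \<Omega> \<kappa> z1 u1 x - flux \<Omega> \<kappa> z2 u2 x)
    \<le> max (1 / \<kappa>min) (1 + \<kappa>max / \<kappa>min) * L * Cgn * b\<^sub>0 powr ((2 - s) / s) * R
      * l2_norm \<Omega> (\<lambda>x. z1 x - z2 x) powr (2 / s) * l2_norm \<Omega> (grad \<Omega> (\<lambda>x. z1 x - z2 x)) powr ((s -
          2) / s)"
proof -
  define e where "e = (\<lambda>x. z1 x - z2 x)"
  have ed: "e \<in> h1d \<Omega> \<Gamma>" unfolding e_def by (rule h1d_diff[OF z])
  have eh: "e \<in> h_space \<Omega> 1" by (rule h1d_h_space[OF ed])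
  have zm: "z1 \<in> borel_measurable M" "z2 \<in> borel_measurable M"
    using h_space_square_integrable(1)[OF h1d_h_space[OF z(1)]] h_space_square_integrable(1)[OF
        h1d_h_space[OF z(2)]]
    by (auto simp: square_integrable_def)
  have km: "(\<lambda>x. \<kappa> (z1 x) - \<kappa> (z2 x)) \<in> borel_measurable M"
    using \<kappa>_measurable[OF zm(1)] \<kappa>_measurable[OF zm(2)] by simp
  have gne: "e \<in> lp_space \<Omega> s" "lp_norm \<Omega> s e \<le> Cgn * l2_norm \<Omega> e powr (2 / s) * h1_norm \<Omega> e powr (1
      - 2 / s)"
    using gn eh by (auto simp: gagliardo_nirenberg_constant_def)
  define X where "X = l2_norm \<Omega> e powr (2 / s)"
  define Y where "Y = h1_norm \<Omega> e powr (1 - 2 / s)"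
  define G where "G = l2_norm \<Omega> (grad \<Omega> e)"
  define Y' where "Y' = (G / b\<^sub>0) powr (1 - 2 / s)"
  have s: "1 - 2 / s > 0" "s > 0" using exps by auto
  have h0: "0 \<le> h1_norm \<Omega> e" by (rule sobolev_norm_nonneg)
  have YY: "Y \<le> Y'"
    unfolding Y_def Y'_def G_def using poincare_ineq[OF ed] b0_pos s h0
    by (intro powr_mono2) (auto simp: field_simps)
  have "lp_norm \<Omega> s e \<le> Cgn * (X * Y')"
  proof (cases "Cgn \<ge> 0")
    case True
    then have "Cgn * X * Y \<le> Cgn * X * Y'" using YY by (intro mult_left_mono) (auto simp: X_def)
    then show ?thesis using gne(2) unfolding X_def Y_def by (simp add: mult.assoc)
  next
    \<comment> \<open>A negative constant forces \<open>X\<close> or \<open>Y\<close> to vanish,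
      since a norm is nonnegative. The product with \<open>Y'\<close> then vanishes too, so
      replacing \<open>Y\<close> by \<open>Y'\<close> changes nothing.\<close>
    case False
    have "0 \<le> Cgn * (X * Y)"
      using order_trans[OF lp_norm_nonneg gne(2)] unfolding X_def Y_def by (simp add: mult.assoc)
    then have "X * Y \<le> 0" using False by (simp add: zero_le_mult_iff)
    then have "X = 0 \<or> Y = 0" by (metis X_def Y_def mult_eq_0_iff mult_nonneg_nonneg order_antisym
        powr_ge_zero)
    then have "X * Y' = 0"
    proof
      assume "Y = 0"
      then have "h1_norm \<Omega> e = 0" by (simp add: Y_def)
      then have "G = 0" using l2_norm_grad_le_h1_norm[OF eh] by (simp add: G_def order_antisym)
      then show ?thesis by (simp add: Y'_def)
    qed simp
    moreover from \<open>X * Y \<le> 0\<close> \<open>0 \<le> Cgn * (X * Y)\<close> have "X * Y = 0"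
      using \<open>X = 0 \<or> Y = 0\<close> by auto
    ultimately have "Cgn * (X * Y) = 0" "Cgn * (X * Y') = 0" by simp_all
    then show ?thesis using gne(2) unfolding X_def Y_def by (simp only: mult.assoc)
  qed
  also have "Y' = G powr ((s - 2) / s) * b\<^sub>0 powr ((2 - s) / s)"
  proof -
    have "1 - 2 / s = (s - 2) / s" using s by (simp add: field_simps)
    moreover have "b\<^sub>0 powr ((2 - s) / s) = 1 / b\<^sub>0 powr ((s - 2) / s)"
      using powr_minus_divide[of b\<^sub>0 "(s - 2) / s"] by (simp add: minus_divide_left)
    ultimately show ?thesis using b0_pos by (simp add: Y'_def powr_divide G_def)
  qed
  finally have E: "lp_norm \<Omega> s e \<le> Cgn * (X * (G powr ((s - 2) / s) * b\<^sub>0 powr ((2 - s) / s)))" .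
  have "lp_norm \<Omega> s (\<lambda>x. \<kappa> (z1 x) - \<kappa> (z2 x)) \<le> L * lp_norm \<Omega> s e"
    using gne(1) s L_nonneg \<kappa>_lip km
    by (intro lp_norm_le_mult) (auto simp: lp_space_def e_def intro!: AE_I2)
  moreover have m: "1 + \<kappa>max / \<kappa>min \<le> max (1 / \<kappa>min) (1 + \<kappa>max / \<kappa>min)" by simp
  moreover have p: "0 \<le> 1 + \<kappa>max / \<kappa>min" using \<kappa>max_pos \<kappa>min_pos by simp
  moreover note R0 = elliptic_solution_grad_lp(4)[OF zm(2) u(2)]
  ultimately have "(1 + \<kappa>max / \<kappa>min) * (lp_norm \<Omega> s (\<lambda>x. \<kappa> (z1 x) - \<kappa> (z2 x)) * R)
      \<le> max (1 / \<kappa>min) (1 + \<kappa>max / \<kappa>min) * (L * lp_norm \<Omega> s e * R)"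
    by (intro mult_mono mult_right_mono) auto
  also have "\<dots> \<le> max (1 / \<kappa>min) (1 + \<kappa>max / \<kappa>min) *
      (L * (Cgn * (X * (G powr ((s - 2) / s) * b\<^sub>0 powr ((2 - s) / s)))) * R)"
    using E L_nonneg R0 p m by (intro mult_left_mono mult_right_mono) auto
  finally show ?thesis
    using flux_difference_lp[OF zm u] unfolding X_def G_def e_def by (simp add: mult_ac)
qed

text \<open>\<open>V\<close> and \<open>Vh\<close> are the two time derivatives at one instant,
  regarded as functionals, and both equations are tested with the difference. In the application
  \<open>c\<close> is \<open>c\<^sub>0 * h\<close>, \<open>\<gamma>\<close> is the norm of
  \<open>g\<close>, and \<open>Pe\<close> is the image of the difference under the interpolation
  operator.\<close>

lemma energy_estimate:
  assumes D: "D \<in> borel_measurable M" "0 < Dmin" "AE x in M. Dmin < D x \<and> D x \<le> Dmax"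
    and q: "square_integrable \<Omega> q" "AE x in M. 0 \<le> g x + 2 * q x"
    and v: "v \<in> h1d \<Omega> \<Gamma>" "AE x in M. 0 \<le> v x \<and> v x \<le> 1" and vh: "vh \<in> h1d \<Omega> \<Gamma>"
    and p: "elliptic_solution \<Omega> \<Gamma> \<kappa> g v p" "elliptic_solution \<Omega> \<Gamma> \<kappa> g vh ph"
    and f: "square_integrable \<Omega> f"
    and Pe: "square_integrable \<Omega> Pe" "l2_norm \<Omega> (\<lambda>x. Pe x - (vh x - v x))
        \<le> c * l2_norm \<Omega> (grad \<Omega> (\<lambda>x. vh x - v x))"
    and \<mu>: "\<mu> > 0" "\<mu> * c\<^sup>2 < Dmin"
    and eq1: "V (\<lambda>x. vh x - v x) + form_A \<Omega> D \<kappa> q v p (\<lambda>x. vh x - v x) v = l2_inner \<Omega> f (\<lambda>x. vh x - v x)"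
    and eq2: "Vh (\<lambda>x. vh x - v x) + form_A \<Omega> D \<kappa> q vh ph (\<lambda>x. vh x - v x) vh
      = l2_inner \<Omega> (\<lambda>x. f x - \<mu> * Pe x) (\<lambda>x. vh x - v x)"
    and R: "R = Cr * \<gamma>" "0 \<le> \<gamma>"
    and Cw: "Cw = max (1 / \<kappa>min) (1 + \<kappa>max / \<kappa>min) * L * Cgn * b\<^sub>0 powr ((2 - s) / s)"
  shows "Vh (\<lambda>x. vh x - v x) - V (\<lambda>x. vh x - v x)
    \<le> (1 / s * ((Cw * Cr) powr s / (s / (2 * (s - 1)) * Dmin) powr (s - 1)) * \<gamma> powr s - \<mu> / 2)
       * (l2_norm \<Omega> (\<lambda>x. vh x - v x))\<^sup>2"
proof -
  define e where "e = (\<lambda>x. vh x - v x)"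
  define n where "n = l2_norm \<Omega> e"
  define G where "G = l2_norm \<Omega> (grad \<Omega> e)"
  define w where "w = flux \<Omega> \<kappa> v p"
  define wh where "wh = flux \<Omega> \<kappa> vh ph"
  have ed: "e \<in> h1d \<Omega> \<Gamma>" unfolding e_def by (rule h1d_diff[OF vh v(1)])
  note vv = h1d_h_space[OF v(1)] h1d_h_space[OF vh]
  note eh = h1d_h_space[OF ed]
  have esq: "square_integrable \<Omega> e" "square_integrable \<Omega> (grad \<Omega> e)"
      by (rule h_space_square_integrable[OF eh])+
  have vsq: "square_integrable \<Omega> v" "square_integrable \<Omega> vh" "square_integrable \<Omega> (grad \<Omega> v)"
      "square_integrable \<Omega> (grad \<Omega> vh)"
    using h_space_square_integrable[OF vv(1)] h_space_square_integrable[OF vv(2)] by auto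
  note vm = square_integrableD(1)[OF vsq(1)] square_integrableD(1)[OF vsq(2)]
  note el = elliptic_solution_grad_lp[OF vm(1) p(1)] elliptic_solution_grad_lp[OF vm(2) p(2)]
  have wsq: "square_integrable \<Omega> w" "square_integrable \<Omega> wh"
    unfolding w_def wh_def by (rule flux_square_integrable[OF vm(1) el(1)], rule
        flux_square_integrable[OF vm(2) el(5)])
  \<comment> \<open>The bounded coefficient carries the Meyers integrability of the pressure
    gradient over to the flux, as the convection identity demands.\<close>
  have whr: "integrable M (\<lambda>x. norm (wh x) powr r)"
  proof (rule lp_norm_le(1)[OF _ _ el(6)])
    show "AE x in M. norm (wh x) powr r \<le> \<kappa>max powr r * norm (grad \<Omega> ph x) powr r"
    proof (rule AE_I2)
      fix x
      have "norm (wh x) \<le> \<kappa>max * norm (grad \<Omega> ph x)"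
        using abs_\<kappa>_le[of "vh x"] by (auto simp: wh_def flux_def intro: mult_right_mono)
      then have "norm (wh x) powr r \<le> (\<kappa>max * norm (grad \<Omega> ph x)) powr r"
        using exps by (intro powr_mono2) auto
      then show "norm (wh x) powr r \<le> \<kappa>max powr r * norm (grad \<Omega> ph x) powr r"
        using \<kappa>max_pos by (simp add: powr_mult)
    qed
    show "wh \<in> borel_measurable M" by (rule square_integrableD(1)[OF wsq(2)])
  qed (use exps in auto)
  have sol: "l2_inner \<Omega> wh (grad \<Omega> \<psi>) = l2_inner \<Omega> g \<psi>" if "\<psi> \<in> h1d \<Omega> \<Gamma>" for \<psi>
    using p(2) that by (auto simp: elliptic_solution_def form_B_def wh_def flux_def[abs_def])
  note conv = convection_identity[OF lip_domain exps gn ed g_sq wsq(2) whr sol]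
  have vbd: "AE x in M. \<bar>v x\<bar> \<le> 1" using v(2) by eventually_elim auto
  \<comment> \<open>Multiplication by \<open>v\<close> does not increase L^2 norms. No such bound is
    given for \<open>vh\<close>, which is why the convective term is split with \<open>v\<close>,
    and not \<open>vh\<close>, in front of the flux difference.\<close>
  have vscale: "square_integrable \<Omega> (\<lambda>x. v x *\<^sub>R H x)" "l2_norm \<Omega> (\<lambda>x. v x *\<^sub>R H x) \<le> 1 * l2_norm \<Omega> H"
    if "square_integrable \<Omega> H" for H :: "plane \<Rightarrow> plane"
  proof -
    have m: "(\<lambda>x. v x *\<^sub>R H x) \<in> borel_measurable M"
      using vm(1) square_integrableD(1)[OF that] by (rule borel_measurable_scaleR)
    have ae: "AE x in M. norm (v x *\<^sub>R H x) \<le> 1 * norm (H x)"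
      using vbd by eventually_elim (auto intro: mult_left_le_one_le)
    show "square_integrable \<Omega> (\<lambda>x. v x *\<^sub>R H x)" by (rule square_integrable_bound[OF that m ae])
    show "l2_norm \<Omega> (\<lambda>x. v x *\<^sub>R H x) \<le> 1 * l2_norm \<Omega> H" by (rule l2_norm_bound[OF that m _ ae]) simp
  qed
  have Dscale: "square_integrable \<Omega> (\<lambda>x. D x *\<^sub>R H x)" if "square_integrable \<Omega> H"
      for H :: "plane \<Rightarrow> plane"
  proof (rule square_integrable_bound[OF that])
    show "(\<lambda>x. D x *\<^sub>R H x) \<in> borel_measurable M"
      using D(1) square_integrableD(1)[OF that] by (rule borel_measurable_scaleR)
    show "AE x in M. norm (D x *\<^sub>R H x) \<le> Dmax * norm (H x)"
      using D(3) by eventually_elim (use D(2) in \<open>auto intro!: mult_right_mono\<close>)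
  qed
  have diffusion: "l2_inner \<Omega> (\<lambda>x. D x *\<^sub>R grad \<Omega> vh x) (grad \<Omega> e)
      - l2_inner \<Omega> (\<lambda>x. D x *\<^sub>R grad \<Omega> v x) (grad \<Omega> e)
      \<ge> Dmin * G\<^sup>2"
  proof -
    have "l2_inner \<Omega> (\<lambda>x. D x *\<^sub>R grad \<Omega> vh x) (grad \<Omega> e)
        - l2_inner \<Omega> (\<lambda>x. D x *\<^sub>R grad \<Omega> v x) (grad \<Omega> e)
      = (LINT x|M. (D x *\<^sub>R grad \<Omega> vh x - D x *\<^sub>R grad \<Omega> v x) \<bullet> grad \<Omega> e x)"
      using l2_inner_diff_left[OF Dscale[OF vsq(4)] Dscale[OF vsq(3)] esq(2)] by (simp add: l2_inner_def)
    also have "\<dots> \<ge> (LINT x|M. Dmin * (norm (grad \<Omega> e x))\<^sup>2)"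
    proof (rule integral_mono_AE)
      show "integrable M (\<lambda>x. Dmin * (norm (grad \<Omega> e x))\<^sup>2)" using square_integrableD(2)[OF esq(2)]
          by simp
      show "integrable M (\<lambda>x. (D x *\<^sub>R grad \<Omega> vh x - D x *\<^sub>R grad \<Omega> v x) \<bullet> grad \<Omega> e x)"
        by (rule square_integrable_inner[OF square_integrable_diff[OF Dscale[OF vsq(4)] Dscale[OF
            vsq(3)]] esq(2)])
      show "AE x in M. Dmin * (norm (grad \<Omega> e x))\<^sup>2 \<le> (D x *\<^sub>R grad \<Omega> vh x
          - D x *\<^sub>R grad \<Omega> v x) \<bullet> grad \<Omega> e x"
        using D(3) h_space_diff(2)[OF vv(2,1)]
      proof eventually_elim
        case (elim x)
        then have "(D x *\<^sub>R grad \<Omega> vh x - D x *\<^sub>R grad \<Omega> v x) \<bullet> grad \<Omega> e x = D x * (norm (grad \<Omega> e x))\<^sup>2"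
          by (simp add: e_def power2_norm_eq_inner flip: scaleR_diff_right)
        then show ?case using elim by (simp add: mult_right_mono)
      qed
    qed
    finally show ?thesis by (simp add: G_def l2_norm_power2)
  qed
  have transport: "l2_inner \<Omega> (\<lambda>x. (vh x * \<kappa> (vh x)) *\<^sub>R grad \<Omega> ph x) (grad \<Omega> e)
      - l2_inner \<Omega> (\<lambda>x. (v x * \<kappa> (v x)) *\<^sub>R grad \<Omega> p x) (grad \<Omega> e)
      = l2_inner \<Omega> g (\<lambda>x. e x * e x) / 2 + l2_inner \<Omega> (\<lambda>x. v x *\<^sub>R (wh x - w x)) (grad \<Omega> e)"
  proof -
    have a: "(\<lambda>x. (v x * \<kappa> (v x)) *\<^sub>R grad \<Omega> p x) = (\<lambda>x. v x *\<^sub>R w x)" by (simp add: w_def flux_def)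
    have b: "(\<lambda>x. (vh x * \<kappa> (vh x)) *\<^sub>R grad \<Omega> ph x) = (\<lambda>x. e x *\<^sub>R wh x + v x *\<^sub>R wh x)"
      by (simp add: wh_def flux_def e_def fun_eq_iff algebra_simps)
    have c: "(\<lambda>x. v x *\<^sub>R (wh x - w x)) = (\<lambda>x. v x *\<^sub>R wh x - v x *\<^sub>R w x)"
        by (simp add: scaleR_diff_right)
    show ?thesis
      unfolding a b c
      using l2_inner_add_left[OF conv(1) vscale(1)[OF wsq(2)] esq(2)] conv(3)
        l2_inner_diff_left[OF vscale(1)[OF wsq(2)] vscale(1)[OF wsq(1)] esq(2)] by simp
  qed
  obtain C where C: "C \<ge> 0" "\<And>u \<phi>. smooth_approximation u \<phi> \<Longrightarrow>
    integrable M (\<lambda>x. (u x) ^ 4) \<and> (LINT x|M. (u x) ^ 4) \<le> C * (h1_norm \<Omega> u) ^ 4"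
    by (rule fourth_power_embedding[OF lip_domain]) blast
  have four: "integrable M (\<lambda>x. (u x) ^ 4)" if "u \<in> h1d \<Omega> \<Gamma>" for u
    using h1d_smooth_approximation[OF that] C(2) by metis
  \<comment> \<open>Products with \<open>e\<close> lie in L^2, so pairings with \<open>q\<close>,
    which is only square integrable, may be split by linearity.\<close>
  have prod4: "square_integrable \<Omega> (\<lambda>x. u x * e x)" if "u \<in> h1d \<Omega> \<Gamma>" for u
    by (rule fourth_power_product(1)[OF _ _ four[OF that] four[OF ed]])
      (rule square_integrableD(1)[OF h_space_square_integrable(1)[OF h1d_h_space[OF that]]],
       rule square_integrableD(1)[OF esq(1)])
  have reaction: "l2_inner \<Omega> (\<lambda>x. q x * vh x) e - l2_inner \<Omega> (\<lambda>x. q x * v x) e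
      = l2_inner \<Omega> q (\<lambda>x. e x * e x)"
  proof -
    have a: "l2_inner \<Omega> (\<lambda>x. q x * u x) e = l2_inner \<Omega> q (\<lambda>x. u x * e x)" for u
      by (simp add: l2_inner_def mult.assoc)
    have b: "(\<lambda>x. e x * e x) = (\<lambda>x. vh x * e x - v x * e x)"
      by (simp add: e_def fun_eq_iff left_diff_distrib)
    show ?thesis unfolding a b by (rule l2_inner_diff_right[OF prod4[OF vh] prod4[OF v(1)] q(1),
        symmetric])
  qed
  have sign: "l2_inner \<Omega> g (\<lambda>x. e x * e x) / 2 + l2_inner \<Omega> q (\<lambda>x. e x * e x) \<ge> 0"
  proof -
    have "l2_inner \<Omega> g (\<lambda>x. e x * e x) + 2 * l2_inner \<Omega> q (\<lambda>x. e x * e x)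
        = (LINT x|M. g x * (e x * e x) + 2 * (q x * (e x * e x)))"
      using square_integrable_times[OF g_sq conv(2)] square_integrable_times[OF q(1) conv(2)]
      by (simp add: l2_inner_def)
    also have "\<dots> \<ge> 0"
    proof (rule integral_nonneg_AE)
      show "AE x in M. 0 \<le> g x * (e x * e x) + 2 * (q x * (e x * e x))"
        using q(2)
      proof eventually_elim
        case (elim x)
        then have "0 \<le> (g x + 2 * q x) * (e x * e x)" by simp
        then show ?case by (simp add: distrib_right mult.assoc)
      qed
    qed
    finally show ?thesis by simp
  qed
  \<comment> \<open>\<open>Pe\<close> is replaced by \<open>e\<close> up to the approximation error,
    and Young's inequality gives up half of the damping to control that error.\<close>
  have nudging: "l2_inner \<Omega> (\<lambda>x. f x - \<mu> * Pe x) e - l2_inner \<Omega> f e \<le> - \<mu> / 2 * n\<^sup>2 + \<mu> * c\<^sup>2 / 2 * G\<^sup>2"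
  proof -
    note ps = square_integrable_diff[OF Pe(1) esq(1)]
    have "l2_inner \<Omega> (\<lambda>x. f x - \<mu> *\<^sub>R Pe x) e = l2_inner \<Omega> f e - \<mu> * l2_inner \<Omega> Pe e"
      by (simp only: l2_inner_diff_left[OF f square_integrable_scaleR[OF Pe(1)] esq(1)]
          l2_inner_scaleR_left)
    moreover have "l2_inner \<Omega> Pe e = l2_inner \<Omega> (\<lambda>x. Pe x - e x) e + n\<^sup>2"
      using l2_inner_diff_left[OF Pe(1) esq(1) esq(1)] by (simp add: n_def l2_inner_self)
    moreover have "- l2_inner \<Omega> (\<lambda>x. Pe x - e x) e \<le> (c * G) * n"
    proof -
      have "- l2_inner \<Omega> (\<lambda>x. Pe x - e x) e \<le> l2_norm \<Omega> (\<lambda>x. Pe x - e x) * n"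
        using l2_cauchy_schwarz[OF ps esq(1)] by (simp add: n_def)
      also have "\<dots> \<le> (c * G) * n"
        using Pe(2) by (intro mult_right_mono) (auto simp: e_def G_def n_def)
      finally show ?thesis .
    qed
    moreover have "(c * G) * n \<le> n\<^sup>2 / 2 + c\<^sup>2 / 2 * G\<^sup>2"
      using sum_squares_bound[of "c * G" n] by (simp add: power_mult_distrib)
    ultimately have "l2_inner \<Omega> (\<lambda>x. f x - \<mu> *\<^sub>R Pe x) e - l2_inner \<Omega> f e \<le> \<mu> * (n\<^sup>2 / 2
        + c\<^sup>2 / 2 * G\<^sup>2) - \<mu> * n\<^sup>2"
    proof -
      have "- l2_inner \<Omega> Pe e \<le> (n\<^sup>2 / 2 + c\<^sup>2 / 2 * G\<^sup>2) - n\<^sup>2"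
        using \<open>l2_inner \<Omega> Pe e = _\<close> \<open>- l2_inner \<Omega> (\<lambda>x. Pe x - e x) e \<le> (c * G) * n\<close> \<open>(c * G) * n \<le>
            _\<close> by linarith
      then have "\<mu> * (- l2_inner \<Omega> Pe e) \<le> \<mu> * ((n\<^sup>2 / 2 + c\<^sup>2 / 2 * G\<^sup>2) - n\<^sup>2)" using \<mu>(1)
          by (intro mult_left_mono) auto
      then show ?thesis
        using \<open>l2_inner \<Omega> (\<lambda>x. f x - \<mu> *\<^sub>R Pe x) e = _\<close> by (simp add: algebra_simps)
    qed
    then show ?thesis by (simp add: algebra_simps)
  qed
  let ?Ct = "1 / s * ((Cw * Cr) powr s / (s / (2 * (s - 1)) * Dmin) powr (s - 1))"
  have coupling: "- l2_inner \<Omega> (\<lambda>x. v x *\<^sub>R (wh x - w x)) (grad \<Omega> e) \<le> ?Ct * \<gamma> powr s * n\<^sup>2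
      + Dmin / 2 * G\<^sup>2"
  proof -
    let ?K = "Cw * Cr * \<gamma>"
    note ds = square_integrable_diff[OF wsq(2,1)]
    have "- l2_inner \<Omega> (\<lambda>x. v x *\<^sub>R (wh x - w x)) (grad \<Omega> e) \<le> l2_norm \<Omega> (\<lambda>x. v x *\<^sub>R (wh x - w x)) * G"
      using l2_cauchy_schwarz[OF vscale(1)[OF ds] esq(2)] by (simp add: G_def)
    also have "\<dots> \<le> l2_norm \<Omega> (\<lambda>x. wh x - w x) * G"
      using vscale(2)[OF ds] by (intro mult_right_mono) (auto simp: G_def)
    also have "\<dots> \<le> (?K * n powr (2 / s) * G powr ((s - 2) / s)) * G"
      using flux_difference_h1[OF vh v(1) p(2,1)]
      by (intro mult_right_mono) (auto simp: G_def n_def e_def w_def wh_def R Cw mult_ac)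
    also have "\<dots> \<le> ?Ct * \<gamma> powr s * n\<^sup>2 + Dmin / 2 * G\<^sup>2"
    proof (cases "?K \<ge> 0")
      case True
      have nG: "n \<ge> 0" "G \<ge> 0" by (auto simp: n_def G_def)
      have "?K powr s = (Cw * Cr) powr s * \<gamma> powr s"
        using True R(2) exps by (cases "\<gamma> = 0") (auto simp: zero_le_mult_iff powr_mult)
      then show ?thesis using young_absorption[OF exps(2) True nG D(2)] by (simp add: mult_ac)
    next
      \<comment> \<open>A negative constant makes the left side nonpositive, while the right side is
        a sum of nonnegative terms.\<close>
      case False
      then have "(?K * n powr (2 / s) * G powr ((s - 2) / s)) * G \<le> 0"
        by (intro mult_nonpos_nonneg[of _ G] mult_nonpos_nonneg[of _ "G powr ((s - 2) / s)"]
            mult_nonpos_nonneg[of ?K "n powr (2 / s)"]) (auto simp: G_def)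
      also have "0 \<le> ?Ct * \<gamma> powr s * n\<^sup>2 + Dmin / 2 * G\<^sup>2"
        using exps D(2) by (intro add_nonneg_nonneg mult_nonneg_nonneg divide_nonneg_nonneg) auto
      finally show ?thesis .
    qed
    finally show ?thesis .
  qed
  have "Vh e - V e = (l2_inner \<Omega> (\<lambda>x. f x - \<mu> * Pe x) e - l2_inner \<Omega> f e)
     - (form_A \<Omega> D \<kappa> q vh ph e vh - form_A \<Omega> D \<kappa> q v p e v)"
    using eq1 eq2 unfolding e_def[symmetric] by simp
  moreover have "form_A \<Omega> D \<kappa> q vh ph e vh - form_A \<Omega> D \<kappa> q v p e v
     \<ge> Dmin * G\<^sup>2 + l2_inner \<Omega> (\<lambda>x. v x *\<^sub>R (wh x - w x)) (grad \<Omega> e)"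
    unfolding form_A_def using diffusion transport reaction sign by linarith
  ultimately have "Vh e - V e \<le> (l2_inner \<Omega> (\<lambda>x. f x - \<mu> * Pe x) e - l2_inner \<Omega> f e)
     - Dmin * G\<^sup>2 - l2_inner \<Omega> (\<lambda>x. v x *\<^sub>R (wh x - w x)) (grad \<Omega> e)" by linarith
  also have "\<dots> \<le> (- \<mu> / 2 * n\<^sup>2 + \<mu> * c\<^sup>2 / 2 * G\<^sup>2) - Dmin * G\<^sup>2 + (?Ct * \<gamma> powr s * n\<^sup>2
      + Dmin / 2 * G\<^sup>2)"
    using nudging coupling by linarith
  \<comment> \<open>All multiples of G^2 are absorbed: Dmin/2 from the coupling and \<mu> c^2/2,
    which is below Dmin/2, from the nudging are together covered by the diffusion.\<close>
  also have "\<dots> \<le> (?Ct * \<gamma> powr s - \<mu> / 2) * n\<^sup>2"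
  proof -
    have "\<mu> * c\<^sup>2 * G\<^sup>2 \<le> Dmin * G\<^sup>2" using \<mu>(2) by (intro mult_right_mono) auto
    then show ?thesis by (simp add: algebra_simps)
  qed
  finally show ?thesis unfolding n_def e_def .
qed

end

subsection \<open>Averages in time\<close>

lemma AE_lebesgue_on_iff:
  fixes S :: "'a::euclidean_space set"
  assumes "S \<in> sets lebesgue"
  shows "(AE x in lebesgue_on S. P x) \<longleftrightarrow> (AE x in lebesgue. x \<in> S \<longrightarrow> P x)"
  using assms by (subst AE_restrict_space_iff) auto

lemma AE_lebesgue_on_subset:
  fixes S :: "'a::euclidean_space set"
  assumes "AE x in lebesgue_on S. P x" "S' \<subseteq> S" "S \<in> sets lebesgue" "S' \<in> sets lebesgue"
  shows "AE x in lebesgue_on S'. P x"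
  using assms by (auto simp: AE_lebesgue_on_iff elim: eventually_mono)

lemma AE_lebesgue_on_negligible:
  fixes S :: "'a::euclidean_space set"
  assumes "negligible N" "\<And>x. x \<in> S \<Longrightarrow> x \<notin> N \<Longrightarrow> P x" "S \<in> sets lebesgue"
  shows "AE x in lebesgue_on S. P x"
proof -
  have "AE x in lebesgue. x \<notin> N" using assms(1) by (intro AE_not_in) (simp add: negligible_iff_null_sets)
  then show ?thesis unfolding AE_lebesgue_on_iff[OF assms(3)] by eventually_elim (use assms(2) in blast)
qed

lemma filterlim_left_sequence:
  fixes t :: real
  assumes "0 < t" "t \<le> T"
  shows "filterlim (\<lambda>n. t - 1 / real (Suc n)) (at t within {0..T}) sequentially"
proof -
  have lim: "(\<lambda>n. 1 / real (Suc n)) \<longlonglongrightarrow> 0"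
    using LIMSEQ_inverse_real_of_nat by (simp add: inverse_eq_divide)
  have "(\<lambda>n. t - 1 / real (Suc n)) \<longlonglongrightarrow> t - 0" by (intro tendsto_diff tendsto_const lim)
  moreover have "eventually (\<lambda>n. 1 / real (Suc n) < t) sequentially"
    using order_tendstoD(2)[OF lim assms(1)] .
  then have "eventually (\<lambda>n. t - 1 / real (Suc n) \<in> {0..T} \<and> t - 1 / real (Suc n) \<noteq> t) sequentially"
  proof eventually_elim
    case (elim n)
    have "0 < 1 / real (Suc n)" by simp
    then show ?case using elim assms unfolding atLeastAtMost_iff by linarith
  qed
  ultimately show ?thesis by (auto simp: filterlim_at elim: eventually_mono)
qed

text \<open>Backward quotients stay inside the interval at its right end point, so t = T is
  allowed.\<close>

lemma left_quotient_tendsto: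
  assumes "(F has_real_derivative f) (at t within {0..T})" "0 < t" "t \<le> T"
  shows "(\<lambda>n. real (Suc n) * (F t - F (t - 1 / real (Suc n)))) \<longlonglongrightarrow> f"
proof -
  have "((\<lambda>y. (F y - F t) / (y - t)) \<longlongrightarrow> f) (at t within {0..T})"
    using assms(1) by (simp add: has_field_derivative_iff)
  from filterlim_compose[OF this filterlim_left_sequence[OF assms(2,3)]]
  have "(\<lambda>n. (F (t - 1 / real (Suc n)) - F t) / (t - 1 / real (Suc n) - t)) \<longlonglongrightarrow> f" .
  moreover have "(F (t - 1 / real (Suc n)) - F t) / (t - 1 / real (Suc n) - t)
      = real (Suc n) * (F t - F (t - 1 / real (Suc n)))" for n
  proof -
    have "(x - y) / (t - 1 / real (Suc n) - t) = real (Suc n) * (y - x)" for x y :: real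
      by (simp add: field_simps)
    then show ?thesis .
  qed
  ultimately show ?thesis by simp
qed

text \<open>In terms of a primitive of \<open>N\<close>, the scaled integral is the mean of
  \<open>N\<close> over [b - h, b] minus its mean over [a - h, a], and both means converge by
  continuity.\<close>

lemma difference_average_tendsto:
  fixes N :: "real \<Rightarrow> real"
  assumes N: "continuous_on {0..T} N" and ab: "0 < a" "a \<le> b" "b \<le> T"
  shows "(\<lambda>n. real (Suc n) * integral {a..b} (\<lambda>t. N t - N (t - 1 / real (Suc n)))) \<longlonglongrightarrow> N b - N a"
proof -
  define P where "P x = integral {0..x} N" for x
  have Ni: "N integrable_on {x..y}" if "0 \<le> x" "y \<le> T" for x y
    by (rule integrable_continuous_interval, rule continuous_on_subset[OF N]) (use that in auto)
  have Pdiff: "integral {x..y} N = P y - P x" if "0 \<le> x" "x \<le> y" "y \<le> T" for x y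
    unfolding P_def using Henstock_Kurzweil_Integration.integral_combine[of 0 x y N] Ni[of 0 y] that
        by simp
  have Pd: "(P has_real_derivative N t) (at t within {0..T})" if "t \<in> {0..T}" for t
    unfolding P_def by (rule integral_has_real_derivative[OF N that])
  have "(\<lambda>n. real (Suc n) * (P b - P (b - 1 / real (Suc n))) - real (Suc n) * (P a - P (a
      - 1 / real (Suc n))))
      \<longlonglongrightarrow> N b - N a"
    using ab by (intro tendsto_diff left_quotient_tendsto[where T=T] Pd) auto
  moreover have "eventually (\<lambda>n. real (Suc n) * (P b - P (b - 1 / real (Suc n)))
      - real (Suc n) * (P a - P (a - 1 / real (Suc n)))
      = real (Suc n) * integral {a..b} (\<lambda>t. N t - N (t - 1 / real (Suc n)))) sequentially"
  proof -
    have lim: "(\<lambda>n. 1 / real (Suc n)) \<longlonglongrightarrow> 0"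
      using LIMSEQ_inverse_real_of_nat by (simp add: inverse_eq_divide)
    \<comment> \<open>Only steps smaller than \<open>a\<close> keep the shifted interval inside
      [0, T]; this holds for all large n.\<close>
    show ?thesis
      using order_tendstoD(2)[OF lim ab(1)]
    proof eventually_elim
      case (elim n)
      define h where "h = 1 / real (Suc n)"
      have h: "0 < h" "h < a" using elim by (auto simp: h_def)
      have c: "continuous_on {a + - h..b + - h} N"
          by (rule continuous_on_subset[OF N]) (use h ab in auto)
      have c2: "continuous_on {a..b} (\<lambda>t. N (t - h))"
        by (rule continuous_on_compose2[OF N]) (use h ab in \<open>auto intro!: continuous_intros\<close>)
      have "integral {a..b} (\<lambda>t. N (t - h)) = integral {a - h..b - h} N"
        using integral_shift[OF c] by (simp add: comp_def)
      also have "\<dots> = P (b - h) - P (a - h)" using h ab by (intro Pdiff) auto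
      finally have I: "integral {a..b} (\<lambda>t. N t - N (t - h)) = (P b - P a) - (P (b - h) - P (a - h))"
        using integral_diff[OF Ni[of a b] integrable_continuous_interval[OF c2]] Pdiff[of a b] ab by simp
      show ?case unfolding h_def[symmetric] I by (simp only: right_diff_distrib)
    qed
  qed
  ultimately show ?thesis by (rule Lim_transform_eventually)
qed

text \<open>The differentiation theorem used here concerns averages to the right of a point.
  Reflection turns them into averages to the left, and the exceptional null set is reflected as
  well.\<close>

lemma lebesgue_point_left:
  fixes f :: "real \<Rightarrow> real"
  assumes f: "f integrable_on {0..T}"
  shows "AE t in lebesgue_on {0..T}. 0 < t \<longrightarrow>
    (\<lambda>n. real (Suc n) * (integral {0..t} f - integral {0..t - 1 / real (Suc n)} f)) \<longlonglongrightarrow> f t"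
proof -
  \<comment> \<open>Integrability on every interval of the line is required, hence the extension by
    zero.\<close>
  define f0 where "f0 x = (if x \<in> {0..T} then f x else 0)" for x
  have f0U: "f0 integrable_on UNIV" unfolding f0_def using f
      by (simp only: Henstock_Kurzweil_Integration.integrable_restrict_UNIV)
  then have f0i: "f0 integrable_on {x..y}" for x y
    using integrable_on_subinterval[of f0 UNIV x y] by simp
  have "(\<lambda>x. f0 (- x)) integrable_on cbox x y" for x y
    using Henstock_Kurzweil_Integration.integrable_reflect_real[of f0 "- x" "- y"] f0i[of "- y"
        "- x"] by simp
  then obtain Z where Z: "negligible Z" "\<And>x e. x \<notin> Z \<Longrightarrow> 0 < e \<Longrightarrow>
      \<exists>d>0. \<forall>h. 0 < h \<and> h < d \<longrightarrow>
        norm (integral (cbox x (x + h *\<^sub>R One)) (\<lambda>x. f0 (- x)) /\<^sub>R h ^ DIM(real) - f0 (- x)) < e"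
    using integrable_ccontinuous_explicit[of "\<lambda>x. f0 (- x)"] by blast
  have neg: "negligible (uminus ` Z)"
    by (rule negligible_differentiable_image_negligible[OF _ Z(1)])
      (auto intro!: derivative_intros simp: differentiable_on_def)
  show ?thesis
  proof (rule AE_lebesgue_on_negligible[OF neg])
    fix t assume t: "t \<in> {0..T}" "t \<notin> uminus ` Z"
    have tZ: "- t \<notin> Z" using t(2) by (metis image_eqI minus_minus)
    show "0 < t \<longrightarrow> (\<lambda>n. real (Suc n) * (integral {0..t} f - integral {0..t - 1 / real (Suc n)} f)) \<longlonglongrightarrow> f t"
    proof (intro impI LIMSEQ_I)
      fix e :: real assume t0: "0 < t" and e: "0 < e"
      obtain d where d: "d > 0" "\<And>h. 0 < h \<Longrightarrow> h < d \<Longrightarrow>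
        norm (integral (cbox (- t) (- t + h *\<^sub>R One)) (\<lambda>x. f0 (- x)) /\<^sub>R h ^ DIM(real) - f0 t) < e"
        using Z(2)[OF tZ e] by auto
      have "min d t > 0" using d t0 by simp
      then obtain n0 where n0: "inverse (real (Suc n0)) < min d t" using reals_Archimedean by blast
      show "\<exists>no. \<forall>n\<ge>no. norm (real (Suc n) * (integral {0..t} f - integral {0..t
          - 1 / real (Suc n)} f) - f t) < e"
      proof (intro exI allI impI)
        fix n assume n: "n0 \<le> n"
        define h where "h = 1 / real (Suc n)"
        have "h \<le> inverse (real (Suc n0))" using n by (simp add: h_def inverse_eq_divide frac_le)
        then have h: "0 < h" "h < d" "h < t" using n0 by (auto simp: h_def)
        have "integral (cbox (- t) (- t + h *\<^sub>R One)) (\<lambda>x. f0 (- x)) = integral {- t..- (t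
            - h)} (\<lambda>x. f0 (- x))"
          by (simp add: add.commute)
        also have "\<dots> = integral {t - h..t} f0"
            by (rule Henstock_Kurzweil_Integration.integral_reflect_real)
        also have "\<dots> = integral {t - h..t} f"
          using t h by (intro integral_cong) (auto simp: f0_def)
        also have "\<dots> = integral {0..t} f - integral {0..t - h} f"
          using Henstock_Kurzweil_Integration.integral_combine[of 0 "t - h" t f]
              integrable_subinterval_real[OF f, of 0 t] h t by simp
        finally have "norm ((integral {0..t} f - integral {0..t - h} f) / h - f t) < e"
          using d(2)[OF h(1,2)] t by (simp add: f0_def divide_inverse mult.commute)
        then show "norm (real (Suc n) * (integral {0..t} f - integral {0..t - 1 / real (Suc n)} f)
            - f t) < e"
          by (simp add: h_def mult.commute)
      qed
    qed
  qed simp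
qed

text \<open>Preimages are finite unions of fibres, so \<open>\<Phi>\<close> may be an arbitrary
  function of the value.\<close>

lemma finite_valued_measurable:
  fixes s :: "real \<Rightarrow> 'v" and \<Phi> :: "'v \<Rightarrow> real"
  assumes fin: "finite (s ` {0..T})" and meas: "\<And>v. {t \<in> {0..T}. s t = v} \<in> sets lebesgue"
  shows "(\<lambda>t. \<Phi> (s t)) \<in> borel_measurable (lebesgue_on {0..T})"
proof (rule measurableI)
  fix A :: "real set"
  have "(\<lambda>t. \<Phi> (s t)) -` A \<inter> space (lebesgue_on {0..T})
      = (\<Union>v\<in>{v \<in> s ` {0..T}. \<Phi> v \<in> A}. {t \<in> {0..T}. s t = v})"
    by (auto simp: space_restrict_space)
  also have "\<dots> \<in> sets lebesgue" using fin meas by (intro sets.finite_UN) auto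
  finally have "(\<lambda>t. \<Phi> (s t)) -` A \<inter> space (lebesgue_on {0..T}) \<in> sets lebesgue" .
  then show "(\<lambda>t. \<Phi> (s t)) -` A \<inter> space (lebesgue_on {0..T}) \<in> sets (lebesgue_on {0..T})"
    by (simp add: sets_restrict_space_iff space_restrict_space)
qed simp

text \<open>Integrates over \<open>t\<close> a bound on \<open>N t - N (t - h)\<close> and lets \<open>h\<close> tend to zero. Absolute
  continuity of \<open>N\<close> is not assumed; the error terms on the right are controlled by \<open>G\<close> and by a
  finite-valued curve \<open>s\<close>, whose oscillation averages vanish at almost every time.\<close>

lemma steklov_inequality:
  fixes N G E2 :: "real \<Rightarrow> real" and s :: "real \<Rightarrow> 'v" and Dm :: "'v \<Rightarrow> 'v \<Rightarrow> real"
  assumes N: "continuous_on {0..T} N" and ab: "0 < a" "a \<le> b" "b \<le> T"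
    and E2: "integrable (lebesgue_on {0..T}) E2" "\<And>t. 0 \<le> E2 t"
    and G: "integrable (lebesgue_on {0..T}) G" "\<And>t. 0 \<le> G t"
    and s: "finite (s ` {0..T})" "\<And>v. {t \<in> {0..T}. s t = v} \<in> sets lebesgue"
    and Dm: "\<And>v. Dm v v = 0" and c: "0 \<le> c" and \<eta>: "0 \<le> \<eta>"
    and H: "\<And>x. H x = integral {0..x} G" and J: "\<And>v x. J v x = integral {0..x} (\<lambda>t. of_bool (s t = v))"
    and ineq: "AE t in lebesgue_on {0..T}. \<forall>h. 0 < h \<longrightarrow> h < t \<longrightarrow>
      N t - N (t - h) \<le> h * (\<xi> * N t) + h * (\<eta> * E2 t)
        + c * (h * G t + (H t - H (t - h)) + (\<Sum>v\<in>s ` {0..T}. Dm v (s t) * (J v t - J v (t - h))))"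
  shows "N b - N a \<le> integral {a..b} (\<lambda>t. \<xi> * N t) + \<eta> * integral {0..T} E2 + 2 * c * integral {0..T} G"
proof -
  let ?T = "lebesgue_on {0..T}" and ?M = "lebesgue_on {a..b}"
  have sub: "{a..b} \<subseteq> {0..T}" using ab by auto
  have sl: "{0..T} \<in> sets lebesgue" "{a..b} \<in> sets lebesgue" by auto
  have Gi: "G integrable_on {0..T}" using G(1) by (simp add: integrable_on_lebesgue_on)
  have Hc: "continuous_on {0..T} H" unfolding H by (rule indefinite_integral_continuous_1[OF Gi])
  have of_m: "(\<lambda>t. of_bool (s t = v) :: real) \<in> borel_measurable ?T" for v
    by (rule finite_valued_measurable[OF s])
  have of_i: "integrable ?T (\<lambda>t. of_bool (s t = v) :: real)" for v
  proof (rule Bochner_Integration.integrable_bound[of _ "\<lambda>_. 1 :: real"])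
    show "integrable ?T (\<lambda>_. 1 :: real)" by (rule continuous_imp_integrable_real) simp
  qed (use of_m in auto)
  have of_I: "(\<lambda>t. of_bool (s t = v) :: real) integrable_on {0..T}" for v
    using of_i by (simp add: integrable_on_lebesgue_on)
  have Jc: "continuous_on {0..T} (J v)" for v unfolding J
      by (rule indefinite_integral_continuous_1[OF of_I])
  define h where "h n = 1 / real (Suc n)" for n
  have hpos: "h n > 0" for n by (simp add: h_def)
  have kh: "real (Suc n) * h n = 1" for n by (simp add: h_def)
  have lim: "h \<longlonglongrightarrow> 0" unfolding h_def using LIMSEQ_inverse_real_of_nat by (simp add: inverse_eq_divide)
  \<comment> \<open>The increment of \<open>J v\<close> times \<open>Suc n\<close> is the fraction
    of the last \<open>h n\<close> time units during which the curve has the value \<open>v\<close>.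
    So \<open>S n t\<close> is the mean of \<open>Dm (s \<tau>) (s t)\<close> over that stretch of
    times \<tau>.\<close>
  define S where "S n t = (\<Sum>v\<in>s ` {0..T}. Dm v (s t) * (real (Suc n) * (J v t - J v (t - h n))))" for n t
  have Jd: "\<bar>real (Suc n) * (J v t - J v (t - h n))\<bar> \<le> 1" if "h n < a" "t \<in> {a..b}" for n v t
  proof -
    have r: "0 \<le> t - h n" "t - h n \<le> t" "t \<le> T" using that ab hpos[of n] by auto
    have "J v t - J v (t - h n) = integral {t - h n..t} (\<lambda>t. of_bool (s t = v))"
      unfolding J using Henstock_Kurzweil_Integration.integral_combine[OF r(1,2), of
          "\<lambda>t. of_bool (s t = v) :: real"]
        integrable_subinterval_real[OF of_I, of 0 t] r by simp
    also have "\<bar>\<dots>\<bar> \<le> integral {t - h n..t} (\<lambda>t. 1)"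
    proof -
      have "norm (integral {t - h n..t} (\<lambda>t. of_bool (s t = v) :: real)) \<le> integral {t - h n..t} (\<lambda>t. 1)"
        by (rule integral_norm_bound_integral) (use integrable_subinterval_real[OF of_I, of
            "t - h n" t] r in auto)
      then show ?thesis by simp
    qed
    also have "\<dots> = h n" using hpos[of n] by simp
    finally have "\<bar>J v t - J v (t - h n)\<bar> \<le> h n" .
    then have "real (Suc n) * \<bar>J v t - J v (t - h n)\<bar> \<le> real (Suc n) * h n"
        by (intro mult_left_mono) auto
    then show ?thesis unfolding kh by (simp add: abs_mult)
  qed
  \<comment> \<open>Fractions of time are at most 1, so this finite double sum bounds
    \<open>S\<close> uniformly in n and t.\<close>
  define B where "B = (\<Sum>v\<in>s ` {0..T}. \<Sum>w\<in>s ` {0..T}. \<bar>Dm v w\<bar>)"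
  have Sb: "\<bar>S n t\<bar> \<le> B" if n: "h n < a" and t: "t \<in> {a..b}" for n t
  proof -
    have "\<bar>S n t\<bar> \<le> (\<Sum>v\<in>s ` {0..T}. \<bar>Dm v (s t) * (real (Suc n) * (J v t - J v (t - h n)))\<bar>)"
      unfolding S_def by (rule sum_abs)
    also have "\<dots> \<le> (\<Sum>v\<in>s ` {0..T}. \<Sum>w\<in>s ` {0..T}. \<bar>Dm v w\<bar>)"
    proof (rule sum_mono)
      fix v assume "v \<in> s ` {0..T}"
      have "\<bar>Dm v (s t) * (real (Suc n) * (J v t - J v (t - h n)))\<bar> \<le> \<bar>Dm v (s t)\<bar> * 1"
        unfolding abs_mult[of "Dm v (s t)"] by (intro mult_left_mono Jd n t) auto
      also have "\<dots> \<le> (\<Sum>w\<in>s ` {0..T}. \<bar>Dm v w\<bar>)"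
        using member_le_sum[of "s t" "s ` {0..T}" "\<lambda>w. \<bar>Dm v w\<bar>"] s(1) t sub by auto
      finally show "\<bar>Dm v (s t) * (real (Suc n) * (J v t - J v (t - h n)))\<bar>
          \<le> (\<Sum>w\<in>s ` {0..T}. \<bar>Dm v w\<bar>)" .
    qed
    finally show ?thesis unfolding B_def .
  qed
  have shift_c: "continuous_on {a..b} (\<lambda>t. F (t - h n))" if "continuous_on {0..T} F" "h n < a"
      for F :: "real \<Rightarrow> real" and n
    by (rule continuous_on_compose2[OF that(1)]) (use that(2) hpos[of n] ab in \<open>auto intro!:
        continuous_intros\<close>)
  have Sm: "S n \<in> borel_measurable ?M" if "h n < a" for n
    unfolding S_def
  proof (intro borel_measurable_sum borel_measurable_times)
    fix v
    show "(\<lambda>t. Dm v (s t)) \<in> borel_measurable ?M"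
      using finite_valued_measurable[OF s, of "Dm v"] sub by (rule measurable_restrict_mono)
    have "continuous_on {a..b} (J v)" using Jc sub continuous_on_subset by blast
    then have "continuous_on {a..b} (\<lambda>t. J v t - J v (t - h n))"
      using shift_c[OF Jc that] by (intro continuous_on_diff)
    then show "(\<lambda>t. J v t - J v (t - h n)) \<in> borel_measurable ?M"
      by (intro continuous_imp_measurable_on_sets_lebesgue) auto
  qed auto
  have cM: "integrable ?M (\<lambda>t. K :: real)" for K by (rule continuous_imp_integrable_real) simp
  have Si: "integrable ?M (S n)" if "h n < a" for n
    by (rule Bochner_Integration.integrable_bound[OF cM[of B] Sm[OF that]])
      (use Sb[OF that] in \<open>auto intro!: AE_I2 simp: space_restrict_space order_trans[OF _ abs_ge_self]\<close>)
  have evn: "eventually (\<lambda>n. h n < a) sequentially" using order_tendstoD(2)[OF lim ab(1)] .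
  then obtain n0 where n0: "\<And>n. n \<ge> n0 \<Longrightarrow> h n < a" by (auto simp: eventually_sequentially)
  \<comment> \<open>At almost every time the fraction tends to 1 for v = s t and to 0 for every
    other value. Only the diagonal term survives, and there \<open>Dm\<close> vanishes. The shift by
    \<open>n0\<close> keeps the step below \<open>a\<close>.\<close>
  have Slim: "(\<lambda>n. LINT t|?M. S (n + n0) t) \<longlonglongrightarrow> (LINT t|?M. 0)"
  proof (rule integral_dominated_convergence[OF _ _ cM[of B]])
    have "AE t in ?T. \<forall>v\<in>s ` {0..T}. 0 < t \<longrightarrow>
        (\<lambda>n. real (Suc n) * (J v t - J v (t - 1 / real (Suc n)))) \<longlonglongrightarrow> of_bool (s t = v)"
      unfolding J using s(1) lebesgue_point_left[OF of_I] by (intro AE_finite_allI) auto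
    then have "AE t in ?M. \<forall>v\<in>s ` {0..T}. 0 < t \<longrightarrow>
        (\<lambda>n. real (Suc n) * (J v t - J v (t - 1 / real (Suc n)))) \<longlonglongrightarrow> of_bool (s t = v)"
      by (rule AE_lebesgue_on_subset[OF _ sub]) auto
    moreover have "AE t in ?M. t \<in> {a..b}" by (auto intro!: AE_I2 simp: space_restrict_space)
    ultimately show "AE t in ?M. (\<lambda>n. S (n + n0) t) \<longlonglongrightarrow> 0"
    proof eventually_elim
      case (elim t)
      have "(\<lambda>n. S n t) \<longlonglongrightarrow> (\<Sum>v\<in>s ` {0..T}. Dm v (s t) * of_bool (s t = v))"
        unfolding S_def h_def using elim ab by (intro tendsto_sum tendsto_mult tendsto_const) auto
      also have "(\<Sum>v\<in>s ` {0..T}. Dm v (s t) * of_bool (s t = v)) = 0"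
        using Dm by (intro sum.neutral) auto
      finally show ?case by (rule LIMSEQ_ignore_initial_segment)
    qed
    show "AE t in ?M. norm (S (n + n0) t) \<le> B" for n
      using Sb[OF n0, of "n + n0"] by (auto intro!: AE_I2 simp: space_restrict_space)
  qed (use Sm n0 in auto)
  have Nc: "continuous_on {a..b} N" using N sub continuous_on_subset by blast
  have Hc': "continuous_on {a..b} H" using Hc sub continuous_on_subset by blast
  have iE: "integrable ?M E2" and iG: "integrable ?M G"
    using integrable_subinterval[OF E2(1) sub] integrable_subinterval[OF G(1) sub] by auto
  have eqI: "(LINT t|?M. f t) = integral {a..b} f" if "integrable ?M f" for f :: "real \<Rightarrow> real"
    by (rule lebesgue_integral_eq_integral[OF that]) simp
  have iN: "integrable ?M (\<lambda>t. \<xi> * N t)" by (intro continuous_imp_integrable_real continuous_intros Nc)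
  have main: "real (Suc n) * integral {a..b} (\<lambda>t. N t - N (t - h n)) \<le>
      integral {a..b} (\<lambda>t. \<xi> * N t) + \<eta> * integral {a..b} E2
      + c * (integral {a..b} G + real (Suc n) * integral {a..b} (\<lambda>t. H t - H (t - h n)) + (LINT
          t|?M. S n t))"
    if n: "h n < a" for n
  proof -
    have iND: "integrable ?M (\<lambda>t. N t - N (t - h n))"
      by (intro continuous_imp_integrable_real continuous_on_diff Nc shift_c[OF N n])
    have iHD: "integrable ?M (\<lambda>t. H t - H (t - h n))"
      by (intro continuous_imp_integrable_real continuous_on_diff Hc' shift_c[OF Hc n])
    let ?R = "\<lambda>t. \<xi> * N t + \<eta> * E2 t + c * (G t + real (Suc n) * (H t - H (t - h n)) + S n t)"
    have iR: "integrable ?M ?R" using iN iE iG iHD Si[OF n]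
      by (auto intro!: Bochner_Integration.integrable_add simp del: of_nat_Suc)
    have "(LINT t|?M. real (Suc n) * (N t - N (t - h n))) \<le> (LINT t|?M. ?R t)"
    proof (rule integral_mono_AE)
      show "integrable ?M (\<lambda>t. real (Suc n) * (N t - N (t - h n)))" using iND
          by (intro integrable_mult_right)
      show "integrable ?M ?R" by (rule iR)
      have "AE t in ?M. t \<in> {a..b}" by (auto intro!: AE_I2 simp: space_restrict_space)
      with AE_lebesgue_on_subset[OF ineq sub sl]
      show "AE t in ?M. real (Suc n) * (N t - N (t - h n)) \<le> ?R t"
      proof eventually_elim
        case (elim t)
        then have "N t - N (t - h n) \<le> h n * (\<xi> * N t) + h n * (\<eta> * E2 t)
          + c * (h n * G t + (H t - H (t - h n)) + (\<Sum>v\<in>s ` {0..T}. Dm v (s t) * (J v t - J v (t - h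
              n))))"
          using n hpos[of n] by auto
        then have "real (Suc n) * (N t - N (t - h n)) \<le> real (Suc n) * (h n * (\<xi> * N t)
            + h n * (\<eta> * E2 t)
          + c * (h n * G t + (H t - H (t - h n)) + (\<Sum>v\<in>s ` {0..T}. Dm v (s t) * (J v t - J v (t - h
              n)))))"
          by (rule mult_left_mono) simp
        also have "\<dots> = (real (Suc n) * h n) * (\<xi> * N t) + (real (Suc n) * h n) * (\<eta> * E2 t)
          + c * ((real (Suc n) * h n) * G t + real (Suc n) * (H t - H (t - h n))
            + real (Suc n) * (\<Sum>v\<in>s ` {0..T}. Dm v (s t) * (J v t - J v (t - h n))))"
          by (simp add: algebra_simps)
        also have "real (Suc n) * (\<Sum>v\<in>s ` {0..T}. Dm v (s t) * (J v t - J v (t - h n))) = S n t"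
          unfolding S_def sum_distrib_left by (intro sum.cong) auto
        finally show ?case unfolding kh by simp
      qed
    qed
    also have "(LINT t|?M. ?R t) = integral {a..b} (\<lambda>t. \<xi> * N t) + \<eta> * integral {a..b} E2
      + c * (integral {a..b} G + real (Suc n) * integral {a..b} (\<lambda>t. H t - H (t - h n)) + (LINT
          t|?M. S n t))"
      unfolding eqI[OF iN, symmetric] eqI[OF iE, symmetric] eqI[OF iG, symmetric] eqI[OF iHD, symmetric]
      using iN iE iG iHD Si[OF n] by (simp del: of_nat_Suc)
    also have "(LINT t|?M. real (Suc n) * (N t - N (t - h n)))
        = real (Suc n) * integral {a..b} (\<lambda>t. N t - N (t - h n))"
      unfolding eqI[OF iND, symmetric] by (simp del: of_nat_Suc)
    finally show ?thesis .
  qed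
  have L: "(\<lambda>n. real (Suc (n + n0)) * integral {a..b} (\<lambda>t. N t - N (t - h (n + n0)))) \<longlonglongrightarrow> N b - N a"
    using LIMSEQ_ignore_initial_segment[OF difference_average_tendsto[OF N ab], of n0]
        by (simp only: h_def)
  have LH: "(\<lambda>n. real (Suc (n + n0)) * integral {a..b} (\<lambda>t. H t - H (t - h (n + n0)))) \<longlonglongrightarrow> H b - H a"
    using LIMSEQ_ignore_initial_segment[OF difference_average_tendsto[OF Hc ab], of n0]
        by (simp only: h_def)
  have "(\<lambda>n. integral {a..b} (\<lambda>t. \<xi> * N t) + \<eta> * integral {a..b} E2
      + c * (integral {a..b} G + real (Suc (n + n0)) * integral {a..b} (\<lambda>t. H t - H (t - h (n +
          n0))) + (LINT t|?M. S (n + n0) t)))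
      \<longlonglongrightarrow> integral {a..b} (\<lambda>t. \<xi> * N t) + \<eta> * integral {a..b} E2 + c * (integral {a..b} G + (H b - H
          a) + (LINT t|?M. 0))"
    by (intro tendsto_add tendsto_mult tendsto_const LH Slim)
  then have "N b - N a \<le> integral {a..b} (\<lambda>t. \<xi> * N t) + \<eta> * integral {a..b} E2
      + c * (integral {a..b} G + (H b - H a) + (LINT t|?M. 0))"
    by (rule LIMSEQ_le[OF L]) (intro exI[of _ 0] allI impI main n0, simp)
  also have "integral {a..b} E2 \<le> integral {0..T} E2"
    using E2 iE sub by (intro integral_subset_le) (auto intro: integrable_on_lebesgue_on)
  also have Gab: "integral {a..b} G \<le> integral {0..T} G"
    using G iG sub by (intro integral_subset_le) (auto intro: integrable_on_lebesgue_on)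
  \<comment> \<open>A second copy of the integral of \<open>G\<close>, which explains the factor 2
    in the conclusion.\<close>
  also have "H b - H a \<le> integral {0..T} G"
  proof -
    have "H b - H a = integral {a..b} G"
      unfolding H using Henstock_Kurzweil_Integration.integral_combine[of 0 a b G]
          integrable_subinterval_real[OF Gi, of 0 b] ab by simp
    then show ?thesis using Gab by simp
  qed
  finally show ?thesis using c \<eta> by (simp add: mult_left_mono)
qed

subsection \<open>Testing with functions of time\<close>

text \<open>The normalised primitive of a bump. Membership in \<open>flat_algebra\<close> is claimed
  for the derivative \<beta> only, so smoothness of the step has to be read off from its
  derivative.\<close>

lemma unit_step_exists:
  obtains B :: "real \<Rightarrow> real" and \<beta> where "flat_algebra \<beta>" "\<And>x. (B has_real_derivative \<beta> x) (at x)"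
    "\<And>x. 0 \<le> \<beta> x" "\<And>x. x \<le> 0 \<Longrightarrow> B x = 0" "\<And>x. 1 \<le> x \<Longrightarrow> B x = 1"
    "\<And>x. 0 \<le> B x" "\<And>x. B x \<le> 1"
proof -
  define p where "p = interval_bump 1 0 1"
  have pf: "flat_algebra p" unfolding p_def by (rule flat_algebra_interval_bump)
  have pc: "continuous_on S p" for S
    using flat_algebra_deriv(2)[OF pf] by (meson DERIV_continuous continuous_at_imp_continuous_on)
  have p0: "p x = 0" if "x \<le> 0 \<or> 1 \<le> x" for x unfolding p_def using that by (rule interval_bump_outside)
  have pn: "0 \<le> p x" for x unfolding p_def by (rule interval_bump_bounds)
  \<comment> \<open>The lower limit -1 lies to the left of the support, so that 0 is an interior
    point and a two-sided derivative is obtained there.\<close>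
  define A where "A x = integral {-1..x} p" for x
  have Azero: "A x = 0" if "x \<le> 0" for x
    unfolding A_def using that p0 by (subst integral_cong[of _ p "\<lambda>_. 0"]) auto
  have Ader: "(A has_real_derivative p x) (at x)" for x
  proof (cases "x < 0")
    case True
    have "(A has_real_derivative 0) (at x)"
      by (rule has_field_derivative_transform_within_open[of "\<lambda>_. 0" _ _ "{..<0}"]) (use True Azero
          in auto)
    then show ?thesis using p0[of x] True by simp
  next
    case False
    have "(A has_real_derivative p x) (at x within {-1..x + 1})"
      unfolding A_def by (rule integral_has_real_derivative[OF pc]) (use False in auto)
    then show ?thesis using False by (simp add: at_within_Icc_at)
  qed
  have Amono: "A x \<le> A y" if "x \<le> y" for x y
    using DERIV_nonneg_imp_nondecreasing[OF that, of A] Ader pn by blast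
  have Aone: "A x = A 1" if "1 \<le> x" for x
  proof (cases "x = 1")
    case False
    then have "1 < x" using that by simp
    from MVT2[OF this, of A p] Ader obtain z where "1 < z" "A x - A 1 = (x - 1) * p z" by blast
    then show ?thesis using p0[of z] by simp
  qed simp
  \<comment> \<open>The mean value theorem yields a point strictly inside the unit interval, where
    the bump is positive.\<close>
  have pos: "A 1 > 0"
  proof -
    obtain z where z: "0 < z" "z < 1" "A 1 - A 0 = (1 - 0) * p z"
      using MVT2[of 0 1 A p] Ader by auto
    have "p z > 0" using z flat_0_bounds(3) by (simp add: p_def interval_bump_def)
    then show ?thesis using z Azero[of 0] by simp
  qed
  show ?thesis
  proof (rule that[of "\<lambda>x. (1 / A 1) * p x" "\<lambda>x. (1 / A 1) * A x"])
    show "flat_algebra (\<lambda>x. (1 / A 1) * p x)" by (intro flat_algebra.mult flat_algebra.const pf)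
    show "((\<lambda>x. (1 / A 1) * A x) has_real_derivative (1 / A 1) * p x) (at x)" for x
      using DERIV_cmult[OF Ader, of "1 / A 1"] .
    show "0 \<le> (1 / A 1) * p x" for x using pn pos by simp
    show "(1 / A 1) * A x = 0" if "x \<le> 0" for x using Azero[OF that] by simp
    show "(1 / A 1) * A x = 1" if "1 \<le> x" for x using Aone[OF that] pos by simp
    have "0 \<le> A x" for x using Amono[of 0 x] Azero[of x] Azero[of 0] by (cases "x \<le> 0") auto
    then show "0 \<le> (1 / A 1) * A x" for x using pos by simp
    have "A x \<le> A 1" for x using Amono[of x 1] Aone[of x] by (cases "x \<le> 1") auto
    then show "(1 / A 1) * A x \<le> 1" for x using pos by (simp add: field_simps)
  qed
qed

lemma flat_algebra_affine: "flat_algebra f \<Longrightarrow> flat_algebra (\<lambda>x. f (a * x + b))"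
proof (induction rule: flat_algebra.induct)
  case (base k c d)
  have "flat_algebra (\<lambda>x. flat k ((c * a) * x + (c * b + d)))" by (rule flat_algebra.base)
  then show ?case by (simp add: algebra_simps)
qed (auto intro: flat_algebra.const flat_algebra.add flat_algebra.mult)

text \<open>Only the distributional derivative of \<open>\<phi>\<close> is known; the test functions approximate the
  indicator of the interval from \<open>a\<close> to \<open>b\<close>, with derivatives of total mass one to the right of
  \<open>a\<close> and of \<open>b\<close>.\<close>

lemma distributional_primitive:
  fixes \<phi> \<rho> :: "real \<Rightarrow> real"
  assumes \<phi>: "continuous_on {0..T} \<phi>" and \<rho>: "integrable (lebesgue_on {0..T}) \<rho>"
    and weak: "\<And>\<eta>. time_test_function T \<eta> \<Longrightarrow>
      (LINT t|lebesgue_on {0..T}. deriv \<eta> t * \<phi> t) = - (LINT t|lebesgue_on {0..T}. \<eta> t * \<rho> t)"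
    and ab: "0 < a" "a < b" "b < T"
  shows "\<phi> b - \<phi> a = integral {a..b} \<rho>"
proof -
  let ?M = "lebesgue_on {0..T}"
  obtain B :: "real \<Rightarrow> real" and \<beta> where \<beta>: "flat_algebra \<beta>" "\<And>x. (B has_real_derivative \<beta> x) (at x)"
    "\<And>x. 0 \<le> \<beta> x" and B: "\<And>x. x \<le> 0 \<Longrightarrow> B x = 0" "\<And>x. 1 \<le> x \<Longrightarrow> B x = 1"
    "\<And>x. 0 \<le> B x" "\<And>x. B x \<le> 1"
    by (rule unit_step_exists) blast
  have \<beta>0: "\<beta> x = 0" if "x < 0 \<or> 1 < x" for x
  proof -
    have "(B has_real_derivative 0) (at x)"
    proof (cases "x < 0")
      case True
      show ?thesis
        by (rule has_field_derivative_transform_within_open[of "\<lambda>_. 0" _ _ "{..<0}"]) (use True B in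
            auto)
    next
      case False
      show ?thesis
        by (rule has_field_derivative_transform_within_open[of "\<lambda>_. 1" _ _ "{1<..}"]) (use False
            that B in auto)
    qed
    then show ?thesis using \<beta>(2) DERIV_unique by blast
  qed
  \<comment> \<open>\<open>st n c\<close> rises from 0 to 1 between c and c + 1/(Suc n); its
    derivative \<open>bt n c\<close> is a mollifier concentrated just to the right of c.\<close>
  define st where "st n c t = B (real (Suc n) * t + (- real (Suc n) * c))" for n c t
  define bt where "bt n c t = real (Suc n) * \<beta> (real (Suc n) * t + (- real (Suc n) * c))" for n c t
  have arg: "real (Suc n) * t + (- real (Suc n) * c) = real (Suc n) * (t - c)" for n t c
    by (simp add: algebra_simps)
  have btf: "flat_algebra (bt n c)" for n c
    unfolding bt_def by (intro flat_algebra.mult flat_algebra.const flat_algebra_affine \<beta>(1))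
  have std: "(st n c has_real_derivative bt n c t) (at t)" for n c t
  proof -
    have "((\<lambda>t. real (Suc n) * t + (- real (Suc n) * c)) has_real_derivative real (Suc n)) (at t)"
      by (auto intro!: derivative_eq_intros)
    from DERIV_chain2[OF \<beta>(2) this] show ?thesis unfolding st_def bt_def by (simp add: mult.commute)
  qed
  have st0: "st n c t = 0" if "t \<le> c" for n c t
    unfolding st_def arg by (rule B(1)) (use that in \<open>simp add: mult_le_0_iff\<close>)
  have st1: "st n c t = 1" if "c + 1 / real (Suc n) \<le> t" for n c t
    unfolding st_def arg by (rule B(2)) (use that in \<open>simp add: field_simps\<close>)
  have btn: "0 \<le> bt n c t" for n c t unfolding bt_def using \<beta>(3) by simp
  have bt0: "bt n c t = 0" if "t < c \<or> c + 1 / real (Suc n) < t" for n c t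
  proof -
    have "real (Suc n) * (t - c) < 0 \<or> 1 < real (Suc n) * (t - c)"
      using that
    proof
      assume "c + 1 / real (Suc n) < t"
      then have "1 / real (Suc n) < t - c" by simp
      then show ?thesis by (simp add: pos_divide_less_eq mult.commute del: of_nat_Suc)
    qed (simp add: mult_less_0_iff)
    then show ?thesis unfolding bt_def arg using \<beta>0 by simp
  qed
  have lim: "(\<lambda>n. 1 / real (Suc n)) \<longlonglongrightarrow> 0" using LIMSEQ_inverse_real_of_nat
      by (simp add: inverse_eq_divide)
  have btc: "continuous_on S (bt n c)" for S n c
    using flat_algebra_deriv(2)[OF btf] by (meson DERIV_continuous continuous_at_imp_continuous_on)
  have stc: "continuous_on S (st n c)" for S n c
    using std by (meson DERIV_continuous continuous_at_imp_continuous_on)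
  \<comment> \<open>Once n is large the mollifier has mass one on [0, T], and its support shrinks to
    c, so continuity of \<phi> at c gives the limit.\<close>
  have conc: "(\<lambda>n. integral {0..T} (\<lambda>t. bt n c t * \<phi> t)) \<longlonglongrightarrow> \<phi> c" if c: "0 < c" "c < T" for c
  proof (rule LIMSEQ_I)
    fix e :: real assume e: "0 < e"
    have "c \<in> {0..T}" using c by simp
    then obtain d where d: "d > 0" "\<And>t. t \<in> {0..T} \<Longrightarrow> dist t c < d \<Longrightarrow> dist (\<phi> t) (\<phi> c) < e / 2"
      using \<phi> e unfolding continuous_on_iff by (metis half_gt_zero)
    have "0 < min d (T - c)" using d c by simp
    from order_tendstoD(2)[OF lim this] obtain n0
        where n0: "\<And>n. n \<ge> n0 \<Longrightarrow> 1 / real (Suc n) < min d (T - c)"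
      by (auto simp: eventually_sequentially)
    show "\<exists>no. \<forall>n\<ge>no. norm (integral {0..T} (\<lambda>t. bt n c t * \<phi> t) - \<phi> c) < e"
    proof (intro exI allI impI)
      fix n assume "n0 \<le> n"
      then have n: "1 / real (Suc n) < d" "c + 1 / real (Suc n) < T" using n0[of n] by auto
      have "(bt n c has_integral (st n c T - st n c 0)) {0..T}"
        using c std by (intro fundamental_theorem_of_calculus)
          (auto simp flip: has_real_derivative_iff_has_vector_derivative intro:
              has_field_derivative_at_within)
      then have I1: "(bt n c has_integral 1) {0..T}" using st0[of 0 c n] st1[of c n T] n c by simp
      have i1: "(\<lambda>t. bt n c t * \<phi> t) integrable_on {0..T}"
        by (intro integrable_continuous_interval continuous_on_mult btc \<phi>)
      have "((\<lambda>t. bt n c t * \<phi> t - bt n c t * \<phi> c) has_integral (integral {0..T} (\<lambda>t. bt n c t * \<phi>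
          t) - 1 * \<phi> c)) {0..T}"
        by (intro has_integral_diff integrable_integral i1 has_integral_mult_left I1)
      moreover have "((\<lambda>t. bt n c t * (e / 2)) has_integral (1 * (e / 2))) {0..T}"
        by (rule has_integral_mult_left[OF I1])
      moreover have "norm (integral {0..T} (\<lambda>t. bt n c t * \<phi> t - bt n c t * \<phi> c))
          \<le> integral {0..T} (\<lambda>t. bt n c t * (e / 2))"
      proof (rule integral_norm_bound_integral)
        fix t assume t: "t \<in> {0..T}"
        show "norm (bt n c t * \<phi> t - bt n c t * \<phi> c) \<le> bt n c t * (e / 2)"
        proof (cases "t < c \<or> c + 1 / real (Suc n) < t")
          case False
          then have "dist t c < d" using n by (auto simp: dist_real_def)
          then have "\<bar>\<phi> t - \<phi> c\<bar> \<le> e / 2" using d(2)[OF t] by (simp add: dist_real_def)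
          then have "bt n c t * \<bar>\<phi> t - \<phi> c\<bar> \<le> bt n c t * (e / 2)" using btn by (rule mult_left_mono)
          moreover have "norm (bt n c t * \<phi> t - bt n c t * \<phi> c) = bt n c t * \<bar>\<phi> t - \<phi> c\<bar>"
            using btn[of n c t] by (simp flip: right_diff_distrib add: abs_mult)
          ultimately show ?thesis by simp
        qed (simp add: bt0)
      qed (use calculation in \<open>auto simp: integrable_on_def\<close>)
      ultimately have "norm (integral {0..T} (\<lambda>t. bt n c t * \<phi> t) - \<phi> c) \<le> e / 2"
        using integral_unique[OF I1] by (simp add: integral_unique)
      then show "norm (integral {0..T} (\<lambda>t. bt n c t * \<phi> t) - \<phi> c) < e" using e by linarith
    qed
  qed
  define \<eta> where "\<eta> n t = st n a t - st n b t" for n t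
  have \<eta>d: "(\<eta> n has_real_derivative bt n a t - bt n b t) (at t)" for n t
    unfolding \<eta>_def by (intro DERIV_diff std)
  have d\<eta>: "deriv (\<eta> n) = (\<lambda>t. bt n a t - bt n b t)" for n
    using \<eta>d by (intro ext DERIV_imp_deriv)
  have d\<eta>f: "flat_algebra (deriv (\<eta> n))" for n
  proof -
    have "flat_algebra (\<lambda>t. bt n a t + (-1) * bt n b t)"
      by (intro flat_algebra.add flat_algebra.mult flat_algebra.const btf)
    then show ?thesis by (simp add: d\<eta>)
  qed
  have eqI: "(LINT t|?M. f t) = integral {0..T} f" if "integrable ?M f" for f :: "real \<Rightarrow> real"
    by (rule lebesgue_integral_eq_integral[OF that]) simp
  have "0 < T - b" using ab by simp
  \<comment> \<open>The second ramp ends at b + 1/(Suc n); this has to lie below T for the support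
    to be admissible.\<close>
  from order_tendstoD(2)[OF lim this] obtain n0 where n0: "\<And>n. n \<ge> n0 \<Longrightarrow> 1 / real (Suc n) < T - b"
    by (auto simp: eventually_sequentially)
  have tf: "time_test_function T (\<eta> n)" if "n \<ge> n0" for n
    unfolding time_test_function_def
  proof (intro conjI allI)
    fix m t show "(deriv ^^ m) (\<eta> n) differentiable (at t)"
    proof (cases m)
      case 0
      then show ?thesis using \<eta>d by (auto simp: real_differentiable_def)
    next
      \<comment> \<open>Membership in the algebra is known for \<open>deriv (\<eta> n)\<close>, not
        for \<open>\<eta> n\<close>, so one derivative is split off.\<close>
      case (Suc k)
      then have "(deriv ^^ m) (\<eta> n) = (deriv ^^ k) (deriv (\<eta> n))"
          by (simp add: funpow_Suc_right del: funpow.simps)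
      then show ?thesis
        using flat_algebra_deriv(2)[OF flat_algebra_deriv_iter[OF d\<eta>f]]
            by (auto simp: real_differentiable_def)
    qed
  next
    have "closure {t. \<eta> n t \<noteq> 0} \<subseteq> {a..b + 1 / real (Suc n)}"
    proof (rule closure_minimal)
      show "{t. \<eta> n t \<noteq> 0} \<subseteq> {a..b + 1 / real (Suc n)}"
      proof
        fix t assume t: "t \<in> {t. \<eta> n t \<noteq> 0}"
        show "t \<in> {a..b + 1 / real (Suc n)}"
        proof (rule ccontr)
          assume "\<not> ?thesis"
          then have "t < a \<or> b + 1 / real (Suc n) < t" by auto
          then have "\<eta> n t = 0" using st0[of t a n] st0[of t b n] st1[of a n t] st1[of b n t] ab
            unfolding \<eta>_def by auto
          then show False using t by simp
        qed
      qed
    qed simp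
    then show "closure {t. \<eta> n t \<noteq> 0} \<subseteq> {0<..<T}" using n0[OF that] ab by fastforce
  qed
  have L: "(\<lambda>n. LINT t|?M. deriv (\<eta> (n + n0)) t * \<phi> t) \<longlonglongrightarrow> \<phi> a - \<phi> b"
  proof -
    have i: "integrable ?M (\<lambda>t. bt n c t * \<phi> t)" for n c
      by (intro continuous_imp_integrable_real continuous_on_mult btc \<phi>)
    have "(LINT t|?M. deriv (\<eta> n) t * \<phi> t) = integral {0..T} (\<lambda>t. bt n a t * \<phi> t)
        - integral {0..T} (\<lambda>t. bt n b t * \<phi> t)" for n
      using i[of n a] i[of n b] by (simp add: d\<eta> left_diff_distrib eqI[symmetric])
    moreover have "(\<lambda>n. integral {0..T} (\<lambda>t. bt n a t * \<phi> t)
        - integral {0..T} (\<lambda>t. bt n b t * \<phi> t)) \<longlonglongrightarrow> \<phi> a - \<phi> b"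
      by (intro tendsto_diff conc) (use ab in auto)
    ultimately show ?thesis using LIMSEQ_ignore_initial_segment[of _ "\<phi> a - \<phi> b" n0] by simp
  qed
  have ind: "(\<lambda>t. indicator {a..b} t * \<rho> t) = (\<lambda>t. if t \<in> {a..b} then \<rho> t else 0)" by auto
  have R: "(\<lambda>n. LINT t|?M. \<eta> (n + n0) t * \<rho> t) \<longlonglongrightarrow> (LINT t|?M. indicator {a..b} t * \<rho> t)"
  proof (rule integral_dominated_convergence[where w="\<lambda>t. \<bar>\<rho> t\<bar>"])
    have \<rho>m: "\<rho> \<in> borel_measurable ?M" using \<rho> by auto
    have \<eta>c: "continuous_on {0..T} (\<eta> n)" for n unfolding \<eta>_def by (intro continuous_on_diff stc)
    show "(\<lambda>t. \<eta> (n + n0) t * \<rho> t) \<in> borel_measurable ?M" for n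
      by (intro borel_measurable_times \<rho>m continuous_imp_measurable_on_sets_lebesgue \<eta>c) auto
    have im: "(\<lambda>t. indicator {a..b} t :: real) \<in> borel_measurable ?M"
      by (intro measurable_restrict_space1 borel_measurable_indicator) simp
    show "(\<lambda>t. indicator {a..b} t * \<rho> t) \<in> borel_measurable ?M"
        by (rule borel_measurable_times[OF im \<rho>m])
    show "integrable ?M (\<lambda>t. \<bar>\<rho> t\<bar>)" using \<rho> by simp
    show "AE t in ?M. norm (\<eta> (n + n0) t * \<rho> t) \<le> \<bar>\<rho> t\<bar>" for n
    proof (rule AE_I2)
      fix t
      have "\<bar>\<eta> (n + n0) t\<bar> \<le> 1"
        unfolding \<eta>_def st_def using B(3,4) by (smt (verit))
      then show "norm (\<eta> (n + n0) t * \<rho> t) \<le> \<bar>\<rho> t\<bar>" by (simp add: abs_mult mult_left_le_one_le)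
    qed
    show "AE t in ?M. (\<lambda>n. \<eta> (n + n0) t * \<rho> t) \<longlonglongrightarrow> indicator {a..b} t * \<rho> t"
    \<comment> \<open>At t = a the limit is 0 while the indicator is 1, so this point is discarded.
      At t = b both are 1.\<close>
    proof (rule AE_lebesgue_on_negligible[of "{a}"])
      fix t assume t: "t \<in> {0..T}" "t \<notin> {a}"
      have stl: "(\<lambda>n. st n c t) \<longlonglongrightarrow> (if c < t then 1 else 0)" for c
      proof (cases "c < t")
        case True
        then have "0 < t - c" by simp
        from order_tendstoD(2)[OF lim this] have "eventually (\<lambda>n. st n c t = 1) sequentially"
          by eventually_elim (intro st1, simp)
        then show ?thesis using True by (simp add: tendsto_eventually)
      qed (simp add: st0)
      have "(\<lambda>n. \<eta> n t) \<longlonglongrightarrow> (if a < t then 1 else 0) - (if b < t then 1 else 0)"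
        unfolding \<eta>_def by (intro tendsto_diff stl)
      also have "(if a < t then 1 else 0) - (if b < t then 1 else 0) = (indicator {a..b} t :: real)"
        using t ab by (auto simp: indicator_def)
      finally have "(\<lambda>n. \<eta> (n + n0) t) \<longlonglongrightarrow> indicator {a..b} t" by (rule LIMSEQ_ignore_initial_segment)
      then show "(\<lambda>n. \<eta> (n + n0) t * \<rho> t) \<longlonglongrightarrow> indicator {a..b} t * \<rho> t"
          by (intro tendsto_mult tendsto_const)
    qed auto
  qed
  have "integrable ?M (\<lambda>t. indicator {a..b} t * \<rho> t)"
  proof (rule Bochner_Integration.integrable_bound[OF \<rho>])
    have im: "(\<lambda>t. indicator {a..b} t :: real) \<in> borel_measurable ?M"
      by (intro measurable_restrict_space1 borel_measurable_indicator) simp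
    show "(\<lambda>t. indicator {a..b} t * \<rho> t) \<in> borel_measurable ?M"
      using \<rho> by (intro borel_measurable_times im) auto
  qed (auto simp: indicator_def)
  then have "(LINT t|?M. indicator {a..b} t * \<rho> t) = integral {0..T} (\<lambda>t. if t \<in> {a..b} then \<rho> t else 0)"
    by (simp only: eqI ind)
  also have "\<dots> = integral {a..b} \<rho>"
  proof -
    have "{a..b} \<inter> {0..T} = {a..b}" using ab by auto
    then show ?thesis by (simp only: integral_restrict_Int)
  qed
  finally have "(\<lambda>n. - (LINT t|?M. \<eta> (n + n0) t * \<rho> t)) \<longlonglongrightarrow> - integral {a..b} \<rho>"
    using tendsto_minus[OF R] by simp
  then have "(\<lambda>n. LINT t|?M. deriv (\<eta> (n + n0)) t * \<phi> t) \<longlonglongrightarrow> - integral {a..b} \<rho>"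
    using weak[OF tf] by simp
  from LIMSEQ_unique[OF L this] show ?thesis by simp
qed

subsection \<open>Curves in seminormed function spaces\<close>

lemma borel_measurable_AE_lebesgue_on:
  fixes f g :: "'a::euclidean_space \<Rightarrow> real"
  assumes "f \<in> borel_measurable (lebesgue_on S)" "AE x in lebesgue_on S. f x = g x" "S \<in> sets lebesgue"
  shows "g \<in> borel_measurable (lebesgue_on S)"
proof -
  have "(\<lambda>x. if x \<in> S then f x else 0) \<in> borel_measurable lebesgue"
    using assms by (simp add: borel_measurable_if)
  then have "(\<lambda>x. if x \<in> S then g x else 0) \<in> borel_measurable lebesgue"
    by (rule borel_measurable_AE) (use assms in \<open>auto simp: AE_lebesgue_on_iff elim: eventually_mono\<close>)
  then show ?thesis using assms by (simp add: borel_measurable_if)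
qed

text \<open>Completeness of Lebesgue measure admits limits that exist only almost
  everywhere.\<close>

lemma borel_measurable_AE_limit:
  fixes f :: "nat \<Rightarrow> 'a::euclidean_space \<Rightarrow> real"
  assumes "\<And>n. f n \<in> borel_measurable (lebesgue_on S)" "S \<in> sets lebesgue"
    and "AE x in lebesgue_on S. (\<lambda>n. f n x) \<longlonglongrightarrow> g x"
  shows "g \<in> borel_measurable (lebesgue_on S)"
proof (rule borel_measurable_AE_lebesgue_on)
  show "(\<lambda>x. lim (\<lambda>n. f n x)) \<in> borel_measurable (lebesgue_on S)"
    by (rule borel_measurable_lim_metric[OF assms(1)])
  show "AE x in lebesgue_on S. lim (\<lambda>n. f n x) = g x"
    using assms(3) by eventually_elim (rule limI)
qed (rule assms(2))

text \<open>Carrier and \<open>N\<close> are explicit parameters because an element is determined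
  only up to distance zero: functionals on \<open>h1d\<close> that differ only elsewhere are not
  separated. So \<open>N\<close> is a seminorm, used only inside \<open>X\<close>.\<close>

locale function_seminorm =
  fixes X :: "('a \<Rightarrow> real) set" and N :: "('a \<Rightarrow> real) \<Rightarrow> real"
  assumes zero_mem: "(\<lambda>x. 0) \<in> X"
    and combination_mem: "u \<in> X \<Longrightarrow> v \<in> X \<Longrightarrow> (\<lambda>x. a * u x + b * v x) \<in> X"
    and norm_combination: "u \<in> X \<Longrightarrow> v \<in> X \<Longrightarrow> N (\<lambda>x. a * u x + b * v x) \<le> \<bar>a\<bar> * N u + \<bar>b\<bar> * N v"
    and norm_nonneg: "u \<in> X \<Longrightarrow> 0 \<le> N u"
begin

lemma diff_mem: "u \<in> X \<Longrightarrow> v \<in> X \<Longrightarrow> (\<lambda>x. u x - v x) \<in> X"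
  using combination_mem[of u v 1 "-1"] by simp

lemma norm_zero: "N (\<lambda>x. 0) = 0"
  using norm_combination[OF zero_mem zero_mem, of 0 0] norm_nonneg[OF zero_mem] by simp

lemma norm_diff_commute:
  assumes "u \<in> X" "v \<in> X" shows "N (\<lambda>x. u x - v x) = N (\<lambda>x. v x - u x)"
proof -
  have *: "N (\<lambda>x. u x - v x) \<le> N (\<lambda>x. v x - u x)" if "u \<in> X" "v \<in> X" for u v
    using norm_combination[OF diff_mem[OF that(2,1)] zero_mem, of "-1" 0] by simp
  show ?thesis using *[OF assms] *[OF assms(2,1)] by simp
qed

lemma norm_diff_triangle:
  assumes "u \<in> X" "v \<in> X" "w \<in> X"
  shows "N (\<lambda>x. u x - w x) \<le> N (\<lambda>x. u x - v x) + N (\<lambda>x. v x - w x)"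
  using norm_combination[OF diff_mem[OF assms(1,2)] diff_mem[OF assms(2,3)], of 1 1] by simp

lemma norm_diff_le: "u \<in> X \<Longrightarrow> v \<in> X \<Longrightarrow> N (\<lambda>x. u x - v x) \<le> N u + N v"
  using norm_combination[of u v 1 "-1"] by simp

lemma simple_curve_mem: "simple_curve T X c \<Longrightarrow> t \<in> {0..T} \<Longrightarrow> c t \<in> X"
  by (auto simp: simple_curve_def)

lemma simple_curve_fibre: "simple_curve T X c \<Longrightarrow> {t \<in> {0..T}. c t = v} \<in> sets lebesgue"
  by (auto simp: simple_curve_def)

text \<open>The pair of the two curves is again finite-valued, so \<open>\<Phi>\<close> may be any
  function of the pair.\<close>

lemma simple_curve_measurable2:
  fixes \<Phi> :: "('a \<Rightarrow> real) \<Rightarrow> ('a \<Rightarrow> real) \<Rightarrow> real"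
  assumes "simple_curve T X c" "simple_curve T X d"
  shows "(\<lambda>t. \<Phi> (c t) (d t)) \<in> borel_measurable (lebesgue_on {0..T})"
proof -
  have "(\<lambda>t. case_prod \<Phi> (c t, d t)) \<in> borel_measurable (lebesgue_on {0..T})"
  proof (rule finite_valued_measurable[of "\<lambda>t. (c t, d t)" T "case_prod \<Phi>"])
    have "(\<lambda>t. (c t, d t)) ` {0..T} \<subseteq> c ` {0..T} \<times> d ` {0..T}" by auto
    then show "finite ((\<lambda>t. (c t, d t)) ` {0..T})"
      by (rule finite_subset) (use assms in \<open>simp add: simple_curve_def\<close>)
    fix v
    have "{t \<in> {0..T}. (c t, d t) = v} = {t \<in> {0..T}. c t = fst v} \<inter> {t \<in> {0..T}. d t = snd v}" by auto
    then show "{t \<in> {0..T}. (c t, d t) = v} \<in> sets lebesgue"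
      using simple_curve_fibre[OF assms(1)] simple_curve_fibre[OF assms(2)] by simp
  qed
  then show ?thesis by simp
qed

lemma simple_curve_diff:
  assumes "simple_curve T X c" "simple_curve T X d"
  shows "simple_curve T X (\<lambda>t x. c t x - d t x)"
  unfolding simple_curve_def
proof (intro conjI allI)
  show "(\<lambda>t x. c t x - d t x) ` {0..T} \<subseteq> X"
    using simple_curve_mem[OF assms(1)] simple_curve_mem[OF assms(2)] diff_mem by blast
  have "(\<lambda>t x. c t x - d t x) ` {0..T} \<subseteq> (\<lambda>(v, w) x. v x - w x) ` (c ` {0..T} \<times> d ` {0..T})" by force
  then show "finite ((\<lambda>t x. c t x - d t x) ` {0..T})"
    by (rule finite_subset) (use assms in \<open>simp add: simple_curve_def\<close>)
  fix v
  \<comment> \<open>The fibre of the difference is recovered as the set where a measurable function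
    of the pair equals 1.\<close>
  have "(\<lambda>t. of_bool ((\<lambda>x. c t x - d t x) = v) :: real) \<in> borel_measurable (lebesgue_on {0..T})"
    by (rule simple_curve_measurable2[OF assms, of "\<lambda>u w. of_bool ((\<lambda>x. u x - w x) = v)"])
  then have "(\<lambda>t. of_bool ((\<lambda>x. c t x - d t x) = v) :: real) -` {1} \<inter> space (lebesgue_on {0..T}) \<in>
      sets (lebesgue_on {0..T})"
    by (rule measurable_sets) simp
  moreover have "(\<lambda>t. of_bool ((\<lambda>x. c t x - d t x) = v) :: real) -` {1} \<inter> space (lebesgue_on {0..T})
      = {t \<in> {0..T}. (\<lambda>x. c t x - d t x) = v}"
    by (auto simp: space_restrict_space)
  ultimately show "{t \<in> {0..T}. (\<lambda>x. c t x - d t x) = v} \<in> sets lebesgue"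
    by (simp add: sets_restrict_space_iff)
qed

lemma simple_curve_zero: "simple_curve T X (\<lambda>t x. 0)"
proof -
  have "{t \<in> {0..T}. (\<lambda>x::'a. 0::real) = v} = (if (\<lambda>x. 0) = v then {0..T} else {})" for v by auto
  then show ?thesis using zero_mem by (auto simp: simple_curve_def image_constant_conv)
qed

text \<open>Cutting off to a measurable set of times is what turns pointwise approximants into
  dominated ones.\<close>

lemma simple_curve_restrict:
  assumes "simple_curve T X c" "A \<in> sets (lebesgue_on {0..T})"
  shows "simple_curve T X (\<lambda>t. if t \<in> A then c t else (\<lambda>x. 0))"
  unfolding simple_curve_def
proof (intro conjI allI)
  have A: "A \<in> sets lebesgue" using assms(2) by (simp add: sets_restrict_space_iff)
  show "(\<lambda>t. if t \<in> A then c t else (\<lambda>x. 0)) ` {0..T} \<subseteq> X"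
    using simple_curve_mem[OF assms(1)] zero_mem by auto
  have "(\<lambda>t. if t \<in> A then c t else (\<lambda>x. 0)) ` {0..T} \<subseteq> insert (\<lambda>x. 0) (c ` {0..T})" by auto
  then show "finite ((\<lambda>t. if t \<in> A then c t else (\<lambda>x. 0)) ` {0..T})"
    by (rule finite_subset) (use assms(1) in \<open>simp add: simple_curve_def\<close>)
  fix v
  have eq: "{t \<in> {0..T}. (if t \<in> A then c t else (\<lambda>x. 0)) = v}
      = (A \<inter> {t \<in> {0..T}. c t = v}) \<union> (if (\<lambda>x. 0) = v then {0..T} - A else {})" by auto
  show "{t \<in> {0..T}. (if t \<in> A then c t else (\<lambda>x. 0)) = v} \<in> sets lebesgue"
    unfolding eq by (intro sets.Un sets.Int A simple_curve_fibre[OF assms(1)]) (use A in auto)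
qed

lemma strongly_measurableE:
  assumes "strongly_measurable T X N u"
  obtains s where "\<And>n::nat. simple_curve T X (s n)" "AE t in lebesgue_on {0..T}. u t \<in> X"
    "AE t in lebesgue_on {0..T}. (\<lambda>n. N (\<lambda>x. s n t x - u t x)) \<longlonglongrightarrow> 0"
  using assms unfolding strongly_measurable_def by blast

lemma AE_interval: "AE t in lebesgue_on {0..T}. t \<in> {0..T::real}"
  by (auto intro!: AE_I2 simp: space_restrict_space)

text \<open>By the reverse triangle inequality the distance is an almost everywhere limit of
  distances between simple curves.\<close>

lemma norm_diff_measurable:
  assumes u: "strongly_measurable T X N u" and c: "simple_curve T X c"
  shows "(\<lambda>t. N (\<lambda>x. c t x - u t x)) \<in> borel_measurable (lebesgue_on {0..T})"
proof -
  obtain s where s: "\<And>n::nat. simple_curve T X (s n)" "AE t in lebesgue_on {0..T}. u t \<in> X"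
    "AE t in lebesgue_on {0..T}. (\<lambda>n. N (\<lambda>x. s n t x - u t x)) \<longlonglongrightarrow> 0"
    using strongly_measurableE[OF u] by blast
  show ?thesis
  proof (rule borel_measurable_AE_limit)
    show "(\<lambda>t. N (\<lambda>x. c t x - s n t x)) \<in> borel_measurable (lebesgue_on {0..T})" for n
      by (rule simple_curve_measurable2[OF c s(1)])
    show "AE t in lebesgue_on {0..T}. (\<lambda>n. N (\<lambda>x. c t x - s n t x)) \<longlonglongrightarrow> N (\<lambda>x. c t x - u t x)"
      using s(2,3) AE_interval[of T]
    proof eventually_elim
      case (elim t)
      note cm = simple_curve_mem[OF c elim(3)] and sm = simple_curve_mem[OF s(1) elim(3)]
      have "norm (N (\<lambda>x. c t x - s n t x) - N (\<lambda>x. c t x - u t x)) \<le> N (\<lambda>x. s n t x - u t x)" for n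
        using norm_diff_triangle[OF cm sm elim(1), of n] norm_diff_triangle[OF cm elim(1) sm, of n]
          norm_diff_commute[OF elim(1) sm, of n] by (simp add: abs_le_iff)
      then show ?case
        by (intro LIM_zero_cancel[OF Lim_null_comparison[OF always_eventually[OF allI] elim(2)]])
    qed
  qed simp
qed

lemma norm_measurable:
  assumes "strongly_measurable T X N u"
  shows "(\<lambda>t. N (u t)) \<in> borel_measurable (lebesgue_on {0..T})"
proof (rule borel_measurable_AE_lebesgue_on[OF norm_diff_measurable[OF assms simple_curve_zero]])
  have "AE t in lebesgue_on {0..T}. u t \<in> X" using assms by (simp add: strongly_measurable_def)
  then show "AE t in lebesgue_on {0..T}. N (\<lambda>x. 0 - u t x) = N (u t)"
  proof eventually_elim
    case (elim t)
    show ?case using norm_diff_commute[OF zero_mem elim] by simp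
  qed
qed simp

lemma bochner2D:
  assumes "u \<in> bochner_lp 2 T X N"
  shows "strongly_measurable T X N u" "AE t in lebesgue_on {0..T}. u t \<in> X"
    "integrable (lebesgue_on {0..T}) (\<lambda>t. (N (u t))\<^sup>2)"
proof -
  show sm: "strongly_measurable T X N u" using assms by (simp add: bochner_lp_def)
  then show X: "AE t in lebesgue_on {0..T}. u t \<in> X" by (simp add: strongly_measurable_def)
  have i: "integrable (lebesgue_on {0..T}) (\<lambda>t. N (u t) powr 2)" using assms
      by (simp add: bochner_lp_def)
  show "integrable (lebesgue_on {0..T}) (\<lambda>t. (N (u t))\<^sup>2)"
  proof (rule integrable_cong_AE_imp[OF i])
    show "(\<lambda>t. (N (u t))\<^sup>2) \<in> borel_measurable (lebesgue_on {0..T})"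
      using norm_measurable[OF sm] by simp
    show "AE t in lebesgue_on {0..T}. N (u t) powr 2 = (N (u t))\<^sup>2"
      using X by eventually_elim (simp add: norm_nonneg)
  qed
qed

lemma bochner2I:
  assumes "strongly_measurable T X N u" "integrable (lebesgue_on {0..T}) g"
    and "AE t in lebesgue_on {0..T}. (N (u t))\<^sup>2 \<le> g t"
  shows "u \<in> bochner_lp 2 T X N"
proof -
  have X: "AE t in lebesgue_on {0..T}. u t \<in> X" using assms(1) by (simp add: strongly_measurable_def)
  have "integrable (lebesgue_on {0..T}) (\<lambda>t. N (u t) powr 2)"
  proof (rule Bochner_Integration.integrable_bound[OF assms(2)])
    show "(\<lambda>t. N (u t) powr 2) \<in> borel_measurable (lebesgue_on {0..T})"
      using norm_measurable[OF assms(1)] by measurable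
    show "AE t in lebesgue_on {0..T}. norm (N (u t) powr 2) \<le> norm (g t)"
      using X assms(3) by eventually_elim (simp add: norm_nonneg)
  qed
  then show ?thesis using assms(1) by (simp add: bochner_lp_def)
qed

lemma strongly_measurable_diff:
  assumes u: "strongly_measurable T X N u" and v: "strongly_measurable T X N v"
  shows "strongly_measurable T X N (\<lambda>t x. u t x - v t x)"
proof -
  obtain s where s: "\<And>n::nat. simple_curve T X (s n)" "AE t in lebesgue_on {0..T}. u t \<in> X"
    "AE t in lebesgue_on {0..T}. (\<lambda>n. N (\<lambda>x. s n t x - u t x)) \<longlonglongrightarrow> 0"
    using strongly_measurableE[OF u] by blast
  obtain r where r: "\<And>n::nat. simple_curve T X (r n)" "AE t in lebesgue_on {0..T}. v t \<in> X"
    "AE t in lebesgue_on {0..T}. (\<lambda>n. N (\<lambda>x. r n t x - v t x)) \<longlonglongrightarrow> 0"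
    using strongly_measurableE[OF v] by blast
  have "AE t in lebesgue_on {0..T}. (\<lambda>n. N (\<lambda>x. (s n t x - r n t x) - (u t x - v t x))) \<longlonglongrightarrow> 0"
    using s(2,3) r(2,3) AE_interval[of T]
  proof eventually_elim
    case (elim t)
    note sm = simple_curve_mem[OF s(1) elim(5)] and rm = simple_curve_mem[OF r(1) elim(5)]
    have le: "norm (N (\<lambda>x. (s n t x - r n t x) - (u t x - v t x))) \<le> N (\<lambda>x. s n t x - u t x)
        + N (\<lambda>x. r n t x - v t x)" for n
    proof -
      have "(\<lambda>x. (s n t x - r n t x) - (u t x - v t x)) = (\<lambda>x. (s n t x - u t x) - (r n t x
          - v t x))" by auto
      then show ?thesis
        using norm_diff_le[OF diff_mem[OF sm[of n] elim(1)] diff_mem[OF rm[of n] elim(3)]]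
          norm_nonneg[OF diff_mem[OF diff_mem[OF sm[of n] elim(1)] diff_mem[OF rm[of n] elim(3)]]]
              by simp
    qed
    have "(\<lambda>n. N (\<lambda>x. s n t x - u t x) + N (\<lambda>x. r n t x - v t x)) \<longlonglongrightarrow> 0"
      using tendsto_add[OF elim(2,4)] by simp
    then show ?case by (rule Lim_null_comparison[OF always_eventually[OF allI[OF le]]])
  qed
  moreover have "AE t in lebesgue_on {0..T}. (\<lambda>x. u t x - v t x) \<in> X"
    using s(2) r(2) by eventually_elim (rule diff_mem)
  ultimately show ?thesis
    unfolding strongly_measurable_def
    by (intro conjI exI[of _ "\<lambda>n t x. s n t x - r n t x"] allI simple_curve_diff s(1) r(1)) auto
qed

lemma bochner2_diff:
  assumes "u \<in> bochner_lp 2 T X N" "v \<in> bochner_lp 2 T X N"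
  shows "(\<lambda>t x. u t x - v t x) \<in> bochner_lp 2 T X N"
proof (rule bochner2I[OF strongly_measurable_diff])
  show "integrable (lebesgue_on {0..T}) (\<lambda>t. 2 * (N (u t))\<^sup>2 + 2 * (N (v t))\<^sup>2)"
    using bochner2D(3)[OF assms(1)] bochner2D(3)[OF assms(2)] by simp
  show "AE t in lebesgue_on {0..T}. (N (\<lambda>x. u t x - v t x))\<^sup>2 \<le> 2 * (N (u t))\<^sup>2 + 2 * (N (v t))\<^sup>2"
    using bochner2D(2)[OF assms(1)] bochner2D(2)[OF assms(2)]
  proof eventually_elim
    case (elim t)
    have "(N (\<lambda>x. u t x - v t x))\<^sup>2 \<le> (N (u t) + N (v t))\<^sup>2"
      using norm_diff_le[OF elim] norm_nonneg[OF diff_mem[OF elim]] by (intro power_mono) auto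
    also have "\<dots> \<le> 2 * (N (u t))\<^sup>2 + 2 * (N (v t))\<^sup>2"
      using sum_squares_bound[of "N (u t)" "N (v t)"] by (simp add: power2_sum)
    finally show ?case .
  qed
qed (use bochner2D(1) assms in auto)

text \<open>Strong measurability gives approximation pointwise in time only. Keeping an approximant
  just where it is within distance 1 of \<open>u\<close>, and zero elsewhere, yields the majorant 1
  + N(u)^2 for dominated convergence.\<close>

lemma bochner2_simple_approximation:
  assumes u: "u \<in> bochner_lp 2 T X N" and e: "0 < e"
  obtains c where "simple_curve T X c"
    "integrable (lebesgue_on {0..T}) (\<lambda>t. (N (\<lambda>x. c t x - u t x))\<^sup>2)"
    "(LINT t|lebesgue_on {0..T}. (N (\<lambda>x. c t x - u t x))\<^sup>2) < e"
proof -
  let ?M = "lebesgue_on {0..T}"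
  note uD = bochner2D[OF u]
  obtain s where s: "\<And>n::nat. simple_curve T X (s n)"
    "AE t in ?M. (\<lambda>n. N (\<lambda>x. s n t x - u t x)) \<longlonglongrightarrow> 0"
    using strongly_measurableE[OF uD(1)] by blast
  define A where "A n = {t \<in> space ?M. N (\<lambda>x. s n t x - u t x) \<le> 1}" for n
  have Am: "A n \<in> sets ?M" for n
    unfolding A_def using norm_diff_measurable[OF uD(1) s(1)[of n]] by measurable
  define c where "c n t = (if t \<in> A n then s n t else (\<lambda>x. 0))" for n t
  have cs: "simple_curve T X (c n)" for n
    unfolding c_def by (rule simple_curve_restrict[OF s(1) Am])
  let ?g = "\<lambda>n t. (N (\<lambda>x. c n t x - u t x))\<^sup>2"
  have gm: "?g n \<in> borel_measurable ?M" for n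
    using norm_diff_measurable[OF uD(1) cs[of n]] by simp
  have c1: "integrable ?M (\<lambda>t. 1 :: real)" by (rule continuous_imp_integrable_real) simp
  have wi: "integrable ?M (\<lambda>t. 1 + (N (u t))\<^sup>2)" using uD(3) c1
      by (intro Bochner_Integration.integrable_add)
  have dom: "AE t in ?M. norm (?g n t) \<le> 1 + (N (u t))\<^sup>2" for n
    using uD(2)
  proof eventually_elim
    case (elim t)
    show ?case
    proof (cases "t \<in> A n")
      case True
      then have t: "t \<in> {0..T}" "N (\<lambda>x. s n t x - u t x) \<le> 1" by (auto simp: A_def space_restrict_space)
      then have "(N (\<lambda>x. s n t x - u t x))\<^sup>2 \<le> 1\<^sup>2"
        using norm_nonneg[OF diff_mem[OF simple_curve_mem[OF s(1) t(1)] elim]] by (intro power_mono) auto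
      then have "(N (\<lambda>x. s n t x - u t x))\<^sup>2 \<le> 1 + (N (u t))\<^sup>2"
        using zero_le_power2[of "N (u t)"] unfolding one_power2 by linarith
      then show ?thesis using True by (simp add: c_def)
    next
      case False
      then show ?thesis using norm_diff_commute[OF zero_mem elim] by (simp add: c_def)
    qed
  qed
  have "(\<lambda>n. LINT t|?M. ?g n t) \<longlonglongrightarrow> (LINT t|?M. 0)"
  proof (rule integral_dominated_convergence[OF _ gm wi _ dom])
    show "AE t in ?M. (\<lambda>n. ?g n t) \<longlonglongrightarrow> 0"
      using s(2) AE_interval[of T]
    proof eventually_elim
      case (elim t)
      \<comment> \<open>At almost every time the cut-off is eventually inactive.\<close>
      have "eventually (\<lambda>n. N (\<lambda>x. s n t x - u t x) < 1) sequentially"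
        using order_tendstoD(2)[OF elim(1), of 1] by simp
      then have "eventually (\<lambda>n. (N (\<lambda>x. s n t x - u t x))\<^sup>2 = ?g n t) sequentially"
        by eventually_elim (use elim(2) in \<open>auto simp: c_def A_def space_restrict_space\<close>)
      moreover have "(\<lambda>n. (N (\<lambda>x. s n t x - u t x))\<^sup>2) \<longlonglongrightarrow> 0\<^sup>2" by (intro tendsto_power elim)
      ultimately show ?case using Lim_transform_eventually by fastforce
    qed
  qed simp
  then have "(\<lambda>n. LINT t|?M. ?g n t) \<longlonglongrightarrow> 0" by simp
  from order_tendstoD(2)[OF this e] obtain n where "(LINT t|?M. ?g n t) < e"
    by (auto simp: eventually_sequentially)
  moreover have "integrable ?M (?g n)"
  proof (rule Bochner_Integration.integrable_bound[OF wi gm])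
    show "AE t in ?M. norm (?g n t) \<le> norm (1 + (N (u t))\<^sup>2)"
      using dom[of n] by eventually_elim simp
  qed
  ultimately show ?thesis using that[OF cs] by blast
qed

end

subsection \<open>The integrated energy inequality\<close>

context bounded_domain
begin

section \<open>The dual of the space with Dirichlet condition\<close>

lemma h1_norm_zero: "h1_norm \<Omega> (\<lambda>x. 0) = 0"
proof -
  have z: "(\<lambda>x. 0) \<in> h_space \<Omega> 1" by (rule smooth_h_space[OF smooth_const])
  show ?thesis using h_space_linear_combination(3)[OF z z, of 0 0] sobolev_norm_nonneg[of \<Omega> 1 2
      "\<lambda>x. 0"] by simp
qed

lemma zero_h1d: "(\<lambda>x. 0) \<in> h1d \<Omega> \<Gamma>"
proof -
  have z: "(\<lambda>x. 0) \<in> h_space \<Omega> 1" by (rule smooth_h_space[OF smooth_const])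
  then have "has_trace \<Omega> (\<lambda>x. 0) (\<lambda>x. 0)"
    unfolding has_trace_def using h1_norm_zero smooth_const[of 0]
    by (intro conjI exI[of _ "\<lambda>n x. 0"]) auto
  then show ?thesis using z by (auto simp: h1d_def)
qed

lemma h1d_dual_linear:
  assumes "F \<in> h1d_dual \<Omega> \<Gamma>" "u \<in> h1d \<Omega> \<Gamma>" "v \<in> h1d \<Omega> \<Gamma>"
  shows "F (\<lambda>x. a * u x + b * v x) = a * F u + b * F v"
  using assms by (simp add: h1d_dual_def)

text \<open>The dual norm is a real supremum, which is informative only over a bounded set; the
  continuity constant in the definition of the dual supplies the bound.\<close>

lemma h1d_dual_bdd:
  assumes "F \<in> h1d_dual \<Omega> \<Gamma>"
  shows "bdd_above ((\<lambda>u. \<bar>F u\<bar>) ` {u \<in> h1d \<Omega> \<Gamma>. h1_norm \<Omega> u \<le> 1})"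
proof -
  have "\<exists>K. \<forall>u \<in> h1d \<Omega> \<Gamma>. \<bar>F u\<bar> \<le> K * h1_norm \<Omega> u" using assms by (simp add: h1d_dual_def)
  then obtain K where K: "\<And>u. u \<in> h1d \<Omega> \<Gamma> \<Longrightarrow> \<bar>F u\<bar> \<le> K * h1_norm \<Omega> u" by blast
  have "\<bar>F u\<bar> \<le> \<bar>K\<bar>" if "u \<in> h1d \<Omega> \<Gamma>" "h1_norm \<Omega> u \<le> 1" for u
  proof -
    have "\<bar>F u\<bar> \<le> K * h1_norm \<Omega> u" by (rule K[OF that(1)])
    also have "\<dots> \<le> \<bar>K\<bar> * 1"
      using that sobolev_norm_nonneg by (intro mult_mono) auto
    finally show ?thesis by simp
  qed
  then show ?thesis by (intro bdd_aboveI2[of _ _ "\<bar>K\<bar>"]) auto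
qed

lemma h1d_dual_norm_upper:
  assumes "F \<in> h1d_dual \<Omega> \<Gamma>" "u \<in> h1d \<Omega> \<Gamma>" "h1_norm \<Omega> u \<le> 1"
  shows "\<bar>F u\<bar> \<le> h1d_dual_norm \<Omega> \<Gamma> F"
  unfolding h1d_dual_norm_def by (rule cSUP_upper[OF _ h1d_dual_bdd[OF assms(1)]]) (use assms in simp)

lemma h1d_dual_norm_nonneg: "F \<in> h1d_dual \<Omega> \<Gamma> \<Longrightarrow> 0 \<le> h1d_dual_norm \<Omega> \<Gamma> F"
  using h1d_dual_norm_upper[OF _ zero_h1d] h1_norm_zero by (metis abs_ge_zero order_trans zero_le_one)

text \<open>Scaling to the unit ball. An element of zero norm cannot be scaled, but there the
  continuity constant forces \<open>F\<close> to vanish.\<close>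

lemma h1d_dual_bound:
  assumes F: "F \<in> h1d_dual \<Omega> \<Gamma>" and u: "u \<in> h1d \<Omega> \<Gamma>"
  shows "\<bar>F u\<bar> \<le> h1d_dual_norm \<Omega> \<Gamma> F * h1_norm \<Omega> u"
proof (cases "h1_norm \<Omega> u = 0")
  case True
  obtain K where "\<bar>F u\<bar> \<le> K * h1_norm \<Omega> u" using F u by (auto simp: h1d_dual_def)
  then show ?thesis using True by simp
next
  case False
  let ?h = "h1_norm \<Omega> u"
  have h: "?h > 0" using False sobolev_norm_nonneg[of \<Omega> 1 2 u] by linarith
  \<comment> \<open>The summand with coefficient 0 brings the scaling into the form of the two-term
    combinations for which closure and linearity are stated.\<close>
  let ?v = "\<lambda>x. (1 / ?h) * u x + 0 * u x"
  have v: "?v \<in> h1d \<Omega> \<Gamma>" by (rule h1d_linear_combination[OF u u])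
  have "h1_norm \<Omega> ?v \<le> \<bar>1 / ?h\<bar> * ?h + \<bar>0\<bar> * ?h"
    by (rule h_space_linear_combination(3)[OF h1d_h_space[OF u] h1d_h_space[OF u]])
  then have "h1_norm \<Omega> ?v \<le> 1" using h by simp
  then have "\<bar>F ?v\<bar> \<le> h1d_dual_norm \<Omega> \<Gamma> F" by (rule h1d_dual_norm_upper[OF F v])
  then have "?h * \<bar>F ?v\<bar> \<le> ?h * h1d_dual_norm \<Omega> \<Gamma> F" using h by (intro mult_left_mono) auto
  moreover have "F ?v = (1 / ?h) * F u" using h1d_dual_linear[OF F u u, of "1 / ?h" 0] by simp
  then have "?h * \<bar>F ?v\<bar> = \<bar>F u\<bar>" using h by (simp only: abs_mult) simp
  ultimately show ?thesis by (simp only: mult.commute)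
qed

lemma h1d_dual_combination:
  assumes F: "F \<in> h1d_dual \<Omega> \<Gamma>" and G: "G \<in> h1d_dual \<Omega> \<Gamma>"
  shows "(\<lambda>u. a * F u + b * G u) \<in> h1d_dual \<Omega> \<Gamma>"
proof -
  have "\<bar>a * F u + b * G u\<bar> \<le> (\<bar>a\<bar> * h1d_dual_norm \<Omega> \<Gamma> F + \<bar>b\<bar> * h1d_dual_norm \<Omega> \<Gamma> G) * h1_norm \<Omega> u"
    if u: "u \<in> h1d \<Omega> \<Gamma>" for u
  proof -
    have "\<bar>a * F u + b * G u\<bar> \<le> \<bar>a\<bar> * \<bar>F u\<bar> + \<bar>b\<bar> * \<bar>G u\<bar>"
      by (metis abs_mult abs_triangle_ineq)
    also have "\<dots> \<le> \<bar>a\<bar> * (h1d_dual_norm \<Omega> \<Gamma> F * h1_norm \<Omega> u) + \<bar>b\<bar> * (h1d_dual_norm \<Omega> \<Gamma> G * h1_norm \<Omega> u)"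
      by (intro add_mono mult_left_mono h1d_dual_bound F G u) auto
    finally show ?thesis by (simp add: algebra_simps)
  qed
  moreover have "a * F (\<lambda>x. c * u x + d * v x) + b * G (\<lambda>x. c * u x + d * v x)
      = c * (a * F u + b * G u) + d * (a * F v + b * G v)" if "u \<in> h1d \<Omega> \<Gamma>" "v \<in> h1d \<Omega> \<Gamma>" for u v c d
    using h1d_dual_linear[OF F that] h1d_dual_linear[OF G that] by (simp add: algebra_simps)
  ultimately show ?thesis unfolding h1d_dual_def by blast
qed

text \<open>Opens the results on measurability and simple approximation of curves to the time
  derivatives, whose values are functionals.\<close>

lemma h1d_dual_seminorm: "function_seminorm (h1d_dual \<Omega> \<Gamma>) (h1d_dual_norm \<Omega> \<Gamma>)"
proof
  show "(\<lambda>x. 0) \<in> h1d_dual \<Omega> \<Gamma>" by (auto simp: h1d_dual_def intro: exI[of _ 0])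
  show "(\<lambda>x. a * u x + b * v x) \<in> h1d_dual \<Omega> \<Gamma>" if "u \<in> h1d_dual \<Omega> \<Gamma>" "v \<in> h1d_dual \<Omega> \<Gamma>" for u v a b
    by (rule h1d_dual_combination[OF that])
  show "0 \<le> h1d_dual_norm \<Omega> \<Gamma> u" if "u \<in> h1d_dual \<Omega> \<Gamma>" for u by (rule h1d_dual_norm_nonneg[OF that])
  fix F G :: "(plane \<Rightarrow> real) \<Rightarrow> real" and a b :: real
  assume FG: "F \<in> h1d_dual \<Omega> \<Gamma>" "G \<in> h1d_dual \<Omega> \<Gamma>"
  show "h1d_dual_norm \<Omega> \<Gamma> (\<lambda>x. a * F x + b * G x) \<le> \<bar>a\<bar> * h1d_dual_norm \<Omega> \<Gamma> F
      + \<bar>b\<bar> * h1d_dual_norm \<Omega> \<Gamma> G"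
    unfolding h1d_dual_norm_def[of _ _ "\<lambda>x. a * F x + b * G x"]
  proof (rule cSUP_least)
    show "{u \<in> h1d \<Omega> \<Gamma>. h1_norm \<Omega> u \<le> 1} \<noteq> {}" using zero_h1d h1_norm_zero by force
    fix u assume "u \<in> {u \<in> h1d \<Omega> \<Gamma>. h1_norm \<Omega> u \<le> 1}"
    then have u: "u \<in> h1d \<Omega> \<Gamma>" "h1_norm \<Omega> u \<le> 1" by auto
    have "\<bar>a * F u + b * G u\<bar> \<le> \<bar>a\<bar> * \<bar>F u\<bar> + \<bar>b\<bar> * \<bar>G u\<bar>"
      by (metis abs_mult abs_triangle_ineq)
    also have "\<dots> \<le> \<bar>a\<bar> * h1d_dual_norm \<Omega> \<Gamma> F + \<bar>b\<bar> * h1d_dual_norm \<Omega> \<Gamma> G"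
      by (intro add_mono mult_left_mono h1d_dual_norm_upper FG u) auto
    finally show "\<bar>a * F u + b * G u\<bar> \<le> \<bar>a\<bar> * h1d_dual_norm \<Omega> \<Gamma> F + \<bar>b\<bar> * h1d_dual_norm \<Omega> \<Gamma> G" .
  qed
qed

text \<open>The pairing is an almost everywhere limit of pairings of simple curves. Bounding a norm
  by one plus its square reduces integrability to square integrability on a bounded
  interval.\<close>

lemma pairing_integrable:
  assumes u: "u \<in> bochner_lp 2 T (h1d_dual \<Omega> \<Gamma>) (h1d_dual_norm \<Omega> \<Gamma>)" and \<psi>: "\<psi> \<in> h1d \<Omega> \<Gamma>"
  shows "integrable (lebesgue_on {0..T}) (\<lambda>t. u t \<psi>)"
proof -
  interpret function_seminorm "h1d_dual \<Omega> \<Gamma>" "h1d_dual_norm \<Omega> \<Gamma>" by (rule h1d_dual_seminorm)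
  let ?M = "lebesgue_on {0..T}" and ?N = "h1d_dual_norm \<Omega> \<Gamma>" and ?h = "h1_norm \<Omega> \<psi>"
  note uD = bochner2D[OF u]
  have h: "0 \<le> ?h" by (rule sobolev_norm_nonneg)
  obtain s where s: "\<And>n::nat. simple_curve T (h1d_dual \<Omega> \<Gamma>) (s n)"
    "AE t in ?M. (\<lambda>n. ?N (\<lambda>x. s n t x - u t x)) \<longlonglongrightarrow> 0"
    using strongly_measurableE[OF uD(1)] by blast
  have m: "(\<lambda>t. u t \<psi>) \<in> borel_measurable ?M"
  proof (rule borel_measurable_AE_limit)
    show "(\<lambda>t. s n t \<psi>) \<in> borel_measurable ?M" for n
      by (rule simple_curve_measurable2[OF s(1) s(1), of "\<lambda>F G. F \<psi>"])
    show "AE t in ?M. (\<lambda>n. s n t \<psi>) \<longlonglongrightarrow> u t \<psi>"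
      using s(2) uD(2) AE_interval[of T]
    proof eventually_elim
      case (elim t)
      have le: "norm (s n t \<psi> - u t \<psi>) \<le> ?N (\<lambda>x. s n t x - u t x) * ?h" for n
        using h1d_dual_bound[OF diff_mem[OF simple_curve_mem[OF s(1) elim(3)] elim(2)] \<psi>, of n] by simp
      have "(\<lambda>n. ?N (\<lambda>x. s n t x - u t x) * ?h) \<longlonglongrightarrow> 0"
        using tendsto_mult[OF elim(1) tendsto_const, of ?h] by simp
      then have "(\<lambda>n. s n t \<psi> - u t \<psi>) \<longlonglongrightarrow> 0"
        by (rule Lim_null_comparison[OF always_eventually[OF allI[OF le]]])
      then show ?case by (rule LIM_zero_cancel)
    qed
  qed simp
  have c1: "integrable ?M (\<lambda>t. 1 :: real)" by (rule continuous_imp_integrable_real) simp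
  have "integrable ?M (\<lambda>t. (1 + (?N (u t))\<^sup>2) * ?h)"
    using uD(3) c1 by (intro integrable_mult_left Bochner_Integration.integrable_add)
  then show ?thesis
  proof (rule Bochner_Integration.integrable_bound[OF _ m])
    show "AE t in ?M. norm (u t \<psi>) \<le> norm ((1 + (?N (u t))\<^sup>2) * ?h)"
      using uD(2)
    proof eventually_elim
      case (elim t)
      have "\<bar>u t \<psi>\<bar> \<le> ?N (u t) * ?h" by (rule h1d_dual_bound[OF elim \<psi>])
      also have "\<dots> \<le> (1 + (?N (u t))\<^sup>2) * ?h"
        using sum_squares_bound[of 1 "?N (u t)"] norm_nonneg[OF elim] h by (intro mult_right_mono) auto
      finally show ?case using h by (simp add: abs_mult)
    qed
  qed
qed

section \<open>Curves continuous in time with values in L^2, and increments of their squared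
  norm\<close>

definition l2_continuous :: "(real \<Rightarrow> plane \<Rightarrow> real) \<Rightarrow> bool" where
  "l2_continuous w \<longleftrightarrow> (\<forall>t\<ge>0. square_integrable \<Omega> (w t) \<and>
     ((\<lambda>\<tau>. l2_norm \<Omega> (\<lambda>x. w \<tau> x - w t x)) \<longlongrightarrow> 0) (at t within {0..}))"

lemma l2_continuousD:
  assumes "l2_continuous w" "0 \<le> t"
  shows "square_integrable \<Omega> (w t)" "((\<lambda>\<tau>. l2_norm \<Omega> (\<lambda>x. w \<tau> x - w t x)) \<longlongrightarrow> 0) (at t within {0..})"
  using assms by (auto simp: l2_continuous_def)

lemma l2_continuous_diff:
  assumes "l2_continuous v" "l2_continuous w"
  shows "l2_continuous (\<lambda>t x. v t x - w t x)"
  unfolding l2_continuous_def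
proof (intro allI impI conjI)
  fix t :: real assume t: "0 \<le> t"
  note v = l2_continuousD[OF assms(1)] and w = l2_continuousD[OF assms(2)]
  show "square_integrable \<Omega> (\<lambda>x. v t x - w t x)"
      by (rule square_integrable_diff[OF v(1)[OF t] w(1)[OF t]])
  have "\<forall>\<^sub>F \<tau> in at t within {0..}. \<tau> \<in> {0..}" by (simp add: eventually_at_filter)
  then have "\<forall>\<^sub>F \<tau> in at t within {0..}. norm (l2_norm \<Omega> (\<lambda>x. (v \<tau> x - w \<tau> x) - (v t x - w t x)))
      \<le> l2_norm \<Omega> (\<lambda>x. v \<tau> x - v t x) + l2_norm \<Omega> (\<lambda>x. w \<tau> x - w t x)"
  proof eventually_elim
    case (elim \<tau>)
    note sv = square_integrable_diff[OF v(1) v(1)[OF t], of \<tau>]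
        and sw = square_integrable_diff[OF w(1) w(1)[OF t], of \<tau>]
    have "(\<lambda>x. (v \<tau> x - w \<tau> x) - (v t x - w t x)) = (\<lambda>x. (v \<tau> x - v t x) + (- 1) *\<^sub>R (w \<tau> x
        - w t x))" by auto
    then show ?case
      using l2_norm_triangle[OF sv square_integrable_scaleR[OF sw, of "-1"]] elim
        l2_norm_scaleR[of \<Omega> "-1" "\<lambda>x. w \<tau> x - w t x"] by simp
  qed
  moreover have "((\<lambda>\<tau>. l2_norm \<Omega> (\<lambda>x. v \<tau> x - v t x) + l2_norm \<Omega> (\<lambda>x. w \<tau> x
      - w t x)) \<longlongrightarrow> 0) (at t within {0..})"
    using tendsto_add[OF v(2)[OF t] w(2)[OF t]] by simp
  ultimately show "((\<lambda>\<tau>. l2_norm \<Omega> (\<lambda>x. (v \<tau> x - w \<tau> x) - (v t x - w t x))) \<longlongrightarrow> 0) (at t within {0..})"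
    by (rule Lim_null_comparison)
qed

lemma l2_continuous_norm:
  assumes "l2_continuous w" shows "continuous_on {0..} (\<lambda>t. (l2_norm \<Omega> (w t))\<^sup>2)"
proof -
  have "continuous_on {0..} (\<lambda>t. l2_norm \<Omega> (w t))"
    unfolding continuous_on_def
  proof
    fix t :: real assume t: "t \<in> {0..}"
    have "\<forall>\<^sub>F \<tau> in at t within {0..}. \<tau> \<in> {0..}" by (simp add: eventually_at_filter)
    then have "\<forall>\<^sub>F \<tau> in at t within {0..}. norm (l2_norm \<Omega> (w \<tau>) - l2_norm \<Omega> (w t))
        \<le> l2_norm \<Omega> (\<lambda>x. w \<tau> x - w t x)"
    proof eventually_elim
      case (elim \<tau>)
      then show ?case
        using l2_norm_diff_triangle[OF l2_continuousD(1)[OF assms] l2_continuousD(1)[OF assms], of \<tau>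
            t] t by simp
    qed
    then have "((\<lambda>\<tau>. l2_norm \<Omega> (w \<tau>) - l2_norm \<Omega> (w t)) \<longlongrightarrow> 0) (at t within {0..})"
      by (rule Lim_null_comparison) (use l2_continuousD(2)[OF assms] t in simp)
    then show "((\<lambda>\<tau>. l2_norm \<Omega> (w \<tau>)) \<longlongrightarrow> l2_norm \<Omega> (w t)) (at t within {0..})" by (rule LIM_zero_cancel)
  qed
  then show ?thesis by (intro continuous_intros)
qed

lemma l2_continuous_inner:
  assumes "l2_continuous w" "square_integrable \<Omega> \<psi>"
  shows "continuous_on {0..} (\<lambda>t. l2_inner \<Omega> (w t) \<psi>)"
  unfolding continuous_on_def
proof
  fix t :: real assume t: "t \<in> {0..}"
  then have t0: "0 \<le> t" by simp
  have "\<forall>\<^sub>F \<tau> in at t within {0..}. \<tau> \<in> {0..}" by (simp add: eventually_at_filter)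
  then have "\<forall>\<^sub>F \<tau> in at t within {0..}. norm (l2_inner \<Omega> (w \<tau>) \<psi> - l2_inner \<Omega> (w t) \<psi>)
      \<le> l2_norm \<Omega> (\<lambda>x. w \<tau> x - w t x) * l2_norm \<Omega> \<psi>"
  proof eventually_elim
    case (elim \<tau>)
    then have "0 \<le> \<tau>" by simp
    note s = l2_continuousD(1)[OF assms(1) this] l2_continuousD(1)[OF assms(1) t0]
    show ?case
      using l2_cauchy_schwarz[OF square_integrable_diff[OF s] assms(2)] l2_inner_diff_left[OF s
          assms(2)] by simp
  qed
  moreover have "((\<lambda>\<tau>. l2_norm \<Omega> (\<lambda>x. w \<tau> x - w t x) * l2_norm \<Omega> \<psi>) \<longlongrightarrow> 0) (at t within {0..})"
    using tendsto_mult[OF l2_continuousD(2)[OF assms(1) t0] tendsto_const, of "l2_norm \<Omega> \<psi>"] by simp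
  ultimately have "((\<lambda>\<tau>. l2_inner \<Omega> (w \<tau>) \<psi> - l2_inner \<Omega> (w t) \<psi>) \<longlongrightarrow> 0) (at t within {0..})"
    by (rule Lim_null_comparison)
  then show "((\<lambda>\<tau>. l2_inner \<Omega> (w \<tau>) \<psi>) \<longlongrightarrow> l2_inner \<Omega> (w t) \<psi>) (at t within {0..})"
      by (rule LIM_zero_cancel)
qed

text \<open>For fixed \<psi> the pairing with \<open>w\<close> is a continuous scalar function, so
  the scalar result applies and the formula holds for all interior times, not just almost
  all.\<close>

lemma time_deriv_increment:
  assumes w: "l2_continuous w" and w': "w' \<in> bochner_lp 2 T (h1d_dual \<Omega> \<Gamma>) (h1d_dual_norm \<Omega> \<Gamma>)"
    and d: "has_time_deriv \<Omega> \<Gamma> T w w'" and \<psi>: "\<psi> \<in> h1d \<Omega> \<Gamma>" and ab: "0 < a" "a < b" "b < T"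
  shows "l2_inner \<Omega> (w b) \<psi> - l2_inner \<Omega> (w a) \<psi> = integral {a..b} (\<lambda>\<tau>. w' \<tau> \<psi>)"
proof (rule distributional_primitive[OF _ pairing_integrable[OF w' \<psi>] _ ab])
  show "continuous_on {0..T} (\<lambda>t. l2_inner \<Omega> (w t) \<psi>)"
    by (rule continuous_on_subset[OF l2_continuous_inner[OF w h_space_square_integrable(1)[OF
        h1d_h_space[OF \<psi>]]]]) auto
  show "(LINT t|lebesgue_on {0..T}. deriv \<eta> t * l2_inner \<Omega> (w t) \<psi>) =
      - (LINT t|lebesgue_on {0..T}. \<eta> t * w' t \<psi>)"
    if "time_test_function T \<eta>" for \<eta> using d \<psi> that by (simp add: has_time_deriv_def)
qed

text \<open>The starting point is \<open>\<parallel>u\<parallel>\<^sup>2 - \<parallel>v\<parallel>\<^sup>2 \<le> 2 \<langle>u - v, u\<rangle>\<close> with \<open>u = w t\<close> and \<open>v = w (t - h)\<close>: the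
  weak derivative is then paired with the single element \<open>w t\<close>.\<close>

lemma integrated_energy_inequality:
  assumes w: "l2_continuous w" and w': "w' \<in> bochner_lp 2 T (h1d_dual \<Omega> \<Gamma>) (h1d_dual_norm \<Omega> \<Gamma>)"
    and inc: "\<And>\<psi> a b. \<psi> \<in> h1d \<Omega> \<Gamma> \<Longrightarrow> 0 < a \<Longrightarrow> a < b \<Longrightarrow> b < T \<Longrightarrow>
      l2_inner \<Omega> (w b) \<psi> - l2_inner \<Omega> (w a) \<psi> = integral {a..b} (\<lambda>\<tau>. w' \<tau> \<psi>)"
    and wd: "AE t in lebesgue_on {0..T}. w t \<in> h1d \<Omega> \<Gamma>"
    and E2: "integrable (lebesgue_on {0..T}) E2" "\<And>t. 0 \<le> E2 t"
      "AE t in lebesgue_on {0..T}. (h1_norm \<Omega> (w t))\<^sup>2 \<le> E2 t"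
    and energy: "AE t in lebesgue_on {0..T}. 2 * w' t (w t) \<le> \<xi> * (l2_norm \<Omega> (w t))\<^sup>2"
    and ab: "0 < a" "a \<le> b" "b \<le> T"
  shows "(l2_norm \<Omega> (w b))\<^sup>2 - (l2_norm \<Omega> (w a))\<^sup>2 \<le> integral {a..b} (\<lambda>t. \<xi> * (l2_norm \<Omega> (w t))\<^sup>2)"
proof -
  interpret function_seminorm "h1d_dual \<Omega> \<Gamma>" "h1d_dual_norm \<Omega> \<Gamma>" by (rule h1d_dual_seminorm)
  let ?M = "lebesgue_on {0..T}" and ?N = "h1d_dual_norm \<Omega> \<Gamma>"
  note w'D = bochner2D[OF w']
  define n where "n t = (l2_norm \<Omega> (w t))\<^sup>2" for t
  have nc: "continuous_on {0..T} n"
    unfolding n_def by (rule continuous_on_subset[OF l2_continuous_norm[OF w]]) auto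
  \<comment> \<open>The parameter \<eta> weights Young's inequality. All error terms end up as
    multiples of \<eta>, which is finally sent to zero.\<close>
  have step: "n b - n a \<le> integral {a..b} (\<lambda>t. \<xi> * n t) + \<eta> * (integral {0..T} E2 + 6)"
      if \<eta>: "0 < \<eta>" for \<eta>
  proof -
    have "0 < \<eta>\<^sup>2" using \<eta> by simp
    \<comment> \<open>Accuracy \<eta>^2 outweighs the factor 1/\<eta> that Young's inequality puts
      in front of the squared distance.\<close>
    then obtain c where c: "simple_curve T (h1d_dual \<Omega> \<Gamma>) c"
      "integrable ?M (\<lambda>t. (?N (\<lambda>x. c t x - w' t x))\<^sup>2)"
      "(LINT t|?M. (?N (\<lambda>x. c t x - w' t x))\<^sup>2) < \<eta>\<^sup>2"
      by (rule bochner2_simple_approximation[OF w'])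
    define G where "G t = (?N (\<lambda>x. c t x - w' t x))\<^sup>2" for t
    define Dm where "Dm F K = (?N (\<lambda>x. F x - K x))\<^sup>2" for F K
    define H where "H x = integral {0..x} G" for x
    define J where "J v x = integral {0..x} (\<lambda>t. of_bool (c t = v) :: real)" for v x
    have Gi: "integrable ?M G" using c(2) unfolding G_def[abs_def] .
    have Gint: "integral {0..T} G \<le> \<eta>\<^sup>2"
      using lebesgue_integral_eq_integral[OF Gi] c(3) unfolding G_def[abs_def] by simp
    have cfin: "finite (c ` {0..T})" using c(1) by (simp add: simple_curve_def)
    have "n b - n a \<le> integral {a..b} (\<lambda>t. \<xi> * n t) + \<eta> * integral {0..T} E2
        + 2 * (3 / \<eta>) * integral {0..T} G"
    proof (rule steklov_inequality[OF nc ab E2(1,2) Gi _ cfin simple_curve_fibre[OF c(1)] _ _ _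
        H_def J_def])
      show "0 \<le> G t" for t by (simp add: G_def)
      show "Dm v v = 0" for v by (simp add: Dm_def norm_zero)
      show "0 \<le> 3 / \<eta>" "0 \<le> \<eta>" using \<eta> by auto
      \<comment> \<open>The increment formula is given for interior times only, so t = T is left
        out.\<close>
      have neT: "AE t in ?M. t \<noteq> T" by (rule AE_lebesgue_on_negligible[of "{T}"]) auto
      show "AE t in ?M. \<forall>h. 0 < h \<longrightarrow> h < t \<longrightarrow> n t - n (t - h) \<le> h * (\<xi> * n t) + h * (\<eta> * E2 t)
          + 3 / \<eta> * (h * G t + (H t - H (t - h)) + (\<Sum>v\<in>c ` {0..T}. Dm v (c t) * (J v t - J v (t - h))))"
        using wd E2(3) energy w'D(2) AE_interval[of T] neT
      proof eventually_elim
        case (elim t)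
        show ?case
        proof (intro allI impI)
          fix h assume h: "0 < h" "h < t"
          let ?I = "{t - h..t}" and ?L = "lebesgue_on {t - h..t}"
          have sub: "?I \<subseteq> {0..T}" using h elim(5) by auto
          have tT: "t < T" using elim(5,6) by simp
          have s: "square_integrable \<Omega> (w t)" "square_integrable \<Omega> (w (t - h))"
            using l2_continuousD(1)[OF w] h by auto
          have "0 \<le> l2_inner \<Omega> (\<lambda>x. w t x - w (t - h) x) (\<lambda>x. w t x - w (t - h) x)"
              by (simp add: l2_inner_self)
          also have "\<dots> = l2_inner \<Omega> (w t) (w t) - l2_inner \<Omega> (w t) (w (t - h))
              - (l2_inner \<Omega> (w (t - h)) (w t) - l2_inner \<Omega> (w (t - h)) (w (t - h)))"
            by (simp only: l2_inner_diff_left[OF s square_integrable_diff[OF s]]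
                l2_inner_diff_right[OF s s(1)] l2_inner_diff_right[OF s s(2)])
          also have "\<dots> = n t - 2 * l2_inner \<Omega> (w (t - h)) (w t) + n (t - h)"
            by (simp add: l2_inner_commute[of \<Omega> "w t" "w (t - h)"] l2_inner_self n_def)
          finally have "n t - n (t - h) \<le> 2 * (l2_inner \<Omega> (w t) (w t) - l2_inner \<Omega> (w (t - h)) (w t))"
            by (simp add: l2_inner_self n_def)
          also have "l2_inner \<Omega> (w t) (w t) - l2_inner \<Omega> (w (t - h)) (w t)
              = integral ?I (\<lambda>\<tau>. w' \<tau> (w t))"
            by (rule inc[OF elim(1)]) (use h tT in auto)
          finally have d: "n t - n (t - h) \<le> 2 * integral ?I (\<lambda>\<tau>. w' \<tau> (w t))" .
          have eqI: "(LINT \<tau>|?L. f \<tau>) = integral ?I f" if "integrable ?L f" for f :: "real \<Rightarrow> real"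
            by (rule lebesgue_integral_eq_integral[OF that]) simp
          have pi: "integrable ?L (\<lambda>\<tau>. w' \<tau> (w t))"
            by (rule integrable_subinterval[OF pairing_integrable[OF w' elim(1)] sub])
          have GL: "integrable ?L G" by (rule integrable_subinterval[OF Gi sub])
          have ofi: "integrable ?M (\<lambda>\<tau>. of_bool (c \<tau> = v) :: real)" for v
          proof (rule Bochner_Integration.integrable_bound[of _ "\<lambda>_. 1 :: real"])
            show "integrable ?M (\<lambda>_. 1 :: real)" by (rule continuous_imp_integrable_real) simp
            show "(\<lambda>\<tau>. of_bool (c \<tau> = v) :: real) \<in> borel_measurable ?M"
              by (rule finite_valued_measurable[OF cfin simple_curve_fibre[OF c(1)]])
          qed auto
          have ofL: "integrable ?L (\<lambda>\<tau>. of_bool (c \<tau> = v) :: real)" for v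
            by (rule integrable_subinterval[OF ofi sub])
          have cL: "integrable ?L (\<lambda>\<tau>. K :: real)" for K by (rule continuous_imp_integrable_real) simp
          have cI: "(LINT \<tau>|?L. K) = h * K" for K :: real
            using h by (subst eqI[OF cL]) simp
          define A where "A = \<xi> * n t + \<eta> * E2 t + 3 / \<eta> * G t"
          let ?S = "\<lambda>\<tau>. \<Sum>v\<in>c ` {0..T}. Dm v (c t) * of_bool (c \<tau> = v)"
          have SL: "integrable ?L ?S" by (intro Bochner_Integration.integrable_sum
              integrable_mult_right ofL)
          have RL: "integrable ?L (\<lambda>\<tau>. A + 3 / \<eta> * (G \<tau> + ?S \<tau>))"
            by (intro Bochner_Integration.integrable_add[OF cL] integrable_mult_right
                Bochner_Integration.integrable_add[OF GL SL])
          have "(LINT \<tau>|?L. 2 * w' \<tau> (w t)) \<le> (LINT \<tau>|?L. A + 3 / \<eta> * (G \<tau> + ?S \<tau>))"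
          proof (rule integral_mono_AE[OF _ RL])
            show "integrable ?L (\<lambda>\<tau>. 2 * w' \<tau> (w t))" using pi by (intro integrable_mult_right)
            have "AE \<tau> in ?L. w' \<tau> \<in> h1d_dual \<Omega> \<Gamma>" by (rule AE_lebesgue_on_subset[OF w'D(2) sub]) auto
            moreover have "AE \<tau> in ?L. \<tau> \<in> {0..T}"
              using sub by (auto intro!: AE_I2 simp: space_restrict_space)
            ultimately show "AE \<tau> in ?L. 2 * w' \<tau> (w t) \<le> A + 3 / \<eta> * (G \<tau> + ?S \<tau>)"
            proof eventually_elim
              case (elim \<tau>)
              note w't = \<open>w' t \<in> h1d_dual \<Omega> \<Gamma>\<close>
              note cm = simple_curve_mem[OF c(1)]
              let ?E = "h1_norm \<Omega> (w t)"
              let ?d = "?N (\<lambda>x. w' \<tau> x - w' t x)"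
              have dn: "0 \<le> ?d" by (rule norm_nonneg[OF diff_mem[OF elim(1) w't]])
              have Sval: "?S \<tau> = Dm (c \<tau>) (c t)"
              proof -
                have "?S \<tau> = (\<Sum>v\<in>c ` {0..T}. if c \<tau> = v then Dm v (c t) else 0)" by (intro sum.cong) auto
                then show ?thesis using cfin elim(2) by (simp add: sum.delta)
              qed
              let ?p = "?N (\<lambda>x. c \<tau> x - w' \<tau> x)" and ?q = "?N (\<lambda>x. c \<tau> x - c t x)"
                  and ?r = "?N (\<lambda>x. c t x - w' t x)"
              \<comment> \<open>The derivative at \<tau> is compared with the one at t through the
                simple curve at both times. The outer distances are approximation errors; the middle
                one takes finitely many values and is averaged out by
                \<open>steklov_inequality\<close>.\<close>
              have "?d \<le> ?p + (?q + ?r)"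
                using norm_diff_triangle[OF elim(1) cm[OF elim(2)] w't]
                  norm_diff_triangle[OF cm[OF elim(2)] cm[OF \<open>t \<in> {0..T}\<close>] w't]
                  norm_diff_commute[OF elim(1) cm[OF elim(2)]] by linarith
              then have "?d\<^sup>2 \<le> (?p + (?q + ?r))\<^sup>2" using dn by (intro power_mono) auto
              also have "\<dots> \<le> 3 * (?p\<^sup>2 + ?q\<^sup>2 + ?r\<^sup>2)"
                using sum_squares_bound[of ?p ?q] sum_squares_bound[of ?q ?r] sum_squares_bound[of ?p ?r]
                by (simp add: power2_sum algebra_simps)
              finally have d2: "?d\<^sup>2 \<le> 3 * (G \<tau> + Dm (c \<tau>) (c t) + G t)" by (simp add: G_def Dm_def)
              have "w' \<tau> (w t) - w' t (w t) \<le> ?d * ?E"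
                using h1d_dual_bound[OF diff_mem[OF elim(1) w't] \<open>w t \<in> h1d \<Omega> \<Gamma>\<close>] by simp
              moreover have "2 * (?d * ?E) \<le> \<eta> * ?E\<^sup>2 + ?d\<^sup>2 / \<eta>"
              proof -
                have "0 \<le> (\<eta> * ?E - ?d)\<^sup>2 / \<eta>" using \<eta> by simp
                also have "\<dots> = \<eta> * ?E\<^sup>2 - 2 * (?d * ?E) + ?d\<^sup>2 / \<eta>"
                  using \<eta> by (simp add: power2_diff power2_eq_square field_simps)
                finally show ?thesis by simp
              qed
              moreover have "\<eta> * ?E\<^sup>2 \<le> \<eta> * E2 t" using \<eta> \<open>?E\<^sup>2 \<le> E2 t\<close> by simp
              moreover have "?d\<^sup>2 / \<eta> \<le> 3 / \<eta> * (G \<tau> + Dm (c \<tau>) (c t) + G t)"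
                using d2 \<eta> by (simp add: divide_right_mono)
              moreover have "2 * w' t (w t) \<le> \<xi> * n t" using \<open>2 * w' t (w t) \<le> _\<close> by (simp add: n_def)
              ultimately have "2 * w' \<tau> (w t) \<le> \<xi> * n t + \<eta> * E2 t + 3 / \<eta> * (G \<tau> + Dm (c \<tau>) (c t)
                  + G t)" by linarith
              then show ?case unfolding Sval A_def by (simp add: distrib_left)
            qed
          qed
          also have "(LINT \<tau>|?L. A + 3 / \<eta> * (G \<tau> + ?S \<tau>))
              = h * A + 3 / \<eta> * (integral ?I G + (\<Sum>v\<in>c ` {0..T}. Dm v (c t) * integral ?I (\<lambda>\<tau>.
                  of_bool (c \<tau> = v))))"
          proof -
            have "(LINT \<tau>|?L. A + 3 / \<eta> * (G \<tau> + ?S \<tau>)) = (LINT \<tau>|?L. A) + 3 / \<eta> * ((LINT \<tau>|?L. G \<tau>)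
                + (LINT \<tau>|?L. ?S \<tau>))"
              using cL GL SL by (simp only: Bochner_Integration.integral_add integral_mult_right_zero
                  Bochner_Integration.integrable_add integrable_mult_right)
            also have "(LINT \<tau>|?L. ?S \<tau>) = (\<Sum>v\<in>c ` {0..T}. Dm v (c t) * (LINT \<tau>|?L. of_bool (c \<tau> = v)))"
              using ofL by (subst Bochner_Integration.integral_sum) auto
            finally show ?thesis by (simp only: cI eqI[OF GL] eqI[OF ofL])
          qed
          also have "integral ?I G = H t - H (t - h)"
            unfolding H_def using Henstock_Kurzweil_Integration.integral_combine[of 0 "t - h" t G]
              integrable_subinterval_real[OF integrable_on_lebesgue_on[OF Gi], of 0 t] h elim(5) by simp
          also have "(\<Sum>v\<in>c ` {0..T}. Dm v (c t) * integral ?I (\<lambda>\<tau>. of_bool (c \<tau> = v)))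
              = (\<Sum>v\<in>c ` {0..T}. Dm v (c t) * (J v t - J v (t - h)))"
          proof (intro sum.cong refl arg_cong2[of _ _ _ _ "(*)"])
            fix v
            show "integral ?I (\<lambda>\<tau>. of_bool (c \<tau> = v)) = J v t - J v (t - h)"
              unfolding J_def using Henstock_Kurzweil_Integration.integral_combine[of 0 "t - h" t
                  "\<lambda>\<tau>. of_bool (c \<tau> = v) :: real"]
                integrable_subinterval_real[OF integrable_on_lebesgue_on[OF ofi], of 0 t v] h
                    elim(5) by simp
          qed
          finally have "(LINT \<tau>|?L. 2 * w' \<tau> (w t)) \<le> h * A + 3 / \<eta> * (H t - H (t - h)
              + (\<Sum>v\<in>c ` {0..T}. Dm v (c t) * (J v t - J v (t - h))))" .
          moreover have "(LINT \<tau>|?L. 2 * w' \<tau> (w t)) = 2 * integral ?I (\<lambda>\<tau>. w' \<tau> (w t))"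
            by (simp only: integral_mult_right_zero eqI[OF pi])
          moreover have "h * A = h * (\<xi> * n t) + h * (\<eta> * E2 t) + 3 / \<eta> * (h * G t)"
            by (simp add: A_def algebra_simps)
          ultimately show "n t - n (t - h) \<le> h * (\<xi> * n t) + h * (\<eta> * E2 t)
            + 3 / \<eta> * (h * G t + (H t - H (t - h)) + (\<Sum>v\<in>c ` {0..T}. Dm v (c t) * (J v t - J v (t -
                h))))"
            using d by (simp add: distrib_left)
        qed
      qed
    qed
    \<comment> \<open>The 3 stems from squaring a sum of three distances, the 2 from the two copies
      of the integral of \<open>G\<close>.\<close>
    also have "2 * (3 / \<eta>) * integral {0..T} G \<le> 2 * (3 / \<eta>) * \<eta>\<^sup>2"
      using Gint \<eta> by (intro mult_left_mono) auto
    also have "2 * (3 / \<eta>) * \<eta>\<^sup>2 = 6 * \<eta>" using \<eta> by (simp add: power2_eq_square)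
    finally show ?thesis by (simp add: algebra_simps)
  qed
  have "n b - n a \<le> integral {a..b} (\<lambda>t. \<xi> * n t)"
  proof (rule field_le_epsilon)
    fix e :: real assume e: "0 < e"
    have I0: "0 \<le> integral {0..T} E2"
      using E2(1,2) by (intro Henstock_Kurzweil_Integration.integral_nonneg
          integrable_on_lebesgue_on) auto
    define \<eta> where "\<eta> = e / (integral {0..T} E2 + 6)"
    have "\<eta> > 0" "\<eta> * (integral {0..T} E2 + 6) = e" using e I0 by (auto simp: \<eta>_def)
    then show "n b - n a \<le> integral {a..b} (\<lambda>t. \<xi> * n t) + e" using step[of \<eta>] by simp
  qed
  then show ?thesis unfolding n_def .
qed

end

text \<open>\<open>N\<close> is nonincreasing on positive times; if it stayed above some \<epsilon>,
  it would fall at least linearly and become negative. This takes the place of Gronwall's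
  inequality.\<close>

lemma decay_of_integral_inequality:
  fixes N :: "real \<Rightarrow> real"
  assumes c: "continuous_on {0..} N" and nn: "\<And>t. 0 \<le> N t" and \<xi>: "\<xi> < 0"
    and ineq: "\<And>a b. 0 < a \<Longrightarrow> a \<le> b \<Longrightarrow> N b - N a \<le> integral {a..b} (\<lambda>t. \<xi> * N t)"
  shows "(N \<longlongrightarrow> 0) at_top"
proof -
  have i: "(\<lambda>t. \<xi> * N t) integrable_on {a..b}" if "0 < a" for a b
    by (intro integrable_continuous_interval continuous_intros continuous_on_subset[OF c]) (use that
        in auto)
  have ub: "N b - N a \<le> \<xi> * m * (b - a)" if ab: "0 < a" "a \<le> b" and m: "\<And>t. a \<le> t \<Longrightarrow> t \<le> b \<Longrightarrow> m \<le> N t"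
      for a b m
  proof -
    have "integral {a..b} (\<lambda>t. \<xi> * N t) \<le> integral {a..b} (\<lambda>t. \<xi> * m)"
      using m \<xi> by (intro integral_le i ab) (auto intro: mult_left_mono_neg)
    also have "\<dots> = \<xi> * m * (b - a)" using ab by simp
    finally show ?thesis using ineq[OF ab] by linarith
  qed
  have mono: "N b \<le> N a" if "0 < a" "a \<le> b" for a b using ub[OF that, of 0] nn by simp
  show ?thesis
  proof (rule order_tendstoI)
    show "\<forall>\<^sub>F t in at_top. y < N t" if "y < 0" for y
      using nn that by (intro always_eventually) (meson less_le_trans)
    fix \<epsilon> :: real assume \<epsilon>: "0 < \<epsilon>"
    \<comment> \<open>A fall at rate -\<xi> \<epsilon> from time 1 up to this time amounts to
      \<open>N 1 + 1\<close>, more than \<open>N\<close> has to lose. The start is 1 because the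
      inequality is given for positive times only.\<close>
    define b where "b = 1 + (N 1 + 1) / (- \<xi> * \<epsilon>)"
    have pos: "0 < - \<xi> * \<epsilon>" using \<xi> \<epsilon> by (simp add: mult_neg_pos)
    have "0 \<le> (N 1 + 1) / (- \<xi> * \<epsilon>)" using pos nn[of 1] by (intro divide_nonneg_pos) auto
    then have b1: "1 \<le> b" unfolding b_def by linarith
    have "N b < \<epsilon>"
    proof (rule ccontr)
      assume "\<not> N b < \<epsilon>"
      then have "\<epsilon> \<le> N t" if "1 \<le> t" "t \<le> b" for t using mono[of t b] that by simp
      then have "N b - N 1 \<le> \<xi> * \<epsilon> * (b - 1)" using b1 by (intro ub) auto
      also have "\<xi> * \<epsilon> * (b - 1) = - (N 1 + 1)" using \<xi> \<epsilon> by (simp add: b_def)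
      finally show False using nn[of b] by simp
    qed
    then have "N t < \<epsilon>" if "b \<le> t" for t using mono[of b t] that b1 by simp
    then show "\<forall>\<^sub>F t in at_top. N t < \<epsilon>" unfolding eventually_at_top_linorder by blast
  qed
qed

theorem theorem3:
  fixes \<Omega> \<Gamma>\<^sub>D \<Gamma>\<^sub>N :: "plane set"
    and \<theta>0 D q g :: "plane \<Rightarrow> real" and \<kappa> :: "real \<Rightarrow> real" and f :: "real \<Rightarrow> plane \<Rightarrow> real"
    and Dmin Dmax \<kappa>min \<kappa>max L\<^sub>\<kappa> b\<^sub>0 c\<^sub>0 C\<^sub>g\<^sub>n C\<^sub>w C\<^sub>t r s \<epsilon> \<mu> h \<xi> :: real
    and r\<^sub>0 :: ereal and C :: "real \<Rightarrow> real"
    and P :: "(plane \<Rightarrow> real) \<Rightarrow> plane \<Rightarrow> real"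
    and \<theta> p \<theta>h ph :: "real \<Rightarrow> plane \<Rightarrow> real" and \<theta>h0 :: "plane \<Rightarrow> real"
  assumes domain: "lipschitz_domain \<Omega>"
    and boundary: "frontier \<Omega> = \<Gamma>\<^sub>D \<union> \<Gamma>\<^sub>N" "\<Gamma>\<^sub>D \<inter> \<Gamma>\<^sub>N = {}" "\<Gamma>\<^sub>D \<noteq> {}"
    and poincare: "b\<^sub>0 > 0"
      "\<And>u. u \<in> h1d \<Omega> \<Gamma>\<^sub>D \<Longrightarrow>
         b\<^sub>0 * h1_norm \<Omega> u \<le> l2_norm \<Omega> (grad \<Omega> u) \<and> l2_norm \<Omega> (grad \<Omega> u) \<le> h1_norm \<Omega> u"
    and data: "\<And>T. T > 0 \<Longrightarrow> admissible_data \<Omega> \<theta>0 D Dmin Dmax \<kappa> \<kappa>min \<kappa>max q g f T"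
    and lipschitz: "\<And>\<zeta>1 \<zeta>2. \<bar>\<kappa> \<zeta>1 - \<kappa> \<zeta>2\<bar> \<le> L\<^sub>\<kappa> * \<bar>\<zeta>1 - \<zeta>2\<bar>"
    and h_pos: "h > 0"
    and P_linear: "linear_h1_l2 \<Omega> P"
    and P_approx: "\<And>k u. k \<in> {1, 2} \<Longrightarrow> u \<in> h_space \<Omega> k \<Longrightarrow>
         l2_norm \<Omega> (\<lambda>x. P u x - u x) \<le> c\<^sub>0 * h ^ k * sobolev_seminorm \<Omega> k u"
    and meyers: "meyers_constants \<Omega> \<Gamma>\<^sub>D \<kappa> g r\<^sub>0 C"
    and exponents: "2 < r" "ereal r < r\<^sub>0" "1 / r + 1 / s = 1 / 2"
    and gn: "gagliardo_nirenberg_constant \<Omega> s 2 C\<^sub>g\<^sub>n"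
    and C\<^sub>w: "C\<^sub>w = max (1 / \<kappa>min) (1 + \<kappa>max / \<kappa>min) * L\<^sub>\<kappa> * C\<^sub>g\<^sub>n * b\<^sub>0 powr ((2 - s) / s)"
    and \<epsilon>: "\<epsilon> = s / (2 * (s - 1))"
    and C\<^sub>t: "C\<^sub>t = 1 / s * ((C\<^sub>w * C r) powr s / (\<epsilon> * Dmin) powr (s - 1))"
    and mu: "\<mu> > 0" "\<mu> * c\<^sub>0\<^sup>2 * h\<^sup>2 < Dmin"
    and xi: "\<xi> = 2 * C\<^sub>t * l2_norm \<Omega> g powr s - \<mu>" "\<xi> < 0"
    and initial: "\<theta>h0 \<in> lp_space \<Omega> 2"
    and weak: "\<And>T. T > 0 \<Longrightarrow> weak_solution \<Omega> \<Gamma>\<^sub>D D \<kappa> q g f \<theta>0 T \<theta> p"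
    and assim: "\<And>T. T > 0 \<Longrightarrow> assimilation_solution \<Omega> \<Gamma>\<^sub>D D \<kappa> q g f \<mu> P \<theta> \<theta>h0 T \<theta>h ph"
    and canonical: "canonical_in_time \<Omega> \<Gamma>\<^sub>D \<kappa> g \<theta> p" "canonical_in_time \<Omega> \<Gamma>\<^sub>D \<kappa> g \<theta>h ph"
  shows "((\<lambda>t. l2_norm \<Omega> (\<lambda>x. \<theta> t x - \<theta>h t x)) \<longlongrightarrow> 0) at_top \<and>
    ((\<lambda>t. l2_norm \<Omega> (\<lambda>x. \<kappa> (\<theta> t x) *\<^sub>R grad \<Omega> (p t) x
                          - \<kappa> (\<theta>h t x) *\<^sub>R grad \<Omega> (ph t) x)) \<longlongrightarrow> 0) at_top"
proof -
  interpret bounded_domain \<Omega>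
    using domain by unfold_locales (auto simp: lipschitz_domain_def)
  note dat = data[of 1, unfolded admissible_data_def]
  have g2: "square_integrable \<Omega> g" and q2: "square_integrable \<Omega> q"
    using dat by (auto simp: lp_space_2)
  have D: "D \<in> borel_measurable M" "0 < Dmin" "AE x in M. Dmin < D x \<and> D x \<le> Dmax"
    and gq: "AE x in M. 0 \<le> g x + 2 * q x" using dat by auto
  \<comment> \<open>The relation of the exponents together with r > 2 puts 1/s strictly between 0
    and 1/2.\<close>
  have s: "2 < s"
  proof -
    have "0 < 1 / r" "1 / r < 1 / 2" using exponents(1) by (auto simp: field_simps)
    then have *: "0 < 1 / s" "1 / s < 1 / 2" using exponents(3) by linarith+
    then have "0 < s" by simp
    then show ?thesis using *(2) by (simp add: field_simps)
  qed
  interpret elliptic_data \<Omega> \<kappa> \<kappa>min \<kappa>max L\<^sub>\<kappa> b\<^sub>0 r s C\<^sub>g\<^sub>n "C r * l2_norm \<Omega> g" \<Gamma>\<^sub>D g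
    using domain dat lipschitz poincare exponents s gn g2 meyers
    by unfold_locales (auto simp: meyers_constants_def)
  have can: "\<theta> t \<in> lp_space \<Omega> 2" "elliptic_solution \<Omega> \<Gamma>\<^sub>D \<kappa> g (\<theta> t) (p t)"
      "\<theta>h t \<in> lp_space \<Omega> 2" "elliptic_solution \<Omega> \<Gamma>\<^sub>D \<kappa> g (\<theta>h t) (ph t)" if "0 \<le> t" for t
    using canonical that by (auto simp: canonical_in_time_def)
  have \<theta>c: "l2_continuous \<theta>" and \<theta>hc: "l2_continuous \<theta>h"
    using canonical by (auto simp: canonical_in_time_def l2_continuous_def lp_space_2)
  define w where "w t x = \<theta>h t x - \<theta> t x" for t x
  have wc: "l2_continuous w" unfolding w_def[abs_def] by (rule l2_continuous_diff[OF \<theta>hc \<theta>c])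
  have decay: "((\<lambda>t. (l2_norm \<Omega> (w t))\<^sup>2) \<longlongrightarrow> 0) at_top"
  proof (rule decay_of_integral_inequality[OF l2_continuous_norm[OF wc] _ xi(2)])
    fix a b :: real assume ab: "0 < a" "a \<le> b"
    \<comment> \<open>Solutions are given interval by interval, and the derivatives \<open>V\<close>
      and \<open>Vh\<close> obtained below belong to [0, T]. The choice T = b is possible because
      the energy inequality includes the right end point.\<close>
    define T where "T = b"
    have T: "0 < T" "b \<le> T" using ab by (auto simp: T_def)
    note sol = weak[OF T(1), unfolded weak_solution_def system_solution_def]
    note solh = assim[OF T(1), unfolded assimilation_solution_def system_solution_def]
    note datT = data[OF T(1), unfolded admissible_data_def]
    obtain V where V: "V \<in> bochner_lp 2 T (h1d_dual \<Omega> \<Gamma>\<^sub>D) (h1d_dual_norm \<Omega> \<Gamma>\<^sub>D)"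
      "has_time_deriv \<Omega> \<Gamma>\<^sub>D T \<theta> V"
      "AE t in lebesgue_on {0..T}. \<forall>\<psi> \<in> h1d \<Omega> \<Gamma>\<^sub>D.
         V t \<psi> + form_A \<Omega> D \<kappa> q (\<theta> t) (p t) \<psi> (\<theta> t) = l2_inner \<Omega> (f t) \<psi>"
      using sol by blast
    obtain Vh where Vh: "Vh \<in> bochner_lp 2 T (h1d_dual \<Omega> \<Gamma>\<^sub>D) (h1d_dual_norm \<Omega> \<Gamma>\<^sub>D)"
      "has_time_deriv \<Omega> \<Gamma>\<^sub>D T \<theta>h Vh"
      "AE t in lebesgue_on {0..T}. \<forall>\<psi> \<in> h1d \<Omega> \<Gamma>\<^sub>D.
         Vh t \<psi> + form_A \<Omega> D \<kappa> q (\<theta>h t) (ph t) \<psi> (\<theta>h t)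
           = l2_inner \<Omega> (\<lambda>x. f t x - \<mu> * P (\<lambda>y. \<theta>h t y - \<theta> t y) x) \<psi>"
      using solh by blast
    have b1: "\<theta> \<in> bochner_lp 2 T (h1d \<Omega> \<Gamma>\<^sub>D) (h1_norm \<Omega>)" "\<theta>h \<in> bochner_lp 2 T (h1d \<Omega> \<Gamma>\<^sub>D) (h1_norm \<Omega>)"
      using sol solh by auto
    have \<theta>d: "AE t in lebesgue_on {0..T}. \<theta> t \<in> h1d \<Omega> \<Gamma>\<^sub>D" "AE t in lebesgue_on {0..T}. \<theta>h t \<in> h1d \<Omega> \<Gamma>\<^sub>D"
      using b1 by (auto simp: bochner_lp_def strongly_measurable_def)
    have nn: "0 \<le> h1_norm \<Omega> u" for u by (rule sobolev_norm_nonneg)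
    have int: "integrable (lebesgue_on {0..T}) (\<lambda>t. (h1_norm \<Omega> (\<theta> t))\<^sup>2)"
      "integrable (lebesgue_on {0..T}) (\<lambda>t. (h1_norm \<Omega> (\<theta>h t))\<^sup>2)"
      using b1 nn by (auto simp: bochner_lp_def)
    interpret S: function_seminorm "h1d_dual \<Omega> \<Gamma>\<^sub>D" "h1d_dual_norm \<Omega> \<Gamma>\<^sub>D" by (rule h1d_dual_seminorm)
    show "(l2_norm \<Omega> (w b))\<^sup>2 - (l2_norm \<Omega> (w a))\<^sup>2 \<le> integral {a..b} (\<lambda>t. \<xi> * (l2_norm \<Omega> (w t))\<^sup>2)"
    \<comment> \<open>\<open>Vh - V\<close> serves as the derivative of \<open>w\<close> through its
      increments alone; these are the difference of the increment formulas of the two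
      solutions.\<close>
    proof (rule integrated_energy_inequality[OF wc S.bochner2_diff[OF Vh(1) V(1)] _ _ _ _ _ _ ab T(2)])
      fix \<psi> c d assume \<psi>: "\<psi> \<in> h1d \<Omega> \<Gamma>\<^sub>D" and cd: "0 < c" "c < d" "d < T"
      have sub: "{c..d} \<subseteq> {0..T}" using cd by auto
      have i: "(\<lambda>\<tau>. V \<tau> \<psi>) integrable_on {c..d}" "(\<lambda>\<tau>. Vh \<tau> \<psi>) integrable_on {c..d}"
        by (intro integrable_on_lebesgue_on integrable_subinterval[OF pairing_integrable[OF _ \<psi>]
            sub] V(1) Vh(1) lmeasurable_cbox; simp)+
      have \<psi>2: "square_integrable \<Omega> \<psi>" by (rule h_space_square_integrable(1)[OF h1d_h_space[OF \<psi>]])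
      have inn: "l2_inner \<Omega> (w t) \<psi> = l2_inner \<Omega> (\<theta>h t) \<psi> - l2_inner \<Omega> (\<theta> t) \<psi>" if "0 < t" for t
        unfolding w_def[abs_def] using can[of t] that \<psi>2
            by (intro l2_inner_diff_left) (auto simp: lp_space_2)
      show "l2_inner \<Omega> (w d) \<psi> - l2_inner \<Omega> (w c) \<psi> = integral {c..d} (\<lambda>\<tau>. Vh \<tau> \<psi> - V \<tau> \<psi>)"
        using time_deriv_increment[OF \<theta>c V(1,2) \<psi> cd] time_deriv_increment[OF \<theta>hc Vh(1,2) \<psi> cd]
          inn[of c] inn[of d] cd
        by (simp add: Henstock_Kurzweil_Integration.integral_diff[OF i(2,1)])
    next
      show "AE t in lebesgue_on {0..T}. w t \<in> h1d \<Omega> \<Gamma>\<^sub>D"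
        using \<theta>d unfolding w_def[abs_def] by eventually_elim (rule h1d_diff)
      \<comment> \<open>This sum dominates the squared H^1 norm of the difference and is integrable
        by hypothesis, so measurability of the latter norm in time is not an issue.\<close>
      show "integrable (lebesgue_on {0..T}) (\<lambda>t. 2 * (h1_norm \<Omega> (\<theta>h t))\<^sup>2 + 2 * (h1_norm \<Omega> (\<theta> t))\<^sup>2)"
        using int by simp
      show "0 \<le> 2 * (h1_norm \<Omega> (\<theta>h t))\<^sup>2 + 2 * (h1_norm \<Omega> (\<theta> t))\<^sup>2" for t by simp
      show "AE t in lebesgue_on {0..T}. (h1_norm \<Omega> (w t))\<^sup>2 \<le> 2 * (h1_norm \<Omega> (\<theta>h t))\<^sup>2
          + 2 * (h1_norm \<Omega> (\<theta> t))\<^sup>2"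
        using \<theta>d
      proof eventually_elim
        case (elim t)
        have "h1_norm \<Omega> (w t) \<le> h1_norm \<Omega> (\<theta>h t) + h1_norm \<Omega> (\<theta> t)"
          using h_space_linear_combination(3)[OF h1d_h_space[OF elim(2)] h1d_h_space[OF elim(1)], of
              1 "- 1"]
          by (simp add: w_def[abs_def])
        then have "(h1_norm \<Omega> (w t))\<^sup>2 \<le> (h1_norm \<Omega> (\<theta>h t) + h1_norm \<Omega> (\<theta> t))\<^sup>2"
          using nn by (intro power_mono)
        then show ?case using sum_squares_bound[of "h1_norm \<Omega> (\<theta>h t)" "h1_norm \<Omega> (\<theta> t)"]
          by (simp add: power2_sum)
      qed
      have "AE t in lebesgue_on {0..T}. f t \<in> lp_space \<Omega> 2"
        using datT by (auto simp: bochner_lp_def strongly_measurable_def)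
      moreover have "AE t in lebesgue_on {0..T}. AE x in M. 0 \<le> \<theta> t x \<and> \<theta> t x \<le> 1"
        using weak[OF T(1)] by (simp add: weak_solution_def)
      ultimately show "AE t in lebesgue_on {0..T}. 2 * (Vh t (w t) - V t (w t))
          \<le> \<xi> * (l2_norm \<Omega> (w t))\<^sup>2"
        using \<theta>d V(3) Vh(3) S.AE_interval[of T]
      proof eventually_elim
        case (elim t)
        have t: "0 \<le> t" using elim(7) by simp
        have wd: "w t \<in> h1d \<Omega> \<Gamma>\<^sub>D" unfolding w_def[abs_def] by (rule h1d_diff[OF elim(4,3)])
        note wh = h1d_h_space[OF wd]
        have f2: "square_integrable \<Omega> (f t)" using elim(1) by (simp add: lp_space_2)
        have P2: "square_integrable \<Omega> (P (w t))" using P_linear wh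
            by (simp add: linear_h1_l2_def lp_space_2)
        \<comment> \<open>The approximation property is taken with k = 1, as the difference is known
          to lie in H^1 only.\<close>
        have Pe: "l2_norm \<Omega> (\<lambda>x. P (w t) x - w t x) \<le> c\<^sub>0 * h * l2_norm \<Omega> (grad \<Omega> (w t))"
          using P_approx[of 1, OF _ wh] by (simp add: sobolev_seminorm_1)
        have \<mu>2: "\<mu> * (c\<^sub>0 * h)\<^sup>2 < Dmin" using mu(2) by (simp add: power_mult_distrib mult.assoc)
        have "Vh t (w t) - V t (w t) \<le> (1 / s * ((C\<^sub>w * C r) powr s / (s / (2 * (s
            - 1)) * Dmin) powr (s - 1))
            * l2_norm \<Omega> g powr s - \<mu> / 2) * (l2_norm \<Omega> (w t))\<^sup>2"
          using energy_estimate[OF D q2 gq elim(3,2,4) can(2,4)[OF t] f2 P2[unfolded w_def[abs_def]]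
              Pe[unfolded w_def[abs_def]] mu(1) \<mu>2
              _ _ refl lp_norm_nonneg C\<^sub>w, of "V t" "Vh t"] elim(5,6) wd
          unfolding w_def[abs_def] by blast
        \<comment> \<open>The pairing is formally half the derivative of the squared norm, hence
          \<xi>/2.\<close>
        also have "(1 / s * ((C\<^sub>w * C r) powr s / (s / (2 * (s - 1)) * Dmin) powr (s - 1))
            * l2_norm \<Omega> g powr s - \<mu> / 2) = \<xi> / 2"
          unfolding xi(1) C\<^sub>t \<epsilon> by simp
        finally show ?case by simp
      qed
    qed
  qed simp
  have n0: "((\<lambda>t. l2_norm \<Omega> (w t)) \<longlongrightarrow> 0) at_top"
    using tendsto_real_sqrt[OF decay] by simp
  have sw: "l2_norm \<Omega> (\<lambda>x. \<theta> t x - \<theta>h t x) = l2_norm \<Omega> (w t)" for t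
    by (simp add: lp_norm_def w_def abs_minus_commute)
  \<comment> \<open>A bound by the L^2 norm at time t alone. The estimate with
    \<open>C\<^sub>w\<close> would also contain the gradient of the difference, for which only
    square integrability in time is given.\<close>
  let ?B = "\<lambda>t. (1 + \<kappa>max / \<kappa>min)
      * (((2 * \<kappa>max) powr (s - 2) * L\<^sub>\<kappa>\<^sup>2 * (l2_norm \<Omega> (w t))\<^sup>2) powr (1 / s) * (C r * l2_norm \<Omega> g))"
  have "((\<lambda>t. ((2 * \<kappa>max) powr (s - 2) * L\<^sub>\<kappa>\<^sup>2 * (l2_norm \<Omega> (w t))\<^sup>2) powr (1 / s)) \<longlongrightarrow> 0) at_top"
  proof (rule tendsto_zero_powrI)
    show "((\<lambda>t. (2 * \<kappa>max) powr (s - 2) * L\<^sub>\<kappa>\<^sup>2 * (l2_norm \<Omega> (w t))\<^sup>2) \<longlongrightarrow> 0) at_top"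
      using tendsto_mult_right_zero[OF decay] by simp
    show "((\<lambda>t. 1 / s) \<longlongrightarrow> 1 / s) at_top" by simp
  qed (use s in \<open>auto intro!: always_eventually\<close>)
  then have B0: "(?B \<longlongrightarrow> 0) at_top"
    by (intro tendsto_mult_right_zero tendsto_mult_left_zero)
  have le: "l2_norm \<Omega> (\<lambda>x. \<kappa> (\<theta> t x) *\<^sub>R grad \<Omega> (p t) x - \<kappa> (\<theta>h t x) *\<^sub>R grad \<Omega> (ph t) x) \<le> ?B t"
      if "0 \<le> t" for t
    using flux_difference_l2[OF _ _ can(2,4)[OF that]] can(1,3)[OF that] sw[of t]
    by (simp add: lp_space_2 flux_def)
  have "((\<lambda>t. l2_norm \<Omega> (\<lambda>x. \<kappa> (\<theta> t x) *\<^sub>R grad \<Omega> (p t) x - \<kappa> (\<theta>h t x) *\<^sub>R grad \<Omega> (ph t) x)) \<longlongrightarrow> 0) at_top"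
    by (rule tendsto_sandwich[OF _ _ tendsto_const B0])
      (auto simp: lp_norm_nonneg eventually_at_top_linorder intro: le)
  then show ?thesis using n0 by (simp add: sw)
qed

end
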